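(* There is an algorithm which, given a system $Ax \le b$ in $LI(2)$ with $A \in \mathbb{R}^{n\times d}$, $b\in\mathbb{R}^n$, decides in time $O(d^2 n \log n)$ (arithmetic operations on real numbers) whether the system is full-dimensional, and in the full-dimensional case outputs an interior point solution of the system.
   Context: A linear system $Ax\le b$ with $A\in\mathbb{R}^{n\times d}$, $b\in\mathbb{R}^n$ ($d<n$) is in $LI(2)$ if every row of $A$ has at most two nonzero entries, i.e., every inequality has the form $\alpha x_i+\beta x_j\le\gamma$. A point $x^*$ is a feasible solution if $Ax^*\le b$ and an interior point solution if $Ax^*<b$ componentwise. The system is called full-dimensional if it has an interior point solution. *)

theory Defs
  imports "HOL-Analysis.Analysis"
begin

text \<open>A system Ax <= b with A an n x d real matrix (rows i < n, columns j < d),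
  represented as A :: nat => nat => real and b :: nat => real; points x :: nat => real
  (only coordinates j < d matter).\<close>

definition LI2 :: "nat \<Rightarrow> nat \<Rightarrow> (nat \<Rightarrow> nat \<Rightarrow> real) \<Rightarrow> bool" where
  "LI2 n d A \<longleftrightarrow> (\<forall>i<n. card {j. j < d \<and> A i j \<noteq> 0} \<le> 2)"

definition row_val :: "nat \<Rightarrow> (nat \<Rightarrow> nat \<Rightarrow> real) \<Rightarrow> (nat \<Rightarrow> real) \<Rightarrow> nat \<Rightarrow> real" where
  "row_val d A x i = (\<Sum>j<d. A i j * x j)"

definition interior_point :: "nat \<Rightarrow> nat \<Rightarrow> (nat \<Rightarrow> nat \<Rightarrow> real) \<Rightarrow> (nat \<Rightarrow> real) \<Rightarrow> (nat \<Rightarrow> real) \<Rightarrow> bool" where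
  "interior_point n d A b x \<longleftrightarrow> (\<forall>i<n. row_val d A x i < b i)"

definition full_dimensional :: "nat \<Rightarrow> nat \<Rightarrow> (nat \<Rightarrow> nat \<Rightarrow> real) \<Rightarrow> (nat \<Rightarrow> real) \<Rightarrow> bool" where
  "full_dimensional n d A b \<longleftrightarrow> (\<exists>x. interior_point n d A b x)"

text \<open>Two memories indexed by integers: an integer memory and a real memory.
  Instruction operands are (constant) addresses; indirect load/store use an address
  held in an integer cell. Real arithmetic: +, -, *, / and comparisons; integers can be
  converted to reals, but there is no floor. Integer arithmetic: constants, +, -,
  comparisons. Every executed instruction costs one time unit.\<close>

datatype instr =
    IConst int int
  | IAdd int int int
  | ISub int int int
  | ILoadInd int int
  | IStoreInd int int
  | IJumpLe int int nat
  | RFromI int int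
  | RAdd int int int
  | RSub int int int
  | RMul int int int
  | RDiv int int int
  | RLoadInd int int
  | RStoreInd int int
  | RJumpLe int int nat
  | RJumpLt int int nat
  | Halt

type_synonym conf = "nat \<times> (int \<Rightarrow> int) \<times> (int \<Rightarrow> real)"

fun exec :: "instr \<Rightarrow> conf \<Rightarrow> conf" where
  "exec (IConst a c) (pc, I, R) = (Suc pc, I(a := c), R)"
| "exec (IAdd a b c) (pc, I, R) = (Suc pc, I(a := I b + I c), R)"
| "exec (ISub a b c) (pc, I, R) = (Suc pc, I(a := I b - I c), R)"
| "exec (ILoadInd a b) (pc, I, R) = (Suc pc, I(a := I (I b)), R)"
| "exec (IStoreInd a b) (pc, I, R) = (Suc pc, I(I a := I b), R)"
| "exec (IJumpLe a b l) (pc, I, R) = ((if I a \<le> I b then l else Suc pc), I, R)"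
| "exec (RFromI a b) (pc, I, R) = (Suc pc, I, R(a := of_int (I b)))"
| "exec (RAdd a b c) (pc, I, R) = (Suc pc, I, R(a := R b + R c))"
| "exec (RSub a b c) (pc, I, R) = (Suc pc, I, R(a := R b - R c))"
| "exec (RMul a b c) (pc, I, R) = (Suc pc, I, R(a := R b * R c))"
| "exec (RDiv a b c) (pc, I, R) = (Suc pc, I, R(a := R b / R c))"
| "exec (RLoadInd a b) (pc, I, R) = (Suc pc, I, R(a := R (I b)))"
| "exec (RStoreInd a b) (pc, I, R) = (Suc pc, I, R(I a := R b))"
| "exec (RJumpLe a b l) (pc, I, R) = ((if R a \<le> R b then l else Suc pc), I, R)"
| "exec (RJumpLt a b l) (pc, I, R) = ((if R a < R b then l else Suc pc), I, R)"
| "exec Halt c = c"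

definition halted :: "instr list \<Rightarrow> conf \<Rightarrow> bool" where
  "halted P c \<longleftrightarrow> fst c \<ge> length P \<or> P ! fst c = Halt"

definition step :: "instr list \<Rightarrow> conf \<Rightarrow> conf" where
  "step P c = (if halted P c then c else exec (P ! fst c) c)"

definition run :: "instr list \<Rightarrow> nat \<Rightarrow> conf \<Rightarrow> conf" where
  "run P t c = (step P ^^ t) c"

text \<open>Input encoding: integer cell 0 holds n, cell 1 holds d; real cell i*d+j holds A i j
  (i<n, j<d) and real cell n*d+i holds b i (i<n); all other cells are 0. Execution starts at
  pc = 0. Output convention: on halting, integer cell 0 is 1 if the system is
  full-dimensional and 0 otherwise; in the full-dimensional case real cells 0..d-1 hold x.\<close>

definition init_conf :: "nat \<Rightarrow> nat \<Rightarrow> (nat \<Rightarrow> nat \<Rightarrow> real) \<Rightarrow> (nat \<Rightarrow> real) \<Rightarrow> conf" where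
  "init_conf n d A b =
     (0,
      (\<lambda>z. if z = 0 then int n else if z = 1 then int d else 0),
      (\<lambda>z. if 0 \<le> z \<and> nat z < n * d then A (nat z div d) (nat z mod d)
           else if 0 \<le> z \<and> nat z < n * d + n then b (nat z - n * d)
           else 0))"

definition out_flag :: "conf \<Rightarrow> int" where
  "out_flag c = fst (snd c) 0"

definition out_point :: "conf \<Rightarrow> nat \<Rightarrow> real" where
  "out_point c = (\<lambda>j. snd (snd c) (int j))"

end

(* Put X_j = x_j and X_(j+d) = - x_j. Each nonzero row becomes two monotone edges X_u < a X_v + b
with a > 0, and conversely the antisymmetric part of a solution of the edge system solves the
nonzero rows.

As in Aspvall and Shiloach, N = 2d rounds of Bellman-Ford started at node l with the value lam,
carried along as a line lam + s (X_l - lam), tell on which side of lam a feasible system still has a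
solution: if some label that improves in the last round traces back to a cycle of gain at least 1,
every solution has X_l > lam, and otherwise one of them has X_l < lam.

As in Hochbaum and Naor, Fourier-Motzkin elimination does not blow up: before X_l is eliminated, a
search over the crossings of the bounds that X_l imposes on each other variable, by medians of paired
crossings and one test per median, confines X_l to an open cell in which one bound per variable
dominates. So each elimination leaves O(N) bounds, and there are O(log n) tests of cost O(d n) in
each of the O(d) eliminations. Back substitution yields a point, and the answer is obtained by
checking this point against the input. If the system is infeasible, the tests may return anything,
so only the running time has to be controlled in that case.

The program is written in a structured language whose semantics counts steps and which is compiled
to the machine with a constant factor. *)
theory Submission
  imports Defs "HOL-Combinatorics.Permutations"
begin

section \<open>A structured language and its compiler\<close>

text \<open>Two accounts are kept apart. The tests never see an edge produced by elimination: they
  run on the input edges and at most two self loops per eliminated variable, which record the cell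
  it was confined to, so every test has O(n) edges. Composed bounds serve only as lines in the
  search and in back substitution. There are O(n + d^2) of them per elimination, and the number of
  lines in excess of one per group falls by a constant factor per round, so even medians computed
  with a heap cost no more than the tests. Strictness shapes the test. Whether values left of lam
  remain possible is decided without choosing an epsilon: a label carries a slope beside its value,
  and ties are broken as if the start value were slightly below lam. Reporting one side suffices
  because solution sets of strict systems are open, which excludes lam itself, and convex, which
  moves a solution into the part of the cell left of lam. A constant node N of value 0 turns bounds
  on a single variable into lines like all others. Zero rows of the input produce no edge and are
  covered by the final check alone.\<close>

datatype iexp = C nat | L nat iexp | Add iexp iexp | Sub iexp iexp
datatype rexp = OfI iexp | RL nat iexp | RAd rexp rexp | RSb rexp rexp | RMl rexp rexp | RDv rexp rexp
datatype bexp = ILe iexp iexp | BLe rexp rexp | BLt rexp rexp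
datatype com = Skip | IA nat iexp iexp | RA nat iexp rexp | Seq com com | Cond bexp com com | For nat iexp bexp com

record st = CK :: nat  IM :: "nat \<Rightarrow> nat \<Rightarrow> nat"  RM :: "nat \<Rightarrow> nat \<Rightarrow> real"

definition tick :: "st \<Rightarrow> st" where "tick s = s\<lparr>CK := Suc (CK s)\<rparr>"
definition seti :: "st \<Rightarrow> nat \<Rightarrow> nat \<Rightarrow> nat \<Rightarrow> st" where
  "seti s k i v = s\<lparr>IM := (IM s)(k := (IM s k)(i := v))\<rparr>"
definition setr :: "st \<Rightarrow> nat \<Rightarrow> nat \<Rightarrow> real \<Rightarrow> st" where
  "setr s k i v = s\<lparr>RM := (RM s)(k := (RM s k)(i := v))\<rparr>"

lemma st_simps [simp]:
  "CK (tick s) = Suc (CK s)" "IM (tick s) = IM s" "RM (tick s) = RM s"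
  "CK (seti s k i v) = CK s" "RM (seti s k i v) = RM s"
  "IM (seti s k i v) k' = (if k' = k then (IM s k)(i := v) else IM s k')"
  "CK (setr s k i w) = CK s" "IM (setr s k i w) = IM s"
  "RM (setr s k i w) k' = (if k' = k then (RM s k)(i := w) else RM s k')"
  by (auto simp: tick_def seti_def setr_def)

fun ie :: "iexp \<Rightarrow> st \<Rightarrow> nat" where
  "ie (C c) s = c"
| "ie (L k e) s = IM s k (ie e s)"
| "ie (Add a b) s = ie a s + ie b s"
| "ie (Sub a b) s = ie a s - ie b s"

fun re :: "rexp \<Rightarrow> st \<Rightarrow> real" where
  "re (OfI e) s = real (ie e s)"
| "re (RL k e) s = RM s k (ie e s)"
| "re (RAd a b) s = re a s + re b s"
| "re (RSb a b) s = re a s - re b s"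
| "re (RMl a b) s = re a s * re b s"
| "re (RDv a b) s = re a s / re b s"

fun be :: "bexp \<Rightarrow> st \<Rightarrow> bool" where
  "be (ILe a b) s = (ie a s \<le> ie b s)"
| "be (BLe a b) s = (re a s \<le> re b s)"
| "be (BLt a b) s = (re a s < re b s)"

text \<open>The bound of a loop is evaluated once and the guard can only end it early. So every
  running time has a bound independent of what the tests answer, as infeasible systems require. The
  counter is stored before the guard is evaluated, and a pass costs its tick even if the guard
  fails.\<close>

fun floop :: "nat \<Rightarrow> (st \<Rightarrow> bool) \<Rightarrow> (st \<Rightarrow> st) \<Rightarrow> nat \<Rightarrow> nat \<Rightarrow> st \<Rightarrow> st" where
  "floop x b f 0 i s = s"
| "floop x b f (Suc r) i s = (if b (seti (tick s) x 0 i) then floop x b f r (Suc i) (f (seti (tick s) x 0 i))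
     else seti (tick s) x 0 i)"

fun sem :: "com \<Rightarrow> st \<Rightarrow> st" where
  "sem Skip s = s"
| "sem (IA k e v) s = seti (tick s) k (ie e s) (ie v s)"
| "sem (RA k e v) s = setr (tick s) k (ie e s) (re v s)"
| "sem (Seq a b) s = sem b (sem a s)"
| "sem (Cond b c1 c2) s = (if be b s then sem c1 (tick s) else sem c2 (tick s))"
| "sem (For x e b c) s = floop x (be b) (sem c) (ie e s) 0 (tick s)"

text \<open>Array 0 occupies the nonnegative addresses, where the conventions for input and output
  place their data; all other arrays are interleaved on the negative side. The spacing is a power of
  two because the machine has no integer multiplication: six doublings yield \<open>64 * z\<close>.
  Programs use arrays below 60, while 61 to 63 serve loops and temporaries.\<close>

definition addr :: "nat \<Rightarrow> nat \<Rightarrow> int" where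
  "addr k z = (if k = 0 then int z else - (64 * int z + int k))"

lemma addr_inj: assumes "k < 64" "k' < 64" "addr k z = addr k' z'" shows "k = k' \<and> z = z'"
proof -
  have "64 * z + k = 64 * z' + k' \<Longrightarrow> k = k' \<and> z = z'"
    using assms(1,2) by (metis add.commute div_mult_self4 div_less add_0_left mod_mult_self2 mod_less zero_neq_numeral)
  moreover have "k \<noteq> 0 \<Longrightarrow> k' \<noteq> 0 \<Longrightarrow> 64 * z + k = 64 * z' + k'"
    using assms(3) by (simp add: addr_def)
  ultimately show ?thesis using assms(3) by (cases "k = 0"; cases "k' = 0") (auto simp: addr_def)
qed

lemma addr_eq [simp]: "k < 64 \<Longrightarrow> k' < 64 \<Longrightarrow> addr k z = addr k' z' \<longleftrightarrow> k = k' \<and> z = z'"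
  using addr_inj by blast

abbreviation tmp :: "nat \<Rightarrow> int" where "tmp j \<equiv> addr 63 j"

definition mkaddr :: "nat \<Rightarrow> nat \<Rightarrow> instr list" where
  "mkaddr k d = (if k = 0 then [] else
     replicate 6 (IAdd (tmp d) (tmp d) (tmp d)) @ [IConst (tmp (Suc d)) (- int k), ISub (tmp d) (tmp (Suc d)) (tmp d)])"

definition malen :: "nat \<Rightarrow> nat" where "malen k = (if k = 0 then 0 else 8)"

lemma length_mkaddr [simp]: "length (mkaddr k d) = malen k" by (simp add: mkaddr_def malen_def)

fun ilen :: "iexp \<Rightarrow> nat" where
  "ilen (C c) = 1"
| "ilen (L k e) = ilen e + malen k + 1"
| "ilen (Add a b) = ilen a + ilen b + 1"
| "ilen (Sub a b) = ilen a + ilen b + 4"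

text \<open>The cells \<open>tmp d\<close> form an evaluation stack of height \<open>d\<close>, so
  the left operand survives the evaluation of the right one. Subtraction of naturals is cut off at
  0, hence the conditional jump over the last constant; the position \<open>pc\<close> matters only
  for its target.\<close>

fun icomp :: "iexp \<Rightarrow> nat \<Rightarrow> nat \<Rightarrow> instr list" where
  "icomp (C c) d pc = [IConst (tmp d) (int c)]"
| "icomp (L k e) d pc = icomp e d pc @ mkaddr k d @ [ILoadInd (tmp d) (tmp d)]"
| "icomp (Add a b) d pc = icomp a d pc @ icomp b (Suc d) (pc + ilen a) @ [IAdd (tmp d) (tmp d) (tmp (Suc d))]"
| "icomp (Sub a b) d pc = icomp a d pc @ icomp b (Suc d) (pc + ilen a) @ [ISub (tmp d) (tmp d) (tmp (Suc d)),
     IConst (tmp (Suc d)) 0, IJumpLe (tmp (Suc d)) (tmp d) (pc + ilen a + ilen b + 4), IConst (tmp d) 0]"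

fun rlen :: "rexp \<Rightarrow> nat" where
  "rlen (OfI e) = ilen e + 1"
| "rlen (RL k e) = ilen e + malen k + 1"
| "rlen (RAd a b) = rlen a + rlen b + 1"
| "rlen (RSb a b) = rlen a + rlen b + 1"
| "rlen (RMl a b) = rlen a + rlen b + 1"
| "rlen (RDv a b) = rlen a + rlen b + 1"

fun rcomp :: "rexp \<Rightarrow> nat \<Rightarrow> nat \<Rightarrow> instr list" where
  "rcomp (OfI e) d pc = icomp e d pc @ [RFromI (tmp d) (tmp d)]"
| "rcomp (RL k e) d pc = icomp e d pc @ mkaddr k d @ [RLoadInd (tmp d) (tmp d)]"
| "rcomp (RAd a b) d pc = rcomp a d pc @ rcomp b (Suc d) (pc + rlen a) @ [RAdd (tmp d) (tmp d) (tmp (Suc d))]"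
| "rcomp (RSb a b) d pc = rcomp a d pc @ rcomp b (Suc d) (pc + rlen a) @ [RSub (tmp d) (tmp d) (tmp (Suc d))]"
| "rcomp (RMl a b) d pc = rcomp a d pc @ rcomp b (Suc d) (pc + rlen a) @ [RMul (tmp d) (tmp d) (tmp (Suc d))]"
| "rcomp (RDv a b) d pc = rcomp a d pc @ rcomp b (Suc d) (pc + rlen a) @ [RDiv (tmp d) (tmp d) (tmp (Suc d))]"

fun blen :: "bexp \<Rightarrow> nat" where
  "blen (ILe a b) = ilen a + ilen b + 1"
| "blen (BLe a b) = rlen a + rlen b + 1"
| "blen (BLt a b) = rlen a + rlen b + 1"

text \<open>Jumps to \<open>l\<close> if the condition holds and falls through otherwise.\<close>
fun bcomp :: "bexp \<Rightarrow> nat \<Rightarrow> nat \<Rightarrow> instr list" where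
  "bcomp (ILe a b) l pc = icomp a 0 pc @ icomp b 1 (pc + ilen a) @ [IJumpLe (tmp 0) (tmp 1) l]"
| "bcomp (BLe a b) l pc = rcomp a 0 pc @ rcomp b 1 (pc + rlen a) @ [RJumpLe (tmp 0) (tmp 1) l]"
| "bcomp (BLt a b) l pc = rcomp a 0 pc @ rcomp b 1 (pc + rlen a) @ [RJumpLt (tmp 0) (tmp 1) l]"

fun clen :: "com \<Rightarrow> nat" where
  "clen Skip = 0"
| "clen (IA k e v) = ilen e + malen k + ilen v + 1"
| "clen (RA k e v) = ilen e + malen k + rlen v + 1"
| "clen (Seq a b) = clen a + clen b"
| "clen (Cond b c1 c2) = blen b + clen c2 + 1 + clen c1"
| "clen (For x e b c) = ilen e + 3 + (3 + (blen b + (1 + (clen c + 3))))"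

text \<open>The counter and the bound of a loop of nesting depth \<open>g\<close> live in the reserved cells
  \<open>addr 62 g\<close> and \<open>addr 61 g\<close>.\<close>
fun ccomp :: "com \<Rightarrow> nat \<Rightarrow> nat \<Rightarrow> instr list" where
  "ccomp Skip g pc = []"
| "ccomp (IA k e v) g pc = icomp e 0 pc @ mkaddr k 0 @ icomp v 1 (pc + ilen e + malen k) @ [IStoreInd (tmp 0) (tmp 1)]"
| "ccomp (RA k e v) g pc = icomp e 0 pc @ mkaddr k 0 @ rcomp v 1 (pc + ilen e + malen k) @ [RStoreInd (tmp 0) (tmp 1)]"
| "ccomp (Seq a b) g pc = ccomp a g pc @ ccomp b g (pc + clen a)"
| "ccomp (Cond b c1 c2) g pc = bcomp b (pc + blen b + clen c2 + 1) pc @ ccomp c2 g (pc + blen b)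
     @ [IJumpLe (tmp 0) (tmp 0) (pc + blen b + clen c2 + 1 + clen c1)] @ ccomp c1 g (pc + blen b + clen c2 + 1)"
| "ccomp (For x e b c) g pc = (let h = pc + ilen e + 3; q = h + 3 + blen b; ex = q + 1 + clen c + 3 in
     icomp e 0 pc @ [IConst (tmp 1) 0, IAdd (addr 61 g) (tmp 0) (tmp 1), IConst (addr 62 g) 0]
     @ [IJumpLe (addr 61 g) (addr 62 g) ex, IConst (tmp 1) 0, IAdd (addr x 0) (addr 62 g) (tmp 1)]
     @ bcomp b (q + 1) (h + 3) @ [IJumpLe (tmp 0) (tmp 0) ex] @ ccomp c (Suc g) (q + 1)
     @ [IConst (tmp 0) 1, IAdd (addr 62 g) (addr 62 g) (tmp 0), IJumpLe (tmp 0) (tmp 0) h])"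

lemma length_icomp [simp]: "length (icomp e d pc) = ilen e"
  by (induction e arbitrary: d pc) auto
lemma length_rcomp [simp]: "length (rcomp e d pc) = rlen e"
  by (induction e arbitrary: d pc) auto
lemma length_bcomp [simp]: "length (bcomp b l pc) = blen b"
  by (cases b) auto
lemma length_ccomp [simp]: "length (ccomp c g pc) = clen c"
  by (induction c arbitrary: g pc) (auto simp: Let_def)

section \<open>Execution of code fragments\<close>

definition code_at :: "instr list \<Rightarrow> nat \<Rightarrow> instr list \<Rightarrow> bool" where
  "code_at P pc xs \<longleftrightarrow> (\<forall>i<length xs. pc + i < length P \<and> P ! (pc + i) = xs ! i)"

lemma code_at_append [simp]: "code_at P pc (xs @ ys) \<longleftrightarrow> code_at P pc xs \<and> code_at P (pc + length xs) ys"
proof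
  assume a: "code_at P pc (xs @ ys)"
  have "code_at P pc xs" unfolding code_at_def
  proof (intro allI impI)
    fix i assume "i < length xs"
    thus "pc + i < length P \<and> P ! (pc + i) = xs ! i"
      using a[unfolded code_at_def, rule_format, of i] by (simp add: nth_append)
  qed
  moreover have "code_at P (pc + length xs) ys" unfolding code_at_def
  proof (intro allI impI)
    fix i assume "i < length ys"
    thus "pc + length xs + i < length P \<and> P ! (pc + length xs + i) = ys ! i"
      using a[unfolded code_at_def, rule_format, of "length xs + i"] by (simp add: add.assoc)
  qed
  ultimately show "code_at P pc xs \<and> code_at P (pc + length xs) ys" ..
next
  assume a: "code_at P pc xs \<and> code_at P (pc + length xs) ys"
  show "code_at P pc (xs @ ys)" unfolding code_at_def
  proof (intro allI impI)
    fix i assume i: "i < length (xs @ ys)"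
    show "pc + i < length P \<and> P ! (pc + i) = (xs @ ys) ! i"
    proof (cases "i < length xs")
      case True thus ?thesis using a by (simp add: code_at_def nth_append)
    next
      case False
      thus ?thesis using a[THEN conjunct2, unfolded code_at_def, rule_format, of "i - length xs"] i
        by (simp add: nth_append)
    qed
  qed
qed

lemma code_at_Cons [simp]: "code_at P pc (x # xs) \<longleftrightarrow> pc < length P \<and> P ! pc = x \<and> code_at P (Suc pc) xs"
proof -
  have "code_at P pc ([x] @ xs) \<longleftrightarrow> code_at P pc [x] \<and> code_at P (Suc pc) xs"
    by (subst code_at_append) simp
  thus ?thesis by (simp add: code_at_def)
qed
lemma code_at_Nil [simp]: "code_at P pc []" by (simp add: code_at_def)

inductive steps :: "instr list \<Rightarrow> nat \<Rightarrow> conf \<Rightarrow> conf \<Rightarrow> bool" for P where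
  steps_0: "steps P 0 c c"
| steps_Suc: "pc < length P \<Longrightarrow> P ! pc \<noteq> Halt \<Longrightarrow> steps P t (exec (P ! pc) (pc, I, R)) c' \<Longrightarrow> steps P (Suc t) (pc, I, R) c'"

lemma steps_trans: "steps P t c c' \<Longrightarrow> steps P t' c' c'' \<Longrightarrow> steps P (t + t') c c''"
  by (induction rule: steps.induct) (auto intro: steps.intros)

lemma steps_run: "steps P t c c' \<Longrightarrow> run P t c = c'"
proof (induction rule: steps.induct)
  case (steps_Suc pc t I R c')
  hence "step P (pc, I, R) = exec (P ! pc) (pc, I, R)" by (simp add: step_def halted_def)
  thus ?case using steps_Suc by (simp add: run_def funpow_swap1)
qed (simp add: run_def)

lemma steps_one: "pc < length P \<Longrightarrow> P ! pc = i \<Longrightarrow> i \<noteq> Halt \<Longrightarrow> exec i (pc, I, R) = c' \<Longrightarrow> steps P 1 (pc, I, R) c'"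
  using steps_Suc[of pc P 0 I R c'] steps_0[of P c'] by simp

text \<open>An upper bound instead of an exact count, since jumps may skip part of a fragment whose
  length serves as the bound.\<close>

definition goes :: "instr list \<Rightarrow> nat \<Rightarrow> conf \<Rightarrow> conf \<Rightarrow> bool" where
  "goes P n c c' \<longleftrightarrow> (\<exists>t\<le>n. steps P t c c')"

lemma goes_trans: "goes P t c c' \<Longrightarrow> goes P t' c' c'' \<Longrightarrow> goes P (t + t') c c''"
  unfolding goes_def by (meson add_mono steps_trans)
lemma goes_mono: "goes P t c c' \<Longrightarrow> t \<le> t' \<Longrightarrow> goes P t' c c'"
  unfolding goes_def by (meson le_trans)
lemma goes_refl: "goes P n c c"
  unfolding goes_def using steps_0 by blast
lemma goes_one: "pc < length P \<Longrightarrow> P ! pc = i \<Longrightarrow> i \<noteq> Halt \<Longrightarrow> exec i (pc, I, R) = c' \<Longrightarrow> goes P 1 (pc, I, R) c'"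
  unfolding goes_def using steps_one by blast

lemma goes_3: "goes P 1 c c1 \<Longrightarrow> goes P 1 c1 c2 \<Longrightarrow> goes P 1 c2 c3 \<Longrightarrow> goes P 3 c c3"
  by (rule goes_mono[OF goes_trans[OF goes_trans]]) auto

lemma steps_IAdd_replicate:
  assumes "code_at P pc (replicate m (IAdd a a a))"
  shows "goes P m (pc, I, R) (pc + m, I(a := 2 ^ m * I a), R)"
  using assms
proof (induction m arbitrary: pc I)
  case 0 thus ?case by (auto intro: goes_refl)
next
  case (Suc m)
  have "goes P m (Suc pc, I(a := I a + I a), R) (Suc pc + m, (I(a := I a + I a))(a := 2 ^ m * (I(a := I a + I a)) a), R)"
    by (rule Suc.IH) (use Suc.prems in simp)
  moreover have "goes P 1 (pc, I, R) (Suc pc, I(a := I a + I a), R)"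
    by (rule goes_one) (use Suc.prems in auto)
  ultimately have "goes P (1 + m) (pc, I, R) (Suc pc + m, I(a := I a + I a, a := 2 ^ m * (I(a := I a + I a)) a), R)"
    by (blast intro: goes_trans)
  moreover have "I(a := I a + I a, a := 2 ^ m * (I(a := I a + I a)) a) = I(a := 2 ^ Suc m * I a)"
    by (rule ext) simp
  ultimately show ?case by (simp add: fun_upd_def)
qed

lemma steps_mkaddr:
  assumes "code_at P pc (mkaddr k d)" "I (tmp d) = int z" "k < 60"
  shows "\<exists>I'. goes P (malen k) (pc, I, R) (pc + malen k, I', R) \<and> I' (tmp d) = addr k z
     \<and> (\<forall>a. (\<forall>j\<ge>d. a \<noteq> tmp j) \<longrightarrow> I' a = I a)"
proof (cases "k = 0")
  case True thus ?thesis using assms by (auto simp: mkaddr_def malen_def addr_def intro: goes_refl)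
next
  case False
  note c = assms(1)[unfolded mkaddr_def]
  let ?I1 = "I(tmp d := 64 * int z)"
  have 1: "goes P 6 (pc, I, R) (pc + 6, ?I1, R)"
    using steps_IAdd_replicate[of P pc 6 "tmp d" I R] c False assms(2) by simp
  let ?I2 = "?I1(tmp (Suc d) := - int k)"
  have 2: "goes P 1 (pc + 6, ?I1, R) (Suc (pc + 6), ?I2, R)"
    by (rule goes_one[of _ _ "IConst (tmp (Suc d)) (- int k)"]) (use c False in auto)
  let ?I3 = "?I2(tmp d := - int k - 64 * int z)"
  have 3: "goes P 1 (Suc (pc + 6), ?I2, R) (Suc (Suc (pc + 6)), ?I3, R)"
    by (rule goes_one[of _ _ "ISub (tmp d) (tmp (Suc d)) (tmp d)"]) (use c False in auto)
  have "goes P 8 (pc, I, R) (pc + 8, ?I3, R)"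
    using goes_trans[OF goes_trans[OF 1 2] 3] by (simp add: add.commute)
  moreover have "addr k z = - int k - 64 * int z" using False by (simp add: addr_def)
  ultimately show ?thesis using False by (intro exI[of _ ?I3]) (auto simp: fun_upd_def malen_def)
qed

section \<open>Simulation of the structured semantics by the machine\<close>

definition match :: "st \<Rightarrow> (int \<Rightarrow> int) \<Rightarrow> (int \<Rightarrow> real) \<Rightarrow> bool" where
  "match s I R \<longleftrightarrow> (\<forall>k<60. \<forall>z. I (addr k z) = int (IM s k z) \<and> R (addr k z) = RM s k z)"

fun wfi :: "iexp \<Rightarrow> bool" where
  "wfi (C c) = True" | "wfi (L k e) = (k < 60 \<and> wfi e)" | "wfi (Add a b) = (wfi a \<and> wfi b)" | "wfi (Sub a b) = (wfi a \<and> wfi b)"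
fun wfr :: "rexp \<Rightarrow> bool" where
  "wfr (OfI e) = wfi e" | "wfr (RL k e) = (k < 60 \<and> wfi e)" | "wfr (RAd a b) = (wfr a \<and> wfr b)"
| "wfr (RSb a b) = (wfr a \<and> wfr b)" | "wfr (RMl a b) = (wfr a \<and> wfr b)" | "wfr (RDv a b) = (wfr a \<and> wfr b)"
fun wfb :: "bexp \<Rightarrow> bool" where
  "wfb (ILe a b) = (wfi a \<and> wfi b)" | "wfb (BLe a b) = (wfr a \<and> wfr b)" | "wfb (BLt a b) = (wfr a \<and> wfr b)"
fun wfc :: "com \<Rightarrow> bool" where
  "wfc Skip = True" | "wfc (IA k e v) = (k < 60 \<and> wfi e \<and> wfi v)" | "wfc (RA k e v) = (k < 60 \<and> wfi e \<and> wfr v)"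
| "wfc (Seq a b) = (wfc a \<and> wfc b)" | "wfc (Cond b c1 c2) = (wfb b \<and> wfc c1 \<and> wfc c2)"
| "wfc (For x e b c) = (x < 60 \<and> wfi e \<and> wfb b \<and> wfc c)"

lemma match_upd_tmp: "match s I R \<Longrightarrow> (\<And>k z. k < 60 \<Longrightarrow> I' (addr k z) = I (addr k z)) \<Longrightarrow>
   (\<And>k z. k < 60 \<Longrightarrow> R' (addr k z) = R (addr k z)) \<Longrightarrow> match s I' R'"
  by (simp add: match_def)

text \<open>Stack cells below height \<open>d\<close> stay untouched, which is what lets the
  induction evaluate two operands in turn; \<open>match\<close> survives because it speaks only of
  arrays below 60.\<close>

lemma steps_icomp:
  assumes "code_at P pc (icomp e d pc)" "match s I R" "wfi e"
  shows "\<exists>I'. goes P (ilen e) (pc, I, R) (pc + ilen e, I', R) \<and> I' (tmp d) = int (ie e s)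
     \<and> (\<forall>a. (\<forall>j\<ge>d. a \<noteq> tmp j) \<longrightarrow> I' a = I a)"
  using assms
proof (induction e arbitrary: d pc I)
  case (C c)
  show ?case using C by (intro exI[of _ "I(tmp d := int c)"]) (auto intro!: goes_one[simplified] simp: fun_upd_def)
next
  case (L k e)
  then obtain I1 where I1: "goes P (ilen e) (pc, I, R) (pc + ilen e, I1, R)" "I1 (tmp d) = int (ie e s)"
     "\<forall>a. (\<forall>j\<ge>d. a \<noteq> tmp j) \<longrightarrow> I1 a = I a" by fastforce
  from steps_mkaddr[of P "pc + ilen e" k d I1 "ie e s" R] L.prems I1(2)
  obtain I2 where I2: "goes P (malen k) (pc + ilen e, I1, R) (pc + ilen e + malen k, I2, R)"
     "I2 (tmp d) = addr k (ie e s)" "\<forall>a. (\<forall>j\<ge>d. a \<noteq> tmp j) \<longrightarrow> I2 a = I1 a" by auto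
  let ?q = "pc + ilen e + malen k"
  let ?I3 = "I2(tmp d := I2 (addr k (ie e s)))"
  have 3: "goes P 1 (?q, I2, R) (Suc ?q, ?I3, R)"
    by (rule goes_one[of _ _ "ILoadInd (tmp d) (tmp d)"]) (use L.prems I2(2) in \<open>auto simp: add.assoc\<close>)
  have "I2 (addr k (ie e s)) = int (IM s k (ie e s))"
    using L.prems I1(3) I2(3) by (simp add: match_def)
  thus ?case using goes_trans[OF goes_trans[OF I1(1) I2(1)] 3] I1(3) I2(3)
    by (intro exI[of _ ?I3]) (auto simp: fun_upd_def add.assoc)
next
  case (Add a b)
  from Add.IH(1)[of pc d I] Add.prems obtain I1 where I1: "goes P (ilen a) (pc, I, R) (pc + ilen a, I1, R)" "I1 (tmp d) = int (ie a s)"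
     "\<forall>x. (\<forall>j\<ge>d. x \<noteq> tmp j) \<longrightarrow> I1 x = I x" by auto
  have "match s I1 R" by (rule match_upd_tmp[OF Add.prems(2)]) (auto simp: I1(3))
  with Add.IH(2)[of "pc + ilen a" "Suc d" I1] Add.prems
  obtain I2 where I2: "goes P (ilen b) (pc + ilen a, I1, R) (pc + ilen a + ilen b, I2, R)" "I2 (tmp (Suc d)) = int (ie b s)"
     "\<forall>x. (\<forall>j\<ge>Suc d. x \<noteq> tmp j) \<longrightarrow> I2 x = I1 x" by auto
  let ?q = "pc + ilen a + ilen b"
  let ?I3 = "I2(tmp d := int (ie a s) + int (ie b s))"
  have "I2 (tmp d) = int (ie a s)" using I2(3) I1(2) by auto
  hence 3: "goes P 1 (?q, I2, R) (Suc ?q, ?I3, R)"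
    by (intro goes_one[of _ _ "IAdd (tmp d) (tmp d) (tmp (Suc d))"]) (use Add.prems I2(2) in \<open>auto simp: add.assoc\<close>)
  show ?case using goes_trans[OF goes_trans[OF I1(1) I2(1)] 3] I1(3) I2(3)
    by (intro exI[of _ ?I3]) (auto simp: fun_upd_def add.assoc)
next
  case (Sub a b)
  from Sub.IH(1)[of pc d I] Sub.prems obtain I1 where I1: "goes P (ilen a) (pc, I, R) (pc + ilen a, I1, R)" "I1 (tmp d) = int (ie a s)"
     "\<forall>x. (\<forall>j\<ge>d. x \<noteq> tmp j) \<longrightarrow> I1 x = I x" by auto
  have "match s I1 R" by (rule match_upd_tmp[OF Sub.prems(2)]) (auto simp: I1(3))
  with Sub.IH(2)[of "pc + ilen a" "Suc d" I1] Sub.prems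
  obtain I2 where I2: "goes P (ilen b) (pc + ilen a, I1, R) (pc + ilen a + ilen b, I2, R)" "I2 (tmp (Suc d)) = int (ie b s)"
     "\<forall>x. (\<forall>j\<ge>Suc d. x \<noteq> tmp j) \<longrightarrow> I2 x = I1 x" by auto
  let ?q = "pc + ilen a + ilen b"
  let ?v = "int (ie a s) - int (ie b s)"
  have td: "I2 (tmp d) = int (ie a s)" using I2(3) I1(2) by auto
  let ?I3 = "I2(tmp d := ?v)"
  have 3: "goes P 1 (?q, I2, R) (Suc ?q, ?I3, R)"
    by (intro goes_one[of _ _ "ISub (tmp d) (tmp d) (tmp (Suc d))"]) (use Sub.prems I2(2) td in \<open>auto simp: add.assoc\<close>)
  let ?I4 = "?I3(tmp (Suc d) := 0)"
  have 4: "goes P 1 (Suc ?q, ?I3, R) (Suc (Suc ?q), ?I4, R)"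
    by (intro goes_one[of _ _ "IConst (tmp (Suc d)) 0"]) (use Sub.prems in \<open>auto simp: add.assoc\<close>)
  note S = goes_trans[OF goes_trans[OF goes_trans[OF I1(1) I2(1)] 3] 4]
  have fr: "\<forall>x. (\<forall>j\<ge>d. x \<noteq> tmp j) \<longrightarrow> ?I4 x = I x" using I1(3) I2(3) by auto
  have e4: "?q + 4 = pc + ilen (Sub a b)" by simp
  show ?case
  proof (cases "0 \<le> ?v")
    case True
    have 5: "goes P 1 (Suc (Suc ?q), ?I4, R) (?q + 4, ?I4, R)"
      by (intro goes_one[of _ _ "IJumpLe (tmp (Suc d)) (tmp d) (?q + 4)"]) (use Sub.prems True in \<open>auto simp: add.assoc\<close>)
    have "?I4 (tmp d) = int (ie (Sub a b) s)" using True by simp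
    moreover have "goes P (ilen (Sub a b)) (pc, I, R) (pc + ilen (Sub a b), ?I4, R)"
      by (rule goes_mono[OF goes_trans[OF S 5, unfolded e4]]) simp
    ultimately show ?thesis using fr by blast
  next
    case False
    have 5: "goes P 1 (Suc (Suc ?q), ?I4, R) (Suc (Suc (Suc ?q)), ?I4, R)"
      by (intro goes_one[of _ _ "IJumpLe (tmp (Suc d)) (tmp d) (?q + 4)"]) (use Sub.prems False in \<open>auto simp: add.assoc\<close>)
    have 6: "goes P 1 (Suc (Suc (Suc ?q)), ?I4, R) (?q + 4, ?I4(tmp d := 0), R)"
      by (intro goes_one[of _ _ "IConst (tmp d) 0"]) (use Sub.prems in \<open>auto simp: add.assoc numeral_eq_Suc\<close>)
    have "(?I4(tmp d := 0)) (tmp d) = int (ie (Sub a b) s)" using False by simp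
    moreover have "goes P (ilen (Sub a b)) (pc, I, R) (pc + ilen (Sub a b), ?I4(tmp d := 0), R)"
      by (rule goes_mono[OF goes_trans[OF goes_trans[OF S 5] 6, unfolded e4]]) simp
    moreover have "\<forall>x. (\<forall>j\<ge>d. x \<noteq> tmp j) \<longrightarrow> (?I4(tmp d := 0)) x = I x" using fr by auto
    ultimately show ?thesis by blast
  qed
qed

lemma steps_rcomp:
  assumes "code_at P pc (rcomp e d pc)" "match s I R" "wfr e"
  shows "\<exists>I' R'. goes P (rlen e) (pc, I, R) (pc + rlen e, I', R') \<and> R' (tmp d) = re e s
     \<and> (\<forall>a. (\<forall>j\<ge>d. a \<noteq> tmp j) \<longrightarrow> I' a = I a \<and> R' a = R a)"
  using assms
proof (induction e arbitrary: d pc I R)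
  case (OfI e)
  with steps_icomp[of P pc e d s I R]
  obtain I1 where I1: "goes P (ilen e) (pc, I, R) (pc + ilen e, I1, R)" "I1 (tmp d) = int (ie e s)"
     "\<forall>x. (\<forall>j\<ge>d. x \<noteq> tmp j) \<longrightarrow> I1 x = I x" by auto
  have "goes P 1 (pc + ilen e, I1, R) (Suc (pc + ilen e), I1, R(tmp d := real (ie e s)))"
    by (intro goes_one[of _ _ "RFromI (tmp d) (tmp d)"]) (use OfI.prems I1(2) in auto)
  from goes_trans[OF I1(1) this] show ?case
    using I1(3) by (intro exI[of _ I1] exI[of _ "R(tmp d := real (ie e s))"]) (auto simp: fun_upd_def)
next
  case (RL k e)
  with steps_icomp[of P pc e d s I R]
  obtain I1 where I1: "goes P (ilen e) (pc, I, R) (pc + ilen e, I1, R)" "I1 (tmp d) = int (ie e s)"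
     "\<forall>x. (\<forall>j\<ge>d. x \<noteq> tmp j) \<longrightarrow> I1 x = I x" by auto
  from steps_mkaddr[of P "pc + ilen e" k d I1 "ie e s" R] RL.prems I1(2)
  obtain I2 where I2: "goes P (malen k) (pc + ilen e, I1, R) (pc + ilen e + malen k, I2, R)"
     "I2 (tmp d) = addr k (ie e s)" "\<forall>a. (\<forall>j\<ge>d. a \<noteq> tmp j) \<longrightarrow> I2 a = I1 a" by auto
  let ?q = "pc + ilen e + malen k"
  let ?R3 = "R(tmp d := R (addr k (ie e s)))"
  have 3: "goes P 1 (?q, I2, R) (Suc ?q, I2, ?R3)"
    by (rule goes_one[of _ _ "RLoadInd (tmp d) (tmp d)"]) (use RL.prems I2(2) in \<open>auto simp: add.assoc\<close>)
  have "R (addr k (ie e s)) = RM s k (ie e s)"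
    using RL.prems by (simp add: match_def)
  thus ?case using goes_trans[OF goes_trans[OF I1(1) I2(1)] 3] I1(3) I2(3)
    by (intro exI[of _ I2] exI[of _ ?R3]) (auto simp: fun_upd_def add.assoc)
next
  case (RAd a b)
  from RAd.IH(1)[of pc d I R] RAd.prems obtain I1 R1 where I1: "goes P (rlen a) (pc, I, R) (pc + rlen a, I1, R1)" "R1 (tmp d) = re a s"
     "\<forall>x. (\<forall>j\<ge>d. x \<noteq> tmp j) \<longrightarrow> I1 x = I x \<and> R1 x = R x" by auto
  have "match s I1 R1" by (rule match_upd_tmp[OF RAd.prems(2)]) (auto simp: I1(3))
  with RAd.IH(2)[of "pc + rlen a" "Suc d" I1 R1] RAd.prems
  obtain I2 R2 where I2: "goes P (rlen b) (pc + rlen a, I1, R1) (pc + rlen a + rlen b, I2, R2)" "R2 (tmp (Suc d)) = re b s"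
     "\<forall>x. (\<forall>j\<ge>Suc d. x \<noteq> tmp j) \<longrightarrow> I2 x = I1 x \<and> R2 x = R1 x" by auto
  let ?q = "pc + rlen a + rlen b"
  let ?R3 = "R2(tmp d := re a s + re b s)"
  have "R2 (tmp d) = re a s" using I2(3) I1(2) by auto
  hence 3: "goes P 1 (?q, I2, R2) (Suc ?q, I2, ?R3)"
    by (intro goes_one[of _ _ "RAdd (tmp d) (tmp d) (tmp (Suc d))"]) (use RAd.prems I2(2) in \<open>auto simp: add.assoc\<close>)
  show ?case using goes_trans[OF goes_trans[OF I1(1) I2(1)] 3] I1(3) I2(3)
    by (intro exI[of _ I2] exI[of _ ?R3]) (auto simp: fun_upd_def add.assoc)
next
  case (RSb a b)
  from RSb.IH(1)[of pc d I R] RSb.prems obtain I1 R1 where I1: "goes P (rlen a) (pc, I, R) (pc + rlen a, I1, R1)" "R1 (tmp d) = re a s"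
     "\<forall>x. (\<forall>j\<ge>d. x \<noteq> tmp j) \<longrightarrow> I1 x = I x \<and> R1 x = R x" by auto
  have "match s I1 R1" by (rule match_upd_tmp[OF RSb.prems(2)]) (auto simp: I1(3))
  with RSb.IH(2)[of "pc + rlen a" "Suc d" I1 R1] RSb.prems
  obtain I2 R2 where I2: "goes P (rlen b) (pc + rlen a, I1, R1) (pc + rlen a + rlen b, I2, R2)" "R2 (tmp (Suc d)) = re b s"
     "\<forall>x. (\<forall>j\<ge>Suc d. x \<noteq> tmp j) \<longrightarrow> I2 x = I1 x \<and> R2 x = R1 x" by auto
  let ?q = "pc + rlen a + rlen b"
  let ?R3 = "R2(tmp d := re a s - re b s)"
  have "R2 (tmp d) = re a s" using I2(3) I1(2) by auto
  hence 3: "goes P 1 (?q, I2, R2) (Suc ?q, I2, ?R3)"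
    by (intro goes_one[of _ _ "RSub (tmp d) (tmp d) (tmp (Suc d))"]) (use RSb.prems I2(2) in \<open>auto simp: add.assoc\<close>)
  show ?case using goes_trans[OF goes_trans[OF I1(1) I2(1)] 3] I1(3) I2(3)
    by (intro exI[of _ I2] exI[of _ ?R3]) (auto simp: fun_upd_def add.assoc)
next
  case (RMl a b)
  from RMl.IH(1)[of pc d I R] RMl.prems obtain I1 R1 where I1: "goes P (rlen a) (pc, I, R) (pc + rlen a, I1, R1)" "R1 (tmp d) = re a s"
     "\<forall>x. (\<forall>j\<ge>d. x \<noteq> tmp j) \<longrightarrow> I1 x = I x \<and> R1 x = R x" by auto
  have "match s I1 R1" by (rule match_upd_tmp[OF RMl.prems(2)]) (auto simp: I1(3))
  with RMl.IH(2)[of "pc + rlen a" "Suc d" I1 R1] RMl.prems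
  obtain I2 R2 where I2: "goes P (rlen b) (pc + rlen a, I1, R1) (pc + rlen a + rlen b, I2, R2)" "R2 (tmp (Suc d)) = re b s"
     "\<forall>x. (\<forall>j\<ge>Suc d. x \<noteq> tmp j) \<longrightarrow> I2 x = I1 x \<and> R2 x = R1 x" by auto
  let ?q = "pc + rlen a + rlen b"
  let ?R3 = "R2(tmp d := re a s * re b s)"
  have "R2 (tmp d) = re a s" using I2(3) I1(2) by auto
  hence 3: "goes P 1 (?q, I2, R2) (Suc ?q, I2, ?R3)"
    by (intro goes_one[of _ _ "RMul (tmp d) (tmp d) (tmp (Suc d))"]) (use RMl.prems I2(2) in \<open>auto simp: add.assoc\<close>)
  show ?case using goes_trans[OF goes_trans[OF I1(1) I2(1)] 3] I1(3) I2(3)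
    by (intro exI[of _ I2] exI[of _ ?R3]) (auto simp: fun_upd_def add.assoc)
next
  case (RDv a b)
  from RDv.IH(1)[of pc d I R] RDv.prems obtain I1 R1 where I1: "goes P (rlen a) (pc, I, R) (pc + rlen a, I1, R1)" "R1 (tmp d) = re a s"
     "\<forall>x. (\<forall>j\<ge>d. x \<noteq> tmp j) \<longrightarrow> I1 x = I x \<and> R1 x = R x" by auto
  have "match s I1 R1" by (rule match_upd_tmp[OF RDv.prems(2)]) (auto simp: I1(3))
  with RDv.IH(2)[of "pc + rlen a" "Suc d" I1 R1] RDv.prems
  obtain I2 R2 where I2: "goes P (rlen b) (pc + rlen a, I1, R1) (pc + rlen a + rlen b, I2, R2)" "R2 (tmp (Suc d)) = re b s"
     "\<forall>x. (\<forall>j\<ge>Suc d. x \<noteq> tmp j) \<longrightarrow> I2 x = I1 x \<and> R2 x = R1 x" by auto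
  let ?q = "pc + rlen a + rlen b"
  let ?R3 = "R2(tmp d := re a s / re b s)"
  have "R2 (tmp d) = re a s" using I2(3) I1(2) by auto
  hence 3: "goes P 1 (?q, I2, R2) (Suc ?q, I2, ?R3)"
    by (intro goes_one[of _ _ "RDiv (tmp d) (tmp d) (tmp (Suc d))"]) (use RDv.prems I2(2) in \<open>auto simp: add.assoc\<close>)
  show ?case using goes_trans[OF goes_trans[OF I1(1) I2(1)] 3] I1(3) I2(3)
    by (intro exI[of _ I2] exI[of _ ?R3]) (auto simp: fun_upd_def add.assoc)
qed

lemma match_keep_tmp:
  assumes "match s I R" "\<forall>x. (\<forall>j\<ge>d. x \<noteq> tmp j) \<longrightarrow> I1 x = I x \<and> R1 x = R x"
  shows "match s I1 R1"
  by (rule match_upd_tmp[OF assms(1)]) (auto simp: assms(2))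

lemma steps_cmp:
  assumes "code_at P pc (rcomp a 0 pc @ rcomp b 1 (pc + rlen a))" "match s I R" "wfr a" "wfr b"
  shows "\<exists>I' R'. goes P (rlen a + rlen b) (pc, I, R) (pc + rlen a + rlen b, I', R')
     \<and> R' (tmp 0) = re a s \<and> R' (tmp 1) = re b s \<and> (\<forall>a. (\<forall>j. a \<noteq> tmp j) \<longrightarrow> I' a = I a \<and> R' a = R a)"
proof -
  from steps_rcomp[of P pc a 0 s I R] assms
  obtain I1 R1 where I1: "goes P (rlen a) (pc, I, R) (pc + rlen a, I1, R1)" "R1 (tmp 0) = re a s"
     "\<forall>x. (\<forall>j\<ge>0. x \<noteq> tmp j) \<longrightarrow> I1 x = I x \<and> R1 x = R x" by auto
  from steps_rcomp[of P "pc + rlen a" b 1 s I1 R1] assms match_keep_tmp[OF assms(2) I1(3)]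
  obtain I2 R2 where I2: "goes P (rlen b) (pc + rlen a, I1, R1) (pc + rlen a + rlen b, I2, R2)" "R2 (tmp 1) = re b s"
     "\<forall>x. (\<forall>j\<ge>1. x \<noteq> tmp j) \<longrightarrow> I2 x = I1 x \<and> R2 x = R1 x" by auto
  have "R2 (tmp 0) = re a s" using I2(3) I1(2) by auto
  thus ?thesis using goes_trans[OF I1(1) I2(1)] I2 I1(3) by (intro exI[of _ I2] exI[of _ R2]) (auto simp: fun_upd_def)
qed

lemma steps_bcomp:
  assumes "code_at P pc (bcomp b l pc)" "match s I R" "wfb b"
  shows "\<exists>I' R'. goes P (blen b) (pc, I, R) (if be b s then l else pc + blen b, I', R')
     \<and> (\<forall>a. (\<forall>j. a \<noteq> tmp j) \<longrightarrow> I' a = I a \<and> R' a = R a)"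
proof (cases b)
  case (ILe a b')
  from steps_icomp[of P pc a 0 s I R] assms ILe
  obtain I1 where I1: "goes P (ilen a) (pc, I, R) (pc + ilen a, I1, R)" "I1 (tmp 0) = int (ie a s)"
     "\<forall>x. (\<forall>j\<ge>0. x \<noteq> tmp j) \<longrightarrow> I1 x = I x" by auto
  have m: "match s I1 R" by (rule match_keep_tmp[OF assms(2)]) (use I1(3) in auto)
  from steps_icomp[of P "pc + ilen a" b' 1 s I1 R] assms ILe m
  obtain I2 where I2: "goes P (ilen b') (pc + ilen a, I1, R) (pc + ilen a + ilen b', I2, R)" "I2 (tmp 1) = int (ie b' s)"
     "\<forall>x. (\<forall>j\<ge>1. x \<noteq> tmp j) \<longrightarrow> I2 x = I1 x" by auto
  have t0: "I2 (tmp 0) = int (ie a s)" using I2(3) I1(2) by auto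
  have "goes P 1 (pc + ilen a + ilen b', I2, R) (if be b s then l else pc + blen b, I2, R)"
    by (rule goes_one[of _ _ "IJumpLe (tmp 0) (tmp 1) l"]) (use assms ILe t0 I2(2) in \<open>auto simp: add.assoc\<close>)
  from goes_trans[OF goes_trans[OF I1(1) I2(1)] this] show ?thesis
    using I1(3) I2(3) ILe by (intro exI[of _ I2] exI[of _ R]) (auto simp: fun_upd_def add.assoc)
next
  case (BLe a b')
  from steps_cmp[of P pc a b' s I R] assms BLe
  obtain I2 R2 where 1: "goes P (rlen a + rlen b') (pc, I, R) (pc + rlen a + rlen b', I2, R2)"
     "R2 (tmp 0) = re a s" "R2 (tmp 1) = re b' s" "\<forall>a. (\<forall>j. a \<noteq> tmp j) \<longrightarrow> I2 a = I a \<and> R2 a = R a" by auto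
  have "goes P 1 (pc + rlen a + rlen b', I2, R2) (if be b s then l else pc + blen b, I2, R2)"
    by (rule goes_one[of _ _ "RJumpLe (tmp 0) (tmp 1) l"]) (use assms BLe 1 in \<open>auto simp: add.assoc\<close>)
  from goes_trans[OF 1(1) this] show ?thesis
    using 1(4) BLe by (intro exI[of _ I2] exI[of _ R2]) (auto simp: fun_upd_def add.assoc)
next
  case (BLt a b')
  from steps_cmp[of P pc a b' s I R] assms BLt
  obtain I2 R2 where 1: "goes P (rlen a + rlen b') (pc, I, R) (pc + rlen a + rlen b', I2, R2)"
     "R2 (tmp 0) = re a s" "R2 (tmp 1) = re b' s" "\<forall>a. (\<forall>j. a \<noteq> tmp j) \<longrightarrow> I2 a = I a \<and> R2 a = R a" by auto
  have "goes P 1 (pc + rlen a + rlen b', I2, R2) (if be b s then l else pc + blen b, I2, R2)"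
    by (rule goes_one[of _ _ "RJumpLt (tmp 0) (tmp 1) l"]) (use assms BLt 1 in \<open>auto simp: add.assoc\<close>)
  from goes_trans[OF 1(1) this] show ?thesis
    using 1(4) BLt by (intro exI[of _ I2] exI[of _ R2]) (auto simp: fun_upd_def add.assoc)
qed

text \<open>A loop of depth \<open>g\<close> owns the two control cells of index \<open>g\<close>.
  Its body runs at depth \<open>Suc g\<close> and has to respect the control cells of all enclosing
  loops.\<close>

definition keeps :: "nat \<Rightarrow> (int \<Rightarrow> int) \<Rightarrow> (int \<Rightarrow> int) \<Rightarrow> bool" where
  "keeps g I I' \<longleftrightarrow> (\<forall>j<g. I' (addr 61 j) = I (addr 61 j) \<and> I' (addr 62 j) = I (addr 62 j))"

text \<open>Each tick of the clock pays for at most \<open>W\<close> machine steps.\<close>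
definition sim :: "instr list \<Rightarrow> nat \<Rightarrow> nat \<Rightarrow> nat \<Rightarrow> nat \<Rightarrow> st \<Rightarrow> st \<Rightarrow> (int \<Rightarrow> int) \<Rightarrow> (int \<Rightarrow> real) \<Rightarrow> nat \<Rightarrow> bool" where
  "sim P W g pc pc' s s' I R extra \<longleftrightarrow> (\<exists>t I' R'. goes P t (pc, I, R) (pc', I', R') \<and> t + W * CK s \<le> W * CK s' + extra
     \<and> match s' I' R' \<and> keeps g I I')"

lemma sim_trans:
  assumes "sim P W g pc pc1 s s1 I R x" "\<And>I' R'. match s1 I' R' \<Longrightarrow> keeps g I I' \<Longrightarrow> sim P W g pc1 pc2 s1 s2 I' R' y"
  shows "sim P W g pc pc2 s s2 I R (x + y)"
proof -
  from assms(1) obtain t I1 R1 where 1: "goes P t (pc, I, R) (pc1, I1, R1)" "t + W * CK s \<le> W * CK s1 + x"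
     "match s1 I1 R1" "keeps g I I1" unfolding sim_def by blast
  from assms(2)[OF 1(3,4)] obtain t' I2 R2 where 2: "goes P t' (pc1, I1, R1) (pc2, I2, R2)" "t' + W * CK s1 \<le> W * CK s2 + y"
     "match s2 I2 R2" "keeps g I1 I2" unfolding sim_def by blast
  have "keeps g I I2" using 1(4) 2(4) by (simp add: keeps_def)
  thus ?thesis unfolding sim_def using goes_trans[OF 1(1) 2(1)] 1(2) 2(2,3)
    by (intro exI[of _ "t + t'"] exI[of _ I2] exI[of _ R2]) (auto simp: fun_upd_def)
qed

lemma simI: "goes P t (pc, I, R) (pc', I', R') \<Longrightarrow> t + W * CK s \<le> W * CK s' + extra \<Longrightarrow> match s' I' R' \<Longrightarrow> keeps g I I'
  \<Longrightarrow> sim P W g pc pc' s s' I R extra"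
  unfolding sim_def by blast

text \<open>Each assignment, branch and loop pass spends a tick and executes, outside its
  subcommands, at most as many instructions as the whole code is long. So any \<open>W\<close> at
  least as large as the code length pays for it.\<close>

lemma sim_ccomp:
  assumes "code_at P pc (ccomp c g pc)" "match s I R" "wfc c" "clen c \<le> W"
  shows "sim P W g pc (pc + clen c) s (sem c s) I R 0"
  using assms
proof (induction c arbitrary: g pc s I R)
  case Skip
  thus ?case by (auto intro!: simI[OF goes_refl[of P 0]] simp: keeps_def)
next
  case (IA k e v)
  from steps_icomp[of P pc e 0 s I R] IA.prems
  obtain I1 where I1: "goes P (ilen e) (pc, I, R) (pc + ilen e, I1, R)" "I1 (tmp 0) = int (ie e s)"
     "\<forall>x. (\<forall>j\<ge>0. x \<noteq> tmp j) \<longrightarrow> I1 x = I x" by auto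
  from steps_mkaddr[of P "pc + ilen e" k 0 I1 "ie e s" R] IA.prems I1(2)
  obtain I2 where I2: "goes P (malen k) (pc + ilen e, I1, R) (pc + ilen e + malen k, I2, R)"
     "I2 (tmp 0) = addr k (ie e s)" "\<forall>a. (\<forall>j\<ge>0. a \<noteq> tmp j) \<longrightarrow> I2 a = I1 a" by auto
  have m: "match s I2 R" by (rule match_keep_tmp[OF IA.prems(2), of 0]) (use I1(3) I2(3) in auto)
  let ?q = "pc + ilen e + malen k"
  from steps_icomp[of P ?q v 1 s I2 R] IA.prems m
  obtain I3 where I3: "goes P (ilen v) (?q, I2, R) (?q + ilen v, I3, R)" "I3 (tmp 1) = int (ie v s)"
     "\<forall>x. (\<forall>j\<ge>1. x \<noteq> tmp j) \<longrightarrow> I3 x = I2 x" by (auto simp: add.assoc)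
  have t0: "I3 (tmp 0) = addr k (ie e s)" using I3(3) I2(2) by auto
  have m3: "match s I3 R" by (rule match_keep_tmp[OF m, of 1]) (use I3(3) in auto)
  let ?I4 = "I3(addr k (ie e s) := int (ie v s))"
  have 4: "goes P 1 (?q + ilen v, I3, R) (Suc (?q + ilen v), ?I4, R)"
    by (intro goes_one[of _ _ "IStoreInd (tmp 0) (tmp 1)"]) (use IA.prems t0 I3(2) in \<open>auto simp: add.assoc\<close>)
  show ?case
  proof (rule simI)
    show "goes P (clen (IA k e v)) (pc, I, R) (pc + clen (IA k e v), ?I4, R)"
      using goes_trans[OF goes_trans[OF goes_trans[OF I1(1) I2(1)] I3(1)] 4] by (simp add: add.assoc)
    show "match (sem (IA k e v) s) ?I4 R" using m3 IA.prems(3) by (auto simp: match_def)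
    show "keeps g I ?I4" using I1(3) I2(3) I3(3) IA.prems(3) by (auto simp: keeps_def)
  qed (use IA.prems in auto)
next
  case (RA k e v)
  from steps_icomp[of P pc e 0 s I R] RA.prems
  obtain I1 where I1: "goes P (ilen e) (pc, I, R) (pc + ilen e, I1, R)" "I1 (tmp 0) = int (ie e s)"
     "\<forall>x. (\<forall>j\<ge>0. x \<noteq> tmp j) \<longrightarrow> I1 x = I x" by auto
  from steps_mkaddr[of P "pc + ilen e" k 0 I1 "ie e s" R] RA.prems I1(2)
  obtain I2 where I2: "goes P (malen k) (pc + ilen e, I1, R) (pc + ilen e + malen k, I2, R)"
     "I2 (tmp 0) = addr k (ie e s)" "\<forall>a. (\<forall>j\<ge>0. a \<noteq> tmp j) \<longrightarrow> I2 a = I1 a" by auto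
  have m: "match s I2 R" by (rule match_keep_tmp[OF RA.prems(2), of 0]) (use I1(3) I2(3) in auto)
  let ?q = "pc + ilen e + malen k"
  from steps_rcomp[of P ?q v 1 s I2 R] RA.prems m
  obtain I3 R3 where I3: "goes P (rlen v) (?q, I2, R) (?q + rlen v, I3, R3)" "R3 (tmp 1) = re v s"
     "\<forall>x. (\<forall>j\<ge>1. x \<noteq> tmp j) \<longrightarrow> I3 x = I2 x \<and> R3 x = R x" by (auto simp: add.assoc)
  have t0: "I3 (tmp 0) = addr k (ie e s)" using I3(3) I2(2) by auto
  have m3: "match s I3 R3" by (rule match_keep_tmp[OF m I3(3)])
  let ?R4 = "R3(addr k (ie e s) := re v s)"
  have 4: "goes P 1 (?q + rlen v, I3, R3) (Suc (?q + rlen v), I3, ?R4)"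
    by (intro goes_one[of _ _ "RStoreInd (tmp 0) (tmp 1)"]) (use RA.prems t0 I3(2) in \<open>auto simp: add.assoc\<close>)
  show ?case
  proof (rule simI)
    show "goes P (clen (RA k e v)) (pc, I, R) (pc + clen (RA k e v), I3, ?R4)"
      using goes_trans[OF goes_trans[OF goes_trans[OF I1(1) I2(1)] I3(1)] 4] by (simp add: add.assoc)
    show "match (sem (RA k e v) s) I3 ?R4" using m3 RA.prems(3) by (auto simp: match_def)
    show "keeps g I I3" using I1(3) I2(3) I3(3) RA.prems(3) by (auto simp: keeps_def)
  qed (use RA.prems in auto)
next
  case (Seq a b)
  have "sim P W g pc (pc + clen a + clen b) s (sem b (sem a s)) I R (0 + 0)"
    by (rule sim_trans) (use Seq in auto)
  thus ?case by (simp add: add.assoc)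
next
  case (Cond b c1 c2)
  from steps_bcomp[of P pc b "pc + blen b + clen c2 + 1" s I R] Cond.prems
  obtain I1 R1 where 1: "goes P (blen b) (pc, I, R) (if be b s then pc + blen b + clen c2 + 1 else pc + blen b, I1, R1)"
     "\<forall>a. (\<forall>j. a \<noteq> tmp j) \<longrightarrow> I1 a = I a \<and> R1 a = R a" by auto
  have m: "match s I1 R1" by (rule match_keep_tmp[OF Cond.prems(2), of 0]) (use 1(2) in auto)
  hence m': "match (tick s) I1 R1" by (simp add: match_def)
  have k: "keeps g I I1" using 1(2) by (auto simp: keeps_def)
  show ?case
  proof (cases "be b s")
    case True
    have "sim P W g (pc + blen b + clen c2 + 1) (pc + blen b + clen c2 + 1 + clen c1) (tick s) (sem c1 (tick s)) I1 R1 0"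
      by (rule Cond.IH(1)) (use Cond.prems m' in \<open>auto simp: add.assoc\<close>)
    then obtain t I2 R2 where 2: "goes P t (pc + blen b + clen c2 + 1, I1, R1) (pc + blen b + clen c2 + 1 + clen c1, I2, R2)"
       "t + W * CK (tick s) \<le> W * CK (sem c1 (tick s))" "match (sem c1 (tick s)) I2 R2" "keeps g I1 I2"
      unfolding sim_def by auto
    show ?thesis
    proof (rule simI)
      show "goes P (blen b + t) (pc, I, R) (pc + clen (Cond b c1 c2), I2, R2)"
        using goes_trans[OF 1(1)] 2(1) True by (simp add: add.assoc)
      show "blen b + t + W * CK s \<le> W * CK (sem (Cond b c1 c2) s) + 0"
        using 2(2) Cond.prems(4) True by simp
    qed (use 2 k True in \<open>auto simp: keeps_def\<close>)
  next
    case False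
    have "sim P W g (pc + blen b) (pc + blen b + clen c2) (tick s) (sem c2 (tick s)) I1 R1 0"
      by (rule Cond.IH(2)) (use Cond.prems m' in \<open>auto simp: add.assoc\<close>)
    then obtain t I2 R2 where 2: "goes P t (pc + blen b, I1, R1) (pc + blen b + clen c2, I2, R2)"
       "t + W * CK (tick s) \<le> W * CK (sem c2 (tick s))" "match (sem c2 (tick s)) I2 R2" "keeps g I1 I2"
      unfolding sim_def by auto
    have 3: "goes P 1 (pc + blen b + clen c2, I2, R2) (pc + clen (Cond b c1 c2), I2, R2)"
      by (rule goes_one[of _ _ "IJumpLe (tmp 0) (tmp 0) (pc + clen (Cond b c1 c2))"])
        (use Cond.prems in \<open>auto simp: add.assoc\<close>)
    show ?thesis
    proof (rule simI)
      show "goes P (blen b + t + 1) (pc, I, R) (pc + clen (Cond b c1 c2), I2, R2)"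
        using goes_trans[OF goes_trans[OF 1(1)] 3] 2(1) False by simp
      show "blen b + t + 1 + W * CK s \<le> W * CK (sem (Cond b c1 c2) s) + 0"
        using 2(2) Cond.prems(4) False by simp
    qed (use 2 k False in \<open>auto simp: keeps_def\<close>)
  qed
next
  case (For x e b c)
  define h where "h = pc + ilen e + 3"
  define q where "q = h + 3 + blen b"
  define ex where "ex = q + 1 + clen c + 3"
  have exeq: "ex = pc + clen (For x e b c)" by (simp add: ex_def q_def h_def)
  note ca = For.prems(1)[unfolded ccomp.simps Let_def, folded h_def, folded q_def, folded ex_def]
  have e3: "length [i1, i2, i3] = 3" and e1: "length [i1] = 1" for i1 i2 i3 :: instr by simp_all
  note ca' = ca[unfolded code_at_append length_icomp length_bcomp length_ccomp e3 e1, folded h_def, folded q_def]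
  have head: "code_at P h [IJumpLe (addr 61 g) (addr 62 g) ex, IConst (tmp 1) 0, IAdd (addr x 0) (addr 62 g) (tmp 1)]"
    and cb: "code_at P (h + 3) (bcomp b (q + 1) (h + 3))"
    and c3: "code_at P q [IJumpLe (tmp 0) (tmp 0) ex]"
    and cc: "code_at P (q + 1) (ccomp c (Suc g) (q + 1))"
    and c4: "code_at P (q + 1 + clen c) [IConst (tmp 0) 1, IAdd (addr 62 g) (addr 62 g) (tmp 0), IJumpLe (tmp 0) (tmp 0) h]"
    and c0: "code_at P pc (icomp e 0 pc)"
    and c1: "code_at P (pc + ilen e) [IConst (tmp 1) 0, IAdd (addr 61 g) (tmp 0) (tmp 1), IConst (addr 62 g) 0]"
    using ca' by blast+
  have x: "x < 60" and wf: "wfb b" "wfc c" "wfi e" using For.prems by auto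
  have W: "ilen e + 4 + (blen b + clen c + 6) \<le> W" using For.prems by simp
  \<comment> \<open>The one extra step is the jump at the loop head by which an exhausted loop
    leaves. The tick spent on entering the loop pays for it.\<close>
  have loop: "sim P W g h ex s (floop x (be b) (sem c) r i s) I R 1"
    if "match s I R" "I (addr 61 g) = int (i + r)" "I (addr 62 g) = int i" for r i s I R
    using that
  proof (induction r arbitrary: i s I R)
    case 0
    have "goes P 1 (h, I, R) (ex, I, R)"
      by (rule goes_one[of _ _ "IJumpLe (addr 61 g) (addr 62 g) ex"]) (use head 0 in auto)
    thus ?case by (rule simI) (use 0 in \<open>auto simp: keeps_def\<close>)
  next
    case (Suc r)
    let ?s1 = "seti (tick s) x 0 i"
    let ?I1 = "I(tmp 1 := 0, addr x 0 := int i)"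
    have "goes P 1 (h, I, R) (Suc h, I, R)"
      by (rule goes_one[of _ _ "IJumpLe (addr 61 g) (addr 62 g) ex"]) (use head Suc.prems in auto)
    moreover have "goes P 1 (Suc h, I, R) (Suc (Suc h), I(tmp 1 := 0), R)"
      by (rule goes_one[of _ _ "IConst (tmp 1) 0"]) (use head in auto)
    moreover have "goes P 1 (Suc (Suc h), I(tmp 1 := 0), R) (h + 3, ?I1, R)"
      by (rule goes_one[of _ _ "IAdd (addr x 0) (addr 62 g) (tmp 1)"]) (use head Suc.prems x in auto)
    ultimately have 1: "goes P 3 (h, I, R) (h + 3, ?I1, R)"
      by (rule goes_3)
    have m1: "match ?s1 ?I1 R" using Suc.prems(1) x by (auto simp: match_def)
    from steps_bcomp[OF cb m1 wf(1), folded q_def] obtain I2 R2 where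
      2: "goes P (blen b) (h + 3, ?I1, R) (if be b ?s1 then q + 1 else q, I2, R2)"
      "\<forall>a. (\<forall>j. a \<noteq> tmp j) \<longrightarrow> I2 a = ?I1 a \<and> R2 a = R a" by blast
    have m2: "match ?s1 I2 R2" by (rule match_keep_tmp[OF m1, of 0]) (use 2(2) in auto)
    have k2: "keeps (Suc g) I I2" using 2(2) x by (auto simp: keeps_def)
    show ?case
    proof (cases "be b ?s1")
      case False
      have 3: "goes P 1 (q, I2, R2) (ex, I2, R2)"
        by (rule goes_one[of _ _ "IJumpLe (tmp 0) (tmp 0) ex"]) (use c3 in auto)
      show ?thesis
      proof (rule simI)
        show "goes P (3 + blen b + 1) (h, I, R) (ex, I2, R2)"
          using goes_trans[OF goes_trans[OF 1] 3] 2(1) False by simp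
        show "3 + blen b + 1 + W * CK s \<le> W * CK (floop x (be b) (sem c) (Suc r) i s) + 1"
          using W False by simp
      qed (use m2 k2 False in \<open>auto simp: keeps_def\<close>)
    next
      case True
      have "sim P W (Suc g) (q + 1) (q + 1 + clen c) ?s1 (sem c ?s1) I2 R2 0"
        by (rule For.IH) (use cc m2 wf W in auto)
      then obtain t I3 R3 where 3: "goes P t (q + 1, I2, R2) (q + 1 + clen c, I3, R3)"
         "t + W * CK ?s1 \<le> W * CK (sem c ?s1)" "match (sem c ?s1) I3 R3" "keeps (Suc g) I2 I3"
        unfolding sim_def by auto
      let ?I4 = "I3(tmp 0 := 1, addr 62 g := I3 (addr 62 g) + 1)"
      let ?p = "q + 1 + clen c"
      have c62: "I3 (addr 62 g) = int i" "I3 (addr 61 g) = int (i + Suc r)"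
        using 3(4) k2 Suc.prems by (auto simp: keeps_def)
      have "goes P 1 (?p, I3, R3) (Suc ?p, I3(tmp 0 := 1), R3)"
        by (rule goes_one[of _ _ "IConst (tmp 0) 1"]) (use c4 in auto)
      moreover have "goes P 1 (Suc ?p, I3(tmp 0 := 1), R3) (Suc (Suc ?p), ?I4, R3)"
        by (rule goes_one[of _ _ "IAdd (addr 62 g) (addr 62 g) (tmp 0)"]) (use c4 in auto)
      moreover have "goes P 1 (Suc (Suc ?p), ?I4, R3) (h, ?I4, R3)"
        by (rule goes_one[of _ _ "IJumpLe (tmp 0) (tmp 0) h"]) (use c4 in auto)
      ultimately have 4: "goes P 3 (?p, I3, R3) (h, ?I4, R3)"
        by (rule goes_3)
      have m4: "match (sem c ?s1) ?I4 R3" using 3(3) by (auto simp: match_def)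
      have "sim P W g h ex (sem c ?s1) (floop x (be b) (sem c) r (Suc i) (sem c ?s1)) ?I4 R3 1"
        by (rule Suc.IH[OF m4]) (use c62 in auto)
      then obtain t' I5 R5 where 5: "goes P t' (h, ?I4, R3) (ex, I5, R5)"
         "t' + W * CK (sem c ?s1) \<le> W * CK (floop x (be b) (sem c) r (Suc i) (sem c ?s1)) + 1"
         "match (floop x (be b) (sem c) r (Suc i) (sem c ?s1)) I5 R5" "keeps g ?I4 I5"
        unfolding sim_def by auto
      have bc: "goes P (blen b) (h + 3, ?I1, R) (q + 1, I2, R2)" using 2(1) True by simp
      show ?thesis
      proof (rule simI)
        show "goes P (3 + blen b + t + 3 + t') (h, I, R) (ex, I5, R5)"
          by (rule goes_trans[OF goes_trans[OF goes_trans[OF goes_trans[OF 1 bc] 3(1)] 4] 5(1)])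
        show "3 + blen b + t + 3 + t' + W * CK s \<le> W * CK (floop x (be b) (sem c) (Suc r) i s) + 1"
          using W 3(2) 5(2) True by simp
        show "match (floop x (be b) (sem c) (Suc r) i s) I5 R5" using 5(3) True by simp
        show "keeps g I I5" using 5(4) 3(4) k2 by (auto simp: keeps_def)
      qed
    qed
  qed
  from steps_icomp[OF c0 For.prems(2) wf(3)]
  obtain I1 where I1: "goes P (ilen e) (pc, I, R) (pc + ilen e, I1, R)" "I1 (tmp 0) = int (ie e s)"
     "\<forall>x. (\<forall>j\<ge>0. x \<noteq> tmp j) \<longrightarrow> I1 x = I x" by auto
  let ?p = "pc + ilen e"
  let ?I2 = "I1(tmp 1 := 0, addr 61 g := int (ie e s), addr 62 g := 0)"
  have "goes P 1 (?p, I1, R) (Suc ?p, I1(tmp 1 := 0), R)"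
    by (rule goes_one[of _ _ "IConst (tmp 1) 0"]) (use c1 in auto)
  moreover have "goes P 1 (Suc ?p, I1(tmp 1 := 0), R) (Suc (Suc ?p), I1(tmp 1 := 0, addr 61 g := int (ie e s)), R)"
    by (rule goes_one[of _ _ "IAdd (addr 61 g) (tmp 0) (tmp 1)"]) (use c1 I1(2) in auto)
  moreover have "goes P 1 (Suc (Suc ?p), I1(tmp 1 := 0, addr 61 g := int (ie e s)), R) (h, ?I2, R)"
    by (rule goes_one[of _ _ "IConst (addr 62 g) 0"]) (use c1 in \<open>auto simp: h_def\<close>)
  ultimately have 2: "goes P 3 (?p, I1, R) (h, ?I2, R)"
    by (rule goes_3)
  have m: "match (tick s) ?I2 R" using For.prems(2) I1(3) by (auto simp: match_def)
  have "sim P W g h ex (tick s) (floop x (be b) (sem c) (ie e s) 0 (tick s)) ?I2 R 1"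
    by (rule loop[OF m]) auto
  hence "sim P W g h ex (tick s) (sem (For x e b c) s) ?I2 R 1" by simp
  from this[unfolded sim_def] obtain t I3 R3 where 3: "goes P t (h, ?I2, R) (ex, I3, R3)"
     "t + W * CK (tick s) \<le> W * CK (sem (For x e b c) s) + 1" "match (sem (For x e b c) s) I3 R3" "keeps g ?I2 I3"
    by blast
  show ?case
  proof (rule simI)
    show "goes P (ilen e + 3 + t) (pc, I, R) (pc + clen (For x e b c), I3, R3)"
      using goes_trans[OF goes_trans[OF I1(1) 2] 3(1)] by (simp add: exeq)
    show "ilen e + 3 + t + W * CK s \<le> W * CK (sem (For x e b c) s) + 0"
      using 3(2) W by simp
    show "keeps g I I3" using 3(4) I1(3) by (auto simp: keeps_def)
  qed (use 3 in auto)
qed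

definition init_st :: "nat \<Rightarrow> nat \<Rightarrow> (nat \<Rightarrow> nat \<Rightarrow> real) \<Rightarrow> (nat \<Rightarrow> real) \<Rightarrow> st" where
  "init_st n d A b = \<lparr>CK = 0, IM = (\<lambda>k z. if k = 0 \<and> z = 0 then n else if k = 0 \<and> z = 1 then d else 0),
     RM = (\<lambda>k z. if k = 0 \<and> z < n * d then A (z div d) (z mod d) else if k = 0 \<and> z < n * d + n then b (z - n * d) else 0)\<rparr>"

text \<open>The compiler emits no \<open>Halt\<close>; the program stops by running off its end. The
  factor \<open>W\<close> is the length of the code and thus independent of the input.\<close>

theorem compile_correct:
  assumes "wfc c"
  shows "\<exists>P W. \<forall>n d A b. \<exists>t. t \<le> W * CK (sem c (init_st n d A b)) \<and> halted P (run P t (init_conf n d A b)) \<and>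
     out_flag (run P t (init_conf n d A b)) = int (IM (sem c (init_st n d A b)) 0 0) \<and>
     out_point (run P t (init_conf n d A b)) = RM (sem c (init_st n d A b)) 0"
proof (rule exI[of _ "ccomp c 0 0"], rule exI[of _ "clen c"], intro allI)
  fix n d A b
  let ?P = "ccomp c 0 0" and ?s = "init_st n d A b"
  obtain I R where c: "init_conf n d A b = (0, I, R)" unfolding init_conf_def by blast
  have m: "match ?s I R"
    using c by (auto simp: match_def init_conf_def init_st_def addr_def)
  have "code_at ?P 0 (ccomp c 0 0)" by (simp add: code_at_def)
  from sim_ccomp[OF this m assms order_refl] obtain t I' R' where
    g: "goes ?P t (0, I, R) (clen c, I', R')" "t \<le> clen c * CK (sem c ?s)" "match (sem c ?s) I' R'"
    unfolding sim_def by (auto simp: init_st_def)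
  from g(1) obtain t' where t': "t' \<le> t" "steps ?P t' (0, I, R) (clen c, I', R')" by (auto simp: goes_def)
  have r: "run ?P t' (init_conf n d A b) = (clen c, I', R')" using steps_run[OF t'(2)] c by simp
  have a0: "addr 0 z = int z" for z by (simp add: addr_def)
  have "I' (int z) = int (IM (sem c ?s) 0 z)" "R' (int z) = RM (sem c ?s) 0 z" for z
    using g(3) a0 unfolding match_def by (metis zero_less_numeral)+
  thus "\<exists>t. t \<le> clen c * CK (sem c ?s) \<and> halted ?P (run ?P t (init_conf n d A b)) \<and>
     out_flag (run ?P t (init_conf n d A b)) = int (IM (sem c ?s) 0 0) \<and>
     out_point (run ?P t (init_conf n d A b)) = RM (sem c ?s) 0"
    using r t'(1) g(2) \<open>\<And>z. I' (int z) = int (IM (sem c ?s) 0 z)\<close>[of 0]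
    by (intro exI[of _ t']) (auto simp: halted_def out_flag_def out_point_def)
qed


section \<open>Program logic\<close>

fun wI :: "com \<Rightarrow> nat set" where
  "wI Skip = {}" | "wI (IA k e v) = {k}" | "wI (RA k e v) = {}" | "wI (Seq a b) = wI a \<union> wI b"
| "wI (Cond b c1 c2) = wI c1 \<union> wI c2" | "wI (For x e b c) = insert x (wI c)"
fun wR :: "com \<Rightarrow> nat set" where
  "wR Skip = {}" | "wR (IA k e v) = {}" | "wR (RA k e v) = {k}" | "wR (Seq a b) = wR a \<union> wR b"
| "wR (Cond b c1 c2) = wR c1 \<union> wR c2" | "wR (For x e b c) = wR c"

definition frame :: "nat set \<Rightarrow> nat set \<Rightarrow> st \<Rightarrow> st \<Rightarrow> bool" where
  "frame A B s t \<longleftrightarrow> (\<forall>k. k \<notin> A \<longrightarrow> IM t k = IM s k) \<and> (\<forall>k. k \<notin> B \<longrightarrow> RM t k = RM s k)"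

lemma frameI: "frame A B s t \<Longrightarrow> k \<notin> A \<Longrightarrow> IM t k = IM s k" by (simp add: frame_def)
lemma frameR: "frame A B s t \<Longrightarrow> k \<notin> B \<Longrightarrow> RM t k = RM s k" by (simp add: frame_def)
lemma frame_refl: "frame A B s s" by (simp add: frame_def)
lemma frame_trans: "frame A B s t \<Longrightarrow> frame A B t u \<Longrightarrow> frame A B s u" by (simp add: frame_def)
lemma frame_mono: "frame A B s t \<Longrightarrow> A \<subseteq> A' \<Longrightarrow> B \<subseteq> B' \<Longrightarrow> frame A' B' s t" by (auto simp: frame_def)

lemma floop_frame:
  assumes "\<And>t. frame A B t (f t)" "x \<in> A"
  shows "frame A B s (floop x b f r i s)"
proof (induction r arbitrary: i s)
  case (Suc r)
  have 1: "frame A B s (seti (tick s) x 0 i)" using assms(2) by (auto simp: frame_def)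
  show ?case using 1 frame_trans[OF frame_trans[OF 1 assms(1)] Suc.IH] by simp
qed (simp add: frame_refl)

lemma sem_frame: "frame (wI c) (wR c) s (sem c s)"
proof (induction c arbitrary: s)
  case (Seq a b)
  have "frame (wI a \<union> wI b) (wR a \<union> wR b) s (sem a s)" by (rule frame_mono[OF Seq(1)]) auto
  moreover have "frame (wI a \<union> wI b) (wR a \<union> wR b) (sem a s) (sem b (sem a s))" by (rule frame_mono[OF Seq(2)]) auto
  ultimately show ?case using frame_trans by simp
next
  case (Cond b c1 c2)
  have t: "frame A B (tick s) u \<Longrightarrow> frame A B s u" for A B u by (simp add: frame_def)
  show ?case using frame_mono[OF t[OF Cond(1)]] frame_mono[OF t[OF Cond(2)]] by simp
next
  case (For x e b c)
  have t: "frame A B (tick s) u \<Longrightarrow> frame A B s u" for A B u by (simp add: frame_def)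
  have "frame (insert x (wI c)) (wR c) (tick s) (floop x (be b) (sem c) (ie e s) 0 (tick s))"
    by (rule floop_frame[OF frame_mono[OF For]]) auto
  thus ?case using t by simp
qed (auto simp: frame_def)

lemma sem_frameI: "k \<notin> wI c \<Longrightarrow> IM (sem c s) k = IM s k" using frameI[OF sem_frame] .
lemma sem_frameR: "k \<notin> wR c \<Longrightarrow> RM (sem c s) k = RM s k" using frameR[OF sem_frame] .

text \<open>\<open>Q i t\<close> describes the state before the counter is set, so
  \<open>exit\<close> has to reach \<open>R\<close> from the state after setting it. The frame
  hypotheses hand every obligation the arrays that the loop does not write, which keeps the
  invariants short.\<close>

lemma For_rule:
  assumes init: "Q 0 (tick s)"
    and step: "\<And>i t. i < ie e s \<Longrightarrow> frame (insert x (wI c)) (wR c) s t \<Longrightarrow> Q i t \<Longrightarrow> be b (seti (tick t) x 0 i) \<Longrightarrow> Q (Suc i) (sem c (seti (tick t) x 0 i))"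
    and exit: "\<And>i t. i < ie e s \<Longrightarrow> frame (insert x (wI c)) (wR c) s t \<Longrightarrow> Q i t \<Longrightarrow> \<not> be b (seti (tick t) x 0 i) \<Longrightarrow> R (seti (tick t) x 0 i)"
    and fin: "\<And>t. frame (insert x (wI c)) (wR c) s t \<Longrightarrow> Q (ie e s) t \<Longrightarrow> R t"
  shows "R (sem (For x e b c) s)"
proof -
  have "R (floop x (be b) (sem c) r i t)"
    if "Q i t" "frame (insert x (wI c)) (wR c) s t" "i + r = ie e s" for r i t
    using that
  proof (induction r arbitrary: i t)
    case 0 thus ?case using fin by simp
  next
    case (Suc r)
    have f: "frame (insert x (wI c)) (wR c) s (seti (tick t) x 0 i)" using Suc.prems(2) by (auto simp: frame_def)
    show ?case
    proof (cases "be b (seti (tick t) x 0 i)")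
      case True
      have "frame (insert x (wI c)) (wR c) s (sem c (seti (tick t) x 0 i))"
        by (rule frame_trans[OF f]) (rule frame_mono[OF sem_frame], auto)
      thus ?thesis using Suc.IH[OF step[OF _ Suc.prems(2,1) True]] Suc.prems(3) True by simp
    next
      case False thus ?thesis using exit[OF _ Suc.prems(2,1)] Suc.prems(3) by simp
    qed
  qed
  moreover have "frame (insert x (wI c)) (wR c) s (tick s)" by (simp add: frame_def)
  ultimately show ?thesis using init by simp
qed

abbreviation "Fr x e c \<equiv> For x e (ILe (C 0) (C 0)) c"

lemma Fr_rule:
  assumes init: "Q 0 (tick s)"
    and step: "\<And>i t. i < ie e s \<Longrightarrow> frame (insert x (wI c)) (wR c) s t \<Longrightarrow> Q i t \<Longrightarrow> Q (Suc i) (sem c (seti (tick t) x 0 i))"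
    and fin: "\<And>t. frame (insert x (wI c)) (wR c) s t \<Longrightarrow> Q (ie e s) t \<Longrightarrow> R t"
  shows "R (sem (Fr x e c) s)"
  by (rule For_rule[where Q = Q]) (use assms in auto)

abbreviation V :: "nat \<Rightarrow> iexp" where "V k \<equiv> L k (C 0)"
abbreviation RV :: "nat \<Rightarrow> rexp" where "RV k \<equiv> RL k (C 0)"
abbreviation IEq :: "iexp \<Rightarrow> iexp \<Rightarrow> bexp" where "IEq a b \<equiv> ILe (Add (Sub a b) (Sub b a)) (C 0)"
abbreviation ILt :: "iexp \<Rightarrow> iexp \<Rightarrow> bexp" where "ILt a b \<equiv> ILe (Add a (C 1)) b"
abbreviation iset (infix "::=" 61) where "x ::= e \<equiv> IA x (C 0) e"
abbreviation rset (infix "::=r" 61) where "x ::=r e \<equiv> RA x (C 0) e"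
notation Seq (infixr ";;" 60)
notation Cond ("(IF _/ THEN _/ ELSE _)" [0, 61, 61] 61)

type_synonym edge = "nat \<times> nat \<times> real \<times> real"

section \<open>Cycles in monotone two-variable systems\<close>

fun esat :: "(nat \<Rightarrow> real) \<Rightarrow> edge \<Rightarrow> bool" where
  "esat x (u, v, a, b) \<longleftrightarrow> x u < a * x v + b"

definition ssol :: "edge set \<Rightarrow> (nat \<Rightarrow> real) \<Rightarrow> bool" where
  "ssol E x \<longleftrightarrow> (\<forall>e\<in>E. esat x e)"

definition wfE :: "nat \<Rightarrow> edge set \<Rightarrow> bool" where
  "wfE N E \<longleftrightarrow> finite E \<and> (\<forall>(u, v, a, b)\<in>E. u < N \<and> v < N \<and> 0 < a)"

lemma ssolD: "ssol E x \<Longrightarrow> (u, v, a, b) \<in> E \<Longrightarrow> x u < a * x v + b"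
  by (auto simp: ssol_def)

text \<open>Replaces explicit choices of a small positive number: finitely many such conditions hold
  together close enough to 0.\<close>

lemma eventually_lin:
  fixes p q :: real
  assumes "p < q" shows "eventually (\<lambda>e. p + e * r < q + e * r') (at_right 0)"
proof -
  have "((\<lambda>e. (q + e * r') - (p + e * r)) \<longlongrightarrow> (q + 0 * r') - (p + 0 * r)) (at_right 0)"
    by (intro tendsto_intros)
  from order_tendstoD(1)[OF this, of 0] assms show ?thesis by (simp add: algebra_simps)
qed

text \<open>Any positive share of the strict solution \<open>z\<close> makes every inequality
  strict. Constructions may therefore aim at weak inequalities only.\<close>

lemma ssol_mix:
  assumes "wfE N E" "ssol E z" "\<And>u v a b. (u, v, a, b) \<in> E \<Longrightarrow> y u \<le> a * y v + b" "0 < t" "t \<le> 1"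
  shows "ssol E (\<lambda>i. (1 - t) * y i + t * z i)"
  unfolding ssol_def
proof
  fix e assume e: "e \<in> E"
  obtain u v a b where [simp]: "e = (u, v, a, b)" by (cases e)
  have "(1 - t) * y u \<le> (1 - t) * (a * y v + b)" using assms(3,5) e by (intro mult_left_mono) auto
  moreover have "t * z u < t * (a * z v + b)" using assms(2,4) e by (auto simp: ssol_def)
  ultimately show "esat (\<lambda>i. (1 - t) * y i + t * z i) e" by (simp add: algebra_simps)
qed

text \<open>Serves to move a solution into the part of a cell that lies left of the tested
  value.\<close>

lemma ssol_convex:
  assumes "wfE N E" "ssol E z" "ssol E y" "x \<in> {min (y l) (z l)..max (y l) (z l)}"
  shows "\<exists>w. ssol E w \<and> w l = x"
proof -
  have *: "\<exists>w. ssol E w \<and> w l = x" if "ssol E z" "ssol E y" "y l \<le> x" "x < z l" for y z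
  proof -
    define t where "t = (x - y l) / (z l - y l)"
    have t: "0 \<le> t" "t \<le> 1" using that by (auto simp: t_def field_simps)
    show ?thesis
    proof (cases "t = 0")
      case True
      hence "y l = x" using that by (auto simp: t_def)
      thus ?thesis using that by blast
    next
      case False
      have "ssol E (\<lambda>i. (1 - t) * y i + t * z i)"
        by (rule ssol_mix[OF assms(1) that(1)]) (use t False that(2) in \<open>auto dest: ssolD intro: less_imp_le\<close>)
      moreover have "t * (z l - y l) = x - y l" using that by (simp add: t_def)
      hence "(1 - t) * y l + t * z l = x" by (simp add: algebra_simps)
      ultimately show ?thesis by (intro exI[of _ "\<lambda>i. (1 - t) * y i + t * z i"]) simp
    qed
  qed
  consider "x = y l" | "x = z l" | "y l < x" "x < z l" | "z l < x" "x < y l"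
    using assms(4) by (cases "y l \<le> z l") (fastforce simp: min_def max_def)+
  thus ?thesis using *[of z y] *[of y z] assms(2,3) by cases auto
qed

text \<open>Sharpens a weak bound on \<open>x l\<close> that is valid for all solutions to a strict
  one.\<close>

lemma ssol_open:
  assumes "wfE N E" "ssol E x"
  shows "\<exists>y. ssol E y \<and> y l < x l"
proof -
  have "\<forall>e\<in>E. eventually (\<lambda>t. esat (\<lambda>i. x i + t * (if i = l then -1 else 0)) e) (at_right 0)"
  proof
    fix e assume e: "e \<in> E"
    obtain u v a b where [simp]: "e = (u, v, a, b)" by (cases e)
    have "x u < a * x v + b" using assms(2) e by (auto simp: ssol_def)
    from eventually_lin[OF this, of "if u = l then -1 else 0" "a * (if v = l then -1 else 0)"]
    show "eventually (\<lambda>t. esat (\<lambda>i. x i + t * (if i = l then -1 else 0)) e) (at_right 0)"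
      by (rule eventually_mono) (auto simp: algebra_simps split: if_splits)
  qed
  hence "eventually (\<lambda>t. \<forall>e\<in>E. esat (\<lambda>i. x i + t * (if i = l then -1 else 0)) e) (at_right 0)"
    using assms(1) by (intro eventually_ball_finite) (auto simp: wfE_def)
  moreover have "eventually (\<lambda>t::real. 0 < t) (at_right 0)" by (simp add: eventually_at_right_less)
  ultimately have "eventually (\<lambda>t. (\<forall>e\<in>E. esat (\<lambda>i. x i + t * (if i = l then -1 else 0)) e) \<and> 0 < t) (at_right 0)"
    by (rule eventually_conj)
  then obtain t where "\<forall>e\<in>E. esat (\<lambda>i. x i + t * (if i = l then -1 else 0)) e" "0 < t"
    using eventually_happens'[OF trivial_limit_at_right_real] by blast
  thus ?thesis by (intro exI[of _ "\<lambda>i. x i + t * (if i = l then -1 else 0)"]) (auto simp: ssol_def)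
qed

section \<open>Bellman-Ford with lines as labels\<close>

type_synonym label = "(real \<times> real) option"

text \<open>A label \<open>(v, s)\<close> stands for the value of a line of slope \<open>s\<close> at a point infinitesimally
  to the left of the test point, where it has the value \<open>v\<close>.\<close>
fun lless :: "label \<Rightarrow> label \<Rightarrow> bool" where
  "lless None y = False"
| "lless (Some x) None = True"
| "lless (Some (v, s)) (Some (v', s')) = (v < v' \<or> v = v' \<and> s' < s)"

definition lle :: "label \<Rightarrow> label \<Rightarrow> bool" where "lle x y \<longleftrightarrow> \<not> lless y x"

fun ap :: "real \<Rightarrow> real \<Rightarrow> label \<Rightarrow> label" where
  "ap a b None = None"
| "ap a b (Some (v, s)) = Some (a * v + b, a * s)"

lemma lle_refl [simp]: "lle x x" by (cases x) (auto simp: lle_def)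
lemma lless_irrefl [simp]: "\<not> lless x x" using lle_refl[of x] unfolding lle_def .
lemma lless_imp_lle: "lless x y \<Longrightarrow> lle x y" by (cases x; cases y) (auto simp: lle_def)
lemma lle_trans: "lle x y \<Longrightarrow> lle y z \<Longrightarrow> lle x z" by (cases x; cases y; cases z) (auto simp: lle_def)
lemma lless_lle_trans: "lless x y \<Longrightarrow> lle y z \<Longrightarrow> lless x z" by (cases x; cases y; cases z) (auto simp: lle_def)

text \<open>The tables are described by what a run leaves behind, not by an order of relaxations.
  Round \<open>Suc k\<close> reads labels of round \<open>k\<close> only, so tracing back one edge
  also goes back one round. Parent 0 marks a label carried over, \<open>Suc v\<close> a label
  improved through \<open>v\<close>.\<close>

locale bellman_ford =
  fixes E :: "edge set" and N l :: nat and lam :: real and D :: "nat \<Rightarrow> nat \<Rightarrow> label" and par :: "nat \<Rightarrow> nat \<Rightarrow> nat"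
  assumes wf: "wfE N E" and lN: "l < N"
    and D0: "u < N \<Longrightarrow> D 0 u = (if u = l then Some (lam, 1) else None)"
    and relax: "k < N \<Longrightarrow> (u, v, a, b) \<in> E \<Longrightarrow> lle (D (Suc k) u) (ap a b (D k v))"
    and par: "k < N \<Longrightarrow> u < N \<Longrightarrow> par (Suc k) u = 0 \<and> D (Suc k) u = D k u \<or>
        (\<exists>v a b. par (Suc k) u = Suc v \<and> (u, v, a, b) \<in> E \<and> D (Suc k) u = ap a b (D k v) \<and> lless (D (Suc k) u) (D k u))"
begin

text \<open>Position \<open>i\<close> of the trace belongs to round \<open>N - i\<close>. The trace
  is meaningful from a node improved in round \<open>N\<close>, where all parents met are positive
  and subtracting 1 undoes their shift.\<close>

primrec tr :: "nat \<Rightarrow> nat \<Rightarrow> nat" where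
  "tr u 0 = u"
| "tr u (Suc i) = par (N - i) (tr u i) - 1"

definition slp :: "nat \<Rightarrow> nat \<Rightarrow> real" where "slp k u = snd (the (D k u))"

lemma edge: "(u, v, a, b) \<in> E \<Longrightarrow> u < N \<and> v < N \<and> 0 < a" using wf by (auto simp: wfE_def)

lemma mono: assumes "k < N" "u < N" shows "lle (D (Suc k) u) (D k u)"
  using par[OF assms] lless_imp_lle by auto

lemma antimono: "u < N \<Longrightarrow> k \<le> k' \<Longrightarrow> k' \<le> N \<Longrightarrow> lle (D k' u) (D k u)"
proof (induction k')
  case (Suc k')
  thus ?case using mono[of k' u] lle_trans by (cases "k = Suc k'") (auto simp: le_Suc_eq)
qed simp

text \<open>Had the parent not been improved one round before, the same edge would have offered the
  same label one round earlier, and the present improvement would not be strict. So a trace from a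
  node improved in round \<open>N\<close> never stalls and runs through \<open>N\<close>
  edges.\<close>

lemma improved:
  assumes "i < N" "u < N" "par N u \<noteq> 0"
  shows "par (N - i) (tr u i) \<noteq> 0 \<and> tr u i < N"
  using assms(1)
proof (induction i)
  case 0 thus ?case using assms by simp
next
  case (Suc i)
  let ?k = "N - Suc i" and ?w = "tr u i"
  have k: "Suc ?k = N - i" "?k < N" "0 < ?k" using Suc.prems by auto
  have w: "par (Suc ?k) ?w \<noteq> 0" "?w < N" using Suc k by auto
  from par[OF k(2) w(2)] w obtain v a b where v: "par (Suc ?k) ?w = Suc v" "(?w, v, a, b) \<in> E"
    "D (Suc ?k) ?w = ap a b (D ?k v)" "lless (D (Suc ?k) ?w) (D ?k ?w)" by auto
  have tr: "tr u (Suc i) = v" using v(1) k(1) by simp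
  have vN: "v < N" using edge[OF v(2)] by simp
  have "par ?k v \<noteq> 0"
  proof
    assume z: "par ?k v = 0"
    obtain k' where k': "?k = Suc k'" using k(3) gr0_implies_Suc by blast
    have "D ?k v = D k' v" using par[of k' v] z k' k(2) vN by auto
    with relax[of k' ?w v a b] v(2,3) k' k(2) have "lle (D ?k ?w) (D (Suc ?k) ?w)" by auto
    thus False using v(4) by (simp add: lle_def)
  qed
  thus ?case using tr vN by simp
qed

lemma trace_edge:
  assumes "i < N" "u < N" "par N u \<noteq> 0"
  shows "\<exists>a b. (tr u i, tr u (Suc i), a, b) \<in> E \<and> D (N - i) (tr u i) = ap a b (D (N - Suc i) (tr u (Suc i)))
     \<and> lless (D (N - i) (tr u i)) (D (N - Suc i) (tr u i))"
proof -
  let ?k = "N - Suc i"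
  have k: "Suc ?k = N - i" "?k < N" using assms by auto
  from par[OF k(2)] improved[OF assms] k show ?thesis by fastforce
qed

lemma trace_le: assumes "i \<le> N" "u < N" "par N u \<noteq> 0" shows "tr u i < N"
proof (cases i)
  case 0 thus ?thesis using assms by simp
next
  case (Suc j) thus ?thesis using trace_edge[of j u] assms edge by (metis Suc_le_lessD)
qed

text \<open>A label that improves strictly is not \<open>None\<close>. The last node of the trace
  lies in round 0 and improves nothing, but the label computed from it is not \<open>None\<close>,
  and \<open>ap\<close> preserves \<open>None\<close>.\<close>

lemma trace_label:
  assumes "i \<le> N" "u < N" "par N u \<noteq> 0" obtains v s where "D (N - i) (tr u i) = Some (v, s)"
proof -
  have N: "0 < N" using lN by simp
  have "D (N - i) (tr u i) \<noteq> None"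
  proof (cases "i < N")
    case True
    with trace_edge[OF True assms(2,3)] show ?thesis by (metis lless.simps(1))
  next
    case False
    hence i: "i = Suc (N - 1)" using assms N by simp
    have "D (N - (N - 1)) (tr u (N - 1)) \<noteq> None"
      using trace_edge[of "N - 1" u] assms N by (metis diff_less less_numeral_extra(1) lless.simps(1))
    thus ?thesis using trace_edge[of "N - 1" u] assms N i by (metis Suc_diff_1 ap.simps(1) diff_less zero_less_one)
  qed
  thus ?thesis using that by (cases "D (N - i) (tr u i)") auto
qed

lemma trace_repeat:
  assumes "u < N" "par N u \<noteq> 0" shows "\<exists>j\<le>N. \<exists>i<j. tr u i = tr u j"
proof (rule ccontr)
  assume "\<not> ?thesis"
  hence "inj_on (tr u) {..N}" by (intro linorder_inj_onI) (auto simp: inj_on_def)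
  hence "card (tr u ` {..N}) = Suc N" by (simp add: card_image)
  moreover have "card (tr u ` {..N}) \<le> card {..<N}" using trace_le assms by (intro card_mono) auto
  ultimately show False by simp
qed

text \<open>The edges of the trace compose to one affine map of positive factor. It transforms
  labels exactly and bounds the values of every solution, strictly as soon as it contains an
  edge.\<close>

lemma chain:
  assumes "u < N" "par N u \<noteq> 0" "i \<le> j" "j \<le> N" "D (N - i) (tr u i) = Some (vi, si)" "D (N - j) (tr u j) = Some (vj, sj)"
  shows "\<exists>\<alpha> \<beta>. 0 < \<alpha> \<and> vi = \<alpha> * vj + \<beta> \<and> si = \<alpha> * sj \<and>
    (\<forall>x. ssol E x \<longrightarrow> x (tr u i) \<le> \<alpha> * x (tr u j) + \<beta> \<and> (i < j \<longrightarrow> x (tr u i) < \<alpha> * x (tr u j) + \<beta>))"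
  using assms(3,4,6)
proof (induction j arbitrary: vj sj rule: dec_induct)
  case base
  thus ?case using assms(5) by (intro exI[of _ 1] exI[of _ 0]) auto
next
  case (step j)
  obtain v s where vs: "D (N - j) (tr u j) = Some (v, s)" using trace_label[of j u] step assms by auto
  from step.IH[OF _ vs] step.prems(1) Suc_leD obtain \<alpha> \<beta> where IH: "0 < \<alpha>" "vi = \<alpha> * v + \<beta>" "si = \<alpha> * s"
    "\<forall>x. ssol E x \<longrightarrow> x (tr u i) \<le> \<alpha> * x (tr u j) + \<beta>" by blast
  from trace_edge[of j u] step.prems assms(1,2) obtain a b where ab: "(tr u j, tr u (Suc j), a, b) \<in> E"
    "Some (v, s) = ap a b (Some (vj, sj))" using vs by auto
  have "\<forall>x. ssol E x \<longrightarrow> x (tr u i) < \<alpha> * a * x (tr u (Suc j)) + (\<alpha> * b + \<beta>)"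
  proof (intro allI impI)
    fix x assume x: "ssol E x"
    have "\<alpha> * x (tr u j) < \<alpha> * (a * x (tr u (Suc j)) + b)" using ssolD[OF x ab(1)] IH(1) by simp
    moreover have "x (tr u i) \<le> \<alpha> * x (tr u j) + \<beta>" using IH(4) x by blast
    ultimately show "x (tr u i) < \<alpha> * a * x (tr u (Suc j)) + (\<alpha> * b + \<beta>)" by (simp add: algebra_simps)
  qed
  thus ?case using IH(1-3) ab edge[OF ab(1)]
    by (intro exI[of _ "\<alpha> * a"] exI[of _ "\<alpha> * b + \<beta>"]) (auto simp: algebra_simps intro: less_imp_le)
qed


lemma slope_pos: "k \<le> N \<Longrightarrow> u < N \<Longrightarrow> D k u = Some (v, s) \<Longrightarrow> 0 < s"
proof (induction k arbitrary: u v s)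
  case 0 thus ?case using D0 by (auto split: if_splits)
next
  case (Suc k)
  from par[of k u] Suc.prems consider "D (Suc k) u = D k u"
    | w a b where "(u, w, a, b) \<in> E" "D (Suc k) u = ap a b (D k w)" by fastforce
  thus ?case
  proof cases
    case 1 thus ?thesis using Suc.IH[of u v s] Suc.prems by simp
  next
    case 2
    with Suc.prems obtain v' s' where "D k w = Some (v', s')" "s = a * s'"
      by (cases "D k w") auto
    thus ?thesis using Suc.IH[of w v' s'] Suc.prems edge[OF 2(1)] by auto
  qed
qed

text \<open>A label is the value at \<open>lam\<close> of an increasing bound in terms of
  \<open>x l\<close>, so it exceeds what the smaller \<open>x l\<close> permits.\<close>

lemma label_bound:
  assumes "ssol E x" "x l < lam"
  shows "k \<le> N \<Longrightarrow> u < N \<Longrightarrow> D k u = Some (v, s) \<Longrightarrow> x u < v"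
proof (induction k arbitrary: u v s)
  case 0 thus ?case using D0 assms by (auto split: if_splits)
next
  case (Suc k)
  from par[of k u] Suc.prems consider "D (Suc k) u = D k u"
    | w a b where "(u, w, a, b) \<in> E" "D (Suc k) u = ap a b (D k w)" by fastforce
  thus ?case
  proof cases
    case 1 thus ?thesis using Suc.IH[of u v s] Suc.prems by simp
  next
    case 2
    with Suc.prems obtain v' s' where w: "D k w = Some (v', s')" "v = a * v' + b"
      by (cases "D k w") auto
    have "x w < v'" using Suc.IH[of w v' s'] Suc.prems edge[OF 2(1)] w by auto
    hence "a * x w < a * v'" using edge[OF 2(1)] by simp
    thus ?thesis using ssolD[OF assms(1) 2(1)] w by simp
  qed
qed

text \<open>\<open>\<alpha>\<close> is the gain of the closed walk and equals
  \<open>si / sj\<close>, so comparing two slopes tells whether the gain is at least 1. Position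
  \<open>i\<close> belongs to the later round, and labels never increase from round to round, whence
  \<open>vi \<le> vj\<close>.\<close>

lemma cycle:
  assumes "u < N" "par N u \<noteq> 0" "i < j" "j \<le> N" "tr u i = tr u j"
  obtains \<alpha> \<beta> vi si vj sj where "D (N - i) (tr u i) = Some (vi, si)" "D (N - j) (tr u j) = Some (vj, sj)"
    "0 < sj" "0 < \<alpha>" "vi = \<alpha> * vj + \<beta>" "si = \<alpha> * sj" "vi \<le> vj" "\<And>x. ssol E x \<Longrightarrow> x (tr u i) < \<alpha> * x (tr u i) + \<beta>"
proof -
  obtain vi si where i: "D (N - i) (tr u i) = Some (vi, si)" using trace_label[of i u] assms by auto
  obtain vj sj where j: "D (N - j) (tr u j) = Some (vj, sj)" using trace_label[of j u] assms by auto
  from chain[OF assms(1,2) _ assms(4) i j] assms(3) obtain \<alpha> \<beta> where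
    c: "0 < \<alpha>" "vi = \<alpha> * vj + \<beta>" "si = \<alpha> * sj" "\<And>x. ssol E x \<Longrightarrow> x (tr u i) < \<alpha> * x (tr u j) + \<beta>" by auto
  have iN: "tr u i < N" using trace_le assms by simp
  have "lle (D (N - i) (tr u i)) (D (N - j) (tr u i))" by (rule antimono) (use iN assms in auto)
  hence "vi \<le> vj" using i j assms(5) by (auto simp: lle_def)
  moreover have "0 < sj" using slope_pos[of "N - j" "tr u j"] iN assms j by auto
  ultimately show ?thesis using that i j c assms(5) by auto
qed

text \<open>The slack \<open>(\<alpha> - 1) * y + \<beta>\<close> of the cycle is
  \<open>vi - vj \<le> 0\<close> at \<open>y = vj\<close>. A solution with \<open>x l < lam\<close>
  lies below \<open>vj\<close> at the repeated node, and for gain at least 1 the slack is no larger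
  there, although a solution needs it to be positive. Openness then excludes
  \<open>x l = lam\<close>.\<close>

lemma right_sound:
  assumes "u < N" "par N u \<noteq> 0" "i < j" "j \<le> N" "tr u i = tr u j" "slp (N - j) (tr u j) \<le> slp (N - i) (tr u i)"
    and "ssol E x"
  shows "lam < x l"
proof -
  have *: False if x: "ssol E x" "x l < lam" for x
  proof -
    obtain \<alpha> \<beta> vi si vj sj where c: "D (N - i) (tr u i) = Some (vi, si)" "D (N - j) (tr u j) = Some (vj, sj)"
      "0 < sj" "0 < \<alpha>" "vi = \<alpha> * vj + \<beta>" "si = \<alpha> * sj" "vi \<le> vj" "\<And>x. ssol E x \<Longrightarrow> x (tr u i) < \<alpha> * x (tr u i) + \<beta>"
      using cycle[OF assms(1-5)] by metis
    have "1 * sj \<le> \<alpha> * sj" using assms(6) c by (simp add: slp_def)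
    hence al: "1 \<le> \<alpha>" using c(3) by simp
    have "x (tr u j) < vj"
      by (rule label_bound[OF x _ _ c(2)]) (use trace_le assms in auto)
    hence "(\<alpha> - 1) * x (tr u i) \<le> (\<alpha> - 1) * vj" using al assms(5) by (intro mult_left_mono) auto
    moreover have "0 < (\<alpha> - 1) * x (tr u i) + \<beta>" using c(8)[OF x(1)] by (simp add: algebra_simps)
    ultimately show False using c(5,7) by (simp add: algebra_simps)
  qed
  have "lam \<le> x l" using *[OF assms(7)] by force
  moreover obtain y where "ssol E y" "y l < x l" using ssol_open[OF wf assms(7)] by blast
  hence "x l \<noteq> lam" using *[of y] by auto
  ultimately show ?thesis by simp
qed

text \<open>The minimum of a solution \<open>z\<close> and the label lines, taken slightly left of
  \<open>lam\<close>, satisfies all edges weakly. Labels still improving in round \<open>N\<close>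
  could violate edges that use them, but the hypothesis on gains forces them above \<open>z\<close>,
  where the minimum ignores them.\<close>

lemma left_sound:
  assumes T0: "\<And>u. u < N \<Longrightarrow> par N u \<noteq> 0 \<Longrightarrow> \<exists>j\<le>N. \<exists>i<j. tr u i = tr u j \<and> slp (N - i) (tr u i) < slp (N - j) (tr u j)"
    and z: "ssol E z"
  shows "\<exists>x. ssol E x \<and> x l < lam"
proof -
  have N: "0 < N" using lN by simp
  \<comment> \<open>A cycle of gain below 1 bounds its node by the fixed point
    \<open>\<beta> / (1 - \<alpha>)\<close>, which is at most \<open>vj\<close> because the labels
    do not increase around it. The chain from \<open>u\<close> carries the bound to
    \<open>u\<close>.\<close>
  have dead: "z u < v" if u: "u < N" "par N u \<noteq> 0" and v: "D N u = Some (v, s)" for u v s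
  proof -
    from T0[OF u] obtain i j where ij: "j \<le> N" "i < j" "tr u i = tr u j" "slp (N - i) (tr u i) < slp (N - j) (tr u j)" by auto
    obtain \<alpha> \<beta> vi si vj sj where c: "D (N - i) (tr u i) = Some (vi, si)" "D (N - j) (tr u j) = Some (vj, sj)"
      "0 < sj" "0 < \<alpha>" "vi = \<alpha> * vj + \<beta>" "si = \<alpha> * sj" "vi \<le> vj" "\<And>x. ssol E x \<Longrightarrow> x (tr u i) < \<alpha> * x (tr u i) + \<beta>"
      using cycle[OF u ij(2,1,3)] by metis
    have "\<alpha> * sj < 1 * sj" using ij(4) c by (simp add: slp_def)
    hence al: "\<alpha> < 1" using c(3) using mult_less_cancel_right_pos by blast
    have "(1 - \<alpha>) * z (tr u j) < (1 - \<alpha>) * vj" using c(8)[OF z] c(5,7) ij(3) by (simp add: algebra_simps)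
    hence zj: "z (tr u j) < vj" using al by simp
    have "D (N - 0) (tr u 0) = Some (v, s)" using v by simp
    from chain[OF u _ ij(1) this c(2)] obtain \<alpha>' \<beta>' where
      d: "0 < \<alpha>'" "v = \<alpha>' * vj + \<beta>'" "z u \<le> \<alpha>' * z (tr u j) + \<beta>'" using z by auto
    have "\<alpha>' * z (tr u j) < \<alpha>' * vj" using zj d(1) by (rule mult_strict_left_mono)
    thus ?thesis using d(2,3) by linarith
  qed
  \<comment> \<open>For small positive \<open>e\<close> this is the minimum of \<open>z\<close> and
    the label lines at \<open>lam - e\<close>. The case distinction does not mention
    \<open>e\<close>, so every inequality to be shown is linear in \<open>e\<close>.\<close>
  define y where "y e u = (case D N u of None \<Rightarrow> z u | Some (v, s) \<Rightarrow> if v \<le> z u then v + e * (- s) else z u)" for e :: real and u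
  have ev1: "eventually (\<lambda>e. case ed of (u, v, a, b) \<Rightarrow> y e u \<le> a * y e v + b) (at_right 0)" if ed: "ed \<in> E" for ed
  proof -
    obtain u v a b where [simp]: "ed = (u, v, a, b)" by (cases ed)
    have uv: "u < N" "v < N" "0 < a" using edge ed by auto
    have pos: "eventually (\<lambda>e::real. 0 < e) (at_right 0)" by (simp add: eventually_at_right_less)
    have yz: "y e u \<le> z u" if "0 < e" for e
    proof (cases "D N u")
      case (Some p)
      obtain vu su where p: "p = (vu, su)" by (cases p)
      have "0 < su" using slope_pos[of N u vu su] uv Some p by auto
      hence "0 < e * su" using that by simp
      thus ?thesis using Some p by (auto simp: y_def)
    qed (simp add: y_def)
    have zz: "z u < a * z v + b" using ssolD[OF z] ed by simp
    show ?thesis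
    proof (cases "\<exists>vv sv. D N v = Some (vv, sv) \<and> vv \<le> z v")
      case False
      hence "y e v = z v" for e by (auto simp: y_def split: option.splits)
      hence "y e u \<le> a * y e v + b" if "0 < e" for e using yz[OF that] zz by simp
      with pos show ?thesis by (auto elim: eventually_mono)
    next
      case True
      then obtain vv sv where v: "D N v = Some (vv, sv)" "vv \<le> z v" by auto
      have yv: "y e v = vv + e * (- sv)" for e using v by (simp add: y_def)
      \<comment> \<open>A label not above \<open>z\<close> did not improve in the last round, so
        that round relaxed this edge with the final label of \<open>v\<close>.\<close>
      have "par N v = 0" using dead[OF uv(2) _ v(1)] v(2) by force
      with par[of "N - 1" v] N uv have "D (N - 1) v = Some (vv, sv)" using v by auto
      with relax[of "N - 1" u v a b] N ed have le: "lle (D N u) (Some (a * vv + b, a * sv))" by simp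
      then obtain vu su where u: "D N u = Some (vu, su)" by (cases "D N u") (auto simp: lle_def)
      have le': "vu < a * vv + b \<or> vu = a * vv + b \<and> a * sv \<le> su" using le u by (auto simp: lle_def)
      show ?thesis
      proof (cases "vu \<le> z u")
        case True
        hence yu: "y e u = vu + e * (- su)" for e using u by (simp add: y_def)
        from le' show ?thesis
        proof
          assume "vu < a * vv + b"
          from eventually_lin[OF this, of "- su" "a * (- sv)"] show ?thesis
            by (rule eventually_mono) (simp add: yu yv algebra_simps)
        next
          assume h: "vu = a * vv + b \<and> a * sv \<le> su"
          have "y e u \<le> a * y e v + b" if "0 < e" for e
            using mult_left_mono[of "a * sv" su e] h that by (simp add: yu yv algebra_simps)
          with pos show ?thesis by (auto elim: eventually_mono)
        qed
      next
        case False
        hence yu: "y e u = z u" for e using u by (simp add: y_def)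
        have "z u < a * vv + b" using False le' by auto
        from eventually_lin[OF this, of 0 "a * (- sv)"] show ?thesis
          by (rule eventually_mono) (simp add: yu yv algebra_simps)
      qed
    qed
  qed
  have ev2: "eventually (\<lambda>e. y e l < lam) (at_right 0)"
  proof -
    \<comment> \<open>Either the value dropped below \<open>lam\<close>, or it equals
      \<open>lam\<close> with slope at least 1; then moving left by \<open>e\<close> lowers
      it.\<close>
    have "lle (D N l) (Some (lam, 1))" using antimono[of l 0 N] D0[of l] lN by simp
    then obtain v s where l: "D N l = Some (v, s)" "v < lam \<or> v = lam \<and> 1 \<le> s"
      by (cases "D N l") (force simp: lle_def not_less)+
    show ?thesis
    proof (cases "v \<le> z l")
      case True
      hence yl: "y e l = v + e * (- s)" for e using l by (simp add: y_def)
      from l(2) show ?thesis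
      proof
        assume "v < lam"
        from eventually_lin[OF this, of "- s" 0] show ?thesis by (simp add: yl)
      next
        assume "v = lam \<and> 1 \<le> s"
        hence "y e l < lam" if "0 < e" for e using that by (simp add: yl)
        moreover have "eventually (\<lambda>e::real. 0 < e) (at_right 0)" by (simp add: eventually_at_right_less)
        ultimately show ?thesis by (auto elim: eventually_mono)
      qed
    next
      case False
      thus ?thesis using l by (auto simp: y_def)
    qed
  qed
  have "eventually (\<lambda>e. (\<forall>ed\<in>E. case ed of (u, v, a, b) \<Rightarrow> y e u \<le> a * y e v + b) \<and> y e l < lam) (at_right 0)"
    using ev1 ev2 wf by (intro eventually_conj eventually_ball_finite) (auto simp: wfE_def)
  then obtain e where e: "\<forall>ed\<in>E. case ed of (u, v, a, b) \<Rightarrow> y e u \<le> a * y e v + b" "y e l < lam"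
    using eventually_happens'[OF trivial_limit_at_right_real] by blast
  \<comment> \<open>If \<open>z l\<close> is not left of \<open>lam\<close>, this weight places the
    mixture halfway between \<open>y e l\<close> and \<open>lam\<close>.\<close>
  define t where "t = (if z l < lam then 1 else (lam - y e l) / (2 * (z l - y e l)))"
  have t: "0 < t" "t \<le> 1" "(1 - t) * y e l + t * z l < lam"
  proof -
    show "0 < t" using e(2) by (auto simp: t_def)
    show "t \<le> 1" using e(2) by (auto simp: t_def field_simps)
    show "(1 - t) * y e l + t * z l < lam"
    proof (cases "z l < lam")
      case False
      define w where "w = z l - y e l"
      have "0 < w" using False e(2) by (simp add: w_def)
      hence "t * w = (lam - y e l) / 2" using False by (simp add: t_def w_def[symmetric])
      hence "t * (z l - y e l) = (lam - y e l) / 2" by (simp add: w_def)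
      thus ?thesis using e(2) by (simp add: algebra_simps)
    qed (simp add: t_def)
  qed
  have "ssol E (\<lambda>i. (1 - t) * y e i + t * z i)"
    by (rule ssol_mix[OF wf z _ t(1,2)]) (use e in auto)
  thus ?thesis using t(3) by (intro exI[of _ "\<lambda>i. (1 - t) * y e i + t * z i"]) simp
qed

end

declare sem.simps(6) [simp del]

section \<open>Testing a value of a variable\<close>

text \<open>Names of memories. The prefixes \<open>i\<close> and \<open>r\<close> mark natural number and real arrays, and scalars are
  stored at index 0. The edges are \<open>(iEU, iEV, rEA, rEB)\<close>, numbered below \<open>iM\<close>; \<open>iHS\<close>, \<open>rVAL\<close>, \<open>rSLP\<close>
  and \<open>iPAR\<close> hold the labels of all rounds and their parents plus 1, with the current round starting at \<open>iB\<close>.\<close>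
abbreviation (input) iN :: nat where "iN \<equiv> 56"
abbreviation (input) iM1 :: nat where "iM1 \<equiv> 2"
abbreviation (input) iM :: nat where "iM \<equiv> 3"
abbreviation (input) iEU :: nat where "iEU \<equiv> 4"
abbreviation (input) iEV :: nat where "iEV \<equiv> 5"
abbreviation (input) iLL :: nat where "iLL \<equiv> 6"
abbreviation (input) iT :: nat where "iT \<equiv> 7"
abbreviation (input) ik :: nat where "ik \<equiv> 8"
abbreviation (input) ie' :: nat where "ie' \<equiv> 9"
abbreviation (input) iu :: nat where "iu \<equiv> 10"
abbreviation (input) iB :: nat where "iB \<equiv> 11"
abbreviation (input) iB2 :: nat where "iB2 \<equiv> 12"
abbreviation (input) iHS :: nat where "iHS \<equiv> 13"
abbreviation (input) iPAR :: nat where "iPAR \<equiv> 14"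
abbreviation (input) iw :: nat where "iw \<equiv> 15"
abbreviation (input) idone :: nat where "idone \<equiv> 16"
abbreviation (input) iMK :: nat where "iMK \<equiv> 17"
abbreviation (input) ix :: nat where "ix \<equiv> 18"
abbreviation (input) ikb :: nat where "ikb \<equiv> 19"
abbreviation (input) rEA :: nat where "rEA \<equiv> 30"
abbreviation (input) rEB :: nat where "rEB \<equiv> 2"
abbreviation (input) rVAL :: nat where "rVAL \<equiv> 3"
abbreviation (input) rSLP :: nat where "rSLP \<equiv> 4"
abbreviation (input) rLAM :: nat where "rLAM \<equiv> 5"
abbreviation (input) rcv :: nat where "rcv \<equiv> 6"
abbreviation (input) rcs :: nat where "rcs \<equiv> 7"
abbreviation (input) rMS :: nat where "rMS \<equiv> 8"

definition edges :: "st \<Rightarrow> edge set" where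
  "edges s = (\<lambda>e. (IM s iEU e, IM s iEV e, RM s rEA e, RM s rEB e)) ` {..<IM s iM 0}"

definition lab :: "st \<Rightarrow> nat \<Rightarrow> label" where
  "lab s j = (if IM s iHS j = 0 then None else Some (RM s rVAL j, RM s rSLP j))"

lemma lab_simps [simp]: "lab (tick s) j = lab s j" "k \<noteq> iHS \<Longrightarrow> lab (seti s k i v) j = lab s j"
  "k \<noteq> rVAL \<Longrightarrow> k \<noteq> rSLP \<Longrightarrow> lab (setr s k i x) j = lab s j"
  by (auto simp: lab_def)

definition p_store :: com where
  "p_store = (let j = Add (V iB2) (L iEU (V ie')) in
     IA iHS j (C 1);; RA rVAL j (RV rcv);; RA rSLP j (RV rcs);; IA iPAR j (Add (L iEV (V ie')) (C 1)))"

definition p_relax :: com where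
  "p_relax = (let jv = Add (V iB) (L iEV (V ie')); ju = Add (V iB2) (L iEU (V ie')) in
     IF ILe (C 1) (L iHS jv) THEN
       (rcv ::=r RAd (RMl (RL rEA (V ie')) (RL rVAL jv)) (RL rEB (V ie'));;
        rcs ::=r RMl (RL rEA (V ie')) (RL rSLP jv);;
        IF ILe (L iHS ju) (C 0) THEN p_store ELSE
        IF BLt (RV rcv) (RL rVAL ju) THEN p_store ELSE
        IF BLt (RL rVAL ju) (RV rcv) THEN Skip ELSE
        IF BLt (RL rSLP ju) (RV rcs) THEN p_store ELSE Skip)
     ELSE Skip)"

definition p_copyrow :: com where
  "p_copyrow = (let i = Add (V iB) (V iu); j = Add (V iB2) (V iu) in
     IA iHS j (L iHS i);; RA rVAL j (RL rVAL i);; RA rSLP j (RL rSLP i);; IA iPAR j (C 0))"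

definition p_round :: com where
  "p_round = (iB2 ::= Add (V iB) (V iN);; Fr iu (V iN) p_copyrow;; Fr ie' (V iM) p_relax;; iB ::= V iB2)"

text \<open>Marks remember the slope at the first visit of a node. At the first repetition the
  current slope belongs to an earlier round, so a remembered slope at least as large means gain at
  least 1.\<close>

definition p_trstep :: com where
  "p_trstep = (let j = Add (V ikb) (V iw) in
     IF ILe (C 1) (L iMK (V iw)) THEN
       (idone ::= C 1;; IF BLe (RL rSLP j) (RL rMS (V iw)) THEN iT ::= C 1 ELSE Skip)
     ELSE (IA iMK (V iw) (C 1);; RA rMS (V iw) (RL rSLP j);; iw ::= Sub (L iPAR j) (C 1);; ikb ::= Sub (V ikb) (V iN)))"

definition p_trace :: com where
  "p_trace = (IF ILe (C 1) (L iPAR (Add (V iB) (V iu))) THEN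
     (idone ::= C 0;; Fr ix (V iN) (IA iMK (V ix) (C 0));; iw ::= V iu;; ikb ::= V iB;;
      For ix (Add (V iN) (C 1)) (ILe (V idone) (C 0)) p_trstep)
     ELSE Skip)"

text \<open>Only round 0 has to be cleared, as every other round starts from a copy of its
  predecessor. A trace costs O(N), so tracing from all nodes is no dearer than the rounds.\<close>

definition p_test :: com where
  "p_test = (iB ::= C 0;; Fr iu (V iN) (IA iHS (V iu) (C 0));;
     IA iHS (V iLL) (C 1);; RA rVAL (V iLL) (RV rLAM);; RA rSLP (V iLL) (OfI (C 1));; iT ::= C 0;;
     Fr ik (V iN) p_round;; Fr iu (V iN) p_trace)"

text \<open>Lemmas of this kind compute the write sets of a program once, so that frame conditions
  follow by simplification without unfolding it.\<close>

lemma wI_relax [simp]: "wI p_relax = {iHS, iPAR}" "wR p_relax = {rVAL, rSLP, rcv, rcs}"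
  by (auto simp: p_relax_def p_store_def Let_def)
lemma wI_copyrow [simp]: "wI p_copyrow = {iHS, iPAR}" "wR p_copyrow = {rVAL, rSLP}"
  by (auto simp: p_copyrow_def Let_def)
lemma wI_round [simp]: "wI p_round = {iHS, iPAR, iB, iB2, iu, ie'}" "wR p_round = {rVAL, rSLP, rcv, rcs}"
  by (auto simp: p_round_def)
lemma wI_trstep [simp]: "wI p_trstep = {idone, iT, iMK, iw, ikb}" "wR p_trstep = {rMS}"
  by (auto simp: p_trstep_def Let_def)
lemma wI_trace [simp]: "wI p_trace = {idone, iT, iMK, iw, ikb, ix}" "wR p_trace = {rMS}"
  by (auto simp: p_trace_def)
lemma wI_test [simp]: "wI p_test = {iHS, iPAR, iB, iB2, iu, ie', ik, idone, iT, iMK, iw, ikb, ix}"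
   "wR p_test = {rVAL, rSLP, rcv, rcs, rMS}"
  by (auto simp: p_test_def)

lemma relax_sem:
  assumes "s' = sem p_relax s" "IM s ie' 0 = e" "IM s iB 0 = b" "IM s iB2 0 = b2" "IM s iEU e = u" "IM s iEV e = v"
    "c = ap (RM s rEA e) (RM s rEB e) (lab s (b + v))"
  shows "CK s' \<le> CK s + 11 \<and> (\<forall>j. j \<noteq> b2 + u \<longrightarrow> lab s' j = lab s j \<and> IM s' iPAR j = IM s iPAR j) \<and>
    (if lless c (lab s (b2 + u)) then lab s' (b2 + u) = c \<and> IM s' iPAR (b2 + u) = Suc v
     else lab s' (b2 + u) = lab s (b2 + u) \<and> IM s' iPAR (b2 + u) = IM s iPAR (b2 + u))"
  using assms(2-)
  unfolding assms(1)
  by (cases "IM s iHS (b + v) = 0"; cases "IM s iHS (b2 + u) = 0")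
    (auto simp: p_relax_def p_store_def Let_def lab_def)

lemma copyrow_sem:
  assumes "s' = sem p_copyrow s" "IM s iu 0 = u" "IM s iB 0 = b" "IM s iB2 0 = b2"
  shows "CK s' = CK s + 4 \<and> (\<forall>j. j \<noteq> b2 + u \<longrightarrow> lab s' j = lab s j \<and> IM s' iPAR j = IM s iPAR j) \<and>
    (u + b \<noteq> b2 + u \<longrightarrow> lab s' (b2 + u) = lab s (b + u) \<and> IM s' iPAR (b2 + u) = 0)"
  using assms(2-) unfolding assms(1)
  by (auto simp: p_copyrow_def Let_def lab_def add.commute)

definition EUV :: "st \<Rightarrow> nat \<Rightarrow> bool" where
  "EUV s N \<longleftrightarrow> (\<forall>e<IM s iM 0. IM s iEU e < N \<and> IM s iEV e < N \<and> 0 < RM s rEA e)"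

text \<open>After copying, each slot satisfies the alternative of an unimproved label. A relaxation
  keeps a slot or replaces it by a smaller label computed from the previous round; since slots only
  decrease, edges treated earlier stay relaxed.\<close>

lemma round_sem:
  assumes "s' = sem p_round s" "IM s iN 0 = N" "IM s iB 0 = b" "IM s iM 0 = m" "EUV s N"
  shows "CK s' \<le> CK s + 4 + 5 * N + 12 * m \<and> IM s' iB 0 = b + N \<and> (\<forall>j<b + N. lab s' j = lab s j \<and> IM s' iPAR j = IM s iPAR j) \<and>
    (\<forall>e<m. lle (lab s' (b + N + IM s iEU e)) (ap (RM s rEA e) (RM s rEB e) (lab s (b + IM s iEV e)))) \<and>
    (\<forall>u<N. IM s' iPAR (b + N + u) = 0 \<and> lab s' (b + N + u) = lab s (b + u) \<or>
       (\<exists>e<m. IM s iEU e = u \<and> IM s' iPAR (b + N + u) = Suc (IM s iEV e) \<and>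
          lab s' (b + N + u) = ap (RM s rEA e) (RM s rEB e) (lab s (b + IM s iEV e)) \<and> lless (lab s' (b + N + u)) (lab s (b + u))))"
proof -
  define s1 where "s1 = sem (iB2 ::= Add (V iB) (V iN)) s"
  define s2 where "s2 = sem (Fr iu (V iN) p_copyrow) s1"
  define s3 where "s3 = sem (Fr ie' (V iM) p_relax) s2"
  have s': "s' = sem (iB ::= V iB2) s3" using assms(1) by (simp add: p_round_def s1_def s2_def s3_def)
  have s1: "CK s1 = CK s + 1" "IM s1 iB2 0 = b + N" "IM s1 iB 0 = b" "IM s1 iN 0 = N"
    "lab s1 j = lab s j" "IM s1 iPAR = IM s iPAR" for j
    using assms(2,3) by (auto simp: s1_def)
  have 2: "CK s2 \<le> CK s + 2 + 5 * N \<and> (\<forall>j<b + N. lab s2 j = lab s j \<and> IM s2 iPAR j = IM s iPAR j) \<and>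
     (\<forall>u<N. lab s2 (b + N + u) = lab s (b + u) \<and> IM s2 iPAR (b + N + u) = 0)"
    unfolding s2_def
  proof (rule Fr_rule[where Q = "\<lambda>i t. CK t \<le> CK s + 2 + 5 * i \<and> (\<forall>j<b + N. lab t j = lab s j \<and> IM t iPAR j = IM s iPAR j) \<and>
     (\<forall>u<i. lab t (b + N + u) = lab s (b + u) \<and> IM t iPAR (b + N + u) = 0)"])
    show "CK (tick s1) \<le> CK s + 2 + 5 * 0 \<and> (\<forall>j<b + N. lab (tick s1) j = lab s j \<and> IM (tick s1) iPAR j = IM s iPAR j) \<and>
      (\<forall>u<0. lab (tick s1) (b + N + u) = lab s (b + u) \<and> IM (tick s1) iPAR (b + N + u) = 0)"
      using s1 by auto
  next
    fix i t
    assume i: "i < ie (V iN) s1" and f: "frame (insert iu (wI p_copyrow)) (wR p_copyrow) s1 t"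
      and Q: "CK t \<le> CK s + 2 + 5 * i \<and> (\<forall>j<b + N. lab t j = lab s j \<and> IM t iPAR j = IM s iPAR j) \<and>
     (\<forall>u<i. lab t (b + N + u) = lab s (b + u) \<and> IM t iPAR (b + N + u) = 0)"
    let ?t = "seti (tick t) iu 0 i"
    have iN: "i < N" using i s1 by simp
    have fr: "IM t iB = IM s1 iB" "IM t iB2 = IM s1 iB2" using frameI[OF f] by auto
    have l: "lab ?t j = lab t j" "IM ?t iPAR j = IM t iPAR j" for j by auto
    from copyrow_sem[OF refl, of ?t i b "b + N"] fr s1 iN
    have c: "CK (sem p_copyrow ?t) = CK ?t + 4" "\<And>j. j \<noteq> b + N + i \<Longrightarrow> lab (sem p_copyrow ?t) j = lab t j \<and> IM (sem p_copyrow ?t) iPAR j = IM t iPAR j"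
      "lab (sem p_copyrow ?t) (b + N + i) = lab t (b + i)" "IM (sem p_copyrow ?t) iPAR (b + N + i) = 0"
      unfolding l by auto
    show "CK (sem p_copyrow ?t) \<le> CK s + 2 + 5 * Suc i \<and>
       (\<forall>j<b + N. lab (sem p_copyrow ?t) j = lab s j \<and> IM (sem p_copyrow ?t) iPAR j = IM s iPAR j) \<and>
       (\<forall>u<Suc i. lab (sem p_copyrow ?t) (b + N + u) = lab s (b + u) \<and> IM (sem p_copyrow ?t) iPAR (b + N + u) = 0)"
      using Q c iN by (auto simp: less_Suc_eq)
  qed (use s1 in simp)
  have fr2: "IM s2 iB = IM s1 iB" "IM s2 iB2 = IM s1 iB2" "IM s2 iM = IM s iM" "IM s2 iEU = IM s iEU" "IM s2 iEV = IM s iEV"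
     "RM s2 rEA = RM s rEA" "RM s2 rEB = RM s rEB"
    unfolding s2_def s1_def by (simp_all add: sem_frameI sem_frameR)
  have 3: "CK s3 \<le> CK s + 3 + 5 * N + 12 * m \<and> (\<forall>j<b + N. lab s3 j = lab s j \<and> IM s3 iPAR j = IM s iPAR j) \<and>
    (\<forall>e<m. lle (lab s3 (b + N + IM s iEU e)) (ap (RM s rEA e) (RM s rEB e) (lab s (b + IM s iEV e)))) \<and>
    (\<forall>u<N. IM s3 iPAR (b + N + u) = 0 \<and> lab s3 (b + N + u) = lab s (b + u) \<or>
       (\<exists>e<m. IM s iEU e = u \<and> IM s3 iPAR (b + N + u) = Suc (IM s iEV e) \<and>
          lab s3 (b + N + u) = ap (RM s rEA e) (RM s rEB e) (lab s (b + IM s iEV e)) \<and> lless (lab s3 (b + N + u)) (lab s (b + u))))"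
    unfolding s3_def
  proof (rule Fr_rule[where Q = "\<lambda>i t. CK t \<le> CK s + 3 + 5 * N + 12 * i \<and> (\<forall>j<b + N. lab t j = lab s j \<and> IM t iPAR j = IM s iPAR j) \<and>
    (\<forall>e<i. lle (lab t (b + N + IM s iEU e)) (ap (RM s rEA e) (RM s rEB e) (lab s (b + IM s iEV e)))) \<and>
    (\<forall>u<N. IM t iPAR (b + N + u) = 0 \<and> lab t (b + N + u) = lab s (b + u) \<or>
       (\<exists>e<i. IM s iEU e = u \<and> IM t iPAR (b + N + u) = Suc (IM s iEV e) \<and>
          lab t (b + N + u) = ap (RM s rEA e) (RM s rEB e) (lab s (b + IM s iEV e)) \<and> lless (lab t (b + N + u)) (lab s (b + u))))"])
    show "CK (tick s2) \<le> CK s + 3 + 5 * N + 12 * 0 \<and> (\<forall>j<b + N. lab (tick s2) j = lab s j \<and> IM (tick s2) iPAR j = IM s iPAR j) \<and>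
    (\<forall>e<0. lle (lab (tick s2) (b + N + IM s iEU e)) (ap (RM s rEA e) (RM s rEB e) (lab s (b + IM s iEV e)))) \<and>
    (\<forall>u<N. IM (tick s2) iPAR (b + N + u) = 0 \<and> lab (tick s2) (b + N + u) = lab s (b + u) \<or>
       (\<exists>e<0. IM s iEU e = u \<and> IM (tick s2) iPAR (b + N + u) = Suc (IM s iEV e) \<and>
          lab (tick s2) (b + N + u) = ap (RM s rEA e) (RM s rEB e) (lab s (b + IM s iEV e)) \<and> lless (lab (tick s2) (b + N + u)) (lab s (b + u))))"
      using 2 by auto
  next
    fix i t
    assume i: "i < ie (V iM) s2" and f: "frame (insert ie' (wI p_relax)) (wR p_relax) s2 t"
      and Q: "CK t \<le> CK s + 3 + 5 * N + 12 * i \<and> (\<forall>j<b + N. lab t j = lab s j \<and> IM t iPAR j = IM s iPAR j) \<and>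
    (\<forall>e<i. lle (lab t (b + N + IM s iEU e)) (ap (RM s rEA e) (RM s rEB e) (lab s (b + IM s iEV e)))) \<and>
    (\<forall>u<N. IM t iPAR (b + N + u) = 0 \<and> lab t (b + N + u) = lab s (b + u) \<or>
       (\<exists>e<i. IM s iEU e = u \<and> IM t iPAR (b + N + u) = Suc (IM s iEV e) \<and>
          lab t (b + N + u) = ap (RM s rEA e) (RM s rEB e) (lab s (b + IM s iEV e)) \<and> lless (lab t (b + N + u)) (lab s (b + u))))"
    let ?t = "seti (tick t) ie' 0 i" and ?u = "IM s iEU i" and ?v = "IM s iEV i"
    let ?r = "sem p_relax ?t"
    have im: "i < m" using i fr2 assms(4) by simp
    have fr: "IM t iB = IM s1 iB" "IM t iB2 = IM s1 iB2" "IM t iEU = IM s iEU" "IM t iEV = IM s iEV" "RM t rEA = RM s rEA" "RM t rEB = RM s rEB"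
      using frameI[OF f] frameR[OF f] fr2 by auto
    have uv: "?u < N" "?v < N" using assms(4,5) im by (auto simp: EUV_def)
    have l: "lab ?t j = lab t j" "IM ?t iPAR j = IM t iPAR j" for j by auto
    have lv: "lab t (b + ?v) = lab s (b + ?v)" using Q uv by simp
    define c where "c = ap (RM s rEA i) (RM s rEB i) (lab s (b + ?v))"
    have cc: "c = ap (RM ?t rEA i) (RM ?t rEB i) (lab ?t (b + ?v))" by (simp add: fr c_def l lv)
    have R: "CK ?r \<le> CK ?t + 11" "\<And>j. j \<noteq> b + N + ?u \<Longrightarrow> lab ?r j = lab t j \<and> IM ?r iPAR j = IM t iPAR j"
      "if lless c (lab t (b + N + ?u)) then lab ?r (b + N + ?u) = c \<and> IM ?r iPAR (b + N + ?u) = Suc ?v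
     else lab ?r (b + N + ?u) = lab t (b + N + ?u) \<and> IM ?r iPAR (b + N + ?u) = IM t iPAR (b + N + ?u)"
      using relax_sem[OF refl _ _ _ _ _ cc, of "b + N" ?u] fr s1 unfolding l by auto
    have base: "lle (lab t (b + N + u)) (lab s (b + u))" if "u < N" for u
      using Q that lless_imp_lle by (metis lle_refl)
    have dec: "lle (lab ?r j) (lab t j)" for j
      using R(2)[of j] R(3) lless_imp_lle by (cases "j = b + N + ?u") (auto split: if_splits)
    have "\<forall>e<Suc i. lle (lab ?r (b + N + IM s iEU e)) (ap (RM s rEA e) (RM s rEB e) (lab s (b + IM s iEV e)))"
    proof (intro allI impI)
      fix e assume "e < Suc i"
      then consider "e < i" | "e = i" by linarith
      thus "lle (lab ?r (b + N + IM s iEU e)) (ap (RM s rEA e) (RM s rEB e) (lab s (b + IM s iEV e)))"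
      proof cases
        case 1 thus ?thesis using Q dec lle_trans by blast
      next
        case 2
        thus ?thesis using R(3) unfolding c_def[symmetric] 2 by (auto simp: lle_def c_def[symmetric] split: if_splits)
      qed
    qed
    moreover have "\<forall>u<N. IM ?r iPAR (b + N + u) = 0 \<and> lab ?r (b + N + u) = lab s (b + u) \<or>
       (\<exists>e<Suc i. IM s iEU e = u \<and> IM ?r iPAR (b + N + u) = Suc (IM s iEV e) \<and>
          lab ?r (b + N + u) = ap (RM s rEA e) (RM s rEB e) (lab s (b + IM s iEV e)) \<and> lless (lab ?r (b + N + u)) (lab s (b + u)))"
    proof (intro allI impI)
      fix u assume u: "u < N"
      show "IM ?r iPAR (b + N + u) = 0 \<and> lab ?r (b + N + u) = lab s (b + u) \<or>
       (\<exists>e<Suc i. IM s iEU e = u \<and> IM ?r iPAR (b + N + u) = Suc (IM s iEV e) \<and>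
          lab ?r (b + N + u) = ap (RM s rEA e) (RM s rEB e) (lab s (b + IM s iEV e)) \<and> lless (lab ?r (b + N + u)) (lab s (b + u)))"
      proof (cases "u = ?u \<and> lless c (lab t (b + N + ?u))")
        case True
        hence "lless (lab ?r (b + N + u)) (lab s (b + u))" using R(3) base[OF u] lless_lle_trans by auto
        thus ?thesis using True R(3) c_def by (intro disjI2 exI[of _ i]) auto
      next
        case False
        hence "lab ?r (b + N + u) = lab t (b + N + u)" "IM ?r iPAR (b + N + u) = IM t iPAR (b + N + u)"
          using R(2)[of "b + N + u"] R(3) by (auto split: if_splits)
        thus ?thesis using Q u less_SucI by metis
      qed
    qed
    moreover have "CK ?r \<le> CK s + 3 + 5 * N + 12 * Suc i" using R(1) Q by simp
    moreover have "\<forall>j<b + N. lab ?r j = lab s j \<and> IM ?r iPAR j = IM s iPAR j" using R(2) Q by auto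
    ultimately show "CK ?r \<le> CK s + 3 + 5 * N + 12 * Suc i \<and> (\<forall>j<b + N. lab ?r j = lab s j \<and> IM ?r iPAR j = IM s iPAR j) \<and>
    (\<forall>e<Suc i. lle (lab ?r (b + N + IM s iEU e)) (ap (RM s rEA e) (RM s rEB e) (lab s (b + IM s iEV e)))) \<and>
    (\<forall>u<N. IM ?r iPAR (b + N + u) = 0 \<and> lab ?r (b + N + u) = lab s (b + u) \<or>
       (\<exists>e<Suc i. IM s iEU e = u \<and> IM ?r iPAR (b + N + u) = Suc (IM s iEV e) \<and>
          lab ?r (b + N + u) = ap (RM s rEA e) (RM s rEB e) (lab s (b + IM s iEV e)) \<and> lless (lab ?r (b + N + u)) (lab s (b + u))))"
      by blast
  qed (use fr2 assms(4) in simp)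
  have "IM s3 iB2 0 = b + N" unfolding s3_def by (simp add: sem_frameI fr2 s1)
  moreover have "lab s' j = lab s3 j" "IM s' iPAR j = IM s3 iPAR j" "CK s' = CK s3 + 1" for j using s' by auto
  ultimately show ?thesis using 3 s' by auto
qed


definition outcome :: "(nat \<Rightarrow> nat) \<Rightarrow> (nat \<Rightarrow> nat \<Rightarrow> real) \<Rightarrow> nat \<Rightarrow> nat \<Rightarrow> nat \<Rightarrow> bool" where
  "outcome tr slp N T T' \<longleftrightarrow> (\<exists>j\<le>N. \<exists>i<j. tr i = tr j \<and> (if slp (N - j) (tr j) \<le> slp (N - i) (tr i) then T' = 1 else T' = T))"

text \<open>By the pigeonhole principle a repetition occurs within \<open>N + 1\<close> positions,
  so the loop cannot be exhausted with \<open>idone\<close> still 0.\<close>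

lemma trace_sem:
  assumes bf: "bellman_ford E N l lam (\<lambda>k u. lab s (k * N + u)) (\<lambda>k u. IM s iPAR (k * N + u))"
    and s: "IM s iN 0 = N" "IM s iB 0 = N * N" "IM s iu 0 = u" "u < N"
    and tr: "tr = bellman_ford.tr N (\<lambda>k u. IM s iPAR (k * N + u)) u"
    and slp: "slp = bellman_ford.slp (\<lambda>k u. lab s (k * N + u))"
  shows "CK (sem p_trace s) \<le> CK s + 10 * N + 20 \<and>
    (if IM s iPAR (N * N + u) = 0 then IM (sem p_trace s) iT 0 = IM s iT 0 else outcome tr slp N (IM s iT 0) (IM (sem p_trace s) iT 0))"
proof (cases "IM s iPAR (N * N + u) = 0")
  case True
  thus ?thesis using s by (simp add: p_trace_def)
next
  case False
  interpret bellman_ford E N l lam "\<lambda>k u. lab s (k * N + u)" "\<lambda>k u. IM s iPAR (k * N + u)" by (rule bf)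
  note tr = tr[symmetric] and slp = slp[symmetric]
  define s1 where "s1 = sem (idone ::= C 0) (tick s)"
  define s2 where "s2 = sem (Fr ix (V iN) (IA iMK (V ix) (C 0))) s1"
  define s3 where "s3 = sem (iw ::= V iu;; ikb ::= V iB) s2"
  have e: "sem p_trace s = sem (For ix (Add (V iN) (C 1)) (ILe (V idone) (C 0)) p_trstep) s3"
    using False s by (simp add: p_trace_def s1_def s2_def s3_def)
  have 2: "CK s2 \<le> CK s + 3 + 2 * N \<and> (\<forall>y<N. IM s2 iMK y = 0)"
    unfolding s2_def
  proof (rule Fr_rule[where Q = "\<lambda>i t. CK t \<le> CK s + 3 + 2 * i \<and> (\<forall>y<i. IM t iMK y = 0)"])
  qed (use s in \<open>auto simp: s1_def less_Suc_eq\<close>)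
  have k2: "k \<noteq> idone \<Longrightarrow> k \<noteq> ix \<Longrightarrow> k \<noteq> iMK \<Longrightarrow> IM s2 k = IM s k" for k
    unfolding s2_def s1_def by (simp add: sem_frameI)
  have r2: "RM s2 k = RM s k" for k unfolding s2_def s1_def by (simp add: sem_frameR)
  have d2: "IM s2 idone 0 = 0" unfolding s2_def s1_def by (simp add: sem_frameI)
  have k3: "k \<noteq> idone \<Longrightarrow> k \<noteq> ix \<Longrightarrow> k \<noteq> iMK \<Longrightarrow> k \<noteq> iw \<Longrightarrow> k \<noteq> ikb \<Longrightarrow> IM s3 k = IM s k" "RM s3 k = RM s k" for k
    unfolding s3_def by (simp_all add: k2 r2)
  have s3: "IM s3 idone 0 = 0" "IM s3 iw 0 = u" "IM s3 ikb 0 = N * N" "CK s3 \<le> CK s + 5 + 2 * N" "\<forall>y<N. IM s3 iMK y = 0"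
    using 2 k2 s d2 by (auto simp: s3_def)
  have uN: "u < N" by fact
  have par0: "IM s iPAR (N * N + u) \<noteq> 0" by fact
  \<comment> \<open>Until the first repetition the visited nodes are distinct and marked, and
    \<open>rMS\<close> holds the slopes at their visits; afterwards only the outcome
    matters.\<close>
  define Q where "Q i t \<longleftrightarrow> CK t \<le> CK s3 + 1 + 6 * i \<and>
     (if IM t idone 0 = 0 then IM t iT 0 = IM s iT 0 \<and> IM t iw 0 = tr i \<and> IM t ikb 0 = (N - i) * N \<and>
        (\<forall>y<N. IM t iMK y \<noteq> 0 \<longleftrightarrow> y \<in> tr ` {..<i}) \<and> (\<forall>i'<i. RM t rMS (tr i') = slp (N - i') (tr i')) \<and> inj_on tr {..<i}
      else outcome tr slp N (IM s iT 0) (IM t iT 0))" for i and t :: st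
  have trN: "i \<le> N \<Longrightarrow> tr i < N" for i using trace_le[OF _ uN, of i] par0 tr by simp
  have lb: "slp (N - i) (tr i) = RM s rSLP ((N - i) * N + tr i)" if iN: "i \<le> N" for i
  proof -
    obtain v x where "lab s ((N - i) * N + bellman_ford.tr N (\<lambda>k u. IM s iPAR (k * N + u)) u i) = Some (v, x)"
      using trace_label[OF iN uN] par0 by blast
    hence "lab s ((N - i) * N + tr i) = Some (v, x)" unfolding tr .
    moreover have "slp (N - i) (tr i) = snd (the (lab s ((N - i) * N + tr i)))"
      using slp_def[of "N - i" "tr i"] unfolding slp .
    ultimately show ?thesis by (auto simp: lab_def split: if_splits)
  qed
  have trS: "tr (Suc i) = IM s iPAR ((N - i) * N + tr i) - 1" for i using tr by auto
  have rep: "\<not> inj_on tr {..<Suc N}"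
    using trace_repeat[OF uN] par0 unfolding tr inj_on_def by (metis lessThan_iff less_Suc_eq_le less_imp_le_nat order_trans nat_neq_iff)
  show ?thesis
    unfolding e
  proof (rule For_rule[where Q = Q])
    have "tr 0 = u" using arg_cong[OF tr, of "\<lambda>f. f 0"] by simp
    thus "Q 0 (tick s3)" using s3 k3 by (simp add: Q_def)
  next
    fix i t
    assume i: "i < ie (Add (V iN) (C 1)) s3" and f: "frame (insert ix (wI p_trstep)) (wR p_trstep) s3 t"
      and Q: "Q i t" and g: "be (ILe (V idone) (C 0)) (seti (tick t) ix 0 i)"
    have iN: "i \<le> N" using i k3 s by simp
    have fr: "IM t iPAR = IM s iPAR" "RM t rSLP = RM s rSLP" "IM t iN = IM s iN"
      using frameI[OF f] frameR[OF f] k3 by auto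
    have q: "CK t \<le> CK s3 + 1 + 6 * i" "IM t iT 0 = IM s iT 0" "IM t iw 0 = tr i" "IM t ikb 0 = (N - i) * N"
       "\<And>y. y < N \<Longrightarrow> IM t iMK y \<noteq> 0 \<longleftrightarrow> y \<in> tr ` {..<i}" "\<And>i'. i' < i \<Longrightarrow> RM t rMS (tr i') = slp (N - i') (tr i')" "inj_on tr {..<i}"
       "IM t idone 0 = 0"
      using Q g by (auto simp: Q_def)
    let ?r = "sem p_trstep (seti (tick t) ix 0 i)"
    show "Q (Suc i) ?r"
    proof (cases "tr i \<in> tr ` {..<i}")
      case True
      then obtain i' where i': "i' < i" "tr i' = tr i" by auto
      have mk: "1 \<le> IM t iMK (tr i)" using q(5)[OF trN[OF iN]] True by simp
      have ms: "RM t rMS (tr i) = slp (N - i') (tr i')" using q(6)[OF i'(1)] i'(2) by simp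
      have "IM ?r iT 0 = (if slp (N - i) (tr i) \<le> slp (N - i') (tr i') then 1 else IM s iT 0)"
         "IM ?r idone 0 = 1" "CK ?r \<le> CK t + 6"
        using mk ms q(2,3,4) fr lb[OF iN] by (auto simp: p_trstep_def Let_def)
      moreover from this have "outcome tr slp N (IM s iT 0) (IM ?r iT 0)"
        unfolding outcome_def using i' iN by (intro exI[of _ i] conjI exI[of _ i']) auto
      ultimately show ?thesis using q(1) unfolding Q_def by auto
    next
      case False
      have mk: "IM t iMK (tr i) = 0" using q(5)[OF trN[OF iN]] False by simp
      have r: "IM ?r iT 0 = IM s iT 0" "IM ?r idone 0 = 0" "CK ?r \<le> CK t + 6" "IM ?r iw 0 = tr (Suc i)"
        "IM ?r ikb 0 = (N - Suc i) * N" "IM ?r iMK = (IM t iMK)(tr i := 1)" "RM ?r rMS = (RM t rMS)(tr i := slp (N - i) (tr i))"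
        using mk q(2,3,4,8) fr lb[OF iN] s(1) trS[of i] by (auto simp: p_trstep_def Let_def diff_mult_distrib)
      have "inj_on tr {..<Suc i}" using q(7) False by (simp add: lessThan_Suc)
      moreover have "\<forall>y<N. IM ?r iMK y \<noteq> 0 \<longleftrightarrow> y \<in> tr ` {..<Suc i}" using q(5) r(6) by (auto simp: lessThan_Suc)
      moreover have "\<forall>i'<Suc i. RM ?r rMS (tr i') = slp (N - i') (tr i')"
      proof (intro allI impI)
        fix i' assume "i' < Suc i"
        then consider "i' < i" "tr i' \<noteq> tr i" | "i' = i" using False by (metis imageI lessThan_iff less_Suc_eq)
        thus "RM ?r rMS (tr i') = slp (N - i') (tr i')" using q(6) r(7) by cases auto
      qed
      ultimately show ?thesis using r q(1) unfolding Q_def by simp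
    qed
  next
    fix i t
    assume i: "i < ie (Add (V iN) (C 1)) s3" and Q: "Q i t" and g: "\<not> be (ILe (V idone) (C 0)) (seti (tick t) ix 0 i)"
    have "CK t \<le> CK s3 + 1 + 6 * N" using i Q k3 s by (auto simp: Q_def)
    thus "CK (seti (tick t) ix 0 i) \<le> CK s + 10 * N + 20 \<and>
       (if IM s iPAR (N * N + u) = 0 then IM (seti (tick t) ix 0 i) iT 0 = IM s iT 0
        else outcome tr slp N (IM s iT 0) (IM (seti (tick t) ix 0 i) iT 0))"
      using Q g par0 s3(4) by (simp add: Q_def)
  next
    fix t
    assume Q: "Q (ie (Add (V iN) (C 1)) s3) t"
    have "CK t \<le> CK s3 + 1 + 6 * (N + 1)" using Q k3 s by (auto simp: Q_def)
    thus "CK t \<le> CK s + 10 * N + 20 \<and>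
       (if IM s iPAR (N * N + u) = 0 then IM t iT 0 = IM s iT 0 else outcome tr slp N (IM s iT 0) (IM t iT 0))"
      using Q par0 s3(4) rep k3 s by (simp add: Q_def split: if_splits)
  qed
qed

theorem test_sem:
  assumes s: "IM s iN 0 = N" "IM s iM 0 = m" "IM s iLL 0 = l" "l < N" "RM s rLAM 0 = lam" and E: "EUV s N"
    and s': "s' = sem p_test s"
  shows "CK s' \<le> CK s + 50 * (N + 1) * (N + m + 1) \<and>
    (IM s' iT 0 \<noteq> 0 \<longrightarrow> (\<forall>x. ssol (edges s) x \<longrightarrow> lam < x l)) \<and>
    (IM s' iT 0 = 0 \<longrightarrow> (\<forall>z. ssol (edges s) z \<longrightarrow> (\<exists>x. ssol (edges s) x \<and> x l < lam)))"
proof -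
  define s1 where "s1 = sem (iB ::= C 0) s"
  define s2 where "s2 = sem (Fr iu (V iN) (IA iHS (V iu) (C 0))) s1"
  define s3 where "s3 = sem (IA iHS (V iLL) (C 1);; RA rVAL (V iLL) (RV rLAM);; RA rSLP (V iLL) (OfI (C 1));; iT ::= C 0) s2"
  define s4 where "s4 = sem (Fr ik (V iN) p_round) s3"
  have e: "s' = sem (Fr iu (V iN) p_trace) s4" by (simp add: s' p_test_def s1_def s2_def s3_def s4_def)
  have 2: "CK s2 \<le> CK s + 2 + 2 * N \<and> (\<forall>y<N. IM s2 iHS y = 0)"
    unfolding s2_def
  proof (rule Fr_rule[where Q = "\<lambda>i t. CK t \<le> CK s + 2 + 2 * i \<and> (\<forall>y<i. IM t iHS y = 0)"])
  qed (use s in \<open>auto simp: s1_def less_Suc_eq\<close>)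
  have k2: "k \<noteq> iB \<Longrightarrow> k \<noteq> iu \<Longrightarrow> k \<noteq> iHS \<Longrightarrow> IM s2 k = IM s k" "RM s2 k = RM s k" for k
    unfolding s2_def s1_def by (simp_all add: sem_frameI sem_frameR)
  have b2: "IM s2 iB 0 = 0" unfolding s2_def s1_def by (simp add: sem_frameI)
  have k3: "k \<noteq> iB \<Longrightarrow> k \<noteq> iu \<Longrightarrow> k \<noteq> iHS \<Longrightarrow> k \<noteq> iT \<Longrightarrow> IM s3 k = IM s k" "x \<noteq> rVAL \<Longrightarrow> x \<noteq> rSLP \<Longrightarrow> RM s3 x = RM s x" for k x
    unfolding s3_def by (simp_all add: k2)
  have s3: "IM s3 iB 0 = 0" "IM s3 iT 0 = 0" "CK s3 \<le> CK s + 6 + 2 * N"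
    using 2 b2 by (auto simp: s3_def)
  have lab3: "u < N \<Longrightarrow> lab s3 u = (if u = l then Some (lam, 1) else None)" for u
    using 2 s k2 by (auto simp: s3_def lab_def)
  \<comment> \<open>The labels of round \<open>k\<close> start at \<open>k * N\<close>. Later rounds
    write beyond them, so what was established for one round persists.\<close>
  define inv where "inv k t \<longleftrightarrow> (\<forall>u<N. lab t u = (if u = l then Some (lam, 1) else None)) \<and>
    (\<forall>k'<k. (\<forall>e<m. lle (lab t (k' * N + N + IM s iEU e)) (ap (RM s rEA e) (RM s rEB e) (lab t (k' * N + IM s iEV e)))) \<and>
    (\<forall>u<N. IM t iPAR (k' * N + N + u) = 0 \<and> lab t (k' * N + N + u) = lab t (k' * N + u) \<or>
       (\<exists>e<m. IM s iEU e = u \<and> IM t iPAR (k' * N + N + u) = Suc (IM s iEV e) \<and>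
          lab t (k' * N + N + u) = ap (RM s rEA e) (RM s rEB e) (lab t (k' * N + IM s iEV e)) \<and> lless (lab t (k' * N + N + u)) (lab t (k' * N + u)))))" for k and t :: st
  have uv: "e < m \<Longrightarrow> IM s iEU e < N \<and> IM s iEV e < N \<and> 0 < RM s rEA e" for e using E s by (auto simp: EUV_def)
  have 4: "CK s4 \<le> CK s3 + 1 + N * (5 + 5 * N + 12 * m) \<and> IM s4 iB 0 = N * N \<and> inv N s4"
    unfolding s4_def
  proof (rule Fr_rule[where Q = "\<lambda>i t. CK t \<le> CK s3 + 1 + i * (5 + 5 * N + 12 * m) \<and> IM t iB 0 = i * N \<and> inv i t"])
    show "CK (tick s3) \<le> CK s3 + 1 + 0 * (5 + 5 * N + 12 * m) \<and> IM (tick s3) iB 0 = 0 * N \<and> inv 0 (tick s3)"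
      using s3 lab3 by (simp add: inv_def)
  next
    fix i t
    assume i: "i < ie (V iN) s3" and f: "frame (insert ik (wI p_round)) (wR p_round) s3 t"
      and Q: "CK t \<le> CK s3 + 1 + i * (5 + 5 * N + 12 * m) \<and> IM t iB 0 = i * N \<and> inv i t"
    let ?t = "seti (tick t) ik 0 i"
    let ?r = "sem p_round ?t"
    have iN: "i < N" using i k3 s by simp
    have fr: "IM t iN = IM s iN" "IM t iM = IM s iM" "IM t iEU = IM s iEU" "IM t iEV = IM s iEV" "RM t rEA = RM s rEA" "RM t rEB = RM s rEB"
      using frameI[OF f] frameR[OF f] k3 by auto
    have R: "CK ?r \<le> CK t + 5 + 5 * N + 12 * m" "IM ?r iB 0 = i * N + N" "\<And>j. j<i * N + N \<Longrightarrow> lab ?r j = lab t j \<and> IM ?r iPAR j = IM t iPAR j"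
      "\<And>e. e<m \<Longrightarrow> lle (lab ?r (i * N + N + IM s iEU e)) (ap (RM s rEA e) (RM s rEB e) (lab t (i * N + IM s iEV e)))"
      "\<And>u. u<N \<Longrightarrow> IM ?r iPAR (i * N + N + u) = 0 \<and> lab ?r (i * N + N + u) = lab t (i * N + u) \<or>
       (\<exists>e<m. IM s iEU e = u \<and> IM ?r iPAR (i * N + N + u) = Suc (IM s iEV e) \<and>
          lab ?r (i * N + N + u) = ap (RM s rEA e) (RM s rEB e) (lab t (i * N + IM s iEV e)) \<and> lless (lab ?r (i * N + N + u)) (lab t (i * N + u)))"
      using round_sem[OF refl, of ?t N "i * N" m] fr s Q E by (auto simp: EUV_def)
    have old: "lab ?r (i * N + u) = lab t (i * N + u)" if "u < N" for u using R(3) that by simp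
    have old': "lab ?r (k * N + u) = lab t (k * N + u)" "lab ?r (k * N + N + u) = lab t (k * N + N + u)" "IM ?r iPAR (k * N + N + u) = IM t iPAR (k * N + N + u)"
      if "k < i" "u < N" for k u
    proof -
      have "(k + 1) * N \<le> i * N" using that by (intro mult_right_mono) auto
      hence "k * N + N + u < i * N + N" using that by (simp add: algebra_simps)
      thus "lab ?r (k * N + u) = lab t (k * N + u)" "lab ?r (k * N + N + u) = lab t (k * N + N + u)" "IM ?r iPAR (k * N + N + u) = IM t iPAR (k * N + N + u)"
        using R(3) by auto
    qed
    have "inv (Suc i) ?r"
      unfolding inv_def
    proof (intro conjI allI impI)
      fix u assume "u < N"
      thus "lab ?r u = (if u = l then Some (lam, 1) else None)" using R(3)[of u] Q by (auto simp: inv_def)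
    next
      fix k e assume k: "k < Suc i" and e: "e < m"
      show "lle (lab ?r (k * N + N + IM s iEU e)) (ap (RM s rEA e) (RM s rEB e) (lab ?r (k * N + IM s iEV e)))"
      proof (cases "k = i")
        case True thus ?thesis using R(4)[OF e] old uv[OF e] by simp
      next
        case False thus ?thesis using old' k uv[OF e] Q e by (simp add: inv_def)
      qed
    next
      fix k u assume k: "k < Suc i" and u: "u < N"
      show "IM ?r iPAR (k * N + N + u) = 0 \<and> lab ?r (k * N + N + u) = lab ?r (k * N + u) \<or>
       (\<exists>e<m. IM s iEU e = u \<and> IM ?r iPAR (k * N + N + u) = Suc (IM s iEV e) \<and>
          lab ?r (k * N + N + u) = ap (RM s rEA e) (RM s rEB e) (lab ?r (k * N + IM s iEV e)) \<and> lless (lab ?r (k * N + N + u)) (lab ?r (k * N + u)))"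
      proof (cases "k = i")
        case True thus ?thesis using R(5)[OF u] old uv u by metis
      next
        case False
        hence "k < i" using k by simp
        moreover have "IM t iPAR (k * N + N + u) = 0 \<and> lab t (k * N + N + u) = lab t (k * N + u) \<or>
       (\<exists>e<m. IM s iEU e = u \<and> IM t iPAR (k * N + N + u) = Suc (IM s iEV e) \<and>
          lab t (k * N + N + u) = ap (RM s rEA e) (RM s rEB e) (lab t (k * N + IM s iEV e)) \<and> lless (lab t (k * N + N + u)) (lab t (k * N + u)))"
          using Q calculation u by (simp add: inv_def)
        ultimately show ?thesis using old'[of k] u uv by metis
      qed
    qed
    thus "CK ?r \<le> CK s3 + 1 + Suc i * (5 + 5 * N + 12 * m) \<and> IM ?r iB 0 = Suc i * N \<and> inv (Suc i) ?r"
      using R(1,2) Q by simp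
  qed (use k3 s in simp)
  have k4: "k \<noteq> iB \<Longrightarrow> k \<noteq> iu \<Longrightarrow> k \<noteq> iHS \<Longrightarrow> k \<noteq> iT \<Longrightarrow> k \<notin> wI p_round \<Longrightarrow> k \<noteq> ik \<Longrightarrow> IM s4 k = IM s k" for k
    unfolding s4_def by (simp add: sem_frameI k3)
  have T4: "IM s4 iT 0 = 0" unfolding s4_def by (simp add: sem_frameI s3)
  define D where "D = (\<lambda>k u. lab s4 (k * N + u))"
  define par where "par = (\<lambda>k u. IM s4 iPAR (k * N + u))"
  have bf: "bellman_ford (edges s) N l lam D par"
  proof
    show "wfE N (edges s)" using uv s by (auto simp: wfE_def edges_def)
    show "l < N" by fact
    show "D 0 u = (if u = l then Some (lam, 1) else None)" if "u < N" for u
      using 4 that by (simp add: D_def inv_def)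
    show "lle (D (Suc k) u) (ap a b (D k v))" if "k < N" "(u, v, a, b) \<in> edges s" for k u v a b
      using 4 that s by (auto simp: D_def inv_def edges_def algebra_simps)
    show "par (Suc k) u = 0 \<and> D (Suc k) u = D k u \<or>
        (\<exists>v a b. par (Suc k) u = Suc v \<and> (u, v, a, b) \<in> edges s \<and> D (Suc k) u = ap a b (D k v) \<and> lless (D (Suc k) u) (D k u))"
      if ku: "k < N" "u < N" for k u
    proof -
      have "IM s4 iPAR (k * N + N + u) = 0 \<and> lab s4 (k * N + N + u) = lab s4 (k * N + u) \<or>
       (\<exists>e<m. IM s iEU e = u \<and> IM s4 iPAR (k * N + N + u) = Suc (IM s iEV e) \<and>
          lab s4 (k * N + N + u) = ap (RM s rEA e) (RM s rEB e) (lab s4 (k * N + IM s iEV e)) \<and> lless (lab s4 (k * N + N + u)) (lab s4 (k * N + u)))"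
        using 4 ku by (simp add: inv_def)
      moreover have "Suc k * N + u = k * N + N + u" by simp
      ultimately show ?thesis unfolding D_def par_def edges_def using s by (force simp only: image_iff lessThan_iff)
    qed
  qed
  interpret bellman_ford "edges s" N l lam D par by (rule bf)
  \<comment> \<open>One trace of gain at least 1 settles the answer, whereas answer 0 needs every
    trace so far to end with gain below 1. Accordingly \<open>iT\<close> is only ever
    raised.\<close>
  define U where "U T i \<longleftrightarrow> (if T = (0::nat) then \<forall>u<i. par N u \<noteq> 0 \<longrightarrow> outcome (tr u) slp N 0 0
     else \<exists>u<N. par N u \<noteq> 0 \<and> (\<exists>j\<le>N. \<exists>i<j. tr u i = tr u j \<and> slp (N - j) (tr u j) \<le> slp (N - i) (tr u i)))" for T i
  have fin: "CK s' \<le> CK s4 + 1 + N * (10 * N + 21) \<and> U (IM s' iT 0) N"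
    unfolding e
  proof (rule Fr_rule[where Q = "\<lambda>i t. CK t \<le> CK s4 + 1 + i * (10 * N + 21) \<and> U (IM t iT 0) i"])
    show "CK (tick s4) \<le> CK s4 + 1 + 0 * (10 * N + 21) \<and> U (IM (tick s4) iT 0) 0" using T4 by (simp add: U_def)
  next
    fix i t
    assume i: "i < ie (V iN) s4" and f: "frame (insert iu (wI p_trace)) (wR p_trace) s4 t"
      and Q: "CK t \<le> CK s4 + 1 + i * (10 * N + 21) \<and> U (IM t iT 0) i"
    let ?t = "seti (tick t) iu 0 i"
    have iN: "i < N" using i k4 s by simp
    have fr: "IM t iN = IM s iN" "IM t iB = IM s4 iB" "IM t iPAR = IM s4 iPAR" "IM t iHS = IM s4 iHS" "RM t rVAL = RM s4 rVAL" "RM t rSLP = RM s4 rSLP"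
      using frameI[OF f] frameR[OF f] k4 by auto
    have DD: "(\<lambda>k u. lab ?t (k * N + u)) = D" by (intro ext) (simp add: D_def lab_def fr)
    have PP: "(\<lambda>k u. IM ?t iPAR (k * N + u)) = par" by (intro ext) (simp add: par_def fr)
    from trace_sem[of "edges s" N l lam ?t i, unfolded DD PP, OF bf _ _ _ iN refl refl] fr s 4
    have R: "CK (sem p_trace ?t) \<le> CK t + 10 * N + 21" "if par N i = 0 then IM (sem p_trace ?t) iT 0 = IM t iT 0
        else outcome (tr i) slp N (IM t iT 0) (IM (sem p_trace ?t) iT 0)"
      by (auto simp: par_def split: if_splits)
    have "U (IM (sem p_trace ?t) iT 0) (Suc i)"
    proof (cases "par N i = 0")
      case True thus ?thesis using R(2) Q by (auto simp: U_def less_Suc_eq split: if_splits)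
    next
      case False
      with R(2) have o: "outcome (tr i) slp N (IM t iT 0) (IM (sem p_trace ?t) iT 0)" by simp
      then obtain i' j where ij: "j \<le> N" "i' < j" "tr i i' = tr i j"
        "if slp (N - j) (tr i j) \<le> slp (N - i') (tr i i') then IM (sem p_trace ?t) iT 0 = 1 else IM (sem p_trace ?t) iT 0 = IM t iT 0"
        by (auto simp: outcome_def)
      show ?thesis
      proof (cases "slp (N - j) (tr i j) \<le> slp (N - i') (tr i i')")
        case True
        have "\<exists>u<N. par N u \<noteq> 0 \<and> (\<exists>j\<le>N. \<exists>i<j. tr u i = tr u j \<and> slp (N - j) (tr u j) \<le> slp (N - i) (tr u i))"
          using ij(1-3) True False iN by blast
        moreover have "IM (sem p_trace ?t) iT 0 = 1" using ij(4) True by simp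
        ultimately show ?thesis by (simp add: U_def)
      next
        case F: False
        hence eq: "IM (sem p_trace ?t) iT 0 = IM t iT 0" using ij by simp
        show ?thesis using Q o False unfolding eq by (auto simp: U_def less_Suc_eq split: if_splits)
      qed
    qed
    thus "CK (sem p_trace ?t) \<le> CK s4 + 1 + Suc i * (10 * N + 21) \<and> U (IM (sem p_trace ?t) iT 0) (Suc i)"
      using R(1) Q by simp
  qed (use k4 s in simp)
  show ?thesis
  proof (intro conjI impI allI)
    have "CK s' \<le> CK s + 6 + 2 * N + 1 + N * (5 + 5 * N + 12 * m) + 1 + N * (10 * N + 21)"
      using fin 4 s3 by simp
    thus "CK s' \<le> CK s + 50 * (N + 1) * (N + m + 1)" by (simp add: algebra_simps)
  next
    fix x assume T: "IM s' iT 0 \<noteq> 0" and x: "ssol (edges s) x"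
    show "lam < x l" using fin T right_sound x by (auto simp: U_def)
  next
    fix z assume T: "IM s' iT 0 = 0" and z: "ssol (edges s) z"
    show "\<exists>x. ssol (edges s) x \<and> x l < lam"
    proof (rule left_sound[OF _ z])
      fix u assume "u < N" "par N u \<noteq> 0"
      hence "outcome (tr u) slp N 0 0" using fin T by (simp add: U_def)
      thus "\<exists>j\<le>N. \<exists>i<j. tr u i = tr u j \<and> slp (N - i) (tr u i) < slp (N - j) (tr u j)"
        by (fastforce simp: outcome_def not_le split: if_splits)
    qed
  qed
qed

section \<open>Medians\<close>

abbreviation (input) iC :: nat where "iC \<equiv> 20"
abbreviation (input) ihi :: nat where "ihi \<equiv> 21"
abbreviation (input) ihj :: nat where "ihj \<equiv> 22"
abbreviation (input) icont :: nat where "icont \<equiv> 23"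
abbreviation (input) isz :: nat where "isz \<equiv> 24"
abbreviation (input) iy :: nat where "iy \<equiv> 25"
abbreviation (input) iz :: nat where "iz \<equiv> 26"
abbreviation (input) rH :: nat where "rH \<equiv> 9"
abbreviation (input) rtmp :: nat where "rtmp \<equiv> 10"

definition p_siftstep :: com where
  "p_siftstep = (ihj ::= Add (Add (V ihi) (V ihi)) (C 1);;
     IF ILt (V ihj) (V isz) THEN
       ((IF ILt (Add (V ihj) (C 1)) (V isz) THEN
          (IF BLt (RL rH (V ihj)) (RL rH (Add (V ihj) (C 1))) THEN ihj ::= Add (V ihj) (C 1) ELSE Skip) ELSE Skip);;
        IF BLt (RL rH (V ihi)) (RL rH (V ihj)) THEN
          (rtmp ::=r RL rH (V ihi);; RA rH (V ihi) (RL rH (V ihj));; RA rH (V ihj) (RV rtmp);; ihi ::= V ihj)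
        ELSE icont ::= C 0)
     ELSE icont ::= C 0)"

definition p_sift :: com where
  "p_sift = (icont ::= C 1;; For iz (V isz) (ILe (C 1) (V icont)) p_siftstep)"

definition p_pop :: com where
  "p_pop = (isz ::= Sub (V isz) (C 1);; rtmp ::=r RL rH (C 0);; RA rH (C 0) (RL rH (V isz));; RA rH (V isz) (RV rtmp);;
     ihi ::= C 0;; p_sift)"

text \<open>Heapsort stopped halfway: after \<open>y\<close> maxima are removed, the root is the
  largest of the \<open>n - y\<close> keys left. The logarithmic factor over linear selection is
  affordable, since the number of keys over all rounds of a search is dominated by a geometric
  series and one key per two unpaired groups of slack per round.\<close>

definition p_median :: com where
  "p_median = (isz ::= V iC;; Fr iy (V iC) (ihi ::= Sub (Sub (V iC) (C 1)) (V iy);; p_sift);;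
     For iy (V iC) (ILe (Add (Add (V iy) (V iy)) (C 2)) (V iC)) p_pop)"

lemma wI_siftstep [simp]: "wI p_siftstep = {ihi, ihj, icont}" "wR p_siftstep = {rH, rtmp}"
  by (auto simp: p_siftstep_def)
lemma wI_sift [simp]: "wI p_sift = {ihi, ihj, icont, iz}" "wR p_sift = {rH, rtmp}"
  by (auto simp: p_sift_def)
lemma wI_pop [simp]: "wI p_pop = {ihi, ihj, icont, iz, isz}" "wR p_pop = {rH, rtmp}"
  by (auto simp: p_pop_def)
lemma wI_median [simp]: "wI p_median = {ihi, ihj, icont, iz, isz, iy}" "wR p_median = {rH, rtmp}"
  by (auto simp: p_median_def)

section \<open>Heaps and permutations of keys\<close>

definition heap_from :: "nat \<Rightarrow> nat \<Rightarrow> (nat \<Rightarrow> real) \<Rightarrow> bool" where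
  "heap_from a sz h \<longleftrightarrow> (\<forall>p c. a \<le> p \<and> (c = 2 * p + 1 \<or> c = 2 * p + 2) \<and> c < sz \<longrightarrow> h c \<le> h p)"

text \<open>The invariant of sifting: only the key at \<open>i\<close> may be smaller than its
  children. The second part bounds these children by the parent of \<open>i\<close>, so that one of
  them may take the place of \<open>i\<close>.\<close>

definition heap_except :: "nat \<Rightarrow> nat \<Rightarrow> (nat \<Rightarrow> real) \<Rightarrow> nat \<Rightarrow> bool" where
  "heap_except a sz h i \<longleftrightarrow> (\<forall>p c. a \<le> p \<and> p \<noteq> i \<and> (c = 2 * p + 1 \<or> c = 2 * p + 2) \<and> c < sz \<longrightarrow> h c \<le> h p) \<and>
     (\<forall>p c. a \<le> p \<and> (i = 2 * p + 1 \<or> i = 2 * p + 2) \<and> (c = 2 * i + 1 \<or> c = 2 * i + 2) \<and> c < sz \<longrightarrow> h c \<le> h p)"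

definition permuted :: "nat \<Rightarrow> (nat \<Rightarrow> real) \<Rightarrow> (nat \<Rightarrow> real) \<Rightarrow> bool" where
  "permuted n h h' \<longleftrightarrow> (\<exists>\<pi>. \<pi> permutes {..<n} \<and> h' = h \<circ> \<pi>)"

lemma permuted_refl: "permuted n h h"
  unfolding permuted_def by (intro exI[of _ id]) (auto simp: permutes_id)

lemma permuted_trans: "permuted n h h' \<Longrightarrow> permuted n h' h'' \<Longrightarrow> permuted n h h''"
  unfolding permuted_def using permutes_compose by (metis comp_assoc)

lemma permuted_mono: "permuted n h h' \<Longrightarrow> n \<le> m \<Longrightarrow> permuted m h h'"
  unfolding permuted_def using permutes_subset by (metis lessThan_subset_iff)

lemma permuted_swap:
  assumes "i < n" "j < n" shows "permuted n h (h(i := h j, j := h i))"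
  unfolding permuted_def
proof (intro exI conjI)
  show "Transposition.transpose i j permutes {..<n}" using assms by (intro permutes_swap_id) auto
  show "h(i := h j, j := h i) = h \<circ> Transposition.transpose i j"
    by (auto simp: fun_eq_iff Transposition.transpose_def)
qed

lemma permuted_outside: "permuted n h h' \<Longrightarrow> n \<le> j \<Longrightarrow> h' j = h j"
  unfolding permuted_def by (auto simp: permutes_not_in)

lemma permuted_all: "permuted n h h' \<Longrightarrow> (\<And>i. i < n \<Longrightarrow> P (h i)) \<Longrightarrow> i < n \<Longrightarrow> P (h' i)"
  unfolding permuted_def using permutes_in_image by fastforce

lemma permuted_card:
  assumes "permuted n h h'" shows "card {i. i < n \<and> P (h' i)} = card {i. i < n \<and> P (h i)}"
proof -
  from assms obtain \<pi> where \<pi>: "\<pi> permutes {..<n}" "h' = h \<circ> \<pi>" by (auto simp: permuted_def)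
  have "\<pi> ` {i. i < n \<and> P (h' i)} = {i. i < n \<and> P (h i)}"
  proof (intro set_eqI iffI)
    fix x assume "x \<in> \<pi> ` {i. i < n \<and> P (h' i)}"
    thus "x \<in> {i. i < n \<and> P (h i)}" using \<pi> permutes_in_image[OF \<pi>(1)] by auto
  next
    fix x assume x: "x \<in> {i. i < n \<and> P (h i)}"
    hence "x \<in> \<pi> ` {..<n}" using permutes_image[OF \<pi>(1)] by simp
    then obtain y where y: "x = \<pi> y" "y < n" by auto
    have "y \<in> {i. i < n \<and> P (h' i)}" using x \<pi>(2) y by simp
    thus "x \<in> \<pi> ` {i. i < n \<and> P (h' i)}" unfolding y(1) by (rule imageI)
  qed
  moreover have "inj_on \<pi> {i. i < n \<and> P (h' i)}" using permutes_inj_on[OF \<pi>(1)] .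
  ultimately show ?thesis using card_image by metis
qed

text \<open>The larger child moves up and therefore dominates its sibling. The position at least
  doubles, which is the source of the logarithmic bound.\<close>

lemma siftstep_sem:
  assumes "IM s ihi 0 = i" "IM s isz 0 = sz" "heap_except a sz (RM s rH) i" "a \<le> i" "IM s icont 0 \<noteq> 0"
    and s': "s' = sem p_siftstep s"
  shows "CK s' \<le> CK s + 10"
    and "IM s' isz 0 = sz"
    and "permuted sz (RM s rH) (RM s' rH)"
    and "if IM s' icont 0 = 0 then heap_from a sz (RM s' rH) else heap_except a sz (RM s' rH) (IM s' ihi 0) \<and> 2 * i + 1 \<le> IM s' ihi 0 \<and> IM s' ihi 0 < sz"
proof -
  show 1: "CK s' \<le> CK s + 10" using s' by (auto simp: p_siftstep_def)
  show "IM s' isz 0 = sz" using s' assms by (simp add: sem_frameI)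
  define j where "j = (if i + i + 2 < sz \<and> RM s rH (i + i + 1) < RM s rH (i + i + 2) then i + i + 2 else i + i + 1)"
  let ?h = "RM s rH"
  have "permuted sz (RM s rH) (RM s' rH) \<and> (if IM s' icont 0 = 0 then heap_from a sz (RM s' rH) else heap_except a sz (RM s' rH) (IM s' ihi 0) \<and> 2 * i + 1 \<le> IM s' ihi 0 \<and> IM s' ihi 0 < sz)"
  proof (cases "i + i + 1 < sz \<and> ?h i < ?h j")
    case True
    hence j: "j < sz" "2 * i + 1 \<le> j" "j = 2 * i + 1 \<or> j = 2 * i + 2" by (auto simp: j_def)
    have r: "RM s' rH = ?h(i := ?h j, j := ?h i)" "IM s' icont 0 \<noteq> 0" "IM s' ihi 0 = j"
      using True assms unfolding s' j_def by (auto simp: p_siftstep_def fun_upd_twist split: if_splits)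
    have mx: "?h c \<le> ?h j" if "c = 2 * i + 1 \<or> c = 2 * i + 2" "c < sz" for c
      using that by (auto simp: j_def mult_2)
    have "heap_except a sz (RM s' rH) j"
      unfolding heap_except_def
    proof (intro conjI allI impI; elim conjE)
      fix p c assume h: "a \<le> p" "p \<noteq> j" "c = 2 * p + 1 \<or> c = 2 * p + 2" "c < sz"
      show "RM s' rH c \<le> RM s' rH p"
      proof (cases "p = i")
        case p: True
        show ?thesis using mx[of c] h j p True by (auto simp: r)
      next
        case p: False
        have cj: "c \<noteq> j" using h(3) j(3) p by auto
        show ?thesis
        proof (cases "c = i")
          case True
          hence "?h j \<le> ?h p" using assms(3) h j unfolding heap_except_def by blast
          thus ?thesis using True p h j by (simp add: r)
        next
          case False
          hence "?h c \<le> ?h p" using assms(3) h p unfolding heap_except_def by blast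
          thus ?thesis using p False cj h by (simp add: r)
        qed
      qed
    next
      fix p c assume h: "a \<le> p" "j = 2 * p + 1 \<or> j = 2 * p + 2" "c = 2 * j + 1 \<or> c = 2 * j + 2" "c < sz"
      have "p = i" using h(2) j(3) by auto
      moreover have "?h c \<le> ?h j"
      proof -
        have "a \<le> j" "j \<noteq> i" using assms(4) j by auto
        thus ?thesis using assms(3) h unfolding heap_except_def by blast
      qed
      moreover have "c \<noteq> j" "c \<noteq> i" using h(3) j(2) by auto
      ultimately show "RM s' rH c \<le> RM s' rH p" using j by (simp add: r)
    qed
    moreover have "permuted sz ?h (RM s' rH)" unfolding r by (rule permuted_swap) (use j in auto)
    ultimately show ?thesis using r j by simp
  next
    case False
    hence r: "RM s' rH = ?h" "IM s' icont 0 = 0"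
      using assms unfolding s' j_def by (auto simp: p_siftstep_def split: if_splits)
    have "heap_from a sz ?h"
      unfolding heap_from_def
    proof (intro allI impI; elim conjE)
      fix p c assume h: "a \<le> p" "c = 2 * p + 1 \<or> c = 2 * p + 2" "c < sz"
      show "?h c \<le> ?h p"
      proof (cases "p = i")
        case True
        hence "?h c \<le> ?h j" using h by (auto simp: j_def mult_2)
        moreover have "i + i + 1 < sz" using h True by auto
        ultimately show ?thesis using False True by auto
      next
        case False thus ?thesis using assms(3) h unfolding heap_except_def by blast
      qed
    qed
    thus ?thesis using r permuted_refl by simp
  qed
  thus "permuted sz (RM s rH) (RM s' rH)"
    "if IM s' icont 0 = 0 then heap_from a sz (RM s' rH) else heap_except a sz (RM s' rH) (IM s' ihi 0) \<and> 2 * i + 1 \<le> IM s' ihi 0 \<and> IM s' ihi 0 < sz"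
    by auto
qed

lemma sift_sem:
  assumes "IM s ihi 0 = a" "IM s isz 0 = sz" "heap_except a sz (RM s rH) a" "sz \<le> 2 ^ T"
    and s': "s' = sem p_sift s"
  shows "CK s' \<le> CK s + 11 * T + 25 \<and> heap_from a sz (RM s' rH) \<and> permuted sz (RM s rH) (RM s' rH)"
proof -
  define s1 where "s1 = sem (icont ::= C 1) s"
  have s1: "IM s1 ihi 0 = a" "IM s1 isz 0 = sz" "RM s1 = RM s" "IM s1 icont 0 = 1" "CK s1 = CK s + 1"
    using assms by (auto simp: s1_def)
  have e: "s' = sem (For iz (V isz) (ILe (C 1) (V icont)) p_siftstep) s1" using s' by (simp add: p_sift_def s1_def)
  \<comment> \<open>After \<open>r\<close> steps the position is at least \<open>2 ^ r - 1\<close>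
    and still below \<open>sz \<le> 2 ^ T\<close>. So at most \<open>T + 1\<close> steps are
    charged, however large the loop bound is.\<close>
  define Q where "Q r t \<longleftrightarrow> CK t \<le> CK s + 2 + 11 * min r (T + 1) \<and> permuted sz (RM s rH) (RM t rH) \<and>
     (if IM t icont 0 = 0 then heap_from a sz (RM t rH)
      else heap_except a sz (RM t rH) (IM t ihi 0) \<and> a \<le> IM t ihi 0 \<and> 2 ^ r \<le> IM t ihi 0 + 1 \<and> (r = 0 \<or> IM t ihi 0 < sz))" for r and t :: st
  have lt: "r \<le> T" if "Q r t" "IM t icont 0 \<noteq> 0" "0 < sz" for r t
  proof (cases "r = 0")
    case False
    hence "2 ^ r \<le> IM t ihi 0 + 1" "IM t ihi 0 < sz" using that by (auto simp: Q_def)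
    hence "(2::nat) ^ r \<le> 2 ^ T" using assms(4) by linarith
    thus ?thesis by (rule power_le_imp_le_exp[rotated]) simp
  qed simp
  show ?thesis
    unfolding e
  proof (rule For_rule[where Q = Q])
    show "Q 0 (tick s1)" using s1 assms by (simp add: Q_def permuted_refl)
  next
    fix i t
    assume i: "i < ie (V isz) s1" and f: "frame (insert iz (wI p_siftstep)) (wR p_siftstep) s1 t"
      and Q: "Q i t" and g: "be (ILe (C 1) (V icont)) (seti (tick t) iz 0 i)"
    let ?t = "seti (tick t) iz 0 i"
    let ?r = "sem p_siftstep ?t"
    have g': "IM t icont 0 \<noteq> 0" using g by simp
    have sz: "IM t isz 0 = sz" using frameI[OF f] s1 by simp
    have iT: "i \<le> T" using lt[OF Q g'] i s1 by simp
    have q: "heap_except a sz (RM t rH) (IM t ihi 0)" "a \<le> IM t ihi 0" "2 ^ i \<le> IM t ihi 0 + 1" "permuted sz (RM s rH) (RM t rH)" "CK t \<le> CK s + 2 + 11 * i"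
      using Q g' iT by (auto simp: Q_def)
    note R = siftstep_sem[where s = ?t and i = "IM t ihi 0" and sz = sz and a = a, OF _ _ _ _ _ refl]
    have R: "CK ?r \<le> CK ?t + 10" "permuted sz (RM t rH) (RM ?r rH)"
      "if IM ?r icont 0 = 0 then heap_from a sz (RM ?r rH) else heap_except a sz (RM ?r rH) (IM ?r ihi 0) \<and> 2 * IM t ihi 0 + 1 \<le> IM ?r ihi 0 \<and> IM ?r ihi 0 < sz"
      using R(1,3,4) sz q g' by auto
    show "Q (Suc i) ?r"
      using R(1,3) permuted_trans[OF q(4) R(2)] q iT by (auto simp: Q_def split: if_splits)
  next
    fix i t
    assume i: "i < ie (V isz) s1" and Q: "Q i t" and g: "\<not> be (ILe (C 1) (V icont)) (seti (tick t) iz 0 i)"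
    have "CK t \<le> CK s + 2 + 11 * (T + 1)" using Q unfolding Q_def by (meson add_left_mono le_trans min.cobounded2 mult_le_mono2)
    thus "CK (seti (tick t) iz 0 i) \<le> CK s + 11 * T + 25 \<and> heap_from a sz (RM (seti (tick t) iz 0 i) rH) \<and> permuted sz (RM s rH) (RM (seti (tick t) iz 0 i) rH)"
      using Q g by (simp add: Q_def)
  next
    fix t assume Q: "Q (ie (V isz) s1) t"
    hence Q: "Q sz t" using s1 by simp
    have "CK t \<le> CK s + 2 + 11 * (T + 1)" using Q unfolding Q_def by (meson add_left_mono le_trans min.cobounded2 mult_le_mono2)
    moreover have "heap_from a sz (RM t rH)"
    proof (cases "IM t icont 0 = 0")
      case True thus ?thesis using Q by (simp add: Q_def)
    next
      case False
      \<comment> \<open>Had all \<open>sz\<close> passes been used, the position would lie outside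
        the heap and the exception would be void.\<close>
      have "sz < 2 ^ sz" by (rule less_exp)
      moreover have "2 ^ sz \<le> IM t ihi 0 + 1" using Q False by (auto simp: Q_def)
      ultimately have "sz \<le> IM t ihi 0" by linarith
      have he: "heap_except a sz (RM t rH) (IM t ihi 0)" using Q False by (simp add: Q_def)
      show ?thesis unfolding heap_from_def
      proof (intro allI impI; elim conjE)
        fix p c assume h: "a \<le> p" "c = 2 * p + 1 \<or> c = 2 * p + 2" "c < sz"
        hence "p \<noteq> IM t ihi 0" using \<open>sz \<le> IM t ihi 0\<close> by auto
        thus "RM t rH c \<le> RM t rH p" using he h unfolding heap_except_def by blast
      qed
    qed
    ultimately show "CK t \<le> CK s + 11 * T + 25 \<and> heap_from a sz (RM t rH) \<and> permuted sz (RM s rH) (RM t rH)"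
      using Q by (simp add: Q_def)
  qed
qed

lemma heap_max: assumes "heap_from 0 sz h" shows "i < sz \<Longrightarrow> h i \<le> h 0"
proof (induction i rule: less_induct)
  case (less i)
  show ?case
  proof (cases "i = 0")
    case False
    define p where "p = (i - 1) div 2"
    have p: "p < i" "i = 2 * p + 1 \<or> i = 2 * p + 2" using False unfolding p_def by presburger+
    have "h i \<le> h p" using assms p(2) less.prems unfolding heap_from_def by blast
    also have "\<dots> \<le> h 0" using less p by simp
    finally show ?thesis .
  qed simp
qed

text \<open>The root is at least each of the \<open>n - y\<close> keys in the heap and at most
  itself and the \<open>y\<close> removed keys; for \<open>2 * y \<le> n < 2 * y + 2\<close> both
  groups make up half of all keys. Permutations preserve these counts.\<close>

lemma median_sem:
  assumes C: "IM s iC 0 = n" "0 < n" "n \<le> 2 ^ T" and s': "s' = sem p_median s"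
  shows "CK s' \<le> CK s + n * (40 * T + 80) + 4 \<and>
    n \<le> 2 * card {i. i < n \<and> RM s rH i \<le> RM s' rH 0} \<and> n \<le> 2 * card {i. i < n \<and> RM s' rH 0 \<le> RM s rH i}"
proof -
  define s1 where "s1 = sem (isz ::= V iC) s"
  define s2 where "s2 = sem (Fr iy (V iC) (ihi ::= Sub (Sub (V iC) (C 1)) (V iy);; p_sift)) s1"
  have e: "s' = sem (For iy (V iC) (ILe (Add (Add (V iy) (V iy)) (C 2)) (V iC)) p_pop) s2"
    using s' by (simp add: p_median_def s1_def s2_def)
  have s1: "IM s1 iC 0 = n" "IM s1 isz 0 = n" "RM s1 = RM s" "CK s1 = CK s + 1" using C by (auto simp: s1_def)
  have 2: "CK s2 \<le> CK s + 2 + n * (11 * T + 27) \<and> heap_from 0 n (RM s2 rH) \<and> permuted n (RM s rH) (RM s2 rH)"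
    unfolding s2_def
  proof (rule Fr_rule[where Q = "\<lambda>i t. CK t \<le> CK s + 2 + i * (11 * T + 27) \<and> heap_from (n - i) n (RM t rH) \<and> permuted n (RM s rH) (RM t rH)"])
    show "CK (tick s1) \<le> CK s + 2 + 0 * (11 * T + 27) \<and> heap_from (n - 0) n (RM (tick s1) rH) \<and> permuted n (RM s rH) (RM (tick s1) rH)"
      using s1 by (auto simp: heap_from_def permuted_refl)
  next
    fix i t
    assume i: "i < ie (V iC) s1" and f: "frame (insert iy (wI (ihi ::= Sub (Sub (V iC) (C 1)) (V iy);; p_sift))) (wR (ihi ::= Sub (Sub (V iC) (C 1)) (V iy);; p_sift)) s1 t"
      and Q: "CK t \<le> CK s + 2 + i * (11 * T + 27) \<and> heap_from (n - i) n (RM t rH) \<and> permuted n (RM s rH) (RM t rH)"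
    have iN: "i < n" using i s1 by simp
    have fr: "IM t iC 0 = n" "IM t isz 0 = n" using frameI[OF f] s1 by auto
    define a where "a = n - Suc i"
    let ?t = "seti (tick (seti (tick t) iy 0 i)) ihi 0 a"
    have aa: "n - i = Suc a" using iN by (simp add: a_def)
    have eq: "sem (ihi ::= Sub (Sub (V iC) (C 1)) (V iy);; p_sift) (seti (tick t) iy 0 i) = sem p_sift ?t"
      using fr by (simp add: a_def)
    have "heap_except a n (RM t rH) a"
      unfolding heap_except_def
    proof (intro conjI allI impI; elim conjE)
      fix p c assume h: "a \<le> p" "p \<noteq> a" "c = 2 * p + 1 \<or> c = 2 * p + 2" "c < n"
      hence "Suc a \<le> p" by simp
      thus "RM t rH c \<le> RM t rH p" using Q h unfolding heap_from_def aa by blast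
    qed auto
    from sift_sem[of ?t a n T, OF _ _ _ C(3) refl] this fr
    have "CK (sem p_sift ?t) \<le> CK t + 2 + 11 * T + 25 \<and> heap_from a n (RM (sem p_sift ?t) rH) \<and> permuted n (RM t rH) (RM (sem p_sift ?t) rH)"
      by simp
    thus "CK (sem (ihi ::= Sub (Sub (V iC) (C 1)) (V iy);; p_sift) (seti (tick t) iy 0 i)) \<le> CK s + 2 + Suc i * (11 * T + 27) \<and>
       heap_from (n - Suc i) n (RM (sem (ihi ::= Sub (Sub (V iC) (C 1)) (V iy);; p_sift) (seti (tick t) iy 0 i)) rH) \<and>
       permuted n (RM s rH) (RM (sem (ihi ::= Sub (Sub (V iC) (C 1)) (V iy);; p_sift) (seti (tick t) iy 0 i)) rH)"
      unfolding eq using Q permuted_trans by (auto simp: a_def)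
  qed (use s1 in simp)
  have k2: "IM s2 iC 0 = n" "IM s2 isz 0 = n" unfolding s2_def by (simp_all add: sem_frameI s1)
  define Q where "Q y t \<longleftrightarrow> CK t \<le> CK s2 + 1 + y * (11 * T + 40) \<and> 2 * y \<le> n \<and> heap_from 0 (n - y) (RM t rH) \<and> permuted n (RM s rH) (RM t rH) \<and>
     IM t isz 0 = n - y \<and> (\<forall>j. n - y \<le> j \<and> j < n \<longrightarrow> (\<forall>i<n - y. RM t rH i \<le> RM t rH j))" for y and t :: st
  have fin: "n \<le> 2 * card {i. i < n \<and> RM s rH i \<le> RM t rH 0} \<and> n \<le> 2 * card {i. i < n \<and> RM t rH 0 \<le> RM s rH i}"
    if Q: "Q y t" and y: "n < 2 * y + 2" for y t
  proof
    let ?h = "RM t rH"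
    have pm: "permuted n (RM s rH) ?h" and hf: "heap_from 0 (n - y) ?h" and y2: "2 * y \<le> n" using Q by (auto simp: Q_def)
    have "{..<n - y} \<subseteq> {i. i < n \<and> ?h i \<le> ?h 0}" using heap_max[OF hf] by auto
    hence "n - y \<le> card {i. i < n \<and> ?h i \<le> ?h 0}" using card_mono[of "{i. i < n \<and> ?h i \<le> ?h 0}" "{..<n - y}"] by simp
    thus "n \<le> 2 * card {i. i < n \<and> RM s rH i \<le> ?h 0}" using permuted_card[OF pm, of "\<lambda>x. x \<le> ?h 0"] y2 by simp
    have "insert 0 {n - y..<n} \<subseteq> {i. i < n \<and> ?h 0 \<le> ?h i}" using Q y C y2 by (auto simp: Q_def)
    moreover have "card (insert 0 {n - y..<n}) = Suc y" using y2 C by (subst card_insert_disjoint) auto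
    ultimately have "Suc y \<le> card {i. i < n \<and> ?h 0 \<le> ?h i}" using card_mono[of "{i. i < n \<and> ?h 0 \<le> ?h i}" "insert 0 {n - y..<n}"] by simp
    thus "n \<le> 2 * card {i. i < n \<and> ?h 0 \<le> RM s rH i}" using permuted_card[OF pm, of "\<lambda>x. ?h 0 \<le> x"] y by simp
  qed
  have "CK s' \<le> CK s2 + 2 + n * (11 * T + 40) \<and>
    n \<le> 2 * card {i. i < n \<and> RM s rH i \<le> RM s' rH 0} \<and> n \<le> 2 * card {i. i < n \<and> RM s' rH 0 \<le> RM s rH i}"
    unfolding e
  proof (rule For_rule[where Q = Q])
    show "Q 0 (tick s2)" using 2 k2 by (simp add: Q_def)
  next
    fix y t
    assume i: "y < ie (V iC) s2" and f: "frame (insert iy (wI p_pop)) (wR p_pop) s2 t"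
      and Q: "Q y t" and g: "be (ILe (Add (Add (V iy) (V iy)) (C 2)) (V iC)) (seti (tick t) iy 0 y)"
    let ?t = "seti (tick t) iy 0 y" and ?h = "RM t rH"
    have fr: "IM t iC 0 = n" using frameI[OF f] k2 by simp
    have y: "2 * y + 2 \<le> n" using g fr by simp
    define z where "z = n - Suc y"
    have z: "n - y = Suc z" "z < n" "0 < z" using y by (auto simp: z_def)
    have q: "CK t \<le> CK s2 + 1 + y * (11 * T + 40)" "heap_from 0 (Suc z) ?h" "permuted n (RM s rH) ?h" "IM t isz 0 = Suc z"
      "\<And>i j. Suc z \<le> j \<Longrightarrow> j < n \<Longrightarrow> i \<le> z \<Longrightarrow> ?h i \<le> ?h j" using Q by (auto simp: Q_def z(1))
    define u where "u = sem (isz ::= Sub (V isz) (C 1);; rtmp ::=r RL rH (C 0);; RA rH (C 0) (RL rH (V isz));; RA rH (V isz) (RV rtmp);; ihi ::= C 0) ?t"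
    have u: "sem p_pop ?t = sem p_sift u" by (simp add: u_def p_pop_def)
    have u': "CK u = CK t + 6" "RM u rH = ?h(0 := ?h z, z := ?h 0)" "IM u isz 0 = z" "IM u ihi 0 = 0"
      using q(4) by (auto simp: u_def)
    have "heap_except 0 z (RM u rH) 0"
      using q(2) unfolding heap_except_def heap_from_def u' by (auto)
    from sift_sem[of u 0 z T, OF u'(4,3) this _ refl] z C
    have R: "CK (sem p_sift u) \<le> CK u + 11 * T + 25" "heap_from 0 z (RM (sem p_sift u) rH)" "permuted z (RM u rH) (RM (sem p_sift u) rH)"
      by auto
    have "permuted n ?h (RM u rH)" unfolding u' using permuted_swap[of 0 n z ?h] z by simp
    hence p: "permuted n (RM s rH) (RM (sem p_sift u) rH)"
      using permuted_trans[OF permuted_trans[OF q(3)] permuted_mono[OF R(3)]] z by simp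
    have ord: "RM (sem p_sift u) rH i \<le> RM (sem p_sift u) rH j" if "z \<le> j" "j < n" "i < z" for i j
    proof (rule permuted_all[OF R(3) _ that(3)])
      fix i assume i: "i < z"
      have "RM (sem p_sift u) rH j = RM u rH j" by (rule permuted_outside[OF R(3) that(1)])
      moreover have "RM u rH i \<le> RM u rH j"
      proof (cases "j = z")
        case True thus ?thesis using heap_max[OF q(2), of i] heap_max[OF q(2), of z] i z by (auto simp: u')
      next
        case False thus ?thesis using q(5)[of j i] q(5)[of j z] that i z by (auto simp: u')
      qed
      ultimately show "RM u rH i \<le> RM (sem p_sift u) rH j" by simp
    qed
    have "IM (sem p_sift u) isz 0 = z" using u' by (simp add: sem_frameI)
    thus "Q (Suc y) (sem p_pop ?t)" unfolding u Q_def using R p ord q(1) u' y z_def by auto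
  next
    fix y t
    assume i: "y < ie (V iC) s2" and f: "frame (insert iy (wI p_pop)) (wR p_pop) s2 t"
      and Q: "Q y t" and g: "\<not> be (ILe (Add (Add (V iy) (V iy)) (C 2)) (V iC)) (seti (tick t) iy 0 y)"
    have "IM t iC 0 = n" using frameI[OF f] k2 by simp
    hence "n < 2 * y + 2" using g by simp
    moreover have "y * (11 * T + 40) \<le> n * (11 * T + 40)" using i k2 by (intro mult_right_mono) auto
    hence "CK t \<le> CK s2 + 1 + n * (11 * T + 40)" using Q unfolding Q_def by linarith
    ultimately show "CK (seti (tick t) iy 0 y) \<le> CK s2 + 2 + n * (11 * T + 40) \<and>
      n \<le> 2 * card {i. i < n \<and> RM s rH i \<le> RM (seti (tick t) iy 0 y) rH 0} \<and> n \<le> 2 * card {i. i < n \<and> RM (seti (tick t) iy 0 y) rH 0 \<le> RM s rH i}"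
      using fin[OF Q] Q by (simp add: Q_def)
  next
    fix t assume "Q (ie (V iC) s2) t"
    hence "Q n t" using k2 by simp
    thus "CK t \<le> CK s2 + 2 + n * (11 * T + 40) \<and>
      n \<le> 2 * card {i. i < n \<and> RM s rH i \<le> RM t rH 0} \<and> n \<le> 2 * card {i. i < n \<and> RM t rH 0 \<le> RM s rH i}"
      using C by (simp add: Q_def)
  qed
  thus ?thesis using 2 by (simp add: algebra_simps)
qed

section \<open>Confining a variable to a cell\<close>

text \<open>The pool of \<open>iK\<close> lines is \<open>(iLG, rLS, rLB)\<close>: group, slope and intercept. A number \<open>i + 1\<close> in
  \<open>iPEND\<close> means that line \<open>i\<close> of the group has no partner yet. The cell of \<open>X l\<close> is \<open>]rp, rq[\<close>, where
  \<open>ihp\<close> and \<open>ihq\<close> tell whether these bounds exist.\<close>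
abbreviation (input) iK :: nat where "iK \<equiv> 27"
abbreviation (input) iLG :: nat where "iLG \<equiv> 28"
abbreviation (input) iPEND :: nat where "iPEND \<equiv> 29"
abbreviation (input) iPA :: nat where "iPA \<equiv> 31"
abbreviation (input) iPB :: nat where "iPB \<equiv> 57"
abbreviation (input) iDEAD :: nat where "iDEAD \<equiv> 32"
abbreviation (input) iK2 :: nat where "iK2 \<equiv> 33"
abbreviation (input) ig :: nat where "ig \<equiv> 34"
abbreviation (input) ii :: nat where "ii \<equiv> 35"
abbreviation (input) ihp :: nat where "ihp \<equiv> 36"
abbreviation (input) ihq :: nat where "ihq \<equiv> 37"
abbreviation (input) igo :: nat where "igo \<equiv> 38"
abbreviation (input) ir :: nat where "ir \<equiv> 39"
abbreviation (input) iG2 :: nat where "iG2 \<equiv> 58"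
abbreviation (input) ia :: nat where "ia \<equiv> 59"
abbreviation (input) ib :: nat where "ib \<equiv> 55"
abbreviation (input) rLS :: nat where "rLS \<equiv> 11"
abbreviation (input) rLB :: nat where "rLB \<equiv> 12"
abbreviation (input) rTX :: nat where "rTX \<equiv> 13"
abbreviation (input) rp :: nat where "rp \<equiv> 14"
abbreviation (input) rq :: nat where "rq \<equiv> 15"

type_synonym line = "nat \<times> real \<times> real"

definition lin :: "st \<Rightarrow> nat \<Rightarrow> line" where
  "lin s i = (IM s iLG i, RM s rLS i, RM s rLB i)"

definition incell :: "st \<Rightarrow> real \<Rightarrow> bool" where
  "incell s x \<longleftrightarrow> (IM s ihp 0 \<noteq> 0 \<longrightarrow> RM s rp 0 < x) \<and> (IM s ihq 0 \<noteq> 0 \<longrightarrow> x < RM s rq 0)"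

definition feas :: "st \<Rightarrow> nat \<Rightarrow> bool" where
  "feas s l \<longleftrightarrow> (\<exists>z. ssol (edges s) z \<and> incell s (z l))"

definition dominates :: "st \<Rightarrow> line \<Rightarrow> line \<Rightarrow> bool" where
  "dominates s k k' \<longleftrightarrow> fst k = fst k' \<and> (\<forall>x. incell s x \<longrightarrow> fst (snd k) * x + snd (snd k) \<le> fst (snd k') * x + snd (snd k'))"

text \<open>The abscissa where two lines meet. For parallel lines the quotient is 0 by the
  convention for division by zero; such pairs are decided by their intercepts instead.\<close>

definition cross :: "line \<Rightarrow> line \<Rightarrow> real" where
  "cross k k' = (snd (snd k') - snd (snd k)) / (fst (snd k) - fst (snd k'))"

lemma cross_le:
  assumes "s1 < s2" "(b2 - b1) / (s1 - s2) \<le> (x::real)" shows "s1 * x + b1 \<le> s2 * x + b2"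
  using assms by (simp add: field_simps)
lemma cross_ge:
  assumes "s1 < s2" "(x::real) \<le> (b2 - b1) / (s1 - s2)" shows "s2 * x + b2 \<le> s1 * x + b1"
  using assms by (simp add: field_simps)
lemma cross_commute: "cross k k' = cross k' k"
proof -
  have "(b' - b) / (a - a') = (b - b') / (a' - a)" for a a' b b' :: real
    by (metis minus_diff_eq minus_divide_divide)
  thus ?thesis by (simp add: cross_def)
qed

definition p_pair :: com where
  "p_pair = (ig ::= L iLG (V ii);; IA iDEAD (V ii) (C 0);;
     IF ILe (C 1) (L iPEND (V ig)) THEN
       (ia ::= Sub (L iPEND (V ig)) (C 1);; IA iPA (V iC) (V ia);; IA iPB (V iC) (V ii);;
        RA rTX (V iC) (RDv (RSb (RL rLB (V ii)) (RL rLB (V ia))) (RSb (RL rLS (V ia)) (RL rLS (V ii))));;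
        RA rH (V iC) (RL rTX (V iC));; IA iPEND (V ig) (C 0);; iC ::= Add (V iC) (C 1))
     ELSE IA iPEND (V ig) (Add (V ii) (C 1)))"

text \<open>A median outside the open cell is already decided by the cell, so a test is run only for
  a median inside it.\<close>

definition p_decide :: com where
  "p_decide = (rLAM ::=r RL rH (C 0);; ig ::= C 1;;
     (IF ILe (C 1) (V ihp) THEN (IF BLe (RV rLAM) (RV rp) THEN ig ::= C 0 ELSE Skip) ELSE Skip);;
     (IF ILe (C 1) (V ihq) THEN (IF BLe (RV rq) (RV rLAM) THEN ig ::= C 0 ELSE Skip) ELSE Skip);;
     IF ILe (C 1) (V ig) THEN
       (p_test;; IF ILe (C 1) (V iT) THEN (ihp ::= C 1;; rp ::=r RV rLAM) ELSE (ihq ::= C 1;; rq ::=r RV rLAM))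
     ELSE Skip)"

text \<open>Left of their crossing, \<open>ia\<close>, the line of smaller slope, lies above \<open>ib\<close> and is redundant; right of it \<open>ib\<close> is.\<close>
definition p_resolve_upper :: com where
  "p_resolve_upper = (IF ILe (C 1) (V ihq) THEN (IF BLe (RV rq) (RL rTX (V ii)) THEN IA iDEAD (V ia) (C 1) ELSE Skip) ELSE Skip)"

definition p_resolve :: com where
  "p_resolve = ((IF BLt (RL rLS (L iPA (V ii))) (RL rLS (L iPB (V ii))) THEN (ia ::= L iPA (V ii);; ib ::= L iPB (V ii))
       ELSE (ia ::= L iPB (V ii);; ib ::= L iPA (V ii)));;
     IF BLt (RL rLS (V ia)) (RL rLS (V ib)) THEN
       (IF ILe (C 1) (V ihp) THEN (IF BLe (RL rTX (V ii)) (RV rp) THEN IA iDEAD (V ib) (C 1) ELSE p_resolve_upper) ELSE p_resolve_upper)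
     ELSE (IF BLe (RL rLB (V ia)) (RL rLB (V ib)) THEN IA iDEAD (V ib) (C 1) ELSE IA iDEAD (V ia) (C 1)))"

definition p_compact :: com where
  "p_compact = (IF ILe (L iDEAD (V ii)) (C 0) THEN
     (IA iLG (V iK2) (L iLG (V ii));; RA rLS (V iK2) (RL rLS (V ii));; RA rLB (V iK2) (RL rLB (V ii));; iK2 ::= Add (V iK2) (C 1))
     ELSE Skip)"

definition p_pairing :: com where
  "p_pairing = (Fr ii (V iG2) (IA iPEND (V ii) (C 0));; iC ::= C 0;; Fr ii (V iK) p_pair)"

text \<open>If no pair is formed, every group has at most one line and \<open>iPEND\<close> points
  to it. In this form the search hands over its result.\<close>

definition p_prune :: com where
  "p_prune = (p_pairing;;
     IF ILe (C 1) (V iC) THEN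
       (p_median;; p_decide;; Fr ii (V iC) p_resolve;; iK2 ::= C 0;; Fr ii (V iK) p_compact;; iK ::= V iK2)
     ELSE igo ::= C 0)"

definition p_search :: com where
  "p_search = (igo ::= C 1;; For ir (Add (V iK) (C 1)) (ILe (C 1) (V igo)) p_prune)"

lemma wI_pair [simp]: "wI p_pair = {ig, iDEAD, ia, iPA, iPB, iPEND, iC}" "wR p_pair = {rTX, rH}"
  by (auto simp: p_pair_def)
lemma wI_pairing [simp]: "wI p_pairing = {ig, iDEAD, ia, iPA, iPB, iPEND, iC, ii}" "wR p_pairing = {rTX, rH}"
  by (auto simp: p_pairing_def)
lemma wI_decide [simp]: "wI p_decide = {ig, ihp, ihq} \<union> wI p_test" "wR p_decide = {rLAM, rp, rq} \<union> wR p_test"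
  by (auto simp: p_decide_def)
lemma wI_resolve [simp]: "wI p_resolve = {ia, ib, iDEAD}" "wR p_resolve = {}"
  by (auto simp: p_resolve_def p_resolve_upper_def)
lemma wI_compact [simp]: "wI p_compact = {iLG, iK2}" "wR p_compact = {rLS, rLB}"
  by (auto simp: p_compact_def)
lemma wI_prune [simp]: "wI p_prune = {ig, iDEAD, ia, ib, iPA, iPB, iPEND, iC, ii, ihp, ihq, iLG, iK2, iK, igo} \<union> wI p_test \<union> wI p_median"
   "wR p_prune = {rTX, rH, rLAM, rp, rq, rLS, rLB} \<union> wR p_test \<union> wR p_median"
  by (auto simp: p_prune_def simp del: wI_test wI_median)
lemma wI_search [simp]: "wI p_search = insert ir (wI p_prune)" "wR p_search = wR p_prune"
  by (auto simp: p_search_def simp del: wI_prune) (auto)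

section \<open>Pairing the lines of each group\<close>

definition pinv :: "st \<Rightarrow> nat \<Rightarrow> nat \<Rightarrow> st \<Rightarrow> bool" where
  "pinv s G i t \<longleftrightarrow>
    (\<forall>g<G. IM t iPEND g \<noteq> 0 \<longrightarrow> (\<exists>j<i. IM t iPEND g = Suc j \<and> IM s iLG j = g)) \<and>
    (\<forall>c<IM t iC 0. IM t iPA c < i \<and> IM t iPB c < i \<and> IM t iPA c \<noteq> IM t iPB c \<and> IM s iLG (IM t iPA c) = IM s iLG (IM t iPB c) \<and>
       RM t rTX c = cross (lin s (IM t iPA c)) (lin s (IM t iPB c)) \<and> RM t rH c = RM t rTX c) \<and>
    (\<forall>c<IM t iC 0. \<forall>c'<IM t iC 0. c \<noteq> c' \<longrightarrow> {IM t iPA c, IM t iPB c} \<inter> {IM t iPA c', IM t iPB c'} = {}) \<and>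
    (\<forall>g<G. \<forall>c<IM t iC 0. IM t iPEND g \<noteq> Suc (IM t iPA c) \<and> IM t iPEND g \<noteq> Suc (IM t iPB c)) \<and>
    (\<forall>j<i. IM t iPEND (IM s iLG j) = Suc j \<or> (\<exists>c<IM t iC 0. j = IM t iPA c \<or> j = IM t iPB c)) \<and>
    i = 2 * IM t iC 0 + card {g. g < G \<and> IM t iPEND g \<noteq> 0} \<and> (\<forall>j<i. IM t iDEAD j = 0)"

text \<open>A processed line either waits for a partner or belongs to exactly one pair. The count of
  lines as twice the pairs plus the waiting ones later shows that at most one line per group escapes
  pairing.\<close>

lemma pair_step:
  assumes P: "pinv s G i t" and g: "IM s iLG i < G" and r: "r = sem p_pair (seti (tick t) ii 0 i)"
    and fr: "IM t iLG = IM s iLG" "RM t rLS = RM s rLS" "RM t rLB = RM s rLB"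
  shows "pinv s G (Suc i) r \<and> CK r \<le> CK t + 12"
proof -
  define g where "g = IM s iLG i"
  have gG: "g < G" using assms by (simp add: g_def)
  define C where "C = IM t iC 0"
  note P1 = P[unfolded pinv_def, folded C_def]
  have D: "IM r iDEAD = (IM t iDEAD)(i := 0)" using r by (auto simp: p_pair_def)
  show ?thesis
  proof (cases "IM t iPEND g = 0")
    case True
    have r': "IM r iPEND = (IM t iPEND)(g := Suc i)" "IM r iC 0 = C" "IM r iPA = IM t iPA" "IM r iPB = IM t iPB"
      "RM r rTX = RM t rTX" "RM r rH = RM t rH" "CK r \<le> CK t + 12"
      using True r fr by (auto simp: p_pair_def g_def C_def)
    have eq: "{k. k < G \<and> IM r iPEND k \<noteq> 0} = insert g {k. k < G \<and> IM t iPEND k \<noteq> 0}"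
      using gG by (auto simp: r')
    have "card {k. k < G \<and> IM r iPEND k \<noteq> 0} = Suc (card {k. k < G \<and> IM t iPEND k \<noteq> 0})"
      unfolding eq using True by (subst card_insert_disjoint) auto
    moreover have "\<forall>k<G. IM r iPEND k \<noteq> 0 \<longrightarrow> (\<exists>j<Suc i. IM r iPEND k = Suc j \<and> IM s iLG j = k)"
      using P1 by (auto simp: r' g_def less_Suc_eq)
    moreover have "\<forall>k<G. \<forall>c<C. IM r iPEND k \<noteq> Suc (IM r iPA c) \<and> IM r iPEND k \<noteq> Suc (IM r iPB c)"
      using P1 by (auto simp: r')
    moreover have "\<forall>j<Suc i. IM r iPEND (IM s iLG j) = Suc j \<or> (\<exists>c<C. j = IM r iPA c \<or> j = IM r iPB c)"
    proof (intro allI impI)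
      fix j assume j: "j < Suc i"
      show "IM r iPEND (IM s iLG j) = Suc j \<or> (\<exists>c<C. j = IM r iPA c \<or> j = IM r iPB c)"
      proof (cases "j = i")
        case False
        hence "IM t iPEND (IM s iLG j) = Suc j \<or> (\<exists>c<C. j = IM t iPA c \<or> j = IM t iPB c)" using P1 j by simp
        thus ?thesis using True by (auto simp: r')
      qed (simp add: r' g_def)
    qed
    ultimately show ?thesis using P1 D r'(7) unfolding pinv_def by (auto simp: r' less_Suc_eq)
  next
    case False
    then obtain j where j: "j < i" "IM t iPEND g = Suc j" "IM s iLG j = g" using P1 gG by blast
    have r': "IM r iPEND = (IM t iPEND)(g := 0)" "IM r iC 0 = Suc C" "IM r iPA = (IM t iPA)(C := j)" "IM r iPB = (IM t iPB)(C := i)"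
      "RM r rTX = (RM t rTX)(C := cross (lin s j) (lin s i))" "RM r rH = (RM t rH)(C := cross (lin s j) (lin s i))" "CK r \<le> CK t + 12"
      using j r fr by (auto simp: p_pair_def g_def C_def cross_def lin_def)
    have eq: "{k. k < G \<and> IM t iPEND k \<noteq> 0} = insert g {k. k < G \<and> IM r iPEND k \<noteq> 0}"
      using gG False by (auto simp: r')
    have "card {k. k < G \<and> IM t iPEND k \<noteq> 0} = Suc (card {k. k < G \<and> IM r iPEND k \<noteq> 0})"
      unfolding eq by (subst card_insert_disjoint) (auto simp: r')
    hence c1: "Suc i = 2 * Suc C + card {k. k < G \<and> IM r iPEND k \<noteq> 0}" using P1 by simp
    have c2: "\<forall>k<G. IM r iPEND k \<noteq> 0 \<longrightarrow> (\<exists>j<Suc i. IM r iPEND k = Suc j \<and> IM s iLG j = k)"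
      using P1 by (auto simp: r' less_Suc_eq)
    have c3: "\<forall>k<G. \<forall>c<Suc C. IM r iPEND k \<noteq> Suc (IM r iPA c) \<and> IM r iPEND k \<noteq> Suc (IM r iPB c)"
    proof (intro allI impI)
      fix k c assume k: "k < G" and c: "c < Suc C"
      show "IM r iPEND k \<noteq> Suc (IM r iPA c) \<and> IM r iPEND k \<noteq> Suc (IM r iPB c)"
      proof (cases "c = C")
        case True
        have "IM t iPEND k \<noteq> Suc j" if "k \<noteq> g" using P1 k j that by (metis Suc_inject nat.distinct(1))
        moreover have "IM t iPEND k \<noteq> Suc i" using P1 k by (metis Suc_inject nat.distinct(1) less_irrefl)
        ultimately show ?thesis using True by (simp add: r')
      next
        case False thus ?thesis using P1 k c by (simp add: r')
      qed
    qed
    have c4: "\<forall>m<Suc i. IM r iPEND (IM s iLG m) = Suc m \<or> (\<exists>c<Suc C. m = IM r iPA c \<or> m = IM r iPB c)"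
    proof (intro allI impI)
      fix m assume m: "m < Suc i"
      show "IM r iPEND (IM s iLG m) = Suc m \<or> (\<exists>c<Suc C. m = IM r iPA c \<or> m = IM r iPB c)"
      proof (cases "m = i \<or> m = j")
        case True thus ?thesis by (intro disjI2 exI[of _ C]) (auto simp: r')
      next
        case F: False
        hence "IM t iPEND (IM s iLG m) = Suc m \<or> (\<exists>c<C. m = IM t iPA c \<or> m = IM t iPB c)" using P1 m by simp
        thus ?thesis
        proof
          assume a: "IM t iPEND (IM s iLG m) = Suc m"
          hence "IM s iLG m \<noteq> g" using F j by auto
          thus ?thesis using a by (simp add: r')
        next
          assume "\<exists>c<C. m = IM t iPA c \<or> m = IM t iPB c"
          then obtain c where "c < C" "m = IM t iPA c \<or> m = IM t iPB c" by blast
          thus ?thesis by (intro disjI2 exI[of _ c]) (auto simp: r')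
        qed
      qed
    qed
    have old: "IM t iPA c \<noteq> j \<and> IM t iPB c \<noteq> j \<and> IM t iPA c \<noteq> i \<and> IM t iPB c \<noteq> i" if c: "c < C" for c
    proof -
      have "IM t iPA c < i" "IM t iPB c < i" using P1 c by blast+
      moreover have "IM t iPEND g \<noteq> Suc (IM t iPA c) \<and> IM t iPEND g \<noteq> Suc (IM t iPB c)" using P1 c gG by blast
      ultimately show ?thesis using j by auto
    qed
    have c5: "\<forall>c<Suc C. \<forall>c'<Suc C. c \<noteq> c' \<longrightarrow> {IM r iPA c, IM r iPB c} \<inter> {IM r iPA c', IM r iPB c'} = {}"
      using P1 old by (auto simp: r' less_Suc_eq)
    have c6: "\<forall>c<Suc C. IM r iPA c < Suc i \<and> IM r iPB c < Suc i \<and> IM r iPA c \<noteq> IM r iPB c \<and> IM s iLG (IM r iPA c) = IM s iLG (IM r iPB c) \<and>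
       RM r rTX c = cross (lin s (IM r iPA c)) (lin s (IM r iPB c)) \<and> RM r rH c = RM r rTX c"
      using P1 j by (auto simp: r' g_def less_Suc_eq)
    show ?thesis unfolding pinv_def r'(2) using c1 c2 c3 c4 c5 c6 D P1 r'(7) by (auto simp: less_Suc_eq)
  qed
qed

lemma pairing_sem:
  assumes s: "IM s iG2 0 = G" "IM s iK 0 = K" "\<And>i. i < K \<Longrightarrow> IM s iLG i < G" and s': "s' = sem p_pairing s"
  shows "pinv s G K s' \<and> CK s' \<le> CK s + 3 + 2 * G + 12 * K"
proof -
  define s1 where "s1 = sem (Fr ii (V iG2) (IA iPEND (V ii) (C 0))) s"
  define s2 where "s2 = sem (iC ::= C 0) s1"
  have e: "s' = sem (Fr ii (V iK) p_pair) s2" using s' by (simp add: p_pairing_def s1_def s2_def)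
  have 1: "CK s1 \<le> CK s + 1 + 2 * G \<and> (\<forall>y<G. IM s1 iPEND y = 0)"
    unfolding s1_def
  proof (rule Fr_rule[where Q = "\<lambda>i t. CK t \<le> CK s + 1 + 2 * i \<and> (\<forall>y<i. IM t iPEND y = 0)"])
  qed (use s in \<open>auto simp: less_Suc_eq\<close>)
  have k2: "k \<noteq> iC \<Longrightarrow> k \<noteq> ii \<Longrightarrow> k \<noteq> iPEND \<Longrightarrow> IM s2 k = IM s k" "RM s2 x = RM s x" for k x
    unfolding s2_def s1_def by (simp_all add: sem_frameI sem_frameR)
  have "pinv s G K s' \<and> CK s' \<le> CK s + 3 + 2 * G + 12 * K"
    unfolding e
  proof (rule Fr_rule[where Q = "\<lambda>i t. pinv s G i t \<and> CK t \<le> CK s + 3 + 2 * G + 12 * i"])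
    have em: "{g. g < G \<and> IM (tick s2) iPEND g \<noteq> 0} = {}" using 1 by (auto simp: s2_def)
    show "pinv s G 0 (tick s2) \<and> CK (tick s2) \<le> CK s + 3 + 2 * G + 12 * 0"
      unfolding pinv_def em using 1 by (auto simp: s2_def)
  next
    fix i t
    assume i: "i < ie (V iK) s2" and f: "frame (insert ii (wI p_pair)) (wR p_pair) s2 t"
      and Q: "pinv s G i t \<and> CK t \<le> CK s + 3 + 2 * G + 12 * i"
    have "pinv s G (Suc i) (sem p_pair (seti (tick t) ii 0 i)) \<and> CK (sem p_pair (seti (tick t) ii 0 i)) \<le> CK t + 12"
      by (rule pair_step[OF _ _ refl]) (use Q i s k2 frameI[OF f] frameR[OF f] in auto)
    thus "pinv s G (Suc i) (sem p_pair (seti (tick t) ii 0 i)) \<and> CK (sem p_pair (seti (tick t) ii 0 i)) \<le> CK s + 3 + 2 * G + 12 * Suc i"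
      using Q by simp
  qed (use k2 s in simp)
  thus ?thesis .
qed

lemma incell_frame: "IM t ihp = IM s ihp \<Longrightarrow> IM t ihq = IM s ihq \<Longrightarrow> RM t rp = RM s rp \<Longrightarrow> RM t rq = RM s rq \<Longrightarrow> incell t x = incell s x"
  by (simp add: incell_def)

lemma edges_frame: "IM t iM = IM s iM \<Longrightarrow> IM t iEU = IM s iEU \<Longrightarrow> IM t iEV = IM s iEV \<Longrightarrow> RM t rEA = RM s rEA \<Longrightarrow> RM t rEB = RM s rEB
  \<Longrightarrow> edges t = edges s"
  by (simp add: edges_def)

text \<open>Afterwards the median lies outside the open cell, and with it all crossings on its far
  side. \<open>feas\<close> is the form in which feasibility survives the cut: solutions may be
  lost, but one remains inside the cell.\<close>

lemma decide_sem:
  assumes s: "IM s iN 0 = N" "IM s iM 0 = m" "IM s iLL 0 = l" "l < N" "RM s rH 0 = lam" and E: "EUV s N"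
    and s': "s' = sem p_decide s"
  shows "CK s' \<le> CK s + 12 + 50 * (N + 1) * (N + m + 1)"
    and "incell s' x \<Longrightarrow> incell s x"
    and "IM s' ihp 0 \<noteq> 0 \<and> lam \<le> RM s' rp 0 \<or> IM s' ihq 0 \<noteq> 0 \<and> RM s' rq 0 \<le> lam"
    and "feas s l \<Longrightarrow> feas s' l"
proof -
  define s1 where "s1 = sem (rLAM ::=r RL rH (C 0);; ig ::= C 1;;
     (IF ILe (C 1) (V ihp) THEN (IF BLe (RV rLAM) (RV rp) THEN ig ::= C 0 ELSE Skip) ELSE Skip);;
     (IF ILe (C 1) (V ihq) THEN (IF BLe (RV rq) (RV rLAM) THEN ig ::= C 0 ELSE Skip) ELSE Skip)) s"
  have e: "s' = sem (IF ILe (C 1) (V ig) THEN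
       (p_test;; IF ILe (C 1) (V iT) THEN (ihp ::= C 1;; rp ::=r RV rLAM) ELSE (ihq ::= C 1;; rq ::=r RV rLAM))
     ELSE Skip) s1" using s' by (simp add: p_decide_def s1_def)
  have s1: "k \<noteq> ig \<Longrightarrow> IM s1 k = IM s k" "x \<noteq> rLAM \<Longrightarrow> RM s1 x = RM s x" "RM s1 rLAM 0 = lam" "CK s1 \<le> CK s + 8"
     "IM s1 ig 0 = (if (IM s ihp 0 \<noteq> 0 \<and> lam \<le> RM s rp 0) \<or> (IM s ihq 0 \<noteq> 0 \<and> RM s rq 0 \<le> lam) then 0 else 1)" for k x
    using s by (auto simp: s1_def)
  have all: "CK s' \<le> CK s + 12 + 50 * (N + 1) * (N + m + 1) \<and> (\<forall>x. incell s' x \<longrightarrow> incell s x) \<and>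
    (IM s' ihp 0 \<noteq> 0 \<and> lam \<le> RM s' rp 0 \<or> IM s' ihq 0 \<noteq> 0 \<and> RM s' rq 0 \<le> lam) \<and> (feas s l \<longrightarrow> feas s' l)"
  proof (cases "IM s1 ig 0 = 0")
    case True
    hence s'': "s' = tick s1" using e by simp
    have c: "incell s' x = incell s x" for x unfolding s'' by (simp add: incell_def s1)
    have ed: "edges s' = edges s" unfolding s'' by (rule edges_frame) (simp_all add: s1)
    have "IM s ihp 0 \<noteq> 0 \<and> lam \<le> RM s rp 0 \<or> IM s ihq 0 \<noteq> 0 \<and> RM s rq 0 \<le> lam"
      using True s1(5) by (auto split: if_splits)
    thus ?thesis using s1 c ed unfolding s'' feas_def by auto
  next
    case False
    hence nb: "IM s ihp 0 \<noteq> 0 \<Longrightarrow> RM s rp 0 < lam" "IM s ihq 0 \<noteq> 0 \<Longrightarrow> lam < RM s rq 0"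
      using s1(5) by (auto split: if_splits)
    define s2 where "s2 = sem p_test (tick s1)"
    have e2: "s' = sem (IF ILe (C 1) (V iT) THEN (ihp ::= C 1;; rp ::=r RV rLAM) ELSE (ihq ::= C 1;; rq ::=r RV rLAM)) s2"
      using False e by (simp add: s2_def)
    have ed1: "edges (tick s1) = edges s" by (rule edges_frame) (simp_all add: s1)
    have "EUV (tick s1) N" using E by (simp add: EUV_def s1)
    from test_sem[of "tick s1" N m l lam, OF _ _ _ s(4) _ this s2_def] s s1
    have t: "CK s2 \<le> CK s + 9 + 50 * (N + 1) * (N + m + 1)"
      "IM s2 iT 0 \<noteq> 0 \<Longrightarrow> ssol (edges s) x \<Longrightarrow> lam < x l"
      "IM s2 iT 0 = 0 \<Longrightarrow> ssol (edges s) z \<Longrightarrow> \<exists>x. ssol (edges s) x \<and> x l < lam" for x z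
      unfolding ed1 by auto
    have k2: "IM s2 ihp = IM s ihp" "IM s2 ihq = IM s ihq" "RM s2 rp = RM s rp" "RM s2 rq = RM s rq" "RM s2 rLAM 0 = lam"
      "IM s2 iM = IM s iM" "IM s2 iEU = IM s iEU" "IM s2 iEV = IM s iEV" "RM s2 rEA = RM s rEA" "RM s2 rEB = RM s rEB"
      unfolding s2_def by (simp_all add: sem_frameI sem_frameR s1)
    show ?thesis
    proof (cases "IM s2 iT 0 = 0")
      case T: False
      have s'': "IM s' ihp 0 = 1" "RM s' rp 0 = lam" "IM s' ihq = IM s ihq" "RM s' rq = RM s rq" "CK s' \<le> CK s2 + 1 + 2"
         "edges s' = edges s"
        using T e2 k2 by (auto simp: edges_def)
      have "CK s' \<le> CK s + 12 + 50 * (N + 1) * (N + m + 1) + 2" using s'' t(1) by simp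
      have c: "incell s' x \<longleftrightarrow> lam < x \<and> incell s x" for x using nb s'' by (auto simp: incell_def)
      have "feas s l \<longrightarrow> feas s' l" using t(2)[OF T] by (auto simp: feas_def c s'')
      thus ?thesis using s'' t(1) c by auto
    next
      case T: True
      have s'': "IM s' ihq 0 = 1" "RM s' rq 0 = lam" "IM s' ihp = IM s ihp" "RM s' rp = RM s rp" "CK s' \<le> CK s2 + 1 + 2"
         "edges s' = edges s"
        using T e2 k2 by (auto simp: edges_def)
      have c: "incell s' x \<longleftrightarrow> x < lam \<and> incell s x" for x using nb s'' by (auto simp: incell_def)
      have "feas s l \<longrightarrow> feas s' l"
      proof
        assume "feas s l"
        then obtain z where z: "ssol (edges s) z" "incell s (z l)" by (auto simp: feas_def)
        obtain x where x: "ssol (edges s) x" "x l < lam" using t(3)[OF T z(1)] by blast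
        show "feas s' l"
        proof (cases "z l < lam")
          case True thus ?thesis using z by (auto simp: feas_def c s'')
        next
          case zl: False
          \<comment> \<open>The solution \<open>x\<close> found by the test may lie left of the
            whole cell. This midpoint lies in the reduced cell and between \<open>x l\<close> and
            \<open>z l\<close>, so convexity supplies a solution there.\<close>
          define y where "y = ((if IM s ihp 0 \<noteq> 0 then max (x l) (RM s rp 0) else x l) + lam) / 2"
          have y: "x l < y" "y < lam" "IM s ihp 0 \<noteq> 0 \<Longrightarrow> RM s rp 0 < y"
            using x nb by (auto simp: y_def max_def)
          have "wfE N (edges s)" using E by (auto simp: wfE_def edges_def EUV_def)
          from ssol_convex[OF this z(1) x(1), of y l] y zl obtain w where w: "ssol (edges s) w" "w l = y" by auto
          have "incell s y" using y nb by (auto simp: incell_def)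
          thus ?thesis using w y by (auto simp: feas_def c s'' intro!: exI[of _ w])
        qed
      qed
      thus ?thesis using s'' t(1) c by auto
    qed
  qed
  show "CK s' \<le> CK s + 12 + 50 * (N + 1) * (N + m + 1)" "IM s' ihp 0 \<noteq> 0 \<and> lam \<le> RM s' rp 0 \<or> IM s' ihq 0 \<noteq> 0 \<and> RM s' rq 0 \<le> lam"
    using all by blast+
  show "incell s' x \<Longrightarrow> incell s x" "feas s l \<Longrightarrow> feas s' l" using all by blast+
qed

section \<open>Resolving crossings and shrinking the pool\<close>

definition resolved :: "st \<Rightarrow> real \<Rightarrow> bool" where
  "resolved s t \<longleftrightarrow> IM s ihp 0 \<noteq> 0 \<and> t \<le> RM s rp 0 \<or> IM s ihq 0 \<noteq> 0 \<and> RM s rq 0 \<le> t"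

lemma dom_cross_left:
  assumes "fst k = fst k'" "fst (snd k) < fst (snd k')" "IM s ihp 0 \<noteq> 0" "cross k k' \<le> RM s rp 0"
  shows "dominates s k k'"
  unfolding dominates_def
proof (intro conjI allI impI)
  fix x assume "incell s x"
  hence "cross k k' \<le> x" using assms(3,4) by (auto simp: incell_def)
  thus "fst (snd k) * x + snd (snd k) \<le> fst (snd k') * x + snd (snd k')" unfolding cross_def by (rule cross_le[OF assms(2)])
qed (rule assms(1))

lemma dom_cross_right:
  assumes "fst k = fst k'" "fst (snd k) < fst (snd k')" "IM s ihq 0 \<noteq> 0" "RM s rq 0 \<le> cross k k'"
  shows "dominates s k' k"
  unfolding dominates_def
proof (intro conjI allI impI)
  fix x assume "incell s x"
  hence "x \<le> cross k k'" using assms(3,4) by (auto simp: incell_def)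
  thus "fst (snd k') * x + snd (snd k') \<le> fst (snd k) * x + snd (snd k)" unfolding cross_def by (rule cross_ge[OF assms(2)])
qed (use assms(1) in simp)

lemma dom_parallel: "fst k = fst k' \<Longrightarrow> fst (snd k) = fst (snd k') \<Longrightarrow> snd (snd k) \<le> snd (snd k') \<Longrightarrow> dominates s k k'"
  by (simp add: dominates_def)

lemma dom_trans:
  assumes "dominates s k k'" "dominates s k' k''" shows "dominates s k k''"
  unfolding dominates_def
proof (intro conjI allI impI)
  fix x assume "incell s x"
  hence "fst (snd k) * x + snd (snd k) \<le> fst (snd k') * x + snd (snd k')"
    "fst (snd k') * x + snd (snd k') \<le> fst (snd k'') * x + snd (snd k'')" using assms by (simp_all add: dominates_def)
  thus "fst (snd k) * x + snd (snd k) \<le> fst (snd k'') * x + snd (snd k'')" by (rule order_trans)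
qed (use assms in \<open>simp add: dominates_def\<close>)

lemma dom_refl: "dominates s k k" by (simp add: dominates_def)

lemma dom_mono: "dominates s k k' \<Longrightarrow> (\<And>x. incell t x \<Longrightarrow> incell s x) \<Longrightarrow> dominates t k k'"
  by (simp add: dominates_def)

text \<open>Outside a crossing two lines keep their order, so a crossing off the open cell makes one
  of them redundant on all of it. Parallel lines always lose the one with the larger
  intercept.\<close>

lemma resolve_step:
  assumes ab: "IM t iPA i = a" "IM t iPB i = b" and TX: "RM t rTX i = cross (lin t a) (lin t b)"
    and g: "IM t iLG a = IM t iLG b"
    and r: "r = sem p_resolve (seti (tick t) ii 0 i)"
  shows "CK r \<le> CK t + 10 \<and>
    (IM r iDEAD = IM t iDEAD \<and> \<not> resolved t (RM t rTX i) \<or>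
     (\<exists>j k. (j = a \<and> k = b \<or> j = b \<and> k = a) \<and> IM r iDEAD = (IM t iDEAD)(j := 1) \<and> dominates t (lin t k) (lin t j)))"
proof -
  have ck: "CK r \<le> CK t + 10" unfolding r p_resolve_def p_resolve_upper_def by simp
  let ?sa = "RM t rLS a" and ?sb = "RM t rLS b" and ?x = "RM t rTX i"
  have key: "IM r iDEAD = IM t iDEAD \<and> \<not> resolved t ?x \<or>
     (\<exists>j k. (j = u \<and> k = v \<or> j = v \<and> k = u) \<and> IM r iDEAD = (IM t iDEAD)(j := 1) \<and> dominates t (lin t k) (lin t j))"
    if uv: "RM t rLS u < RM t rLS v" "?x = cross (lin t u) (lin t v)" "IM t iLG u = IM t iLG v"
      and D: "IM r iDEAD = (if IM t ihp 0 \<noteq> 0 \<and> ?x \<le> RM t rp 0 then (IM t iDEAD)(v := 1) else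
          if IM t ihq 0 \<noteq> 0 \<and> RM t rq 0 \<le> ?x then (IM t iDEAD)(u := 1) else IM t iDEAD)" for u v
  proof -
    have f: "fst (lin t u) = fst (lin t v)" "fst (snd (lin t u)) < fst (snd (lin t v))" using uv by (auto simp: lin_def)
    consider "IM t ihp 0 \<noteq> 0 \<and> ?x \<le> RM t rp 0" | "\<not> (IM t ihp 0 \<noteq> 0 \<and> ?x \<le> RM t rp 0)" "IM t ihq 0 \<noteq> 0 \<and> RM t rq 0 \<le> ?x"
      | "\<not> resolved t ?x" unfolding resolved_def by blast
    thus ?thesis
    proof cases
      case 1
      hence "dominates t (lin t u) (lin t v)" using dom_cross_left[OF f] uv(2) by simp
      thus ?thesis using D 1 by auto
    next
      case 2
      hence "dominates t (lin t v) (lin t u)" using dom_cross_right[OF f] uv(2) by simp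
      thus ?thesis using D 2 by auto
    next
      case 3 thus ?thesis using D by (auto simp: resolved_def)
    qed
  qed
  consider "?sa < ?sb" | "?sb < ?sa" | "?sa = ?sb" by linarith
  thus ?thesis
  proof cases
    case 1
    have "IM r iDEAD = (if IM t ihp 0 \<noteq> 0 \<and> ?x \<le> RM t rp 0 then (IM t iDEAD)(b := 1) else
          if IM t ihq 0 \<noteq> 0 \<and> RM t rq 0 \<le> ?x then (IM t iDEAD)(a := 1) else IM t iDEAD)"
      unfolding r p_resolve_def p_resolve_upper_def using ab 1 by simp
    from key[OF 1 TX g this] ck show ?thesis by auto
  next
    case 2
    have "IM r iDEAD = (if IM t ihp 0 \<noteq> 0 \<and> ?x \<le> RM t rp 0 then (IM t iDEAD)(a := 1) else
          if IM t ihq 0 \<noteq> 0 \<and> RM t rq 0 \<le> ?x then (IM t iDEAD)(b := 1) else IM t iDEAD)"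
      unfolding r p_resolve_def p_resolve_upper_def using ab 2 by simp
    from key[OF 2 _ g[symmetric] this] TX cross_commute[of "lin t a" "lin t b"] ck show ?thesis by auto
  next
    case 3
    show ?thesis
    proof (cases "RM t rLB b \<le> RM t rLB a")
      case True
      have "IM r iDEAD = (IM t iDEAD)(a := 1)" unfolding r p_resolve_def using ab 3 True by simp
      moreover have "dominates t (lin t b) (lin t a)" by (rule dom_parallel) (use g 3 True in \<open>auto simp: lin_def\<close>)
      ultimately show ?thesis using ck by blast
    next
      case False
      have "IM r iDEAD = (IM t iDEAD)(b := 1)" unfolding r p_resolve_def using ab 3 False by simp
      moreover have "dominates t (lin t a) (lin t b)" by (rule dom_parallel) (use g 3 False in \<open>auto simp: lin_def\<close>)
      ultimately show ?thesis using ck by blast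
    qed
  qed
qed

lemma pinv_pair: assumes "pinv s G i t" "c < IM t iC 0" shows "IM t iPA c < i \<and> IM t iPB c < i \<and> IM t iPA c \<noteq> IM t iPB c \<and> IM s iLG (IM t iPA c) = IM s iLG (IM t iPB c) \<and>
       RM t rTX c = cross (lin s (IM t iPA c)) (lin s (IM t iPB c)) \<and> RM t rH c = RM t rTX c"
proof -
  have "\<forall>c<IM t iC 0. IM t iPA c < i \<and> IM t iPB c < i \<and> IM t iPA c \<noteq> IM t iPB c \<and> IM s iLG (IM t iPA c) = IM s iLG (IM t iPB c) \<and>
       RM t rTX c = cross (lin s (IM t iPA c)) (lin s (IM t iPB c)) \<and> RM t rH c = RM t rTX c" using assms(1) unfolding pinv_def by (elim conjE)
  thus ?thesis using assms(2-) by blast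
qed
lemma pinv_disjoint: assumes "pinv s G i t" "c < IM t iC 0" "c' < IM t iC 0" "c \<noteq> c'" shows "{IM t iPA c, IM t iPB c} \<inter> {IM t iPA c', IM t iPB c'} = {}"
proof -
  have "\<forall>c<IM t iC 0. \<forall>c'<IM t iC 0. c \<noteq> c' \<longrightarrow> {IM t iPA c, IM t iPB c} \<inter> {IM t iPA c', IM t iPB c'} = {}" using assms(1) unfolding pinv_def by (elim conjE)
  thus ?thesis using assms(2-) by blast
qed
lemma pinv_dead: assumes "pinv s G i t" "j < i" shows "IM t iDEAD j = 0"
proof -
  have "\<forall>j<i. IM t iDEAD j = 0" using assms(1) unfolding pinv_def by (elim conjE)
  thus ?thesis using assms(2-) by blast
qed
lemma pinv_pend: assumes "pinv s G i t" "g < G" "IM t iPEND g \<noteq> 0" shows "\<exists>j<i. IM t iPEND g = Suc j \<and> IM s iLG j = g"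
proof -
  have "\<forall>g<G. IM t iPEND g \<noteq> 0 \<longrightarrow> (\<exists>j<i. IM t iPEND g = Suc j \<and> IM s iLG j = g)" using assms(1) unfolding pinv_def by (elim conjE)
  thus ?thesis using assms(2-) by blast
qed
lemma pinv_card: "pinv s G i t \<Longrightarrow> i = 2 * IM t iC 0 + card {g. g < G \<and> IM t iPEND g \<noteq> 0}"
  unfolding pinv_def by (elim conjE)
lemma pinv_cover: assumes "pinv s G i t" "IM t iC 0 = 0" "j < i" shows "IM t iPEND (IM s iLG j) = Suc j"
proof -
  have "\<forall>j<i. IM t iPEND (IM s iLG j) = Suc j \<or> (\<exists>c<IM t iC 0. j = IM t iPA c \<or> j = IM t iPB c)"
    using assms(1) unfolding pinv_def by (elim conjE)
  thus ?thesis using assms(2-) by auto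
qed

text \<open>Pairs are disjoint, so the partner that dominates a dead line is not killed by another
  pair. The same disjointness makes the map from resolved pairs to dead lines injective, which gives
  the count.\<close>

lemma resolve_sem:
  assumes C: "IM s iC 0 = n"
    and P1: "\<And>c. c < n \<Longrightarrow> IM s iPA c < K \<and> IM s iPB c < K \<and> IM s iPA c \<noteq> IM s iPB c \<and> IM s iLG (IM s iPA c) = IM s iLG (IM s iPB c) \<and>
       RM s rTX c = cross (lin s (IM s iPA c)) (lin s (IM s iPB c))"
    and P2: "\<And>c c'. c < n \<Longrightarrow> c' < n \<Longrightarrow> c \<noteq> c' \<Longrightarrow> {IM s iPA c, IM s iPB c} \<inter> {IM s iPA c', IM s iPB c'} = {}"
    and P3: "\<And>j. j < K \<Longrightarrow> IM s iDEAD j = 0"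
    and half: "n \<le> 2 * card {c. c < n \<and> resolved s (RM s rTX c)}"
    and r: "r = sem (Fr ii (V iC) p_resolve) s"
  shows "CK r \<le> CK s + 1 + 11 * n \<and> n \<le> 2 * card {j. j < K \<and> IM r iDEAD j \<noteq> 0} \<and>
    (\<forall>j<K. IM r iDEAD j \<noteq> 0 \<longrightarrow> (\<exists>k<K. IM r iDEAD k = 0 \<and> dominates s (lin s k) (lin s j)))"
proof -
  let ?A = "IM s iPA" and ?B = "IM s iPB"
  define Q where "Q i t \<longleftrightarrow> CK t \<le> CK s + 1 + 11 * i \<and>
    (\<forall>j<K. IM t iDEAD j \<noteq> 0 \<longrightarrow> (\<exists>c<i. \<exists>k. (j = ?A c \<and> k = ?B c \<or> j = ?B c \<and> k = ?A c) \<and> IM t iDEAD k = 0 \<and> dominates s (lin s k) (lin s j))) \<and>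
    (\<forall>c<i. resolved s (RM s rTX c) \<longrightarrow> IM t iDEAD (?A c) \<noteq> 0 \<or> IM t iDEAD (?B c) \<noteq> 0)" for i and t :: st
  have Q: "Q n r"
    unfolding r
  proof (rule Fr_rule[where Q = Q])
    show "Q 0 (tick s)" using P3 by (auto simp: Q_def)
  next
    fix i t
    assume i: "i < ie (V iC) s" and f: "frame (insert ii (wI p_resolve)) (wR p_resolve) s t" and q: "Q i t"
    have iN: "i < n" using i C by simp
    have fr: "IM t iPA = ?A" "IM t iPB = ?B" "IM t iLG = IM s iLG" "RM t rLS = RM s rLS" "RM t rLB = RM s rLB" "RM t rTX = RM s rTX"
       "IM t ihp = IM s ihp" "IM t ihq = IM s ihq" "RM t rp = RM s rp" "RM t rq = RM s rq"
      using frameI[OF f] frameR[OF f] by auto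
    have lin: "lin t j = lin s j" for j by (simp add: lin_def fr)
    have dm: "dominates t k k' = dominates s k k'" for k k' by (simp add: dominates_def incell_def fr)
    have rs: "resolved t x = resolved s x" for x by (simp add: resolved_def fr)
    define a where "a = ?A i"
    define b where "b = ?B i"
    let ?r = "sem p_resolve (seti (tick t) ii 0 i)"
    have R: "CK ?r \<le> CK t + 10 \<and>
    (IM ?r iDEAD = IM t iDEAD \<and> \<not> resolved s (RM s rTX i) \<or>
     (\<exists>j k. (j = a \<and> k = b \<or> j = b \<and> k = a) \<and> IM ?r iDEAD = (IM t iDEAD)(j := 1) \<and> dominates s (lin s k) (lin s j)))"
      using resolve_step[of t i a b ?r] P1[OF iN] by (simp add: fr lin dm rs a_def b_def)
    have dis: "?A c \<noteq> a \<and> ?A c \<noteq> b \<and> ?B c \<noteq> a \<and> ?B c \<noteq> b" if "c < i" for c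
      using P2[of c i] that iN unfolding a_def b_def by auto
    have fr0: "IM t iDEAD x = 0" if x: "x = a \<or> x = b" for x
    proof (rule ccontr)
      assume nz: "IM t iDEAD x \<noteq> 0"
      have "x < K" using x P1[OF iN] unfolding a_def b_def by auto
      then obtain c k where "c < i" "x = ?A c \<and> k = ?B c \<or> x = ?B c \<and> k = ?A c" using q nz unfolding Q_def by blast
      thus False using dis[of c] x by auto
    qed
    hence fresh: "IM t iDEAD a = 0 \<and> IM t iDEAD b = 0" by simp
    show "Q (Suc i) ?r"
    proof (cases "IM ?r iDEAD = IM t iDEAD \<and> \<not> resolved s (RM s rTX i)")
      case True
      have "\<forall>j<K. IM t iDEAD j \<noteq> 0 \<longrightarrow> (\<exists>c<Suc i. \<exists>k. (j = ?A c \<and> k = ?B c \<or> j = ?B c \<and> k = ?A c) \<and> IM t iDEAD k = 0 \<and> dominates s (lin s k) (lin s j))"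
        using q less_SucI unfolding Q_def by blast
      moreover have "\<forall>c<Suc i. resolved s (RM s rTX c) \<longrightarrow> IM t iDEAD (?A c) \<noteq> 0 \<or> IM t iDEAD (?B c) \<noteq> 0"
        using q True less_antisym unfolding Q_def by blast
      ultimately show ?thesis using R q True unfolding Q_def by simp
    next
      case False
      then obtain j k where jk: "j = a \<and> k = b \<or> j = b \<and> k = a" "IM ?r iDEAD = (IM t iDEAD)(j := 1)" "dominates s (lin s k) (lin s j)"
        using R by blast
      have "\<forall>j'<K. IM ?r iDEAD j' \<noteq> 0 \<longrightarrow> (\<exists>c<Suc i. \<exists>k. (j' = ?A c \<and> k = ?B c \<or> j' = ?B c \<and> k = ?A c) \<and> IM ?r iDEAD k = 0 \<and> dominates s (lin s k) (lin s j'))"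
      proof (intro allI impI)
        fix j' assume j': "j' < K" "IM ?r iDEAD j' \<noteq> 0"
        show "\<exists>c<Suc i. \<exists>k. (j' = ?A c \<and> k = ?B c \<or> j' = ?B c \<and> k = ?A c) \<and> IM ?r iDEAD k = 0 \<and> dominates s (lin s k) (lin s j')"
        proof (cases "j' = j")
          case True
          have "k \<noteq> j" using jk(1) P1[OF iN] unfolding a_def b_def by auto
          hence "IM ?r iDEAD k = 0" using jk fresh by auto
          moreover have "j' = ?A i \<and> k = ?B i \<or> j' = ?B i \<and> k = ?A i" using True jk(1) unfolding a_def b_def by simp
          moreover have "dominates s (lin s k) (lin s j')" using True jk(3) by simp
          ultimately show ?thesis using lessI by blast
        next
          case False
          hence "IM t iDEAD j' \<noteq> 0" using j' jk(2) by simp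
          then obtain c k' where c: "c < i" "j' = ?A c \<and> k' = ?B c \<or> j' = ?B c \<and> k' = ?A c" "IM t iDEAD k' = 0" "dominates s (lin s k') (lin s j')"
            using q j' unfolding Q_def by blast
          have "k' \<noteq> j" using dis[OF c(1)] c(2) jk(1) by auto
          hence "IM ?r iDEAD k' = 0" using c(3) jk(2) by simp
          thus ?thesis using c less_SucI by blast
        qed
      qed
      moreover have "\<forall>c<Suc i. resolved s (RM s rTX c) \<longrightarrow> IM ?r iDEAD (?A c) \<noteq> 0 \<or> IM ?r iDEAD (?B c) \<noteq> 0"
        using q jk unfolding Q_def a_def b_def by (auto simp: less_Suc_eq)
      ultimately show ?thesis using R q unfolding Q_def by auto
    qed
  qed (use C in simp)
  define f where "f c = (if IM r iDEAD (?A c) \<noteq> 0 then ?A c else ?B c)" for c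
  let ?R = "{c. c < n \<and> resolved s (RM s rTX c)}" and ?D = "{j. j < K \<and> IM r iDEAD j \<noteq> 0}"
  have "inj_on f ?R"
  proof (rule inj_onI)
    fix c c' assume c: "c \<in> ?R" "c' \<in> ?R" "f c = f c'"
    show "c = c'"
    proof (rule ccontr)
      assume "c \<noteq> c'"
      hence "{?A c, ?B c} \<inter> {?A c', ?B c'} = {}" using P2 c by auto
      thus False using c(3) by (auto simp: f_def split: if_splits)
    qed
  qed
  moreover have "f ` ?R \<subseteq> ?D" using Q P1 by (auto simp: f_def Q_def)
  ultimately have "card ?R \<le> card ?D" by (intro card_inj_on_le[of f]) auto
  hence "n \<le> 2 * card ?D" using half by linarith
  moreover have "\<forall>j<K. IM r iDEAD j \<noteq> 0 \<longrightarrow> (\<exists>k<K. IM r iDEAD k = 0 \<and> dominates s (lin s k) (lin s j))"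
    using Q P1 unfolding Q_def by blast
  ultimately show ?thesis using Q by (simp add: Q_def)
qed

text \<open>Compaction in place is safe because the write position never overtakes the read
  position.\<close>

lemma compact_sem:
  assumes K: "IM s iK 0 = K" "IM s iK2 0 = 0" and r: "r = sem (Fr ii (V iK) p_compact) s"
  shows "CK r \<le> CK s + 1 + 6 * K \<and> IM r iK2 0 = card {j. j < K \<and> IM s iDEAD j = 0} \<and>
    (\<forall>i<IM r iK2 0. \<exists>j<K. IM s iDEAD j = 0 \<and> lin r i = lin s j) \<and> (\<forall>j<K. IM s iDEAD j = 0 \<longrightarrow> (\<exists>i<IM r iK2 0. lin r i = lin s j))"
proof -
  define Q where "Q i t \<longleftrightarrow> CK t \<le> CK s + 1 + 6 * i \<and> IM t iK2 0 = card {j. j < i \<and> IM s iDEAD j = 0} \<and> IM t iK2 0 \<le> i \<and> (\<forall>j\<ge>i. lin t j = lin s j) \<and>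
    (\<forall>i'<IM t iK2 0. \<exists>j<i. IM s iDEAD j = 0 \<and> lin t i' = lin s j) \<and> (\<forall>j<i. IM s iDEAD j = 0 \<longrightarrow> (\<exists>i'<IM t iK2 0. lin t i' = lin s j))" for i and t :: st
  have "Q K r"
    unfolding r
  proof (rule Fr_rule[where Q = Q])
    show "Q 0 (tick s)" using K by (auto simp: Q_def lin_def)
  next
    fix i t
    assume i: "i < ie (V iK) s" and f: "frame (insert ii (wI p_compact)) (wR p_compact) s t" and q: "Q i t"
    have D: "IM t iDEAD = IM s iDEAD" using frameI[OF f] by simp
    let ?r = "sem p_compact (seti (tick t) ii 0 i)"
    show "Q (Suc i) ?r"
    proof (cases "IM s iDEAD i = 0")
      case True
      have r: "CK ?r \<le> CK t + 6" "IM ?r iK2 0 = Suc (IM t iK2 0)" "\<And>j. lin ?r j = (if j = IM t iK2 0 then lin t i else lin t j)"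
        using True D by (auto simp: p_compact_def lin_def)
      have eq: "{j. j < Suc i \<and> IM s iDEAD j = 0} = insert i {j. j < i \<and> IM s iDEAD j = 0}" using True by auto
      have cd: "card {j. j < Suc i \<and> IM s iDEAD j = 0} = Suc (card {j. j < i \<and> IM s iDEAD j = 0})"
        unfolding eq by (subst card_insert_disjoint) auto
      have A: "\<exists>i'<Suc (IM t iK2 0). lin ?r i' = lin s j" if j: "j < Suc i" "IM s iDEAD j = 0" for j
      proof (cases "j = i")
        case True thus ?thesis using q by (intro exI[of _ "IM t iK2 0"]) (simp add: r Q_def)
      next
        case False
        hence "j < i" using j by simp
        then obtain i' where "i' < IM t iK2 0" "lin t i' = lin s j" using q j(2) unfolding Q_def by blast
        thus ?thesis by (intro exI[of _ i']) (simp add: r)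
      qed
      have B: "\<exists>j<Suc i. IM s iDEAD j = 0 \<and> lin ?r i' = lin s j" if "i' < Suc (IM t iK2 0)" for i'
      proof (cases "i' = IM t iK2 0")
        case t: True thus ?thesis using q True by (intro exI[of _ i]) (simp add: r Q_def)
      next
        case False
        hence "i' < IM t iK2 0" using that by simp
        then obtain j where "j < i" "IM s iDEAD j = 0" "lin t i' = lin s j" using q unfolding Q_def by blast
        thus ?thesis using False by (intro exI[of _ j]) (simp add: r)
      qed
      have L: "lin ?r j = lin s j" if "Suc i \<le> j" for j
      proof -
        have "\<forall>j\<ge>i. lin t j = lin s j" "IM t iK2 0 \<le> i" using q unfolding Q_def by blast+
        thus ?thesis using that by (simp add: r(3))
      qed
      have "CK t \<le> CK s + 1 + 6 * i" "IM t iK2 0 = card {j. j < i \<and> IM s iDEAD j = 0}" "IM t iK2 0 \<le> i"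
        using q unfolding Q_def by blast+
      hence "CK ?r \<le> CK s + 1 + 6 * Suc i" "Suc (IM t iK2 0) = card {j. j < Suc i \<and> IM s iDEAD j = 0}" "Suc (IM t iK2 0) \<le> Suc i"
        using r(1) unfolding cd by simp_all
      thus ?thesis unfolding Q_def r(2) using A B L by blast
    next
      case False
      have r: "CK ?r \<le> CK t + 6" "IM ?r iK2 0 = IM t iK2 0" "\<And>j. lin ?r j = lin t j"
        using False D by (auto simp: p_compact_def lin_def)
      have eq: "{j. j < Suc i \<and> IM s iDEAD j = 0} = {j. j < i \<and> IM s iDEAD j = 0}" using False by (auto simp: less_Suc_eq)
      have ex: "\<exists>j<Suc i. IM s iDEAD j = 0 \<and> lin t i' = lin s j" if "i' < IM t iK2 0" for i'
        using q that less_SucI unfolding Q_def by blast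
      have "j < i" if "j < Suc i" "IM s iDEAD j = 0" for j by (cases "j = i") (use that False in auto)
      moreover have "CK ?r \<le> CK s + 1 + 6 * Suc i" using q r(1) unfolding Q_def by simp
      moreover have "IM t iK2 0 \<le> Suc i" using q unfolding Q_def by simp
      moreover have "\<forall>j\<ge>Suc i. lin t j = lin s j" using q unfolding Q_def by simp
      ultimately show ?thesis using q ex unfolding Q_def eq r(2,3) by blast
    qed
  qed (use K in simp)
  thus ?thesis unfolding Q_def by blast
qed

lemma lin_frame: "IM t iLG = IM s iLG \<Longrightarrow> RM t rLS = RM s rLS \<Longrightarrow> RM t rLB = RM s rLB \<Longrightarrow> lin t i = lin s i"
  by (simp add: lin_def)

text \<open>At least half of the \<open>n\<close> pairs lose a line and at most one line per group
  is unpaired, so \<open>K = 2 * n + pending\<close> yields \<open>4 * K' \<le> 3 * K + Gc\<close>: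
  the excess over one line per group shrinks to three quarters. No group dies out, because each dead
  line is dominated by a survivor of its group.\<close>

lemma prune_sem:
  assumes s: "IM s iN 0 = N" "IM s iM 0 = m" "IM s iLL 0 = l" "l < N" and E: "EUV s N"
    and G: "IM s iG2 0 = G" "IM s iK 0 = K" "\<And>i. i < K \<Longrightarrow> IM s iLG i < G" "K \<le> 2 ^ T"
    and r: "r = sem p_prune s" and Gc: "Gc = card (IM s iLG ` {..<K})"
  shows "CK r \<le> CK s + K * (40 * T + 120) + 2 * G + 40 + 50 * (N + 1) * (N + m + 1) \<and>
    (IM r igo 0 = 0 \<and> K \<le> Gc \<and> IM r iK 0 = K \<and> (\<forall>g<G. IM r iPEND g \<noteq> 0 \<longrightarrow> (\<exists>j<K. IM r iPEND g = Suc j \<and> IM s iLG j = g)) \<and>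
       (\<forall>j<K. IM r iPEND (IM s iLG j) = Suc j) \<and> (\<forall>i. lin r i = lin s i) \<and> (\<forall>x. incell r x = incell s x) \<and> edges r = edges s \<or>
     IM r igo 0 = IM s igo 0 \<and> IM r iK 0 < K \<and> 4 * IM r iK 0 \<le> 3 * K + Gc \<and> IM r iLG ` {..<IM r iK 0} = IM s iLG ` {..<K} \<and>
       (\<forall>i<IM r iK 0. \<exists>j<K. lin r i = lin s j) \<and> (\<forall>j<K. \<exists>i<IM r iK 0. dominates r (lin r i) (lin s j)) \<and>
       (\<forall>x. incell r x \<longrightarrow> incell s x) \<and> (feas s l \<longrightarrow> feas r l) \<and> edges r = edges s)"
proof -
  define s1 where "s1 = sem p_pairing s"
  have p: "pinv s G K s1" "CK s1 \<le> CK s + 3 + 2 * G + 12 * K" using pairing_sem[OF G(1-3) s1_def] by auto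
  have k1: "k \<notin> wI p_pairing \<Longrightarrow> IM s1 k = IM s k" "x \<notin> wR p_pairing \<Longrightarrow> RM s1 x = RM s x" for k x
    unfolding s1_def by (rule sem_frameI sem_frameR, assumption)+
  define n where "n = IM s1 iC 0"
  have r1: "r = sem (IF ILe (C 1) (V iC) THEN
       (p_median;; p_decide;; Fr ii (V iC) p_resolve;; iK2 ::= C 0;; Fr ii (V iK) p_compact;; iK ::= V iK2)
     ELSE igo ::= C 0) s1" using r by (simp add: p_prune_def s1_def)
  have pend_sub: "{g. g < G \<and> IM s1 iPEND g \<noteq> 0} \<subseteq> IM s iLG ` {..<K}"
    using pinv_pend[OF p(1)] by fastforce
  have pc: "card {g. g < G \<and> IM s1 iPEND g \<noteq> 0} \<le> Gc" unfolding Gc by (rule card_mono[OF _ pend_sub]) simp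
  have Kn: "K = 2 * n + card {g. g < G \<and> IM s1 iPEND g \<noteq> 0}" using pinv_card[OF p(1)] by (simp add: n_def)
  show ?thesis
  proof (cases "n = 0")
    case True
    have r2: "r = sem (igo ::= C 0) (tick s1)" using r1 True by (simp add: n_def)
    have "\<forall>g<G. IM r iPEND g \<noteq> 0 \<longrightarrow> (\<exists>j<K. IM r iPEND g = Suc j \<and> IM s iLG j = g)" "\<forall>j<K. IM r iPEND (IM s iLG j) = Suc j"
      using pinv_pend[OF p(1)] pinv_cover[OF p(1)] True unfolding r2 n_def by auto
    moreover have "lin r i = lin s i" for i by (rule lin_frame) (auto simp: r2 k1)
    moreover have "incell r x = incell s x" for x by (rule incell_frame) (auto simp: r2 k1)
    moreover have "edges r = edges s" by (rule edges_frame) (auto simp: r2 k1)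
    moreover have "IM r igo 0 = 0" "K \<le> Gc" "IM r iK 0 = K" using Kn pc True G by (auto simp: r2 k1)
    moreover have "CK r \<le> CK s + K * (40 * T + 120) + 2 * G + 40 + 50 * (N + 1) * (N + m + 1)"
      using p(2) by (simp add: r2 algebra_simps)
    ultimately show ?thesis by blast
  next
    case False
    define s2 where "s2 = sem p_median (tick s1)"
    define s3 where "s3 = sem p_decide s2"
    define s4 where "s4 = sem (Fr ii (V iC) p_resolve) s3"
    define s5 where "s5 = sem (iK2 ::= C 0) s4"
    define s6 where "s6 = sem (Fr ii (V iK) p_compact) s5"
    have r2: "r = sem (iK ::= V iK2) s6" using r1 False by (simp add: n_def s2_def s3_def s4_def s5_def s6_def)
    have nK: "n \<le> K" using Kn by simp
    hence nT: "n \<le> 2 ^ T" using G(4) by simp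
    define lam where "lam = RM s2 rH 0"
    have m: "CK s2 \<le> CK s1 + 1 + n * (40 * T + 80) + 4" "n \<le> 2 * card {i. i < n \<and> RM s1 rH i \<le> lam}" "n \<le> 2 * card {i. i < n \<and> lam \<le> RM s1 rH i}"
      using median_sem[of "tick s1" n T s2, OF _ _ nT s2_def] False by (auto simp: n_def lam_def)
    have k2: "k \<notin> wI p_median \<Longrightarrow> IM s2 k = IM s1 k" "x \<notin> wR p_median \<Longrightarrow> RM s2 x = RM s1 x" for k x
      using sem_frameI[of k p_median "tick s1"] sem_frameR[of x p_median "tick s1"] unfolding s2_def by auto
    have ed2: "edges s2 = edges s" by (rule edges_frame) (auto simp: k1 k2)
    have "EUV s2 N" using E by (simp add: EUV_def k1 k2)
    note D = decide_sem[where s = s2 and N = N and m = m and l = l and lam = lam and s' = s3, OF _ _ _ s(4) _ this s3_def]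
    have D: "CK s3 \<le> CK s2 + 12 + 50 * (N + 1) * (N + m + 1)" "\<And>x. incell s3 x \<Longrightarrow> incell s2 x"
      "IM s3 ihp 0 \<noteq> 0 \<and> lam \<le> RM s3 rp 0 \<or> IM s3 ihq 0 \<noteq> 0 \<and> RM s3 rq 0 \<le> lam" "feas s2 l \<Longrightarrow> feas s3 l"
      using D s by (auto simp: k1 k2 lam_def)
    have k3: "k \<notin> wI p_decide \<Longrightarrow> IM s3 k = IM s2 k" "x \<notin> wR p_decide \<Longrightarrow> RM s3 x = RM s2 x" for k x
      unfolding s3_def by (rule sem_frameI sem_frameR, assumption)+
    have lin3: "lin s3 i = lin s i" for i by (rule lin_frame) (auto simp: k1 k2 k3)
    have C3: "IM s3 iC 0 = n" by (simp add: k2 k3 n_def)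
    have eq3: "IM s3 iPA = IM s1 iPA" "IM s3 iPB = IM s1 iPB" "RM s3 rTX = RM s1 rTX" "IM s3 iDEAD = IM s1 iDEAD" "IM s3 iLG = IM s iLG"
      by (auto simp: k1 k2 k3)
    have P1: "IM s3 iPA c < K \<and> IM s3 iPB c < K \<and> IM s3 iPA c \<noteq> IM s3 iPB c \<and> IM s3 iLG (IM s3 iPA c) = IM s3 iLG (IM s3 iPB c) \<and>
       RM s3 rTX c = cross (lin s3 (IM s3 iPA c)) (lin s3 (IM s3 iPB c))" if "c < n" for c
      using pinv_pair[OF p(1), of c] that by (simp add: eq3 lin3 n_def)
    have P2: "{IM s3 iPA c, IM s3 iPB c} \<inter> {IM s3 iPA c', IM s3 iPB c'} = {}" if "c < n" "c' < n" "c \<noteq> c'" for c c'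
      unfolding eq3 by (rule pinv_disjoint[OF p(1)]) (use that in \<open>simp_all add: n_def\<close>)
    have P3: "IM s3 iDEAD j = 0" if "j < K" for j unfolding eq3 by (rule pinv_dead[OF p(1) that])
    have half: "n \<le> 2 * card {c. c < n \<and> resolved s3 (RM s3 rTX c)}"
    proof -
      have h: "RM s1 rH c = RM s3 rTX c" if "c < n" for c using pinv_pair[OF p(1), of c] that by (simp add: n_def k2 k3)
      from D(3) show ?thesis
      proof
        assume a: "IM s3 ihp 0 \<noteq> 0 \<and> lam \<le> RM s3 rp 0"
        have "{i. i < n \<and> RM s1 rH i \<le> lam} \<subseteq> {c. c < n \<and> resolved s3 (RM s3 rTX c)}"
          using a h by (auto simp: resolved_def)
        hence "card {i. i < n \<and> RM s1 rH i \<le> lam} \<le> card {c. c < n \<and> resolved s3 (RM s3 rTX c)}" by (intro card_mono) auto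
        thus ?thesis using m(2) by linarith
      next
        assume a: "IM s3 ihq 0 \<noteq> 0 \<and> RM s3 rq 0 \<le> lam"
        have "{i. i < n \<and> lam \<le> RM s1 rH i} \<subseteq> {c. c < n \<and> resolved s3 (RM s3 rTX c)}"
          using a h by (auto simp: resolved_def)
        hence "card {i. i < n \<and> lam \<le> RM s1 rH i} \<le> card {c. c < n \<and> resolved s3 (RM s3 rTX c)}" by (intro card_mono) auto
        thus ?thesis using m(3) by linarith
      qed
    qed
    have R: "CK s4 \<le> CK s3 + 1 + 11 * n" "n \<le> 2 * card {j. j < K \<and> IM s4 iDEAD j \<noteq> 0}"
      "\<And>j. j<K \<Longrightarrow> IM s4 iDEAD j \<noteq> 0 \<Longrightarrow> \<exists>k<K. IM s4 iDEAD k = 0 \<and> dominates s3 (lin s k) (lin s j)"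
      using resolve_sem[OF C3 P1 P2 P3 half s4_def] by (auto simp: lin3)
    have k4: "k \<notin> wI (Fr ii (V iC) p_resolve) \<Longrightarrow> IM s4 k = IM s3 k" "RM s4 x = RM s3 x" for k x
      unfolding s4_def by (simp_all add: sem_frameI sem_frameR)
    have lin5: "lin s5 i = lin s i" for i unfolding lin3[symmetric] by (rule lin_frame) (auto simp: k4 s5_def)
    have K5: "IM s5 iK 0 = K" "IM s5 iK2 0 = 0" "IM s5 iDEAD = IM s4 iDEAD" using G by (auto simp: s5_def k1 k2 k3 k4)
    define K' where "K' = IM s6 iK2 0"
    have c: "CK s6 \<le> CK s5 + 1 + 6 * K" "K' = card {j. j < K \<and> IM s4 iDEAD j = 0}"
       "\<And>i. i<K' \<Longrightarrow> \<exists>j<K. IM s4 iDEAD j = 0 \<and> lin s6 i = lin s j" "\<And>j. j<K \<Longrightarrow> IM s4 iDEAD j = 0 \<Longrightarrow> \<exists>i<K'. lin s6 i = lin s j"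
      using compact_sem[OF K5(1,2) s6_def] by (auto simp: K5(3) lin5 K'_def)
    have k6: "k \<notin> wI (Fr ii (V iK) p_compact) \<Longrightarrow> IM s6 k = IM s5 k" "x \<notin> wR p_compact \<Longrightarrow> RM s6 x = RM s5 x" for k x
      unfolding s6_def by (simp_all add: sem_frameI sem_frameR)
    have r3: "IM r iK 0 = K'" "lin r i = lin s6 i" for i unfolding r2 by (auto simp: K'_def lin_def)
    have cell: "incell r x = incell s3 x" for x by (rule incell_frame) (auto simp: r2 k6 s5_def k4)
    have edr: "edges r = edges s" unfolding ed2[symmetric] by (rule edges_frame) (auto simp: r2 k6 s5_def k4 k3)
    have ed3: "edges s3 = edges s" unfolding ed2[symmetric] by (rule edges_frame) (auto simp: k3)
    have cell2: "incell s2 x = incell s x" for x by (rule incell_frame) (auto simp: k1 k2)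
    have dm: "dominates r k k' = dominates s3 k k'" for k k' by (simp add: dominates_def cell)
    have surv: "\<exists>i<K'. dominates r (lin r i) (lin s j)" if j: "j < K" for j
    proof (cases "IM s4 iDEAD j = 0")
      case True thus ?thesis using c(4)[OF j] dom_refl by (metis r3(2))
    next
      case False
      then obtain k where k: "k < K" "IM s4 iDEAD k = 0" "dominates s3 (lin s k) (lin s j)" using R(3)[OF j] by blast
      thus ?thesis using c(4)[OF k(1,2)] by (metis r3(2) dm)
    qed
    have eqs: "{j. j < K} = {j. j < K \<and> IM s4 iDEAD j = 0} \<union> {j. j < K \<and> IM s4 iDEAD j \<noteq> 0}" by auto
    have "K = card {j. j < K}" by simp
    also have "\<dots> = K' + card {j. j < K \<and> IM s4 iDEAD j \<noteq> 0}" unfolding c(2) by (subst eqs, subst card_Un_disjoint) auto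
    finally have KK: "K = K' + card {j. j < K \<and> IM s4 iDEAD j \<noteq> 0}" .
    have sz: "K' < K" "4 * K' \<le> 3 * K + Gc" using KK R(2) Kn pc False by linarith+
    have grp: "IM r iLG ` {..<K'} = IM s iLG ` {..<K}"
    proof -
      have fl: "IM t iLG i = fst (lin t i)" for t i by (simp add: lin_def)
      show ?thesis
      proof
        show "IM r iLG ` {..<K'} \<subseteq> IM s iLG ` {..<K}" using c(3) by (fastforce simp: fl r3(2))
        show "IM s iLG ` {..<K} \<subseteq> IM r iLG ` {..<K'}"
        proof (rule subsetI, elim imageE)
          fix g j assume "g = IM s iLG j" "j \<in> {..<K}"
          moreover from this obtain i where "i < K'" "dominates r (lin r i) (lin s j)" using surv by auto
          ultimately show "g \<in> IM r iLG ` {..<K'}" by (intro image_eqI[of _ _ i]) (auto simp: fl dominates_def)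
        qed
      qed
    qed
    have fe: "feas s l \<longrightarrow> feas r l" using D(4) by (simp add: feas_def ed2 ed3 edr cell cell2)
    have "IM r igo 0 = IM s igo 0" by (simp add: r2 k6 s5_def k4 k3 k2 k1)
    moreover have "\<forall>i<K'. \<exists>j<K. lin r i = lin s j" using c(3) by (metis r3(2))
    moreover have "\<forall>x. incell r x \<longrightarrow> incell s x" using D(2) by (simp add: cell cell2)
    moreover have "CK r \<le> CK s + K * (40 * T + 120) + 2 * G + 40 + 50 * (N + 1) * (N + m + 1)"
    proof -
      have "CK r = CK s6 + 1" "CK s5 = CK s4 + 1" by (simp_all add: r2 s5_def)
      moreover have "n * (40 * T + 80) \<le> K * (40 * T + 80)" using nK by (rule mult_right_mono) simp
      moreover have "K * (40 * T + 120) = K * (40 * T + 80) + 40 * K" by (simp add: algebra_simps)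
      ultimately show ?thesis using c(1) R(1) D(1) m(1) p(2) nK by linarith
    qed
    ultimately show ?thesis using sz grp surv fe edr unfolding r3(1) by blast
  qed
qed


text \<open>Since \<open>(4 / 3) ^ 3 = 64 / 27\<close> exceeds 2, three rounds halve the excess; the
  proof compares 64 with \<open>2 * 27 = 54\<close>.\<close>

lemma rounds_bound:
  assumes "(4::nat) ^ r \<le> 3 ^ r * 2 ^ T" shows "r \<le> 3 * (T::nat)"
proof (rule ccontr)
  assume "\<not> ?thesis"
  then obtain k where r: "r = 3 * T + Suc k" by (metis add_Suc_right less_imp_Suc_add not_le)
  have "(4::nat) ^ r = 64 ^ T * 4 ^ Suc k" by (simp add: r power_add power_mult)
  moreover have "(3::nat) ^ r * 2 ^ T = 54 ^ T * 3 ^ Suc k"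
    by (simp add: r power_add power_mult power_mult_distrib[symmetric] mult.assoc)
  moreover have "(54::nat) ^ T * 3 ^ Suc k < 64 ^ T * 4 ^ Suc k"
    by (intro mult_le_less_imp_less power_mono power_strict_mono) auto
  ultimately show False using assms by simp
qed

text \<open>The work on lines in a round is split. The share of \<open>Gc\<close> lines is charged
  to the round. The share of the excess is at most four times its decrease, so these charges
  telescope to \<open>4 * c * E0\<close> and carry no second logarithm.\<close>

lemma search_sem:
  assumes s: "IM s iN 0 = N" "IM s iM 0 = m" "IM s iLL 0 = l" "l < N" and E: "EUV s N"
    and G: "IM s iG2 0 = G" "IM s iK 0 = K" "\<And>i. i < K \<Longrightarrow> IM s iLG i < G" "K \<le> 2 ^ T"
    and r: "r = sem p_search s"
  shows "CK r \<le> CK s + 3 + (3 * T + 2) * (G * (40 * T + 120) + 2 * G + 50 + 50 * (N + 1) * (N + m + 1)) + 4 * K * (40 * T + 120) \<and>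
    (\<forall>g<G. IM r iPEND g \<noteq> 0 \<longrightarrow> (\<exists>j<K. (g, RM r rLS (IM r iPEND g - 1), RM r rLB (IM r iPEND g - 1)) = lin s j)) \<and>
    (\<forall>j<K. let g = IM s iLG j in IM r iPEND g \<noteq> 0 \<and> dominates r (g, RM r rLS (IM r iPEND g - 1), RM r rLB (IM r iPEND g - 1)) (lin s j)) \<and>
    (\<forall>x. incell r x \<longrightarrow> incell s x) \<and> (feas s l \<longrightarrow> feas r l)"
proof -
  define s1 where "s1 = sem (igo ::= C 1) s"
  have r1: "r = sem (For ir (Add (V iK) (C 1)) (ILe (C 1) (V igo)) p_prune) s1" using r by (simp add: p_search_def s1_def)
  have k1: "k \<noteq> igo \<Longrightarrow> IM s1 k = IM s k" "RM s1 x = RM s x" "IM s1 igo 0 = 1" "CK s1 = CK s + 1" for k x by (auto simp: s1_def)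
  define Gc where "Gc = card (IM s iLG ` {..<K})"
  have "Gc \<le> card {..<G}" unfolding Gc_def by (rule card_mono) (use G(3) in auto)
  hence GcG: "Gc \<le> G" by simp
  have GcK: "card (IM t iLG ` {..<k}) \<le> k" for t k using card_image_le[of "{..<k}" "IM t iLG"] by simp
  define c where "c = 40 * T + 120"
  define B where "B = G * c + 2 * G + 41 + 50 * (N + 1) * (N + m + 1)"
  define E0 where "E0 = K - Gc"
  define base where "base t \<longleftrightarrow> (\<forall>i<IM t iK 0. \<exists>j<K. lin t i = lin s j) \<and> (\<forall>j<K. \<exists>i<IM t iK 0. dominates t (lin t i) (lin s j)) \<and>
     IM t iLG ` {..<IM t iK 0} = IM s iLG ` {..<K} \<and> (\<forall>x. incell t x \<longrightarrow> incell s x) \<and> (feas s l \<longrightarrow> feas t l) \<and> edges t = edges s" for t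
  define fin where "fin t \<longleftrightarrow> (\<forall>g<G. IM t iPEND g \<noteq> 0 \<longrightarrow> (\<exists>j<IM t iK 0. IM t iPEND g = Suc j \<and> IM t iLG j = g)) \<and>
       (\<forall>j<IM t iK 0. IM t iPEND (IM t iLG j) = Suc j)" for t :: st
  \<comment> \<open>The excess falls by at least 1 per round, so the loop bound \<open>K + 1\<close>
    suffices for termination, and it falls by the factor 3/4, so the number of rounds is at most
    \<open>3 * T + 2\<close>.\<close>
  define Q where "Q i t \<longleftrightarrow> base t \<and> IM t iK 0 - Gc \<le> E0 \<and> CK t \<le> CK s + 2 + i * B + 4 * c * (E0 - (IM t iK 0 - Gc)) \<and>
     (if IM t igo 0 = 0 then fin t \<and> i \<le> 3 * T + 2
      else IM t igo 0 = 1 \<and> IM t iK 0 - Gc + i \<le> E0 \<and> (IM t iK 0 - Gc) * 4 ^ i \<le> E0 * 3 ^ i \<and> i \<le> 3 * T + 1)" for i and t :: st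
  define R where "R t \<longleftrightarrow> base t \<and> fin t \<and> CK t \<le> CK s + 3 + (3 * T + 2) * B + 4 * c * E0" for t
  have QR: "R (seti (tick t) ir 0 i)" if Q: "Q i t" "IM t igo 0 = 0" for i t
  proof -
    have "i * B \<le> (3 * T + 2) * B" using Q by (intro mult_right_mono) (auto simp: Q_def)
    moreover have "4 * c * (E0 - (IM t iK 0 - Gc)) \<le> 4 * c * E0" by (rule mult_left_mono) simp_all
    moreover have "CK t \<le> CK s + 2 + i * B + 4 * c * (E0 - (IM t iK 0 - Gc))" using Q unfolding Q_def by blast
    ultimately have "CK (seti (tick t) ir 0 i) \<le> CK s + 3 + (3 * T + 2) * B + 4 * c * E0" unfolding st_simps by linarith
    moreover have "base (seti (tick t) ir 0 i) = base t"
    proof -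
      have "lin (seti (tick t) ir 0 i) = lin t" "incell (seti (tick t) ir 0 i) = incell t" "edges (seti (tick t) ir 0 i) = edges t"
        by (auto simp: lin_def incell_def edges_def fun_eq_iff)
      thus ?thesis by (simp add: base_def dominates_def feas_def)
    qed
    moreover have "fin (seti (tick t) ir 0 i) = fin t" by (simp add: fin_def)
    ultimately show ?thesis using Q unfolding R_def Q_def by simp
  qed
  have "R r"
    unfolding r1
  proof (rule For_rule[where Q = Q])
    have l1: "lin (tick s1) = lin s" "incell (tick s1) = incell s" "edges (tick s1) = edges s"
      by (auto simp: lin_def incell_def edges_def fun_eq_iff k1)
    have K1: "IM (tick s1) iK 0 = K" "IM (tick s1) iLG = IM s iLG" using G(2) by (simp_all add: k1)
    have "base (tick s1)" unfolding base_def feas_def l1 K1 using dom_refl by blast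
    thus "Q 0 (tick s1)" using G(2) by (simp add: Q_def k1 E0_def)
  next
    fix i t
    assume f: "frame (insert ir (wI p_prune)) (wR p_prune) s1 t" and Q: "Q i t" and g: "be (ILe (C 1) (V igo)) (seti (tick t) ir 0 i)"
    let ?t = "seti (tick t) ir 0 i"
    let ?r = "sem p_prune ?t"
    define k where "k = IM t iK 0"
    have go: "IM t igo 0 = 1" using Q g by (auto simp: Q_def)
    have b: "base t" and q: "k - Gc \<le> E0" "CK t \<le> CK s + 2 + i * B + 4 * c * (E0 - (k - Gc))" "k - Gc + i \<le> E0" "(k - Gc) * 4 ^ i \<le> E0 * 3 ^ i" "i \<le> 3 * T + 1"
      using Q go by (auto simp: Q_def k_def)
    have fr: "IM t iN = IM s iN" "IM t iM = IM s iM" "IM t iLL = IM s iLL" "IM t iG2 = IM s iG2" "IM t iEU = IM s iEU" "IM t iEV = IM s iEV" "RM t rEA = RM s rEA"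
      using frameI[OF f] frameR[OF f] k1 by auto
    have "EUV ?t N" using E by (simp add: EUV_def fr)
    have LG: "IM ?t iLG j < G" if "j < k" for j
    proof -
      have "IM t iLG j \<in> IM s iLG ` {..<K}" using b that unfolding base_def k_def by blast
      thus ?thesis using G(3) by auto
    qed
    have Gk: "Gc \<le> k" using GcK[of t k] b by (simp add: base_def Gc_def k_def)
    have E0K: "E0 + Gc \<le> K" using GcK[of s K] by (simp add: E0_def Gc_def)
    have kT: "k \<le> 2 ^ T" using q(1) E0K Gk G(4) by linarith
    have lt: "lin ?t = lin t" "incell ?t = incell t" "edges ?t = edges t" by (auto simp: lin_def incell_def edges_def fun_eq_iff)
    have ft: "feas ?t l = feas t l" by (simp add: feas_def lt)
    have gc: "Gc = card (IM ?t iLG ` {..<k})" using b by (simp add: base_def Gc_def k_def)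
    note P = prune_sem[where s = ?t and N = N and m = m and l = l and G = G and K = k and T = T and r = ?r and Gc = Gc, OF _ _ _ s(4) \<open>EUV ?t N\<close> _ _ _ kT refl gc]
    have "CK ?r \<le> CK ?t + k * c + 2 * G + 40 + 50 * (N + 1) * (N + m + 1) \<and>
    (IM ?r igo 0 = 0 \<and> k \<le> Gc \<and> IM ?r iK 0 = k \<and> (\<forall>g<G. IM ?r iPEND g \<noteq> 0 \<longrightarrow> (\<exists>j<k. IM ?r iPEND g = Suc j \<and> IM t iLG j = g)) \<and>
       (\<forall>j<k. IM ?r iPEND (IM t iLG j) = Suc j) \<and> (\<forall>i. lin ?r i = lin t i) \<and> (\<forall>x. incell ?r x = incell t x) \<and> edges ?r = edges t \<or>
     IM ?r igo 0 = IM t igo 0 \<and> IM ?r iK 0 < k \<and> 4 * IM ?r iK 0 \<le> 3 * k + Gc \<and> IM ?r iLG ` {..<IM ?r iK 0} = IM t iLG ` {..<k} \<and>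
       (\<forall>i<IM ?r iK 0. \<exists>j<k. lin ?r i = lin t j) \<and> (\<forall>j<k. \<exists>i<IM ?r iK 0. dominates ?r (lin ?r i) (lin t j)) \<and>
       (\<forall>x. incell ?r x \<longrightarrow> incell t x) \<and> (feas t l \<longrightarrow> feas ?r l) \<and> edges ?r = edges t)"
      using P s G(1) LG by (simp add: fr lt ft k_def c_def)
    hence ck: "CK ?r \<le> CK t + 1 + k * c + 2 * G + 40 + 50 * (N + 1) * (N + m + 1)" and
      alt: "IM ?r igo 0 = 0 \<and> k \<le> Gc \<and> IM ?r iK 0 = k \<and> (\<forall>g<G. IM ?r iPEND g \<noteq> 0 \<longrightarrow> (\<exists>j<k. IM ?r iPEND g = Suc j \<and> IM t iLG j = g)) \<and>
       (\<forall>j<k. IM ?r iPEND (IM t iLG j) = Suc j) \<and> (\<forall>i. lin ?r i = lin t i) \<and> (\<forall>x. incell ?r x = incell t x) \<and> edges ?r = edges t \<or>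
     IM ?r igo 0 = 1 \<and> IM ?r iK 0 < k \<and> 4 * IM ?r iK 0 \<le> 3 * k + Gc \<and> IM ?r iLG ` {..<IM ?r iK 0} = IM t iLG ` {..<k} \<and>
       (\<forall>i<IM ?r iK 0. \<exists>j<k. lin ?r i = lin t j) \<and> (\<forall>j<k. \<exists>i<IM ?r iK 0. dominates ?r (lin ?r i) (lin t j)) \<and>
       (\<forall>x. incell ?r x \<longrightarrow> incell t x) \<and> (feas t l \<longrightarrow> feas ?r l) \<and> edges ?r = edges t"
      using go by auto
    have "k * c = Gc * c + (k - Gc) * c" using Gk by (simp add: add_mult_distrib[symmetric])
    also have "\<dots> \<le> G * c + (k - Gc) * c" using GcG by simp
    finally have kc: "k * c \<le> G * c + (k - Gc) * c" .
    from alt show "Q (Suc i) ?r"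
    proof
      assume A: "IM ?r igo 0 = 0 \<and> k \<le> Gc \<and> IM ?r iK 0 = k \<and> (\<forall>g<G. IM ?r iPEND g \<noteq> 0 \<longrightarrow> (\<exists>j<k. IM ?r iPEND g = Suc j \<and> IM t iLG j = g)) \<and>
       (\<forall>j<k. IM ?r iPEND (IM t iLG j) = Suc j) \<and> (\<forall>i. lin ?r i = lin t i) \<and> (\<forall>x. incell ?r x = incell t x) \<and> edges ?r = edges t"
      have lg: "IM ?r iLG i = IM t iLG i" for i using A by (metis fst_conv lin_def)
      have l2: "lin ?r = lin t" "incell ?r = incell t" "edges ?r = edges t" "IM ?r iK 0 = IM t iK 0" "IM ?r iLG = IM t iLG" using A lg by (auto simp: fun_eq_iff k_def)
      have "base ?r" using b unfolding base_def feas_def dominates_def l2 .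
      moreover have "fin ?r" using A unfolding fin_def l2 k_def by blast
      moreover have "CK ?r \<le> CK s + 2 + Suc i * B + 4 * c * (E0 - (k - Gc))"
      proof -
      have "k = Gc" using A Gk by simp
      hence "k * c \<le> G * c" using kc by simp
      hence "CK ?r \<le> CK t + B" using ck unfolding B_def by linarith
      moreover have "Suc i * B = i * B + B" by simp
      ultimately have "CK ?r \<le> CK s + 2 + Suc i * B + 4 * c * (E0 - (k - Gc))" using q(2) by linarith
      thus ?thesis .
      qed
      ultimately show ?thesis using A q unfolding Q_def k_def by simp
    next
      assume A: "IM ?r igo 0 = 1 \<and> IM ?r iK 0 < k \<and> 4 * IM ?r iK 0 \<le> 3 * k + Gc \<and> IM ?r iLG ` {..<IM ?r iK 0} = IM t iLG ` {..<k} \<and>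
       (\<forall>i<IM ?r iK 0. \<exists>j<k. lin ?r i = lin t j) \<and> (\<forall>j<k. \<exists>i<IM ?r iK 0. dominates ?r (lin ?r i) (lin t j)) \<and>
       (\<forall>x. incell ?r x \<longrightarrow> incell t x) \<and> (feas t l \<longrightarrow> feas ?r l) \<and> edges ?r = edges t"
      define k' where "k' = IM ?r iK 0"
      have k': "k' < k" "4 * k' \<le> 3 * k + Gc" using A by (auto simp: k'_def)
      have gr: "IM ?r iLG ` {..<k'} = IM s iLG ` {..<K}" using A b by (simp add: base_def k_def k'_def)
      have Gk': "Gc \<le> k'" using GcK[of ?r k'] gr by (simp add: Gc_def)
      have base': "base ?r"
        unfolding base_def
      proof (intro conjI allI impI)
        fix i assume "i < IM ?r iK 0"
        then obtain j where "j < k" "lin ?r i = lin t j" using A by blast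
        thus "\<exists>j<K. lin ?r i = lin s j" using b unfolding base_def k_def by metis
      next
        fix j assume "j < K"
        then obtain i where i: "i < k" "dominates t (lin t i) (lin s j)" using b unfolding base_def k_def by blast
        then obtain i' where i': "i' < IM ?r iK 0" "dominates ?r (lin ?r i') (lin t i)" using A by blast
        have "dominates ?r (lin t i) (lin s j)" by (rule dom_mono[OF i(2)]) (use A in blast)
        thus "\<exists>i<IM ?r iK 0. dominates ?r (lin ?r i) (lin s j)" using i' dom_trans by blast
      next
        show "IM ?r iLG ` {..<IM ?r iK 0} = IM s iLG ` {..<K}" using gr by (simp add: k'_def)
      next
        fix x assume "incell ?r x" thus "incell s x" using A b unfolding base_def by blast
      next
        assume "feas s l" thus "feas ?r l" using A b unfolding base_def by blast
      next
        show "edges ?r = edges s" using A b unfolding base_def by simp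
      qed
      have E: "4 * (k' - Gc) \<le> 3 * (k - Gc)" "1 \<le> k - Gc" "k' - Gc < k - Gc" using k' Gk' by linarith+
      have "1 * 4 ^ i \<le> (k - Gc) * 4 ^ i" using E(2) by (rule mult_right_mono) simp
      also have "\<dots> \<le> E0 * 3 ^ i" by (rule q(4))
      also have "\<dots> \<le> 2 ^ T * 3 ^ i" using E0K G(4) by (intro mult_right_mono) auto
      finally have "i \<le> 3 * T" using rounds_bound[of i T] by (simp add: mult.commute)
      moreover have "(k' - Gc) * 4 ^ Suc i \<le> E0 * 3 ^ Suc i"
      proof -
        have "(k' - Gc) * 4 ^ Suc i = (4 * (k' - Gc)) * 4 ^ i" by simp
        also have "\<dots> \<le> (3 * (k - Gc)) * 4 ^ i" using E(1) by (rule mult_right_mono) simp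
        also have "\<dots> = 3 * ((k - Gc) * 4 ^ i)" by simp
        also have "\<dots> \<le> 3 * (E0 * 3 ^ i)" using q(4) by (rule mult_left_mono) simp
        finally show ?thesis by simp
      qed
      moreover have "CK ?r \<le> CK s + 2 + Suc i * B + 4 * c * (E0 - (k' - Gc))"
      proof -
        have "E0 - (k - Gc) + (k - Gc - (k' - Gc)) = E0 - (k' - Gc)" using q(1) E(3) by linarith
        hence "4 * c * (E0 - (k' - Gc)) = 4 * c * (E0 - (k - Gc)) + c * (4 * (k - Gc - (k' - Gc)))"
          by (metis (no_types, lifting) add_mult_distrib2 mult.assoc mult.left_commute)
        moreover have "c * (k - Gc) \<le> c * (4 * (k - Gc - (k' - Gc)))" using E(1) by (intro mult_left_mono) linarith+
        moreover have "(k - Gc) * c = c * (k - Gc)" by simp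
        moreover have "Suc i * B = i * B + B" by simp
        moreover have "CK ?r \<le> CK t + B + (k - Gc) * c" using ck kc unfolding B_def by linarith
        ultimately show ?thesis using q(2) by linarith
      qed
      moreover have "k' - Gc + Suc i \<le> E0" "k' - Gc \<le> E0" using E(3) q(3) by linarith+
      ultimately show ?thesis using A base' unfolding Q_def k'_def by simp
    qed
  next
    fix i t
    assume "Q i t" "\<not> be (ILe (C 1) (V igo)) (seti (tick t) ir 0 i)"
    thus "R (seti (tick t) ir 0 i)" by (intro QR) simp_all
  next
    fix t assume Q: "Q (ie (Add (V iK) (C 1)) s1) t"
    have "ie (Add (V iK) (C 1)) s1 = K + 1" using G by (simp add: k1)
    hence Q: "Q (K + 1) t" using Q by simp
    have "IM t igo 0 = 0"
    proof (rule ccontr)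
      assume "IM t igo 0 \<noteq> 0"
      hence "K + 1 \<le> E0" using Q by (simp add: Q_def)
      thus False by (simp add: E0_def)
    qed
    hence "R (seti (tick t) ir 0 (K + 1))" by (rule QR[OF Q])
    moreover have "(K + 1) * B \<le> (3 * T + 2) * B" using Q \<open>IM t igo 0 = 0\<close> by (intro mult_right_mono) (auto simp: Q_def)
    moreover have "4 * c * (E0 - (IM t iK 0 - Gc)) \<le> 4 * c * E0" by (rule mult_left_mono) simp_all
    moreover have "CK t \<le> CK s + 2 + (K + 1) * B + 4 * c * (E0 - (IM t iK 0 - Gc))" using Q unfolding Q_def by blast
    ultimately have "CK t \<le> CK s + 3 + (3 * T + 2) * B + 4 * c * E0" by linarith
    thus "R t" using Q \<open>IM t igo 0 = 0\<close> unfolding R_def Q_def by simp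
  qed
  hence b: "base r" and f: "fin r" and ck: "CK r \<le> CK s + 3 + (3 * T + 2) * B + 4 * c * E0" by (auto simp: R_def)
  have "4 * c * E0 \<le> 4 * K * c" by (simp add: E0_def)
  hence "CK r \<le> CK s + 3 + (3 * T + 2) * (G * c + 2 * G + 50 + 50 * (N + 1) * (N + m + 1)) + 4 * K * c"
    using ck mult_left_mono[of B "G * c + 2 * G + 50 + 50 * (N + 1) * (N + m + 1)" "3 * T + 2"] by (simp only: B_def) linarith
  moreover have "\<exists>j<K. (g, RM r rLS (IM r iPEND g - 1), RM r rLB (IM r iPEND g - 1)) = lin s j" if gG: "g < G" and pg: "IM r iPEND g \<noteq> 0" for g
  proof -
    obtain j where j: "j < IM r iK 0" "IM r iPEND g = Suc j" "IM r iLG j = g" using f gG pg unfolding fin_def by blast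
    hence "(g, RM r rLS (IM r iPEND g - 1), RM r rLB (IM r iPEND g - 1)) = lin r j" by (simp add: lin_def)
    thus ?thesis using b j(1) unfolding base_def by metis
  qed
  moreover have "let g = IM s iLG j in IM r iPEND g \<noteq> 0 \<and> dominates r (g, RM r rLS (IM r iPEND g - 1), RM r rLB (IM r iPEND g - 1)) (lin s j)" if jK: "j < K" for j
  proof -
    obtain i where i: "i < IM r iK 0" "dominates r (lin r i) (lin s j)" using b jK unfolding base_def by blast
    have g: "IM r iLG i = IM s iLG j" using i(2) by (simp add: dominates_def lin_def)
    have p: "IM r iPEND (IM r iLG i) = Suc i" using f i(1) unfolding fin_def by blast
    have "(IM s iLG j, RM r rLS i, RM r rLB i) = lin r i" by (simp add: lin_def g)
    thus ?thesis using p i(2) g by (simp add: Let_def)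
  qed
  ultimately show ?thesis using b unfolding c_def base_def by blast
qed

section \<open>Eliminating a variable\<close>

abbreviation (input) iAU :: nat where "iAU \<equiv> 40"
abbreviation (input) iAV :: nat where "iAV \<equiv> 41"
abbreviation (input) ikk :: nat where "ikk \<equiv> 42"
abbreviation (input) iuu :: nat where "iuu \<equiv> 43"
abbreviation (input) ibk :: nat where "ibk \<equiv> 44"
abbreviation (input) iRH :: nat where "iRH \<equiv> 45"
abbreviation (input) iROW :: nat where "iROW \<equiv> 46"
abbreviation (input) rAA :: nat where "rAA \<equiv> 16"
abbreviation (input) rAB :: nat where "rAB \<equiv> 17"
abbreviation (input) rRS :: nat where "rRS \<equiv> 18"
abbreviation (input) rRB :: nat where "rRB \<equiv> 19"
abbreviation (input) rX :: nat where "rX \<equiv> 20"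
abbreviation (input) rt :: nat where "rt \<equiv> 23"

definition p_lower :: com where
  "p_lower = (IF ILe (C 1) (V ihp) THEN (IF BLt (RV rp) (RV rt) THEN rp ::=r RV rt ELSE Skip) ELSE (ihp ::= C 1;; rp ::=r RV rt))"
definition p_upper :: com where
  "p_upper = (IF ILe (C 1) (V ihq) THEN (IF BLt (RV rt) (RV rq) THEN rq ::=r RV rt ELSE Skip) ELSE (ihq ::= C 1;; rq ::=r RV rt))"

definition p_addline :: "iexp \<Rightarrow> rexp \<Rightarrow> rexp \<Rightarrow> com" where
  "p_addline g a b = (IA iLG (V iK) g;; RA rLS (V iK) a;; RA rLB (V iK) b;; iK ::= Add (V iK) (C 1))"

text \<open>Bounds on \<open>X l\<close> alone narrow the cell at once, those linking it to a later
  variable become lines. Node \<open>iN\<close> stands for the constant 0. Edges without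
  \<open>l\<close> as smaller endpoint belong to other eliminations, and a self loop of gain 1 says
  nothing about \<open>X l\<close>.\<close>

definition p_add :: com where
  "p_add = (IF IEq (V iAU) (V iLL) THEN
     (IF IEq (V iAV) (V iLL) THEN
        (rt ::=r RDv (RV rAB) (RSb (OfI (C 1)) (RV rAA));;
         IF BLt (RV rAA) (OfI (C 1)) THEN p_upper ELSE IF BLt (OfI (C 1)) (RV rAA) THEN p_lower ELSE Skip)
      ELSE IF IEq (V iAV) (V iN) THEN (rt ::=r RV rAB;; p_upper)
      ELSE IF ILt (V iLL) (V iAV) THEN
        p_addline (Add (V iM1) (V iAV)) (RDv (RSb (OfI (C 0)) (OfI (C 1))) (RV rAA)) (RDv (RV rAB) (RV rAA)) ELSE Skip)
     ELSE IF IEq (V iAV) (V iLL) THEN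
       (IF IEq (V iAU) (V iN) THEN (rt ::=r RDv (RSb (OfI (C 0)) (RV rAB)) (RV rAA);; p_lower)
        ELSE IF ILt (V iLL) (V iAU) THEN p_addline (V iAU) (RV rAA) (RV rAB) ELSE Skip)
     ELSE Skip)"

definition p_addcomp :: com where
  "p_addcomp = (IF ILe (C 1) (L iRH (V ia)) THEN
       (IF ILe (C 1) (L iRH (V ib)) THEN
         (rAA ::=r RDv (RL rRS (V ia)) (RSb (OfI (C 0)) (RL rRS (V ib)));;
          rAB ::=r RAd (RMl (RV rAA) (RL rRB (V ib))) (RL rRB (V ia));; p_add)
        ELSE Skip)
     ELSE Skip)"

text \<open>The parameters name the memories that hold the two nodes, so one program serves the
  composites leaving \<open>l\<close> and those entering it.\<close>

definition p_compose :: "nat \<Rightarrow> nat \<Rightarrow> com" where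
  "p_compose u v = (iAU ::= V u;; iAV ::= V v;; ia ::= Add (V ibk) (V u);; ib ::= Add (Add (V ibk) (V iM1)) (V v);; p_addcomp)"

text \<open>Composites of earlier rows are recomputed on demand. A row stands for quadratically many
  of them, but only the linearly many with endpoint \<open>l\<close> concern this
  elimination.\<close>

definition p_build :: com where
  "p_build = (iK ::= C 0;; ihp ::= C 0;; ihq ::= C 0;;
     Fr ie' (V iM) (iAU ::= L iEU (V ie');; iAV ::= L iEV (V ie');; rAA ::=r RL rEA (V ie');; rAB ::=r RL rEB (V ie');; p_add);;
     Fr ikk (V iLL) (ibk ::= L iROW (V ikk);; Fr iuu (V iM1) (p_compose iuu iLL;; p_compose iLL iuu)))"

definition p_rowentry :: com where
  "p_rowentry = (ia ::= Add (V ibk) (V iuu);;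
     IF ILe (C 1) (L iPEND (V iuu)) THEN
       (IA iRH (V ia) (C 1);; RA rRS (V ia) (RL rLS (Sub (L iPEND (V iuu)) (C 1)));; RA rRB (V ia) (RL rLB (Sub (L iPEND (V iuu)) (C 1))))
     ELSE IA iRH (V ia) (C 0))"

text \<open>The bounds of the cell are stored as lines and, as self loops, in the edge list.\<close>
definition p_storelow :: com where
  "p_storelow = (IF ILe (C 1) (V ihp) THEN
       (ia ::= Add (V ibk) (V iN);; IA iRH (V ia) (C 1);; RA rRS (V ia) (OfI (C 1));; RA rRB (V ia) (RSb (OfI (C 0)) (RV rp));;
        IA iEU (V iM) (V iLL);; IA iEV (V iM) (V iLL);; RA rEA (V iM) (OfI (C 2));; RA rEB (V iM) (RSb (OfI (C 0)) (RV rp));; iM ::= Add (V iM) (C 1))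
      ELSE Skip)"

definition p_storeup :: com where
  "p_storeup = (IF ILe (C 1) (V ihq) THEN
       (ia ::= Add (Add (V ibk) (V iM1)) (V iN);; IA iRH (V ia) (C 1);; RA rRS (V ia) (RSb (OfI (C 0)) (OfI (C 1)));; RA rRB (V ia) (RV rq);;
        IA iEU (V iM) (V iLL);; IA iEV (V iM) (V iLL);; RA rEA (V iM) (RDv (OfI (C 1)) (OfI (C 2)));; RA rEB (V iM) (RDv (RV rq) (OfI (C 2)));; iM ::= Add (V iM) (C 1))
      ELSE Skip)"

definition p_storerow :: com where
  "p_storerow = (ibk ::= L iROW (V iLL);; Fr iuu (V iG2) p_rowentry;; p_storelow;; p_storeup)"

definition p_stage :: com where
  "p_stage = (p_build;; p_search;; p_storerow)"

lemma wI_lower [simp]: "wI p_lower = {ihp}" "wR p_lower = {rp}" "wI p_upper = {ihq}" "wR p_upper = {rq}"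
  by (auto simp: p_lower_def p_upper_def)
lemma wI_add [simp]: "wI p_add = {ihp, ihq, iK, iLG}" "wR p_add = {rp, rq, rt, rLS, rLB}"
  by (auto simp: p_add_def p_addline_def)
lemma wI_compose [simp]: "wI (p_compose u v) = {iAU, iAV, ia, ib, ihp, ihq, iK, iLG}" "wR (p_compose u v) = {rAA, rAB, rp, rq, rt, rLS, rLB}"
  by (auto simp: p_compose_def p_addcomp_def)
lemma wI_build [simp]: "wI p_build = {iAU, iAV, ia, ib, ihp, ihq, iK, iLG, ie', ikk, ibk, iuu}" "wR p_build = {rAA, rAB, rp, rq, rt, rLS, rLB}"
  by (auto simp: p_build_def)
lemma wI_storerow [simp]: "wI p_storerow = {ibk, iuu, ia, iRH, iEU, iEV, iM}" "wR p_storerow = {rRS, rRB, rEA, rEB}"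
  by (auto simp: p_storerow_def p_rowentry_def p_storelow_def p_storeup_def)

text \<open>Group \<open>g < M\<close> collects the upper bounds on \<open>x g\<close>, group \<open>M + v\<close> those on \<open>- x v\<close>.\<close>
definition ov :: "nat \<Rightarrow> (nat \<Rightarrow> real) \<Rightarrow> nat \<Rightarrow> real" where
  "ov M x g = (if g < M then x g else - x (g - M))"

definition linesat :: "nat \<Rightarrow> nat \<Rightarrow> (nat \<Rightarrow> real) \<Rightarrow> line \<Rightarrow> bool" where
  "linesat M l x k \<longleftrightarrow> ov M x (fst k) < fst (snd k) * x l + snd (snd k)"

text \<open>The signs of the slopes reflect monotonicity of the edges. The groups of the constant
  node stay free; the ends of the cell are stored there.\<close>

definition goodline :: "nat \<Rightarrow> nat \<Rightarrow> line \<Rightarrow> bool" where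
  "goodline N l k \<longleftrightarrow> l < fst k \<and> fst k < N \<and> 0 < fst (snd k) \<or> N + 1 + l < fst k \<and> fst k < N + 1 + N \<and> fst (snd k) < 0"

definition lsat :: "nat \<Rightarrow> nat \<Rightarrow> (nat \<Rightarrow> real) \<Rightarrow> st \<Rightarrow> bool" where
  "lsat M l x s \<longleftrightarrow> (\<forall>i<IM s iK 0. linesat M l x (lin s i)) \<and> incell s (x l)"

text \<open>The edges that the elimination of \<open>l\<close> must account for. A self loop of gain
  1 is a condition on constants, which feasibility alone guarantees.\<close>

fun rel :: "nat \<Rightarrow> edge \<Rightarrow> bool" where
  "rel l (u, v, a, b) \<longleftrightarrow> (u = l \<and> l \<le> v \<or> v = l \<and> l \<le> u) \<and> \<not> (u = v \<and> a = 1)"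

lemma lower_sem: assumes "r = sem p_lower s"
  shows "CK r \<le> CK s + 3" "incell r x \<longleftrightarrow> incell s x \<and> RM s rt 0 < x"
  unfolding assms by (auto simp: p_lower_def incell_def)

lemma upper_sem: assumes "r = sem p_upper s"
  shows "CK r \<le> CK s + 3" "incell r x \<longleftrightarrow> incell s x \<and> x < RM s rt 0"
  unfolding assms by (auto simp: p_upper_def incell_def)

lemma be_IEq [simp]: "be (IEq a b) s \<longleftrightarrow> ie a s = ie b s" by auto

lemma be_ILt [simp]: "be (ILe (Add a (C (Suc 0))) b) s \<longleftrightarrow> ie a s < ie b s" by auto
declare be.simps(1) [simp del]

lemma add_sem:
  assumes s: "IM s iN 0 = N" "IM s iM1 0 = Suc N" "IM s iLL 0 = l" "l < N" "IM s iAU 0 = u" "IM s iAV 0 = v" "u \<le> N" "v \<le> N"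
      "RM s rAA 0 = a" "RM s rAB 0 = b" "0 < a"
    and good: "\<And>i. i < IM s iK 0 \<Longrightarrow> goodline N l (lin s i)" and r: "r = sem p_add s"
  shows "CK r \<le> CK s + 9 \<and> IM r iK 0 \<le> IM s iK 0 + 1 \<and> (\<forall>i<IM r iK 0. goodline N l (lin r i)) \<and>
    (\<forall>x. x N = 0 \<longrightarrow> (lsat (Suc N) l x r \<longleftrightarrow> lsat (Suc N) l x s \<and> (rel l (u, v, a, b) \<longrightarrow> esat x (u, v, a, b))))"
proof -
  define k where "k = IM s iK 0"
  have bound: ?thesis if c: "CK r \<le> CK s + 9" "IM r iK 0 = k" "\<And>i. lin r i = lin s i"
    "\<And>x. x N = 0 \<Longrightarrow> incell r (x l) \<longleftrightarrow> incell s (x l) \<and> (rel l (u, v, a, b) \<longrightarrow> esat x (u, v, a, b))"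
    using c good unfolding lsat_def k_def by auto
  have line: ?thesis if c: "CK r \<le> CK s + 9" "IM r iK 0 = Suc k" "\<And>i. lin r i = (if i = k then nl else lin s i)" "goodline N l nl"
    "\<And>y. incell r y \<longleftrightarrow> incell s y" "\<And>x. linesat (Suc N) l x nl \<longleftrightarrow> esat x (u, v, a, b)" "rel l (u, v, a, b)" for nl
  proof -
    have "lsat (Suc N) l x r \<longleftrightarrow> lsat (Suc N) l x s \<and> esat x (u, v, a, b)" for x
      unfolding lsat_def c(2) k_def[symmetric] using c(3,5,6) by (auto simp: less_Suc_eq)
    moreover have "\<forall>i<IM r iK 0. goodline N l (lin r i)" using good c(2,3,4) by (auto simp: less_Suc_eq k_def)
    ultimately show ?thesis using c(1,2,7) by (simp add: k_def)
  qed
  have "(u = l \<and> v = l) \<or> (u = l \<and> v = N) \<or> (u = l \<and> l < v \<and> v < N) \<or> (v = l \<and> u = N) \<or> (v = l \<and> l < u \<and> u < N) \<or>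
    (\<not> (u = l \<and> l \<le> v \<or> v = l \<and> l \<le> u) \<and> \<not> (u = l \<and> v = l))"
    using s(7,8) by arith
  then consider (self) "u = l" "v = l" | (outc) "u = l" "v = N" | (out) "u = l" "l < v" "v < N" | (inc) "v = l" "u = N" | (inn) "v = l" "l < u" "u < N"
    | (none) "\<not> rel l (u, v, a, b)" "\<not> (u = l \<and> v = l)"
    by auto
  thus ?thesis
  proof cases
    \<comment> \<open>A loop bounds \<open>X l\<close> by its fixed point
      \<open>b / (1 - a)\<close>, from above for \<open>a < 1\<close> and from below for
      \<open>a > 1\<close>.\<close>
    case self
    let ?s = "tick (setr (tick (tick (tick s))) rt 0 (b / (1 - a)))"
    have lin: "lin (tick t) i = lin t i" "incell (tick t) y = incell t y" for t i y by (simp_all add: lin_def incell_def)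
    consider "a < 1" | "1 < a" | "a = 1" by linarith
    thus ?thesis
    proof cases
      case 1
      have r': "r = sem p_upper ?s" unfolding r p_add_def using s self 1 by simp
      show ?thesis
      proof (rule bound)
        show "CK r \<le> CK s + 9" using upper_sem(1)[OF r'] by simp
        show "IM r iK 0 = k" unfolding r' by (simp add: sem_frameI k_def)
        show "lin r i = lin s i" for i unfolding r' by (rule lin_frame) (simp_all add: sem_frameI sem_frameR)
        fix x :: "nat \<Rightarrow> real"
        have "x l < b / (1 - a) \<longleftrightarrow> x l < a * x l + b" using 1 by (simp add: field_simps)
        moreover have "incell ?s (x l) = incell s (x l)" by (simp add: incell_def)
        ultimately show "incell r (x l) \<longleftrightarrow> incell s (x l) \<and> (rel l (u, v, a, b) \<longrightarrow> esat x (u, v, a, b))"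
          unfolding upper_sem(2)[OF r'] using self 1 by simp
      qed
    next
      case 2
      have r': "r = sem p_lower (tick ?s)" unfolding r p_add_def using s self 2 by simp
      show ?thesis
      proof (rule bound)
        show "CK r \<le> CK s + 9" using lower_sem(1)[OF r'] by simp
        show "IM r iK 0 = k" unfolding r' by (simp add: sem_frameI k_def)
        show "lin r i = lin s i" for i unfolding r' by (rule lin_frame) (simp_all add: sem_frameI sem_frameR)
        fix x :: "nat \<Rightarrow> real"
        have "b / (1 - a) < x l \<longleftrightarrow> x l < a * x l + b" using 2 by (simp add: field_simps)
        moreover have "incell (tick ?s) (x l) = incell s (x l)" by (simp add: incell_def)
        ultimately show "incell r (x l) \<longleftrightarrow> incell s (x l) \<and> (rel l (u, v, a, b) \<longrightarrow> esat x (u, v, a, b))"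
          unfolding lower_sem(2)[OF r'] using self 2 by simp
      qed
    next
      case 3
      have r': "r = tick ?s" unfolding r p_add_def using s self 3 by simp
      show ?thesis
        by (rule bound) (use 3 self in \<open>simp_all add: r' k_def lin_def incell_def\<close>)
    qed
  next
    case outc
    have r': "r = sem p_upper (setr (tick (tick (tick (tick s)))) rt 0 b)"
      unfolding r p_add_def using s outc by simp
    show ?thesis
    proof (rule bound)
      show "CK r \<le> CK s + 9" using upper_sem(1)[OF r'] by simp
      show "IM r iK 0 = k" unfolding r' by (simp add: sem_frameI k_def)
      show "lin r i = lin s i" for i unfolding r' by (rule lin_frame) (simp_all add: sem_frameI sem_frameR)
      fix x :: "nat \<Rightarrow> real" assume "x N = 0"
      moreover have "incell (setr (tick (tick (tick (tick s)))) rt 0 b) (x l) = incell s (x l)" by (simp add: incell_def)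
      ultimately show "incell r (x l) \<longleftrightarrow> incell s (x l) \<and> (rel l (u, v, a, b) \<longrightarrow> esat x (u, v, a, b))"
        unfolding upper_sem(2)[OF r'] using outc s by simp
    qed
  next
    \<comment> \<open>Division by \<open>a\<close> turns \<open>X l < a * X v + b\<close> into an
      upper bound on \<open>- X v\<close>, hence the group \<open>Suc N + v\<close> and the negative
      slope.\<close>
    case out
    show ?thesis
    proof (rule line[of "(Suc N + v, - 1 / a, b / a)"])
      show "CK r \<le> CK s + 9" "IM r iK 0 = Suc k" unfolding r p_add_def p_addline_def using s out by (simp_all add: k_def)
      show "lin r i = (if i = k then (Suc N + v, - 1 / a, b / a) else lin s i)" for i
        unfolding r p_add_def p_addline_def using s out by (simp add: k_def lin_def)
      show "incell r y \<longleftrightarrow> incell s y" for y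
        unfolding r p_add_def p_addline_def using s out by (simp add: incell_def)
      show "goodline N l (Suc N + v, - 1 / a, b / a)" using out s by (simp add: goodline_def)
      show "linesat (Suc N) l x (Suc N + v, - 1 / a, b / a) \<longleftrightarrow> esat x (u, v, a, b)" for x
        using s out by (simp add: linesat_def ov_def field_simps)
    qed (use out in simp)
  next
    case inc
    have r': "r = sem p_lower (setr (tick (tick (tick (tick s)))) rt 0 (- b / a))"
      unfolding r p_add_def using s inc by simp
    show ?thesis
    proof (rule bound)
      show "CK r \<le> CK s + 9" using lower_sem(1)[OF r'] by simp
      show "IM r iK 0 = k" unfolding r' by (simp add: sem_frameI k_def)
      show "lin r i = lin s i" for i unfolding r' by (rule lin_frame) (simp_all add: sem_frameI sem_frameR)
      fix x :: "nat \<Rightarrow> real" assume "x N = 0"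
      moreover have "incell (setr (tick (tick (tick (tick s)))) rt 0 (- b / a)) (x l) = incell s (x l)" by (simp add: incell_def)
      moreover have "- b / a < x l \<longleftrightarrow> 0 < a * x l + b"
      proof -
        have "- b / a < x l \<longleftrightarrow> - b < a * x l" using s by (simp add: field_simps)
        moreover have "- b < a * x l \<longleftrightarrow> 0 < a * x l + b" by auto
        ultimately show ?thesis by simp
      qed
      ultimately show "incell r (x l) \<longleftrightarrow> incell s (x l) \<and> (rel l (u, v, a, b) \<longrightarrow> esat x (u, v, a, b))"
        unfolding lower_sem(2)[OF r'] using inc s by simp
    qed
  next
    case inn
    show ?thesis
    proof (rule line[of "(u, a, b)"])
      show "CK r \<le> CK s + 9" "IM r iK 0 = Suc k" unfolding r p_add_def p_addline_def using s inn by (simp_all add: k_def)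
      show "lin r i = (if i = k then (u, a, b) else lin s i)" for i
        unfolding r p_add_def p_addline_def using s inn by (simp add: k_def lin_def)
      show "incell r y \<longleftrightarrow> incell s y" for y
        unfolding r p_add_def p_addline_def using s inn by (simp add: incell_def)
      show "goodline N l (u, a, b)" using inn s by (simp add: goodline_def)
      show "linesat (Suc N) l x (u, a, b) \<longleftrightarrow> esat x (u, v, a, b)" for x
        using s inn by (simp add: linesat_def ov_def)
    qed (use inn in simp)
  next
    case none
    have c: "CK r \<le> CK s + 9 \<and> IM r = IM s \<and> RM r = RM s"
    proof (cases "u = l")
      case True
      hence "v < l" using none by auto
      hence "v \<noteq> l" "v \<noteq> N" "\<not> l < v" using s(4) by auto
      thus ?thesis unfolding r p_add_def using s True by simp
    next
      case u: False
      show ?thesis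
      proof (cases "v = l")
        case True
        hence "u < l" using none u by auto
        hence "u \<noteq> N" "\<not> l < u" using s(4) by auto
        thus ?thesis unfolding r p_add_def using s u True by simp
      next
        case False
        thus ?thesis unfolding r p_add_def using s u by simp
      qed
    qed
    show ?thesis by (rule bound) (use c none(1) in \<open>simp_all add: k_def lin_def incell_def del: rel.simps\<close>)
  qed
qed


section \<open>Stored rows and their composites\<close>

declare be.simps(1) [simp]

text \<open>Fourier-Motzkin elimination of \<open>X k\<close> from \<open>X u < r * X k + c\<close>
  and \<open>- X v < r' * X k + c'\<close> with \<open>r' < 0\<close>: the second line says
  \<open>X k < (X v + c') / (- r')\<close>, which is substituted into the first.\<close>

definition cmp :: "nat \<Rightarrow> st \<Rightarrow> nat \<Rightarrow> nat \<Rightarrow> nat \<Rightarrow> edge" where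
  "cmp M s k u v = (let i = IM s iROW k + u; j = IM s iROW k + M + v; a = RM s rRS i / (- RM s rRS j)
     in (u, v, a, a * RM s rRB j + RM s rRB i))"

definition has :: "nat \<Rightarrow> st \<Rightarrow> nat \<Rightarrow> nat \<Rightarrow> nat \<Rightarrow> bool" where
  "has M s k u v \<longleftrightarrow> IM s iRH (IM s iROW k + u) \<noteq> 0 \<and> IM s iRH (IM s iROW k + M + v) \<noteq> 0"

definition compE :: "nat \<Rightarrow> st \<Rightarrow> nat \<Rightarrow> edge set" where
  "compE M s k = {cmp M s k u v | u v. u < M \<and> v < M \<and> has M s k u v}"

definition rowline :: "st \<Rightarrow> nat \<Rightarrow> nat \<Rightarrow> line" where
  "rowline s k g = (g, RM s rRS (IM s iROW k + g), RM s rRB (IM s iROW k + g))"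

text \<open>Lines of row \<open>k\<close> speak of later variables or of the constant only, which
  makes back substitution possible, and have the signs that the division in \<open>cmp\<close>
  relies on.\<close>

definition rowok :: "nat \<Rightarrow> st \<Rightarrow> nat \<Rightarrow> bool" where
  "rowok M s k \<longleftrightarrow> (\<forall>g<2 * M. IM s iRH (IM s iROW k + g) \<noteq> 0 \<longrightarrow>
     (if g < M then k < g \<and> 0 < fst (snd (rowline s k g)) else k + M < g \<and> fst (snd (rowline s k g)) < 0))"

definition Hrow :: "nat \<Rightarrow> st \<Rightarrow> nat \<Rightarrow> (nat \<Rightarrow> real) \<Rightarrow> bool" where
  "Hrow M s k x \<longleftrightarrow> (\<forall>g<2 * M. IM s iRH (IM s iROW k + g) \<noteq> 0 \<longrightarrow> linesat M k x (rowline s k g))"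

lemma row_frame:
  assumes "IM w iROW = IM s iROW" "IM w iRH = IM s iRH" "RM w rRS = RM s rRS" "RM w rRB = RM s rRB"
  shows "rowline w k = rowline s k" "has M w k = has M s k" "cmp M w k = cmp M s k" "rowok M w k = rowok M s k"
    "Hrow M w k = Hrow M s k" "compE M w k = compE M s k"
proof -
  show 1: "rowline w k = rowline s k" "has M w k = has M s k" "cmp M w k = cmp M s k"
    by (intro ext; simp add: rowline_def has_def cmp_def assms)+
  show "rowok M w k = rowok M s k" "compE M w k = compE M s k"
    by (simp_all add: rowok_def compE_def 1 assms)
  show "Hrow M w k = Hrow M s k" by (intro ext) (simp add: Hrow_def 1 assms)
qed

lemma compose_sem:
  assumes s: "IM s iN 0 = N" "IM s iM1 0 = Suc N" "IM s iLL 0 = l" "l < N" "IM s nu 0 = u" "IM s nv 0 = v" "u \<le> N" "v \<le> N"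
      "IM s ibk 0 = IM s iROW k" "rowok (Suc N) s k" and n: "nu \<noteq> iAU" "nv \<noteq> iAU" "nv \<noteq> iAV" "nu \<noteq> iAV" "nv \<noteq> ia" "nu \<noteq> ia"
    and good: "\<And>i. i < IM s iK 0 \<Longrightarrow> goodline N l (lin s i)" and r: "r = sem (p_compose nu nv) s"
  shows "CK r \<le> CK s + 17 \<and> IM r iK 0 \<le> IM s iK 0 + 1 \<and> (\<forall>i<IM r iK 0. goodline N l (lin r i)) \<and>
    (\<forall>x. x N = 0 \<longrightarrow> (lsat (Suc N) l x r \<longleftrightarrow> lsat (Suc N) l x s \<and> (has (Suc N) s k u v \<and> rel l (cmp (Suc N) s k u v) \<longrightarrow> esat x (cmp (Suc N) s k u v))))"
proof -
  define i where "i = IM s iROW k + u"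
  define j where "j = IM s iROW k + Suc N + v"
  define s1 where "s1 = sem (iAU ::= V nu;; iAV ::= V nv;; ia ::= Add (V ibk) (V nu);; ib ::= Add (Add (V ibk) (V iM1)) (V nv)) s"
  have s1: "IM s1 iAU 0 = u" "IM s1 iAV 0 = v" "IM s1 ia 0 = i" "IM s1 ib 0 = j" "RM s1 = RM s" "CK s1 = CK s + 4"
     "\<And>n. n \<notin> {iAU, iAV, ia, ib} \<Longrightarrow> IM s1 n = IM s n"
    using s n by (auto simp: s1_def i_def j_def add.assoc)
  have rs1: "r = sem p_addcomp s1" by (simp add: r p_compose_def s1_def)
  have ls: "lsat (Suc N) l x t = lsat (Suc N) l x s" if "IM t iK = IM s iK" "IM t iLG = IM s iLG" "RM t rLS = RM s rLS" "RM t rLB = RM s rLB"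
     "IM t ihp = IM s ihp" "IM t ihq = IM s ihq" "RM t rp = RM s rp" "RM t rq = RM s rq" for x t
    unfolding lsat_def using that by (simp add: lin_def incell_def)
  show ?thesis
  proof (cases "has (Suc N) s k u v")
    case True
    hence h: "IM s iRH i \<noteq> 0" "IM s iRH j \<noteq> 0" by (auto simp: has_def i_def j_def)
    define a where "a = RM s rRS i / (- RM s rRS j)"
    define b where "b = a * RM s rRB j + RM s rRB i"
    have c: "cmp (Suc N) s k u v = (u, v, a, b)" by (simp add: cmp_def Let_def a_def b_def i_def j_def)
    define s2 where "s2 = setr (tick (setr (tick (tick (tick s1))) rAA 0 a)) rAB 0 b"
    have r': "r = sem p_add s2"
      unfolding rs1 p_addcomp_def s2_def using h s1 by (simp add: a_def b_def)
    have "0 < RM s rRS i" using s(10)[unfolded rowok_def, rule_format, of u] h(1) s(7) by (simp add: rowline_def i_def)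
    moreover have "RM s rRS j < 0" using s(10)[unfolded rowok_def, rule_format, of "Suc N + v"] h(2) s(8) by (simp add: rowline_def j_def add.assoc)
    ultimately have "0 < a" by (simp add: a_def divide_pos_neg)
    have l2: "lin s2 i = lin s i" for i by (rule lin_frame) (simp_all add: s2_def s1)
    have k2: "IM s2 n = IM s n" if "n \<notin> {iAU, iAV, ia, ib}" for n using that by (simp add: s2_def s1)
    have "IM s2 iAU 0 = u" "IM s2 iAV 0 = v" "RM s2 rAA 0 = a" "RM s2 rAB 0 = b" "CK s2 = CK s + 8" by (simp_all add: s2_def s1)
    hence "CK r \<le> CK s2 + 9 \<and> IM r iK 0 \<le> IM s2 iK 0 + 1 \<and> (\<forall>i<IM r iK 0. goodline N l (lin r i)) \<and>
    (\<forall>x. x N = 0 \<longrightarrow> (lsat (Suc N) l x r \<longleftrightarrow> lsat (Suc N) l x s2 \<and> (rel l (u, v, a, b) \<longrightarrow> esat x (u, v, a, b))))"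
      by (intro add_sem[OF _ _ _ s(4) _ _ s(7,8) _ _ \<open>0 < a\<close> _ r']) (use s good in \<open>simp_all add: l2 k2\<close>)
    moreover have "lsat (Suc N) l x s2 = lsat (Suc N) l x s" for x by (rule ls) (simp_all add: s2_def s1)
    ultimately show ?thesis using True \<open>CK s2 = CK s + 8\<close> unfolding c by (simp add: k2 del: rel.simps esat.simps)
  next
    case False
    have r': "CK r \<le> CK s + 6 \<and> (\<forall>n. n \<notin> {iAU, iAV, ia, ib} \<longrightarrow> IM r n = IM s n) \<and> RM r = RM s"
      unfolding rs1 p_addcomp_def using False s1 by (auto simp: has_def i_def j_def)
    have "lin r i = lin s i" for i by (rule lin_frame) (use r' in auto)
    thus ?thesis using r' good False ls[of r] by auto
  qed
qed

text \<open>At most one line arises per edge and two per earlier row and node. This is where the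
  pool size O(n + d^2) comes from.\<close>

lemma build_sem:
  assumes s: "IM s iN 0 = N" "IM s iM1 0 = Suc N" "IM s iLL 0 = l" "l < N" "IM s iM 0 = m" and E: "EUV s N"
    and row: "\<And>k. k < l \<Longrightarrow> rowok (Suc N) s k" and r: "r = sem p_build s"
  shows "CK r \<le> CK s + 5 + 14 * m + l * (3 + 35 * Suc N) \<and> IM r iK 0 \<le> m + 2 * l * Suc N \<and> (\<forall>i<IM r iK 0. goodline N l (lin r i)) \<and>
    (\<forall>x. x N = 0 \<longrightarrow> (lsat (Suc N) l x r \<longleftrightarrow> (\<forall>e\<in>edges s \<union> (\<Union>k<l. compE (Suc N) s k). rel l e \<longrightarrow> esat x e)))"
proof -
  let ?M = "Suc N"
  let ?body1 = "iAU ::= L iEU (V ie');; iAV ::= L iEV (V ie');; rAA ::=r RL rEA (V ie');; rAB ::=r RL rEB (V ie');; p_add"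
  let ?body2 = "p_compose iuu iLL;; p_compose iLL iuu"
  define s1 where "s1 = sem (iK ::= C 0;; ihp ::= C 0;; ihq ::= C 0) s"
  define s2 where "s2 = sem (Fr ie' (V iM) ?body1) s1"
  have r1: "r = sem (Fr ikk (V iLL) (ibk ::= L iROW (V ikk);; Fr iuu (V iM1) ?body2)) s2"
    using r by (simp add: p_build_def s1_def s2_def)
  have s1: "IM s1 iK 0 = 0" "IM s1 ihp 0 = 0" "IM s1 ihq 0 = 0" "CK s1 = CK s + 3" "RM s1 = RM s" "\<And>n. n \<notin> {iK, ihp, ihq} \<Longrightarrow> IM s1 n = IM s n"
    by (auto simp: s1_def)
  have lt: "lsat ?M l x (seti (tick t) n 0 i) = lsat ?M l x t" "lin (seti (tick t) n 0 i) j = lin t j" if "n \<notin> {iK, ihp, ihq, iLG}" for x t n i j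
    using that unfolding lsat_def by (simp_all add: lin_def incell_def)
  define ed where "ed e = (IM s iEU e, IM s iEV e, RM s rEA e, RM s rEB e)" for e
  have edges: "edges s = ed ` {..<m}" using s by (simp add: edges_def ed_def[abs_def])
  define Q where "Q i t \<longleftrightarrow> CK t \<le> CK s + 4 + 14 * i \<and> IM t iK 0 \<le> i \<and> (\<forall>j<IM t iK 0. goodline N l (lin t j)) \<and>
    (\<forall>x. x N = 0 \<longrightarrow> (lsat ?M l x t \<longleftrightarrow> (\<forall>e<i. rel l (ed e) \<longrightarrow> esat x (ed e))))" for i t
  have Q2: "Q m s2"
    unfolding s2_def
  proof (rule Fr_rule[where Q = Q])
    show "Q 0 (tick s1)" by (simp add: Q_def s1 lsat_def incell_def)
  next
    fix i t
    assume i: "i < ie (V iM) s1" and f: "frame (insert ie' (wI ?body1)) (wR ?body1) s1 t" and q: "Q i t"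
    have im: "i < m" using i s s1 by simp
    have fr: "IM t iN = IM s iN" "IM t iM1 = IM s iM1" "IM t iLL = IM s iLL" "IM t iEU = IM s iEU" "IM t iEV = IM s iEV" "RM t rEA = RM s rEA" "RM t rEB = RM s rEB"
      using frameI[OF f] frameR[OF f] s1 by auto
    let ?r = "sem ?body1 (seti (tick t) ie' 0 i)"
    define t1 where "t1 = sem (iAU ::= L iEU (V ie');; iAV ::= L iEV (V ie');; rAA ::=r RL rEA (V ie');; rAB ::=r RL rEB (V ie')) (seti (tick t) ie' 0 i)"
    have r': "?r = sem p_add t1" by (simp add: t1_def)
    have t1: "lin t1 j = lin t j" "lsat ?M l x t1 = lsat ?M l x t" "CK t1 = CK t + 5" "IM t1 iK 0 = IM t iK 0" for j x
      by (simp_all add: t1_def lsat_def lin_def incell_def)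
    have uv: "IM s iEU i < N" "IM s iEV i < N" "0 < RM s rEA i" using E im s by (auto simp: EUV_def)
    have "CK ?r \<le> CK t1 + 9 \<and> IM ?r iK 0 \<le> IM t1 iK 0 + 1 \<and> (\<forall>i<IM ?r iK 0. goodline N l (lin ?r i)) \<and>
    (\<forall>x. x N = 0 \<longrightarrow> (lsat ?M l x ?r \<longleftrightarrow> lsat ?M l x t1 \<and> (rel l (ed i) \<longrightarrow> esat x (ed i))))"
      unfolding ed_def
      by (rule add_sem[OF _ _ _ s(4) _ _ _ _ _ _ uv(3) _ r']) (use uv s fr q in \<open>auto simp: t1_def[THEN arg_cong, of "\<lambda>s. IM s"] t1_def[THEN arg_cong, of "\<lambda>s. RM s"] t1 Q_def\<close>)
    thus "Q (Suc i) ?r" using q unfolding Q_def t1 by (auto simp: less_Suc_eq)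
  qed (use s1 s in simp)
  have k2: "n \<notin> insert ie' (wI ?body1) \<union> {iK, ihp, ihq} \<Longrightarrow> IM s2 n = IM s n" "x \<notin> wR ?body1 \<Longrightarrow> RM s2 x = RM s x" for n x
    unfolding s2_def using sem_frameI[of n "Fr ie' (V iM) ?body1" s1] sem_frameR[of x "Fr ie' (V iM) ?body1" s1] s1 by auto
  define P where "P k u v x \<longleftrightarrow> (has ?M s k u v \<and> rel l (cmp ?M s k u v) \<longrightarrow> esat x (cmp ?M s k u v))" for k u v x
  define Pk where "Pk k x \<longleftrightarrow> (\<forall>e\<in>compE ?M s k. rel l e \<longrightarrow> esat x e)" for k x
  \<comment> \<open>A composite that is relevant for \<open>l\<close> has \<open>l\<close> as an
    endpoint, so the two families built by the loop exhaust all relevant ones.\<close>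
  have PPk: "(\<forall>u<?M. P k u l x \<and> P k l u x) \<longleftrightarrow> Pk k x" for k x
  proof
    assume a: "\<forall>u<?M. P k u l x \<and> P k l u x"
    show "Pk k x" unfolding Pk_def
    proof (intro ballI impI)
      fix e assume e: "e \<in> compE ?M s k" "rel l e"
      then obtain u v where uv: "e = cmp ?M s k u v" "u < ?M" "v < ?M" "has ?M s k u v" by (auto simp: compE_def)
      have "u = l \<or> v = l" using e(2) uv(1) by (auto simp: cmp_def Let_def)
      thus "esat x e" using a uv e(2) by (auto simp: P_def)
    qed
  next
    assume Pk: "Pk k x"
    have "l < ?M" using s(4) by simp
    hence "cmp ?M s k u v \<in> compE ?M s k" if "has ?M s k u v" "u < ?M" "v < ?M" for u v
      using that unfolding compE_def by blast
    thus "\<forall>u<?M. P k u l x \<and> P k l u x" using Pk \<open>l < ?M\<close> unfolding Pk_def P_def by blast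
  qed
  define Q' where "Q' k t \<longleftrightarrow> CK t \<le> CK s + 5 + 14 * m + k * (3 + 35 * ?M) \<and> IM t iK 0 \<le> m + 2 * k * ?M \<and> (\<forall>j<IM t iK 0. goodline N l (lin t j)) \<and>
    (\<forall>x. x N = 0 \<longrightarrow> (lsat ?M l x t \<longleftrightarrow> (\<forall>e\<in>edges s. rel l e \<longrightarrow> esat x e) \<and> (\<forall>j<k. Pk j x)))" for k t
  have "Q' l r"
    unfolding r1
  proof (rule Fr_rule[where Q = Q'])
    have "lsat ?M l x (tick s2) = lsat ?M l x s2" "lin (tick s2) j = lin s2 j" for x j by (simp_all add: lsat_def lin_def incell_def)
    thus "Q' 0 (tick s2)" using Q2 unfolding Q'_def Q_def edges by auto
  next
    fix k t
    assume k: "k < ie (V iLL) s2"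
      and f: "frame (insert ikk (wI (ibk ::= L iROW (V ikk);; Fr iuu (V iM1) ?body2))) (wR (ibk ::= L iROW (V ikk);; Fr iuu (V iM1) ?body2)) s2 t"
      and q: "Q' k t"
    have kl: "k < l" using k k2 s by simp
    have fr: "IM t n = IM s n" if "n \<notin> {iAU, iAV, ia, ib, ihp, ihq, iK, iLG, iuu, ibk, ikk, ie'}" for n
      using frameI[OF f, of n] k2(1)[of n] that by auto
    have frR: "RM t rRS = RM s rRS" "RM t rRB = RM s rRB" using frameR[OF f] k2(2) by auto
    let ?t1 = "seti (tick (seti (tick t) ikk 0 k)) ibk 0 (IM s iROW k)"
    have e: "sem (ibk ::= L iROW (V ikk);; Fr iuu (V iM1) ?body2) (seti (tick t) ikk 0 k) = sem (Fr iuu (V iM1) ?body2) ?t1"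
      by (simp add: fr)
    define R where "R u t' \<longleftrightarrow> CK t' \<le> CK t + 3 + 35 * u \<and> IM t' iK 0 \<le> IM t iK 0 + 2 * u \<and> (\<forall>j<IM t' iK 0. goodline N l (lin t' j)) \<and>
      (\<forall>x. x N = 0 \<longrightarrow> (lsat ?M l x t' \<longleftrightarrow> lsat ?M l x t \<and> (\<forall>u'<u. P k u' l x \<and> P k l u' x)))" for u t'
    have "R ?M (sem (Fr iuu (V iM1) ?body2) ?t1)"
    proof (rule Fr_rule[where Q = R])
      show "R 0 (tick ?t1)" using q unfolding R_def Q'_def by (simp add: lsat_def lin_def incell_def)
    next
      fix u t'
      assume u: "u < ie (V iM1) ?t1" and f': "frame (insert iuu (wI ?body2)) (wR ?body2) ?t1 t'" and R: "R u t'"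
      have uN: "u < ?M" using u s by (simp add: fr)
      have fr': "IM t' n = IM s n" if "n \<notin> {iAU, iAV, ia, ib, ihp, ihq, iK, iLG, iuu, ibk, ikk, ie'}" for n
        using frameI[OF f', of n] fr[of n] that by auto
      have frR': "RM t' rRS = RM s rRS" "RM t' rRB = RM s rRB" using frameR[OF f'] frR by auto
      have bk: "IM t' ibk 0 = IM s iROW k" using frameI[OF f', of ibk] by simp
      have same: "has ?M w k = has ?M s k" "cmp ?M w k = cmp ?M s k" "rowok ?M w k"
        if "IM w iROW = IM s iROW" "IM w iRH = IM s iRH" "RM w rRS = RM s rRS" "RM w rRB = RM s rRB" for w
        using row[OF kl] row_frame[OF that] by simp_all
      let ?a = "seti (tick t') iuu 0 u"
      let ?b = "sem (p_compose iuu iLL) ?a"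
      let ?c = "sem (p_compose iLL iuu) ?b"
      have sa: "has ?M ?a k = has ?M s k" "cmp ?M ?a k = cmp ?M s k" "rowok ?M ?a k"
        by (rule same; simp add: fr' frR')+
      have la: "lsat ?M l x ?a = lsat ?M l x t'" "lin ?a j = lin t' j" for x j by (simp_all add: lsat_def lin_def incell_def)
      have b: "CK ?b \<le> CK ?a + 17 \<and> IM ?b iK 0 \<le> IM ?a iK 0 + 1 \<and> (\<forall>i<IM ?b iK 0. goodline N l (lin ?b i)) \<and>
    (\<forall>x. x N = 0 \<longrightarrow> (lsat ?M l x ?b \<longleftrightarrow> lsat ?M l x ?a \<and> (has ?M ?a k u l \<and> rel l (cmp ?M ?a k u l) \<longrightarrow> esat x (cmp ?M ?a k u l))))"
        by (rule compose_sem) (use s uN sa R in \<open>auto simp: fr' bk la R_def\<close>)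
      have kb: "IM ?b n = IM ?a n" if "n \<notin> wI (p_compose iuu iLL)" for n using sem_frameI[OF that] .
      have kbR: "RM ?b n = RM ?a n" if "n \<notin> wR (p_compose iuu iLL)" for n using sem_frameR[OF that] .
      have sb: "has ?M ?b k = has ?M s k" "cmp ?M ?b k = cmp ?M s k" "rowok ?M ?b k"
        by (rule same; simp add: kb kbR fr' frR')+
      have c: "CK ?c \<le> CK ?b + 17 \<and> IM ?c iK 0 \<le> IM ?b iK 0 + 1 \<and> (\<forall>i<IM ?c iK 0. goodline N l (lin ?c i)) \<and>
    (\<forall>x. x N = 0 \<longrightarrow> (lsat ?M l x ?c \<longleftrightarrow> lsat ?M l x ?b \<and> (has ?M ?b k l u \<and> rel l (cmp ?M ?b k l u) \<longrightarrow> esat x (cmp ?M ?b k l u))))"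
        by (rule compose_sem) (use s uN sb b in \<open>auto simp: kb fr' bk\<close>)
      have ls: "lsat ?M l x ?c \<longleftrightarrow> lsat ?M l x t' \<and> P k u l x \<and> P k l u x" if "x N = 0" for x
        using b c that unfolding la sa sb P_def by blast
      have "IM ?a iK 0 = IM t' iK 0" "CK ?a = CK t' + 1" by simp_all
      hence cc: "CK ?c \<le> CK t' + 35" "IM ?c iK 0 \<le> IM t' iK 0 + 2" using b c by linarith+
      have "\<forall>x. x N = 0 \<longrightarrow> (lsat ?M l x ?c \<longleftrightarrow> lsat ?M l x t \<and> (\<forall>u'<Suc u. P k u' l x \<and> P k l u' x))"
        using R ls unfolding R_def by (auto simp: less_Suc_eq)
      moreover have "\<forall>i<IM ?c iK 0. goodline N l (lin ?c i)" using c by blast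
      ultimately have "R (Suc u) ?c" using R cc unfolding R_def by simp
      thus "R (Suc u) (sem ?body2 ?a)" by simp
    qed (use s in \<open>simp add: fr\<close>)
    hence R: "CK (sem (Fr iuu (V iM1) ?body2) ?t1) \<le> CK t + 3 + 35 * ?M" "IM (sem (Fr iuu (V iM1) ?body2) ?t1) iK 0 \<le> IM t iK 0 + 2 * ?M"
      "\<forall>j<IM (sem (Fr iuu (V iM1) ?body2) ?t1) iK 0. goodline N l (lin (sem (Fr iuu (V iM1) ?body2) ?t1) j)"
      "\<And>x. x N = 0 \<Longrightarrow> (lsat ?M l x (sem (Fr iuu (V iM1) ?body2) ?t1) \<longleftrightarrow> lsat ?M l x t \<and> Pk k x)"
      unfolding R_def PPk by blast+
    have "\<forall>x. x N = 0 \<longrightarrow> (lsat ?M l x (sem (Fr iuu (V iM1) ?body2) ?t1) \<longleftrightarrow> (\<forall>e\<in>edges s. rel l e \<longrightarrow> esat x e) \<and> (\<forall>j<Suc k. Pk j x))"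
      using R(4) q unfolding Q'_def by (auto simp: less_Suc_eq)
    thus "Q' (Suc k) (sem (ibk ::= L iROW (V ikk);; Fr iuu (V iM1) ?body2) (seti (tick t) ikk 0 k))"
      unfolding e Q'_def using q R(1-3) unfolding Q'_def by simp
  qed (use k2 s in simp)
  thus ?thesis unfolding Q'_def Pk_def by blast
qed

lemma rowentry_sem:
  assumes "IM t ibk 0 = b" and r: "r = sem p_rowentry (seti (tick t) iuu 0 g)"
  shows "CK r \<le> CK t + 6 \<and> (\<forall>j. j \<noteq> b + g \<longrightarrow> IM r iRH j = IM t iRH j \<and> RM r rRS j = RM t rRS j \<and> RM r rRB j = RM t rRB j) \<and>
    (IM r iRH (b + g) \<noteq> 0 \<longleftrightarrow> IM t iPEND g \<noteq> 0) \<and>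
    (IM t iPEND g \<noteq> 0 \<longrightarrow> RM r rRS (b + g) = RM t rLS (IM t iPEND g - 1) \<and> RM r rRB (b + g) = RM t rLB (IM t iPEND g - 1))"
  unfolding r p_rowentry_def using assms(1) by auto

text \<open>In the row the ends of the cell are lines of the constant groups,
  \<open>0 < x - p\<close> and \<open>0 < - x + q\<close>. Edge endpoints stay below
  \<open>N\<close>, so for the tests they become self loops instead: \<open>x < 2 * x - p\<close>
  means \<open>p < x\<close>, and \<open>x < x / 2 + q / 2\<close> means
  \<open>x < q\<close>.\<close>

lemma storerow_sem:
  assumes s: "IM s iN 0 = N" "IM s iM1 0 = Suc N" "IM s iG2 0 = 2 * Suc N" "IM s iLL 0 = l" "l < N" "IM s iROW l = b"
    and P: "IM s iPEND N = 0" "IM s iPEND (Suc N + N) = 0" and r: "r = sem p_storerow s"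
  shows "CK r \<le> CK s + 12 * Suc N + 30"
    and "\<And>j. j < b \<or> b + 2 * Suc N \<le> j \<Longrightarrow> IM r iRH j = IM s iRH j \<and> RM r rRS j = RM s rRS j \<and> RM r rRB j = RM s rRB j"
    and "\<And>g. g < 2 * Suc N \<Longrightarrow> (IM r iRH (b + g) \<noteq> 0 \<longleftrightarrow> IM s iPEND g \<noteq> 0 \<or> g = N \<and> IM s ihp 0 \<noteq> 0 \<or> g = Suc N + N \<and> IM s ihq 0 \<noteq> 0) \<and>
      (IM r iRH (b + g) \<noteq> 0 \<longrightarrow> rowline r l g = (if g = N then (N, 1, - RM s rp 0) else if g = Suc N + N then (Suc N + N, -1, RM s rq 0)
         else (g, RM s rLS (IM s iPEND g - 1), RM s rLB (IM s iPEND g - 1))))"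
    and "edges r = edges s \<union> (if IM s ihp 0 \<noteq> 0 then {(l, l, 2, - RM s rp 0)} else {}) \<union> (if IM s ihq 0 \<noteq> 0 then {(l, l, 1 / 2, RM s rq 0 / 2)} else {})"
    and "EUV s N \<Longrightarrow> EUV r N" and "IM r iM 0 \<le> IM s iM 0 + 2"
proof -
  let ?G = "2 * Suc N"
  define s1 where "s1 = sem (Fr iuu (V iG2) p_rowentry) (sem (ibk ::= L iROW (V iLL)) s)"
  define s2 where "s2 = sem p_storelow s1"
  have r2: "r = sem p_storeup s2" unfolding r p_storerow_def s2_def s1_def by simp
  have k1: "IM s1 n = IM s n" if "n \<notin> {iuu, ia, iRH, ibk}" for n
    unfolding s1_def using that by (simp add: sem_frameI p_rowentry_def)
  have k1R: "RM s1 n = RM s n" if "n \<notin> {rRS, rRB}" for n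
    unfolding s1_def using that by (simp add: sem_frameR p_rowentry_def)
  have b1: "IM s1 ibk 0 = b" unfolding s1_def using s by (simp add: sem_frameI p_rowentry_def)
  define Q where "Q i t \<longleftrightarrow> CK t \<le> CK s + 2 + 6 * i \<and> (\<forall>j. j < b \<or> b + i \<le> j \<longrightarrow> IM t iRH j = IM s iRH j \<and> RM t rRS j = RM s rRS j \<and> RM t rRB j = RM s rRB j) \<and>
    (\<forall>g<i. (IM t iRH (b + g) \<noteq> 0 \<longleftrightarrow> IM s iPEND g \<noteq> 0) \<and>
      (IM s iPEND g \<noteq> 0 \<longrightarrow> RM t rRS (b + g) = RM s rLS (IM s iPEND g - 1) \<and> RM t rRB (b + g) = RM s rLB (IM s iPEND g - 1)))" for i and t :: st
  have Q1: "Q ?G s1"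
    unfolding s1_def
  proof (rule Fr_rule[where Q = Q])
    show "Q 0 (tick (sem (ibk ::= L iROW (V iLL)) s))" by (simp add: Q_def)
  next
    fix i t
    assume f: "frame (insert iuu (wI p_rowentry)) (wR p_rowentry) (sem (ibk ::= L iROW (V iLL)) s) t" and q: "Q i t"
    have fr: "IM t ibk 0 = b" "IM t iPEND = IM s iPEND" "RM t rLS = RM s rLS" "RM t rLB = RM s rLB"
      using frameI[OF f] frameR[OF f] s by (auto simp: p_rowentry_def)
    from rowentry_sem[OF fr(1) refl, of i] q show "Q (Suc i) (sem p_rowentry (seti (tick t) iuu 0 i))"
      unfolding Q_def by (auto simp: less_Suc_eq fr)
  qed (use s in simp)
  define hp where "hp \<longleftrightarrow> IM s ihp 0 \<noteq> 0"
  define hq where "hq \<longleftrightarrow> IM s ihq 0 \<noteq> 0"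
  define m where "m = IM s iM 0"
  define m2 where "m2 = (if hp then Suc m else m)"
  have s2: "CK s2 \<le> CK s1 + 10" "IM s2 iRH = (if hp then (IM s1 iRH)(b + N := 1) else IM s1 iRH)"
    "RM s2 rRS = (if hp then (RM s1 rRS)(b + N := 1) else RM s1 rRS)" "RM s2 rRB = (if hp then (RM s1 rRB)(b + N := - RM s rp 0) else RM s1 rRB)"
    "IM s2 iEU = (if hp then (IM s iEU)(m := l) else IM s iEU)" "IM s2 iEV = (if hp then (IM s iEV)(m := l) else IM s iEV)"
    "RM s2 rEA = (if hp then (RM s rEA)(m := 2) else RM s rEA)" "RM s2 rEB = (if hp then (RM s rEB)(m := - RM s rp 0) else RM s rEB)"
    "IM s2 iM 0 = m2" "IM s2 ibk 0 = b" "IM s2 iN 0 = N" "IM s2 iM1 0 = Suc N" "IM s2 iLL 0 = l" "RM s2 rq 0 = RM s rq 0" "IM s2 ihq 0 = IM s ihq 0"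
    unfolding s2_def p_storelow_def using s k1 k1R b1 by (auto simp: hp_def m_def m2_def)
  have r3: "CK r \<le> CK s2 + 10" "IM r iRH = (if hq then (IM s2 iRH)(b + Suc N + N := 1) else IM s2 iRH)"
    "RM r rRS = (if hq then (RM s2 rRS)(b + Suc N + N := - 1) else RM s2 rRS)" "RM r rRB = (if hq then (RM s2 rRB)(b + Suc N + N := RM s rq 0) else RM s2 rRB)"
    "IM r iEU = (if hq then (IM s2 iEU)(m2 := l) else IM s2 iEU)" "IM r iEV = (if hq then (IM s2 iEV)(m2 := l) else IM s2 iEV)"
    "RM r rEA = (if hq then (RM s2 rEA)(m2 := 1 / 2) else RM s2 rEA)" "RM r rEB = (if hq then (RM s2 rEB)(m2 := RM s rq 0 / 2) else RM s2 rEB)"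
    "IM r iM 0 = (if hq then Suc m2 else m2)"
    unfolding r2 p_storeup_def using s2 by (auto simp: hq_def add.assoc)
  have row: "IM r iROW l = b" unfolding r by (simp add: sem_frameI s)
  show "CK r \<le> CK s + 12 * Suc N + 30" using r3(1) s2(1) Q1 unfolding Q_def by simp
  show "IM r iRH j = IM s iRH j \<and> RM r rRS j = RM s rRS j \<and> RM r rRB j = RM s rRB j" if j: "j < b \<or> b + 2 * Suc N \<le> j" for j
  proof -
    have "IM s1 iRH j = IM s iRH j \<and> RM s1 rRS j = RM s rRS j \<and> RM s1 rRB j = RM s rRB j" using Q1 j unfolding Q_def by blast
    moreover have "j \<noteq> b + N" "j \<noteq> b + Suc N + N" using j by auto
    ultimately show ?thesis by (simp add: r3 s2)
  qed
  show "(IM r iRH (b + g) \<noteq> 0 \<longleftrightarrow> IM s iPEND g \<noteq> 0 \<or> g = N \<and> IM s ihp 0 \<noteq> 0 \<or> g = Suc N + N \<and> IM s ihq 0 \<noteq> 0) \<and>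
      (IM r iRH (b + g) \<noteq> 0 \<longrightarrow> rowline r l g = (if g = N then (N, 1, - RM s rp 0) else if g = Suc N + N then (Suc N + N, -1, RM s rq 0)
         else (g, RM s rLS (IM s iPEND g - 1), RM s rLB (IM s iPEND g - 1))))" if g: "g < 2 * Suc N" for g
  proof -
    have e: "(IM s1 iRH (b + g) \<noteq> 0 \<longleftrightarrow> IM s iPEND g \<noteq> 0) \<and>
      (IM s iPEND g \<noteq> 0 \<longrightarrow> RM s1 rRS (b + g) = RM s rLS (IM s iPEND g - 1) \<and> RM s1 rRB (b + g) = RM s rLB (IM s iPEND g - 1))"
      using Q1 g unfolding Q_def by blast
    consider "g = N" | "g = Suc N + N" | "g \<noteq> N" "g \<noteq> Suc N + N" by blast
    thus ?thesis
    proof cases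
      case 1
      have "IM s1 iRH (b + N) = 0" using e P(1) 1 by simp
      thus ?thesis using 1 P(1) by (simp add: rowline_def row r3 s2 hp_def)
    next
      case 2
      have "IM s1 iRH (b + (Suc N + N)) = 0" using e P(2) 2 by simp
      thus ?thesis using 2 P(2) by (simp add: rowline_def row r3 s2 hq_def add.assoc)
    next
      case 3
      hence n: "b + g \<noteq> b + N" "b + g \<noteq> b + Suc N + N" by auto
      hence "IM r iRH (b + g) = IM s1 iRH (b + g)" "RM r rRS (b + g) = RM s1 rRS (b + g)" "RM r rRB (b + g) = RM s1 rRB (b + g)"
        by (simp_all add: r3 s2)
      thus ?thesis using e 3 by (simp add: rowline_def row)
    qed
  qed
  have em: "edges t = (\<lambda>e. (IM t iEU e, IM t iEV e, RM t rEA e, RM t rEB e)) ` {..<IM t iM 0}" for t by (simp add: edges_def)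
  have e2: "edges s2 = edges s \<union> (if hp then {(l, l, 2, - RM s rp 0)} else {})"
    unfolding em[of s2] em[of s] s2 m2_def m_def[symmetric] by (cases hp) (auto simp: lessThan_Suc intro!: image_cong)
  have e3: "edges r = edges s2 \<union> (if hq then {(l, l, 1 / 2, RM s rq 0 / 2)} else {})"
    unfolding em[of r] em[of s2] r3 s2(9) by (cases hq) (auto simp: lessThan_Suc intro!: image_cong)
  show "edges r = edges s \<union> (if IM s ihp 0 \<noteq> 0 then {(l, l, 2, - RM s rp 0)} else {}) \<union> (if IM s ihq 0 \<noteq> 0 then {(l, l, 1 / 2, RM s rq 0 / 2)} else {})"
    unfolding e3 e2 by (simp add: hp_def hq_def)
  show "IM r iM 0 \<le> IM s iM 0 + 2" by (simp add: r3 m2_def m_def)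
  have euv: "EUV t N \<longleftrightarrow> (\<forall>(u, v, a, b)\<in>edges t. u < N \<and> v < N \<and> 0 < a)" for t by (auto simp: EUV_def edges_def)
  show "EUV r N" if "EUV s N" using that s(5) unfolding euv e3 e2 by (auto split: if_splits)
qed

lemma row_frame_local:
  assumes "IM w iROW k = IM s iROW k"
    and "\<And>g. g < 2 * M \<Longrightarrow> IM w iRH (IM s iROW k + g) = IM s iRH (IM s iROW k + g) \<and> RM w rRS (IM s iROW k + g) = RM s rRS (IM s iROW k + g) \<and>
      RM w rRB (IM s iROW k + g) = RM s rRB (IM s iROW k + g)"
  shows "rowok M w k = rowok M s k" "Hrow M w k = Hrow M s k" "compE M w k = compE M s k"
proof -
  have 1: "rowline w k g = rowline s k g" if "g < 2 * M" for g using assms(2)[OF that] by (simp add: rowline_def assms(1))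
  have 2: "cmp M w k u v = cmp M s k u v" "has M w k u v = has M s k u v" if "u < M" "v < M" for u v
    using assms(2)[of u] assms(2)[of "M + v"] that by (simp_all add: cmp_def has_def assms(1) add.assoc)
  show "rowok M w k = rowok M s k" using assms(2) 1 by (simp add: rowok_def assms(1))
  show "Hrow M w k = Hrow M s k" using assms(2) 1 by (intro ext) (simp add: Hrow_def assms(1))
  show "compE M w k = compE M s k" unfolding compE_def using 2 by (intro Collect_cong) metis
qed

text \<open>The sound half of Fourier-Motzkin elimination. Its other half is the choice of a value
  in back substitution.\<close>

lemma comp_sat:
  assumes ok: "rowok M s k" and H: "Hrow M s k x" and e: "e \<in> compE M s k"
  shows "esat x e"
proof -
  obtain u v where uv: "u < M" "v < M" "has M s k u v" "e = cmp M s k u v" using e by (auto simp: compE_def)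
  define i where "i = IM s iROW k + u"
  define j where "j = IM s iROW k + (M + v)"
  have h: "IM s iRH i \<noteq> 0" "IM s iRH j \<noteq> 0" using uv(3) by (auto simp: has_def i_def j_def add.assoc)
  have s1: "0 < RM s rRS i" using ok[unfolded rowok_def, rule_format, of u] h(1) uv(1) by (simp add: rowline_def i_def)
  have s2: "RM s rRS j < 0" using ok[unfolded rowok_def, rule_format, of "M + v"] h(2) uv(2) by (simp add: rowline_def j_def)
  have l1: "x u < RM s rRS i * x k + RM s rRB i"
    using H[unfolded Hrow_def, rule_format, of u] h(1) uv(1) by (simp add: linesat_def ov_def rowline_def i_def)
  have l2: "- x v < RM s rRS j * x k + RM s rRB j"
    using H[unfolded Hrow_def, rule_format, of "M + v"] h(2) uv(2) by (simp add: linesat_def ov_def rowline_def j_def)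
  have "x k < (x v + RM s rRB j) / (- RM s rRS j)" using l2 s2 by (simp add: field_simps)
  hence "RM s rRS i * x k < RM s rRS i * ((x v + RM s rRB j) / (- RM s rRS j))" using s1 by (rule mult_strict_left_mono)
  hence "x u < RM s rRS i * ((x v + RM s rRB j) / (- RM s rRS j)) + RM s rRB i" using l1 by linarith
  also have "\<dots> = RM s rRS i / (- RM s rRS j) * x v + (RM s rRS i / (- RM s rRS j) * RM s rRB j + RM s rRB i)"
    using s2 by (simp add: field_simps)
  finally show ?thesis unfolding uv(4) cmp_def Let_def by (simp add: i_def j_def add.assoc)
qed

text \<open>Rows are complete for what they replace: row \<open>k\<close> implies every edge
  relevant for \<open>k\<close>, original or composed from earlier rows. They are sound as well,
  since solutions of the current edges satisfy them. The current edges may have fewer solutions than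
  \<open>E0\<close>, because cells cut some off, but feasibility is never lost.\<close>

definition stinv :: "nat \<Rightarrow> edge set \<Rightarrow> nat \<Rightarrow> nat \<Rightarrow> st \<Rightarrow> bool" where
  "stinv N E0 m0 l s \<longleftrightarrow> IM s iN 0 = N \<and> IM s iM1 0 = Suc N \<and> IM s iG2 0 = 2 * Suc N \<and> (\<forall>k<N. IM s iROW k = k * (2 * Suc N)) \<and>
    EUV s N \<and> IM s iM 0 \<le> m0 + 2 * l \<and> E0 \<subseteq> edges s \<and> (\<forall>k<l. rowok (Suc N) s k) \<and>
    (\<forall>k<l. \<forall>x. x N = 0 \<longrightarrow> Hrow (Suc N) s k x \<longrightarrow> (\<forall>e\<in>E0 \<union> (\<Union>j<k. compE (Suc N) s j). rel k e \<longrightarrow> esat x e)) \<and>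
    (\<forall>z. ssol (edges s) z \<longrightarrow> (\<forall>k<l. Hrow (Suc N) s k (z(N := 0)))) \<and>
    ((\<exists>z. ssol E0 z) \<longrightarrow> (\<exists>z. ssol (edges s) z))"

definition stcost :: "nat \<Rightarrow> nat \<Rightarrow> nat \<Rightarrow> nat \<Rightarrow> nat" where
  "stcost N mm K T = 100 + 14 * mm + N * (3 + 35 * Suc N) + 12 * Suc N +
     (3 * T + 2) * (2 * Suc N * (40 * T + 120) + 2 * (2 * Suc N) + 50 + 50 * (N + 1) * (N + mm + 1)) + 4 * K * (40 * T + 120)"

lemma stage_cost_chain:
  fixes a b c d n m m2 X Y L X' Y' L' :: nat
  assumes "a \<le> b + 12 * n + 30" "b \<le> c + 3 + X + Y" "c \<le> d + 5 + 14 * m + L" "m \<le> m2" "L \<le> L'" "Y \<le> Y'" "X \<le> X'"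
  shows "a \<le> d + (100 + 14 * m2 + L' + 12 * n + X' + Y')"
  using assms by linarith

text \<open>Dominated lines may be dropped because the row also records the cell, inside which the
  surviving lines imply the others. The cell joins the edge list as well, so that later tests
  respect the restriction and keep a common solution alive.\<close>

lemma stage_sem:
  assumes S: "stinv N E0 m0 l s" and l: "IM s iLL 0 = l" "l < N" and T: "m0 + 2 * N + 2 * N * Suc N \<le> 2 ^ T"
    and r: "r = sem p_stage s"
  shows "stinv N E0 m0 (Suc l) r \<and> CK r \<le> CK s + stcost N (m0 + 2 * N) (m0 + 2 * N + 2 * N * Suc N) T"
proof -
  let ?M = "Suc N"
  have N: "IM s iN 0 = N" "IM s iM1 0 = ?M" "IM s iG2 0 = 2 * ?M" and ROW: "\<And>k. k < N \<Longrightarrow> IM s iROW k = k * (2 * ?M)" and E: "EUV s N"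
    and m: "IM s iM 0 \<le> m0 + 2 * l" and E0: "E0 \<subseteq> edges s" and ok: "\<And>k. k < l \<Longrightarrow> rowok ?M s k"
    and D: "\<And>k x e. k < l \<Longrightarrow> x N = 0 \<Longrightarrow> Hrow ?M s k x \<Longrightarrow> e \<in> E0 \<union> (\<Union>j<k. compE ?M s j) \<Longrightarrow> rel k e \<Longrightarrow> esat x e"
    and Z: "\<And>z k. ssol (edges s) z \<Longrightarrow> k < l \<Longrightarrow> Hrow ?M s k (z(N := 0))"
    and F: "(\<exists>z. ssol E0 z) \<Longrightarrow> (\<exists>z. ssol (edges s) z)"
    using S unfolding stinv_def by blast+
  define s1 where "s1 = sem p_build s"
  define s2 where "s2 = sem p_search s1"
  have r': "r = sem p_storerow s2" using r by (simp add: p_stage_def s1_def s2_def)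
  define m' where "m' = IM s iM 0"
  define K where "K = IM s1 iK 0"
  have m'le: "m' \<le> m0 + 2 * N" using m l by (simp add: m'_def)
  have B: "CK s1 \<le> CK s + 5 + 14 * m' + l * (3 + 35 * ?M)" "K \<le> m' + 2 * l * ?M" "\<And>i. i < K \<Longrightarrow> goodline N l (lin s1 i)"
    "\<And>x. x N = 0 \<Longrightarrow> (lsat ?M l x s1 \<longleftrightarrow> (\<forall>e\<in>edges s \<union> (\<Union>k<l. compE ?M s k). rel l e \<longrightarrow> esat x e))"
    using build_sem[OF N(1,2) l _ E ok s1_def, of m'] unfolding K_def m'_def by blast+
  have k1: "IM s1 n = IM s n" if "n \<notin> wI p_build" for n unfolding s1_def using that by (rule sem_frameI)
  have k1R: "RM s1 n = RM s n" if "n \<notin> wR p_build" for n unfolding s1_def using that by (rule sem_frameR)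
  have ed1: "edges s1 = edges s" by (rule edges_frame) (simp_all add: k1 k1R)
  have E1: "EUV s1 N" using E by (simp add: EUV_def k1 k1R)
  have "l * ?M \<le> N * ?M" using l by (intro mult_right_mono) auto
  hence Kle: "K \<le> m0 + 2 * N + 2 * N * ?M" using B(2) m'le by simp
  have LG: "IM s1 iLG i < 2 * ?M" if "i < K" for i using B(3)[OF that] by (auto simp: goodline_def lin_def)
  have s1v: "IM s1 iN 0 = N" "IM s1 iM 0 = m'" "IM s1 iLL 0 = l" "IM s1 iG2 0 = 2 * ?M" "IM s1 iK 0 = K" "IM s1 iROW = IM s iROW" "IM s1 iM1 0 = ?M"
    using N l by (simp_all add: k1 m'_def K_def)
  note SS = search_sem[OF s1v(1,2,3) l(2) E1 s1v(4,5) LG _ s2_def, of T]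
  have KT: "K \<le> 2 ^ T" using Kle T by linarith
  have C2: "CK s2 \<le> CK s1 + 3 + (3 * T + 2) * (2 * ?M * (40 * T + 120) + 2 * (2 * ?M) + 50 + 50 * (N + 1) * (N + m' + 1)) + 4 * K * (40 * T + 120)"
    and W1: "\<And>g. g<2 * ?M \<Longrightarrow> IM s2 iPEND g \<noteq> 0 \<Longrightarrow> \<exists>j<K. (g, RM s2 rLS (IM s2 iPEND g - 1), RM s2 rLB (IM s2 iPEND g - 1)) = lin s1 j"
    and W2: "\<And>j. j<K \<Longrightarrow> let g = IM s1 iLG j in IM s2 iPEND g \<noteq> 0 \<and> dominates s2 (g, RM s2 rLS (IM s2 iPEND g - 1), RM s2 rLB (IM s2 iPEND g - 1)) (lin s1 j)"
    and W3: "\<And>x. incell s2 x \<Longrightarrow> incell s1 x" and W4: "feas s1 l \<Longrightarrow> feas s2 l"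
    using SS KT by blast+
  have k2: "IM s2 n = IM s1 n" if "n \<notin> wI p_search" for n unfolding s2_def using that by (rule sem_frameI)
  have k2R: "RM s2 n = RM s1 n" if "n \<notin> wR p_search" for n unfolding s2_def using that by (rule sem_frameR)
  have s2v: "IM s2 iN 0 = N" "IM s2 iM1 0 = ?M" "IM s2 iG2 0 = 2 * ?M" "IM s2 iLL 0 = l" "IM s2 iROW l = l * (2 * ?M)" "IM s2 iM 0 = m'"
    using s1v ROW l by (simp_all add: k2)
  have ed2: "edges s2 = edges s" unfolding ed1[symmetric] by (rule edges_frame) (simp_all add: k2 k2R)
  have E2: "EUV s2 N" using E1 by (simp add: EUV_def k2 k2R)
  have Wg: "goodline N l (g, RM s2 rLS (IM s2 iPEND g - 1), RM s2 rLB (IM s2 iPEND g - 1))" if "g < 2 * ?M" "IM s2 iPEND g \<noteq> 0" for g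
    using W1[OF that] B(3) by metis
  \<comment> \<open>No line of the search belongs to a constant group, so the slots for the ends of
    the cell are empty before they are filled.\<close>
  have P0: "IM s2 iPEND N = 0" "IM s2 iPEND (Suc N + N) = 0"
    using Wg[of N] Wg[of "Suc N + N"] by (auto simp: goodline_def)
  note R = storerow_sem[OF s2v(1-4) l(2) s2v(5) P0 r']
  have kr: "IM r n = IM s n" if "n \<in> {iN, iM1, iG2, iROW}" for n
    using that sem_frameI[of n p_storerow s2] by (auto simp: r' k2 k1)
  have old: "rowok ?M r k = rowok ?M s k" "Hrow ?M r k = Hrow ?M s k" "compE ?M r k = compE ?M s k" if k: "k < l" for k
  proof -
    have b: "IM r iRH (IM s iROW k + g) = IM s iRH (IM s iROW k + g) \<and> RM r rRS (IM s iROW k + g) = RM s rRS (IM s iROW k + g) \<and>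
      RM r rRB (IM s iROW k + g) = RM s rRB (IM s iROW k + g)" if g: "g < 2 * ?M" for g
    proof -
      have "Suc k * (2 * ?M) \<le> l * (2 * ?M)" using k by (intro mult_right_mono) auto
      hence "IM s iROW k + g < l * (2 * ?M)" using g ROW[of k] k l by simp
      thus ?thesis using R(2)[of "IM s iROW k + g"] by (simp add: k2 k1 k2R k1R)
    qed
    have a: "IM r iROW k = IM s iROW k" by (simp add: kr)
    show "rowok ?M r k = rowok ?M s k" "Hrow ?M r k = Hrow ?M s k" "compE ?M r k = compE ?M s k"
      using row_frame_local[where M = "Suc N", OF a b] by blast+
  qed
  have rl: "IM r iROW l = l * (2 * ?M)" using ROW l by (simp add: kr)
  have okl: "rowok ?M r l"
    unfolding rowok_def rl
  proof (intro allI impI)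
    fix g assume g: "g < 2 * ?M" "IM r iRH (l * (2 * ?M) + g) \<noteq> 0"
    note R3 = R(3)[OF g(1)]
    consider "g = N" | "g = Suc N + N" | "g \<noteq> N" "g \<noteq> Suc N + N" by blast
    thus "if g < ?M then l < g \<and> 0 < fst (snd (rowline r l g)) else l + ?M < g \<and> fst (snd (rowline r l g)) < 0"
    proof cases
      case 1 thus ?thesis using R3 g l by simp
    next
      case 2 thus ?thesis using R3 g l by simp
    next
      case 3
      hence "IM s2 iPEND g \<noteq> 0" using R3 g by blast
      from Wg[OF g(1) this] show ?thesis using R3 g 3 by (auto simp: goodline_def)
    qed
  qed
  \<comment> \<open>With the constant node at 0, the two constant groups say exactly that
    \<open>x l\<close> lies in the cell.\<close>
  have Hl: "Hrow ?M r l x \<longleftrightarrow> (\<forall>g<2 * ?M. IM s2 iPEND g \<noteq> 0 \<longrightarrow> linesat ?M l x (g, RM s2 rLS (IM s2 iPEND g - 1), RM s2 rLB (IM s2 iPEND g - 1))) \<and> incell s2 (x l)"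
    if x: "x N = 0" for x
  proof
    assume H: "Hrow ?M r l x"
    have a: "linesat ?M l x (g, RM s2 rLS (IM s2 iPEND g - 1), RM s2 rLB (IM s2 iPEND g - 1))" if g: "g < 2 * ?M" "IM s2 iPEND g \<noteq> 0" for g
    proof -
      have "g \<noteq> N" "g \<noteq> Suc N + N" using g P0 by auto
      thus ?thesis using R(3)[OF g(1)] g H unfolding Hrow_def rl by metis
    qed
    moreover have "incell s2 (x l)"
      unfolding incell_def
    proof (intro conjI impI)
      assume h: "IM s2 ihp 0 \<noteq> 0"
      have RN: "N < 2 * ?M" by simp
      have nz: "IM r iRH (l * (2 * ?M) + N) \<noteq> 0" using R(3)[OF RN] h by blast
      have "rowline r l N = (N, 1, - RM s2 rp 0)" using R(3)[OF RN] nz by simp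
      hence "linesat ?M l x (N, 1, - RM s2 rp 0)" using H[unfolded Hrow_def rl, rule_format, OF RN nz] by simp
      thus "RM s2 rp 0 < x l" using x by (simp add: linesat_def ov_def)
    next
      assume h: "IM s2 ihq 0 \<noteq> 0"
      have RN: "Suc N + N < 2 * ?M" by simp
      have nz: "IM r iRH (l * (2 * ?M) + (Suc N + N)) \<noteq> 0" using R(3)[OF RN] h by blast
      have "rowline r l (Suc N + N) = (Suc N + N, -1, RM s2 rq 0)" using R(3)[OF RN] nz by simp
      hence "linesat ?M l x (Suc N + N, -1, RM s2 rq 0)" using H[unfolded Hrow_def rl, rule_format, OF RN nz] by simp
      thus "x l < RM s2 rq 0" using x by (simp add: linesat_def ov_def)
    qed
    ultimately show "(\<forall>g<2 * ?M. IM s2 iPEND g \<noteq> 0 \<longrightarrow> linesat ?M l x (g, RM s2 rLS (IM s2 iPEND g - 1), RM s2 rLB (IM s2 iPEND g - 1))) \<and> incell s2 (x l)"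
      by blast
  next
    assume H: "(\<forall>g<2 * ?M. IM s2 iPEND g \<noteq> 0 \<longrightarrow> linesat ?M l x (g, RM s2 rLS (IM s2 iPEND g - 1), RM s2 rLB (IM s2 iPEND g - 1))) \<and> incell s2 (x l)"
    show "Hrow ?M r l x"
      unfolding Hrow_def rl
    proof (intro allI impI)
      fix g assume g: "g < 2 * ?M" "IM r iRH (l * (2 * ?M) + g) \<noteq> 0"
      note R3 = R(3)[OF g(1)]
      consider "g = N" | "g = Suc N + N" | "g \<noteq> N" "g \<noteq> Suc N + N" by blast
      thus "linesat ?M l x (rowline r l g)"
      proof cases
        case 1
        hence "IM s2 ihp 0 \<noteq> 0" using R3 g P0 by auto
        thus ?thesis using R3 g 1 H x by (simp add: linesat_def ov_def incell_def)
      next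
        case 2
        hence "IM s2 ihq 0 \<noteq> 0" using R3 g P0 by auto
        thus ?thesis using R3 g 2 H x by (simp add: linesat_def ov_def incell_def)
      next
        case 3
        hence "IM s2 iPEND g \<noteq> 0" using R3 g by blast
        thus ?thesis using R3 g 3 H by auto
      qed
    qed
  qed
  \<comment> \<open>Completeness of the new row: it places \<open>x l\<close> in the cell, and there
    the stored lines dominate all lines of the pool.\<close>
  have dom: "lsat ?M l x s1" if "x N = 0" "Hrow ?M r l x" for x
    unfolding lsat_def
  proof (intro conjI allI impI)
    have H: "\<forall>g<2 * ?M. IM s2 iPEND g \<noteq> 0 \<longrightarrow> linesat ?M l x (g, RM s2 rLS (IM s2 iPEND g - 1), RM s2 rLB (IM s2 iPEND g - 1))" "incell s2 (x l)"
      using Hl[of x, OF that(1)] that(2) by blast+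
    show "incell s1 (x l)" using W3 H(2) by blast
    fix i assume i: "i < IM s1 iK 0"
    hence iK: "i < K" by (simp add: K_def)
    define g where "g = IM s1 iLG i"
    have w: "IM s2 iPEND g \<noteq> 0" "dominates s2 (g, RM s2 rLS (IM s2 iPEND g - 1), RM s2 rLB (IM s2 iPEND g - 1)) (lin s1 i)"
      using W2[OF iK] by (auto simp: Let_def g_def)
    have "linesat ?M l x (g, RM s2 rLS (IM s2 iPEND g - 1), RM s2 rLB (IM s2 iPEND g - 1))" using H(1) w(1) LG[OF iK] by (simp add: g_def)
    moreover have "g = fst (lin s1 i)" using w(2) by (simp add: dominates_def)
    moreover have "RM s2 rLS (IM s2 iPEND g - 1) * x l + RM s2 rLB (IM s2 iPEND g - 1) \<le> fst (snd (lin s1 i)) * x l + snd (snd (lin s1 i))"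
      using w(2)[unfolded dominates_def, THEN conjunct2, rule_format, OF H(2)] by (simp only: fst_conv snd_conv)
    ultimately show "linesat ?M l x (lin s1 i)" unfolding linesat_def by simp
  qed
  \<comment> \<open>Soundness of the new row: its lines are lines of the pool, and those follow from
    edges and from composites of sound rows.\<close>
  have snd: "Hrow ?M r l (z(N := 0))" if z: "ssol (edges s) z" "incell s2 (z l)" for z
  proof -
    have "lsat ?M l (z(N := 0)) s1"
      unfolding B(4)[of "z(N := 0)", simplified]
    proof (intro ballI impI)
      fix e assume "e \<in> edges s \<union> (\<Union>k<l. compE ?M s k)"
      thus "esat (z(N := 0)) e"
      proof
        assume e: "e \<in> edges s"
        then obtain u v a b where [simp]: "e = (u, v, a, b)" by (cases e)
        have "u < N" "v < N" using e E by (auto simp: edges_def EUV_def)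
        thus ?thesis using z(1) e by (auto simp: ssol_def)
      next
        assume "e \<in> (\<Union>k<l. compE ?M s k)"
        then obtain k where "k < l" "e \<in> compE ?M s k" by blast
        thus ?thesis using comp_sat[OF ok Z[OF z(1)]] by blast
      qed
    qed
    hence ls: "\<And>i. i < K \<Longrightarrow> linesat ?M l (z(N := 0)) (lin s1 i)" unfolding lsat_def K_def by blast
    have "linesat ?M l (z(N := 0)) (g, RM s2 rLS (IM s2 iPEND g - 1), RM s2 rLB (IM s2 iPEND g - 1))" if "g < 2 * ?M" "IM s2 iPEND g \<noteq> 0" for g
      using W1[OF that] ls by metis
    thus ?thesis using Hl[of "z(N := 0)"] z(2) l by simp
  qed
  have edr: "ssol (edges r) z \<longleftrightarrow> ssol (edges s) z \<and> incell s2 (z l)" for z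
    unfolding R(4) ed2 by (auto simp: ssol_def incell_def)
  have "stinv N E0 m0 (Suc l) r"
    unfolding stinv_def
  proof (intro conjI allI impI ballI)
    show "IM r iN 0 = N" "IM r iM1 0 = ?M" "IM r iG2 0 = 2 * ?M" using N by (simp_all add: kr)
    show "k < N \<Longrightarrow> IM r iROW k = k * (2 * ?M)" for k using ROW by (simp add: kr)
    show "EUV r N" using R(5)[OF E2] .
    show "IM r iM 0 \<le> m0 + 2 * Suc l" using R(6) m s2v(6) by (simp add: m'_def)
    show "E0 \<subseteq> edges r" using E0 unfolding R(4) ed2 by blast
    show "k < Suc l \<Longrightarrow> rowok ?M r k" for k using okl ok old(1) by (cases "k = l") auto
    show "(\<exists>z. ssol E0 z) \<Longrightarrow> \<exists>z. ssol (edges r) z"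
    proof -
      assume "\<exists>z. ssol E0 z"
      then obtain z where z: "ssol (edges s) z" using F by blast
      have "lsat ?M l (z(N := 0)) s1"
        unfolding B(4)[of "z(N := 0)", simplified]
      proof (intro ballI impI)
        fix e assume "e \<in> edges s \<union> (\<Union>k<l. compE ?M s k)"
        thus "esat (z(N := 0)) e"
        proof
          assume e: "e \<in> edges s"
          then obtain u v a b where [simp]: "e = (u, v, a, b)" by (cases e)
          have "u < N" "v < N" using e E by (auto simp: edges_def EUV_def)
          thus ?thesis using z e by (auto simp: ssol_def)
        next
          assume "e \<in> (\<Union>k<l. compE ?M s k)"
          then obtain k where "k < l" "e \<in> compE ?M s k" by blast
          thus ?thesis using comp_sat[OF ok Z[OF z]] by blast
        qed
      qed
      hence "incell s1 (z l)" using l by (auto simp: lsat_def)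
      hence "feas s1 l" using z ed1 by (auto simp: feas_def)
      from W4[OF this] show ?thesis unfolding feas_def ed2 edr by blast
    qed
    fix k assume k: "k < Suc l"
    show "Hrow ?M r k (z(N := 0))" if "ssol (edges r) z" for z
      using snd[of z] Z[of z k] old(2)[of k] that k unfolding edr by (cases "k = l") auto
    fix x e assume x: "x N = 0" "Hrow ?M r k x" and e: "e \<in> E0 \<union> (\<Union>j<k. compE ?M r j)" "rel k e"
    have ce: "(\<Union>j<k. compE ?M r j) = (\<Union>j<k. compE ?M s j)" using old(3) k by (intro SUP_cong) auto
    show "esat x e"
    proof (cases "k = l")
      case True
      hence "lsat ?M l x s1" using dom x by simp
      thus ?thesis using B(4)[of x, OF x(1)] e E0 True unfolding ce by blast
    next
      case False
      thus ?thesis using D[of k x e] x e old(2)[of k] k unfolding ce by simp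
    qed
  qed
  moreover have "CK r \<le> CK s + stcost N (m0 + 2 * N) (m0 + 2 * N + 2 * N * ?M) T"
  proof -
    have "l * (3 + 35 * ?M) \<le> N * (3 + 35 * ?M)" using l by (intro mult_right_mono) auto
    moreover have "4 * K * (40 * T + 120) \<le> 4 * (m0 + 2 * N + 2 * N * ?M) * (40 * T + 120)" using Kle by (intro mult_right_mono mult_left_mono) auto
    moreover have "(3 * T + 2) * (2 * ?M * (40 * T + 120) + 2 * (2 * ?M) + 50 + 50 * (N + 1) * (N + m' + 1))
       \<le> (3 * T + 2) * (2 * ?M * (40 * T + 120) + 2 * (2 * ?M) + 50 + 50 * (N + 1) * (N + (m0 + 2 * N) + 1))"
      using m'le by (intro mult_left_mono add_left_mono add_right_mono) auto
    ultimately show ?thesis unfolding stcost_def by (rule stage_cost_chain[OF R(1) C2 B(1) m'le])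
  qed
  ultimately show ?thesis ..
qed

section \<open>Back substitution\<close>

text \<open>The line is solved for \<open>X l\<close>. The second half of \<open>rX\<close> holds
  negated values, so one quotient serves both kinds of groups, and the group tells whether it bounds
  \<open>X l\<close> from below or from above.\<close>

definition p_bline :: com where
  "p_bline = (ia ::= Add (V ibk) (V iuu);;
     IF ILe (C 1) (L iRH (V ia)) THEN
       (rt ::=r RDv (RSb (RL rX (V iuu)) (RL rRB (V ia))) (RL rRS (V ia));;
        IF ILt (V iuu) (V iM1) THEN p_lower ELSE p_upper)
     ELSE Skip)"

definition p_pick :: com where
  "p_pick = ((IF ILe (C 1) (V ihp) THEN
       (IF ILe (C 1) (V ihq) THEN rt ::=r RDv (RAd (RV rp) (RV rq)) (OfI (C 2)) ELSE rt ::=r RAd (RV rp) (OfI (C 1)))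
     ELSE (IF ILe (C 1) (V ihq) THEN rt ::=r RSb (RV rq) (OfI (C 1)) ELSE rt ::=r OfI (C 0)));;
     RA rX (V iLL) (RV rt);; RA rX (Add (V iM1) (V iLL)) (RSb (OfI (C 0)) (RV rt)))"

definition p_backstep :: com where
  "p_backstep = (iLL ::= Sub (Sub (V iN) (C 1)) (V iy);; ibk ::= L iROW (V iLL);; ihp ::= C 0;; ihq ::= C 0;;
     Fr iuu (V iG2) p_bline;; p_pick)"

definition p_back :: com where
  "p_back = (RA rX (V iN) (OfI (C 0));; RA rX (Add (V iM1) (V iN)) (OfI (C 0));; Fr iy (V iN) p_backstep)"

lemma wI_bline [simp]: "wI p_bline = {ia, ihp, ihq}" "wR p_bline = {rt, rp, rq}" by (auto simp: p_bline_def)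
lemma wI_pick [simp]: "wI p_pick = {}" "wR p_pick = {rt, rX}" by (auto simp: p_pick_def)
lemma wI_backstep [simp]: "wI p_backstep = {iLL, ibk, ihp, ihq, iuu, ia}" "wR p_backstep = {rt, rp, rq, rX}" by (auto simp: p_backstep_def)
lemma wI_back [simp]: "wI p_back = {iLL, ibk, ihp, ihq, iuu, ia, iy}" "wR p_back = {rt, rp, rq, rX}" by (auto simp: p_back_def)

lemma between:
  fixes U W :: "real set"
  assumes "finite U" "finite W" "\<And>a b. a \<in> U \<Longrightarrow> b \<in> W \<Longrightarrow> a < b"
  shows "\<exists>y. (\<forall>a\<in>U. a < y) \<and> (\<forall>b\<in>W. y < b)"
proof (cases "U = {} \<or> W = {}")
  case True
  thus ?thesis
  proof
    assume "U = {}"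
    moreover have "\<forall>b\<in>W. Min (insert 0 W) - 1 < b"
    proof
      fix b assume "b \<in> W"
      hence "Min (insert 0 W) \<le> b" using assms(2) by (intro Min_le) auto
      thus "Min (insert 0 W) - 1 < b" by linarith
    qed
    ultimately show ?thesis by blast
  next
    assume "W = {}"
    moreover have "\<forall>a\<in>U. a < Max (insert 0 U) + 1"
    proof
      fix a assume "a \<in> U"
      hence "a \<le> Max (insert 0 U)" using assms(1) by (intro Max_ge) auto
      thus "a < Max (insert 0 U) + 1" by linarith
    qed
    ultimately show ?thesis by blast
  qed
next
  case False
  hence "Max U < Min W" using assms by simp
  then obtain y where "Max U < y" "y < Min W" using dense by blast
  thus ?thesis using assms False by (intro exI[of _ y]) auto
qed

lemma pick_sem:
  assumes "IM s iM1 0 = M" "IM s iLL 0 = l" "l < M" and r: "r = sem p_pick s"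
  shows "CK r \<le> CK s + 5 \<and> (\<exists>v. RM r rX = (RM s rX)(l := v, M + l := - v) \<and> ((\<exists>y. incell s y) \<longrightarrow> incell s v))"
proof -
  define v where "v = (if IM s ihp 0 \<noteq> 0 then if IM s ihq 0 \<noteq> 0 then (RM s rp 0 + RM s rq 0) / 2 else RM s rp 0 + 1
     else if IM s ihq 0 \<noteq> 0 then RM s rq 0 - 1 else 0)"
  have "RM r rX = (RM s rX)(l := v, M + l := - v)" "CK r \<le> CK s + 5"
    unfolding r p_pick_def v_def using assms(1-3) by auto
  moreover have "incell s v" if "incell s y" for y using that by (auto simp: incell_def v_def)
  ultimately show ?thesis by blast
qed

lemma bline_sem:
  assumes "IM t ibk 0 = b" "IM t iM1 0 = M" and r: "r = sem p_bline (seti (tick t) iuu 0 g)"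
  defines "x \<equiv> (RM t rX g - RM t rRB (b + g)) / RM t rRS (b + g)"
  shows "CK r \<le> CK t + 8 \<and> (\<forall>y. incell r y \<longleftrightarrow> incell t y \<and> (IM t iRH (b + g) \<noteq> 0 \<longrightarrow> (if g < M then x < y else y < x)))"
proof (cases "IM t iRH (b + g) = 0")
  case True
  thus ?thesis unfolding r p_bline_def using assms(1) by (simp add: incell_def)
next
  case False
  let ?s = "tick (setr (tick (tick (seti (tick (seti (tick t) iuu 0 g)) ia 0 (b + g)))) rt 0 x)"
  have ic: "incell ?s y = incell t y" for y by (simp add: incell_def)
  show ?thesis
  proof (cases "g < M")
    case g: True
    have r': "r = sem p_lower ?s" unfolding r p_bline_def x_def using assms(1,2) False g by simp
    show ?thesis using lower_sem[OF r'] False g by (simp add: ic)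
  next
    case g: False
    have r': "r = sem p_upper ?s" unfolding r p_bline_def x_def using assms(1,2) False g by simp
    show ?thesis using upper_sem[OF r'] False g by (simp add: ic)
  qed
qed

context
  fixes N m0 E0 s z
  assumes S: "stinv N E0 m0 N s" and z: "ssol (edges s) z"
begin

abbreviation (input) "M \<equiv> Suc N"

text \<open>An edge belongs to the row of its smaller endpoint, which is already satisfied. The
  edges of no row are self loops of gain 1 and loops at the constant node; with the constant at 0
  they do not depend on the point, so they hold because they hold for \<open>z\<close>.\<close>

lemma back_edge:
  assumes e: "(u, v, a, b) = e" "e \<in> E0 \<union> (\<Union>k<l. compE M s k)" "u \<le> N" "v \<le> N" "l \<le> u" "l \<le> v" "l \<le> N"
    and H: "\<And>k. l \<le> k \<Longrightarrow> k < N \<Longrightarrow> Hrow M s k x" and x: "x N = 0"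
  shows "esat x e"
proof -
  have ok: "\<And>k. k < N \<Longrightarrow> rowok M s k"
    and D: "\<And>k x e. k < N \<Longrightarrow> x N = 0 \<Longrightarrow> Hrow M s k x \<Longrightarrow> e \<in> E0 \<union> (\<Union>j<k. compE M s j) \<Longrightarrow> rel k e \<Longrightarrow> esat x e"
    and Z: "\<And>k. k < N \<Longrightarrow> Hrow M s k (z(N := 0))" and E0: "E0 \<subseteq> edges s" and E: "EUV s N"
    using S z unfolding stinv_def by blast+
  have ze: "esat (z(N := 0)) e"
    using e(2)
  proof
    assume "e \<in> E0"
    hence ee: "e \<in> edges s" using E0 by blast
    hence "u < N" "v < N" using E e(1) by (auto simp: edges_def EUV_def)
    thus ?thesis using z ee e(1) by (auto simp: ssol_def)
  next
    assume "e \<in> (\<Union>k<l. compE M s k)"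
    then obtain k where "k < l" "e \<in> compE M s k" by blast
    have kN: "k < N" using \<open>k < l\<close> e(7) by simp
    show ?thesis by (rule comp_sat[OF ok[OF kN] Z[OF kN] \<open>e \<in> compE M s k\<close>])
  qed
  show ?thesis
  proof (cases "u = v \<and> (a = 1 \<or> u = N)")
    case True
    thus ?thesis using ze e(1) x by (cases "u = N") auto
  next
    case False
    define k where "k = min u v"
    have k: "k < N" "l \<le> k" using False e by (auto simp: k_def)
    have "rel k e" using False unfolding e(1)[symmetric] by (auto simp: k_def)
    moreover have "e \<in> E0 \<union> (\<Union>j<k. compE M s j)" using e(2) k by auto
    ultimately show ?thesis using D[OF k(1) x H[OF k(2,1)]] by blast
  qed
qed

text \<open>A lower and an upper bound on \<open>X l\<close> compose to an edge of row
  \<open>l\<close> between values already chosen, and that edge says precisely that the first bound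
  is below the second. So the interval for \<open>X l\<close> is nonempty.\<close>

lemma backstep_sem:
  assumes t: "frame {iLL, ibk, ihp, ihq, iuu, ia, iy} {rt, rp, rq, rX} s t" and l: "IM t iy 0 = N - Suc l" "l < N"
    and X: "\<And>v. l < v \<Longrightarrow> v \<le> N \<Longrightarrow> RM t rX (M + v) = - RM t rX v" "RM t rX N = 0"
    and H: "\<And>k. l < k \<Longrightarrow> k < N \<Longrightarrow> Hrow M s k (RM t rX)" and r: "r = sem p_backstep t"
  shows "(\<forall>v. l \<le> v \<and> v \<le> N \<longrightarrow> RM r rX (M + v) = - RM r rX v) \<and> RM r rX N = 0 \<and> (\<forall>k. l \<le> k \<and> k < N \<longrightarrow> Hrow M s k (RM r rX))"
proof -
  have st: "IM s iN 0 = N" "IM s iM1 0 = M" "IM s iG2 0 = 2 * M" and ok: "\<And>k. k < N \<Longrightarrow> rowok M s k"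
    using S unfolding stinv_def by blast+
  define b where "b = IM s iROW l"
  define s1 where "s1 = sem (iLL ::= Sub (Sub (V iN) (C 1)) (V iy);; ibk ::= L iROW (V iLL);; ihp ::= C 0;; ihq ::= C 0) t"
  define s2 where "s2 = sem (Fr iuu (V iG2) p_bline) s1"
  have r2: "r = sem p_pick s2" by (simp add: r p_backstep_def s1_def s2_def)
  have ft: "IM t n = IM s n" "RM t k = RM s k" if "n \<notin> {iLL, ibk, ihp, ihq, iuu, ia, iy}" "k \<notin> {rt, rp, rq, rX}" for n k
    using frameI[OF t that(1)] frameR[OF t that(2)] by auto
  have tv: "IM t iN = IM s iN" "IM t iROW = IM s iROW" "IM t iM1 = IM s iM1" "IM t iG2 = IM s iG2" "IM t iRH = IM s iRH"
    "RM t rRS = RM s rRS" "RM t rRB = RM s rRB"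
    using ft[of iN rRS] ft[of iROW rRS] ft[of iM1 rRS] ft[of iG2 rRS] ft[of iRH rRB] by simp_all
  have s1: "IM s1 iLL 0 = l" "IM s1 ibk 0 = b" "IM s1 ihp 0 = 0" "IM s1 ihq 0 = 0" "RM s1 = RM t" "IM s1 iM1 0 = M" "IM s1 iG2 0 = 2 * M" "IM s1 iRH = IM s iRH"
    using l st by (auto simp: s1_def tv b_def)
  define tg where "tg g = (RM t rX g - RM s rRB (b + g)) / RM s rRS (b + g)" for g
  define ok' where "ok' g y \<longleftrightarrow> (IM s iRH (b + g) \<noteq> 0 \<longrightarrow> (if g < M then tg g < y else y < tg g))" for g y
  have c2: "\<forall>y. incell s2 y \<longleftrightarrow> (\<forall>g<2 * M. ok' g y)"
    unfolding s2_def
  proof (rule Fr_rule[where Q = "\<lambda>i t'. \<forall>y. incell t' y \<longleftrightarrow> (\<forall>g<i. ok' g y)"])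
    show "\<forall>y. incell (tick s1) y \<longleftrightarrow> (\<forall>g<0. ok' g y)" by (simp add: incell_def s1)
  next
    fix i t'
    assume f: "frame (insert iuu (wI p_bline)) (wR p_bline) s1 t'" and q: "\<forall>y. incell t' y \<longleftrightarrow> (\<forall>g<i. ok' g y)"
    have fr: "IM t' ibk 0 = b" "IM t' iM1 0 = M" "IM t' iRH = IM s iRH" "RM t' rX = RM t rX" "RM t' rRS = RM s rRS" "RM t' rRB = RM s rRB"
      using frameI[OF f] frameR[OF f] s1 tv by auto
    from bline_sem[OF fr(1,2) refl, of i] q
    show "\<forall>y. incell (sem p_bline (seti (tick t') iuu 0 i)) y \<longleftrightarrow> (\<forall>g<Suc i. ok' g y)"
      unfolding fr(3-6) ok'_def tg_def by (auto simp: less_Suc_eq)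
  qed (use s1 in simp)
  have k2: "IM s2 iLL 0 = l" "IM s2 iM1 0 = M" "RM s2 rX = RM t rX"
    unfolding s2_def by (simp_all add: sem_frameI sem_frameR s1)
  obtain v where v: "RM r rX = (RM t rX)(l := v, M + l := - v)" "(\<exists>y. incell s2 y) \<Longrightarrow> incell s2 v"
    using pick_sem[OF k2(2,1) _ r2] l(2) k2(3) by auto
  note okl = ok[OF l(2), unfolded rowok_def, folded b_def]
  have sg: "g < M \<Longrightarrow> l < g \<and> 0 < RM s rRS (b + g)" "\<not> g < M \<Longrightarrow> l + M < g \<and> RM s rRS (b + g) < 0" if g: "g < 2 * M" "IM s iRH (b + g) \<noteq> 0" for g
  proof -
    have "fst (snd (rowline s l g)) = RM s rRS (b + g)" by (simp add: rowline_def b_def)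
    thus "g < M \<Longrightarrow> l < g \<and> 0 < RM s rRS (b + g)" "\<not> g < M \<Longrightarrow> l + M < g \<and> RM s rRS (b + g) < 0"
      using okl[rule_format, OF g] by (auto split: if_splits)
  qed
  have "\<exists>y. incell s2 y"
  proof -
    define U where "U = tg ` {g. g < M \<and> IM s iRH (b + g) \<noteq> 0}"
    define W where "W = tg ` {g. M \<le> g \<and> g < 2 * M \<and> IM s iRH (b + g) \<noteq> 0}"
    have "\<exists>y. (\<forall>a\<in>U. a < y) \<and> (\<forall>b\<in>W. y < b)"
    proof (rule between)
      show "finite U" "finite W" by (simp_all add: U_def W_def)
      fix p q assume "p \<in> U" "q \<in> W"
      then obtain u w where u: "u < M" "IM s iRH (b + u) \<noteq> 0" "p = tg u" and w: "M \<le> w" "w < 2 * M" "IM s iRH (b + w) \<noteq> 0" "q = tg w"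
        by (auto simp: U_def W_def)
      define v where "v = w - M"
      have v: "w = M + v" "v < M" using w by (auto simp: v_def)
      have su: "l < u" "0 < RM s rRS (b + u)" using sg(1)[of u] u by auto
      have sv: "l < v" "RM s rRS (b + w) < 0" using sg(2)[of w] w v by auto
      have hh: "has M s l u v" using u w v by (simp add: has_def b_def[symmetric] add.assoc)
      hence "cmp M s l u v \<in> compE M s l" using u v by (auto simp: compE_def)
      hence mem: "cmp M s l u v \<in> E0 \<union> (\<Union>k<Suc l. compE M s k)" by auto
      define a where "a = RM s rRS (b + u) / (- RM s rRS (b + w))"
      have c: "(u, v, a, a * RM s rRB (b + w) + RM s rRB (b + u)) = cmp M s l u v"
        by (simp add: cmp_def Let_def b_def[symmetric] a_def v(1) add.assoc)
      have "esat (RM t rX) (cmp M s l u v)"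
        by (rule back_edge[OF c mem]) (use u v su sv l X H in auto)
      hence es: "RM t rX u < a * RM t rX v + (a * RM s rRB (b + w) + RM s rRB (b + u))" unfolding c[symmetric] by simp
      have Xv: "RM t rX w = - RM t rX v" using X(1)[of v] sv v by simp
      have "RM t rX u - RM s rRB (b + u) < a * (RM t rX v + RM s rRB (b + w))" using es by (simp add: algebra_simps)
      hence "(RM t rX u - RM s rRB (b + u)) / RM s rRS (b + u) < a * (RM t rX v + RM s rRB (b + w)) / RM s rRS (b + u)"
        using su by (intro divide_strict_right_mono)
      also have "\<dots> = tg w" using su sv unfolding tg_def Xv a_def by (simp add: field_simps)
      finally show "p < q" by (simp add: u w tg_def)
    qed
    then obtain y where y: "\<forall>a\<in>U. a < y" "\<forall>b\<in>W. y < b" by blast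
    have "ok' g y" if "g < 2 * M" for g using y that by (auto simp: ok'_def U_def W_def not_less)
    thus ?thesis using c2 by blast
  qed
  hence ic: "\<And>g. g < 2 * M \<Longrightarrow> ok' g v" using v(2) c2 by blast
  have Xr: "RM r rX j = RM t rX j" if "l < j" "j \<le> N" for j using that by (simp add: v)
  have ovr: "ov M (RM r rX) g = RM t rX g" if g: "g < 2 * M" "g < M \<Longrightarrow> l < g" "\<not> g < M \<Longrightarrow> l + M < g" for g
  proof (cases "g < M")
    case True thus ?thesis using g Xr[of g] by (simp add: ov_def)
  next
    case False
    hence "l < g - M" "g - M \<le> N" using g by auto
    thus ?thesis using Xr[of "g - M"] X(1)[of "g - M"] False by (simp add: ov_def)
  qed
  have "Hrow M s l (RM r rX)"
    unfolding Hrow_def b_def[symmetric]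
  proof (intro allI impI)
    fix g assume g: "g < 2 * M" "IM s iRH (b + g) \<noteq> 0"
    have o: "ov M (RM r rX) g = RM t rX g" using ovr[OF g(1)] sg[OF g] by blast
    have rl: "RM r rX l = v" using l by (simp add: v)
    show "linesat M l (RM r rX) (rowline s l g)"
    proof (cases "g < M")
      case True
      have "tg g < v" using ic[OF g(1)] g(2) True by (simp add: ok'_def)
      thus ?thesis using sg(1)[OF g True] by (simp add: linesat_def rowline_def o rl b_def[symmetric] tg_def field_simps)
    next
      case False
      have "v < tg g" using ic[OF g(1)] g(2) False by (simp add: ok'_def)
      thus ?thesis using sg(2)[OF g False] by (simp add: linesat_def rowline_def o rl b_def[symmetric] tg_def field_simps)
    qed
  qed
  moreover have "Hrow M s k (RM r rX)" if k: "l < k" "k < N" for k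
  proof -
    have "ov M (RM r rX) g = ov M (RM t rX) g" if "g < 2 * M" "IM s iRH (IM s iROW k + g) \<noteq> 0" for g
    proof -
      have "if g < M then k < g else k + M < g" using ok[OF k(2)] that unfolding rowok_def by meson
      hence "if g < M then l < g else l + M < g" using k by (auto split: if_splits)
      thus ?thesis using Xr[of g] Xr[of "g - M"] that(1) by (auto simp: ov_def split: if_splits)
    qed
    moreover have "RM r rX k = RM t rX k" using Xr k by simp
    ultimately show ?thesis using H[OF k] by (simp add: Hrow_def linesat_def rowline_def)
  qed
  ultimately have "\<forall>k. l \<le> k \<and> k < N \<longrightarrow> Hrow M s k (RM r rX)" by (metis le_neq_implies_less)
  moreover have "RM r rX (M + w) = - RM r rX w" if "l \<le> w" "w \<le> N" for w
    using X(1)[of w] that l by (cases "w = l") (auto simp: v)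
  moreover have "RM r rX N = 0" using X(2) l by (simp add: v)
  ultimately show ?thesis by blast
qed

end

lemma backstep_cost: "IM t iG2 0 = G \<Longrightarrow> CK (sem p_backstep t) \<le> CK t + 10 + 9 * G"
proof -
  assume G: "IM t iG2 0 = G"
  define s1 where "s1 = sem (iLL ::= Sub (Sub (V iN) (C 1)) (V iy);; ibk ::= L iROW (V iLL);; ihp ::= C 0;; ihq ::= C 0) t"
  define s2 where "s2 = sem (Fr iuu (V iG2) p_bline) s1"
  have "CK s2 \<le> CK s1 + 1 + 9 * IM s1 iG2 0"
    unfolding s2_def
  proof (rule Fr_rule[where Q = "\<lambda>i t'. CK t' \<le> CK s1 + 1 + 9 * i"])
    show "CK (sem p_bline (seti (tick t') iuu 0 i)) \<le> CK s1 + 1 + 9 * Suc i" if "CK t' \<le> CK s1 + 1 + 9 * i" for i t'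
      using bline_sem[OF refl refl refl, of t' i] that by simp
  qed simp_all
  moreover have "CK (sem p_pick s2) \<le> CK s2 + 5" by (simp add: p_pick_def)
  moreover have "sem p_backstep t = sem p_pick s2" by (simp add: p_backstep_def s1_def s2_def)
  ultimately show ?thesis using G by (simp add: s1_def)
qed

text \<open>The bound on the cost holds for every run, while the second claim starts from
  feasibility of \<open>E0\<close>, which the eliminations have carried over to the current
  edges.\<close>

lemma back_sem:
  assumes S: "stinv N E0 m0 N s" and r: "r = sem p_back s"
  shows "CK r \<le> CK s + 3 + N * (11 + 18 * Suc N)" and "\<exists>z. ssol E0 z \<Longrightarrow> ssol E0 (RM r rX)"
proof -
  have st: "IM s iN 0 = N" "IM s iM1 0 = Suc N" "IM s iG2 0 = 2 * Suc N" and E: "EUV s N" "E0 \<subseteq> edges s"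
    and F: "(\<exists>z. ssol E0 z) \<longrightarrow> (\<exists>z. ssol (edges s) z)"
    using S unfolding stinv_def by blast+
  define s0 where "s0 = sem (RA rX (V iN) (OfI (C 0));; RA rX (Add (V iM1) (V iN)) (OfI (C 0))) s"
  have r0: "r = sem (Fr iy (V iN) p_backstep) s0" by (simp add: r p_back_def s0_def)
  have s0: "CK s0 = CK s + 2" "IM s0 = IM s" "RM s0 rX N = 0" "RM s0 rX (Suc N + N) = 0" "frame {} {rX} s s0"
    using st by (auto simp: s0_def frame_def)
  have fr: "frame {iLL, ibk, ihp, ihq, iuu, ia, iy} {rt, rp, rq, rX} s t" if "frame (insert iy (wI p_backstep)) (wR p_backstep) s0 t" for t
    by (rule frame_trans[OF frame_mono[OF s0(5)] frame_mono[OF that]]) auto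
  show "CK r \<le> CK s + 3 + N * (11 + 18 * Suc N)"
    unfolding r0
  proof (rule Fr_rule[where Q = "\<lambda>i t. CK t \<le> CK s + 3 + i * (11 + 18 * Suc N)"])
    fix i t assume f: "frame (insert iy (wI p_backstep)) (wR p_backstep) s0 t" and q: "CK t \<le> CK s + 3 + i * (11 + 18 * Suc N)"
    have "IM (seti (tick t) iy 0 i) iG2 0 = 2 * Suc N" using frameI[OF fr[OF f], of iG2] st by simp
    from backstep_cost[OF this] q show "CK (sem p_backstep (seti (tick t) iy 0 i)) \<le> CK s + 3 + Suc i * (11 + 18 * Suc N)" by simp
  qed (use s0 st in simp_all)
  assume "\<exists>z. ssol E0 z"
  then obtain z where z: "ssol (edges s) z" using F by blast
  define Q where "Q i t \<longleftrightarrow> (\<forall>v. N - i \<le> v \<and> v \<le> N \<longrightarrow> RM t rX (Suc N + v) = - RM t rX v) \<and> RM t rX N = 0 \<and>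
    (\<forall>k. N - i \<le> k \<and> k < N \<longrightarrow> Hrow (Suc N) s k (RM t rX))" for i and t :: st
  have "Q N r"
    unfolding r0
  proof (rule Fr_rule[where Q = Q])
    show "Q 0 (tick s0)" using s0 by (auto simp: Q_def)
  next
    fix i t assume i: "i < ie (V iN) s0" and f: "frame (insert iy (wI p_backstep)) (wR p_backstep) s0 t" and q: "Q i t"
    define l where "l = N - Suc i"
    have iN: "i < N" using i s0 st by simp
    have l: "l < N" "N - Suc l = i" "N - i = Suc l" using iN by (auto simp: l_def)
    let ?t = "seti (tick t) iy 0 i"
    have f': "frame {iLL, ibk, ihp, ihq, iuu, ia, iy} {rt, rp, rq, rX} s ?t" using fr[OF f] by (auto simp: frame_def)
    note b = backstep_sem[OF S z f' _ l(1) _ _ _ refl]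
    show "Q (Suc i) (sem p_backstep ?t)"
      unfolding Q_def l_def[symmetric]
      by (rule b) (use q l in \<open>auto simp: Q_def\<close>)
  qed (use s0 st in simp)
  hence X: "RM r rX N = 0" "\<And>k. k < N \<Longrightarrow> Hrow (Suc N) s k (RM r rX)" by (auto simp: Q_def)
  show "ssol E0 (RM r rX)"
    unfolding ssol_def
  proof
    fix e assume e: "e \<in> E0"
    obtain u v a b where uv: "(u, v, a, b) = e" by (cases e) auto
    have "u < N" "v < N" using e E uv by (auto simp: edges_def EUV_def)
    thus "esat (RM r rX) e" using back_edge[OF S z uv, of 0] e X by auto
  qed
qed

section \<open>Encoding the input and checking the output\<close>

abbreviation (input) irow :: nat where "irow \<equiv> 48"
abbreviation (input) icol :: nat where "icol \<equiv> 49"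
abbreviation (input) ihit :: nat where "ihit \<equiv> 50"
abbreviation (input) ij1 :: nat where "ij1 \<equiv> 51"
abbreviation (input) ij2 :: nat where "ij2 \<equiv> 52"
abbreviation (input) ibase :: nat where "ibase \<equiv> 53"
abbreviation (input) iind :: nat where "iind \<equiv> 54"
abbreviation (input) rca :: nat where "rca \<equiv> 21"
abbreviation (input) rcb :: nat where "rcb \<equiv> 22"
abbreviation (input) rXO :: nat where "rXO \<equiv> 24"
abbreviation (input) racc :: nat where "racc \<equiv> 25"

definition p_hit :: com where
  "p_hit = ((IF ILe (C 1) (V ihit) THEN Skip ELSE (ihit ::= C 1;; ij1 ::= V icol));; ij2 ::= V icol)"

text \<open>With at most two nonzero entries, the first and the last nonzero column describe a row
  completely; \<open>ihit\<close> tells zero rows apart.\<close>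

definition p_scan :: com where
  "p_scan = (IF BLt (RL 0 (Add (V ibase) (V icol))) (OfI (C 0)) THEN p_hit
     ELSE IF BLt (OfI (C 0)) (RL 0 (Add (V ibase) (V icol))) THEN p_hit ELSE Skip)"

definition p_sign :: "nat \<Rightarrow> nat \<Rightarrow> nat \<Rightarrow> nat \<Rightarrow> com" where
  "p_sign r j p q = (IF BLt (OfI (C 0)) (RV r) THEN (p ::= V j;; q ::= Add (V j) (L 0 (C 1)))
     ELSE (p ::= Add (V j) (L 0 (C 1));; q ::= V j;; r ::=r RSb (OfI (C 0)) (RV r)))"

definition p_edge :: "nat \<Rightarrow> nat \<Rightarrow> nat \<Rightarrow> nat \<Rightarrow> com" where
  "p_edge u v x y = (IA iEU (V iM) (V u);; IA iEV (V iM) (V v);; RA rEA (V iM) (RDv (RV x) (RV y));;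
     RA rEB (V iM) (RDv (RL 0 (Add (V iind) (V irow))) (RV y));; iM ::= Add (V iM) (C 1))"

text \<open>A single nonzero entry \<open>a\<close> is read as
  \<open>a / 2 * x j + a / 2 * x j\<close>. It then yields edges between \<open>x j\<close> and its
  negation by the same code as two entries.\<close>

definition p_rowedges :: com where
  "p_rowedges = (rca ::=r RL 0 (Add (V ibase) (V ij1));; rcb ::=r RL 0 (Add (V ibase) (V ij2));;
     (IF IEq (V ij1) (V ij2) THEN (rca ::=r RDv (RV rca) (OfI (C 2));; rcb ::=r RDv (RV rcb) (OfI (C 2))) ELSE Skip);;
     p_sign rca ij1 16 17;; p_sign rcb ij2 18 19;; p_edge 16 19 rcb rca;; p_edge 18 17 rca rcb)"

definition p_row :: com where
  "p_row = (ihit ::= C 0;; Fr icol (L 0 (C 1)) p_scan;; (IF ILe (C 1) (V ihit) THEN p_rowedges ELSE Skip);;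
     ibase ::= Add (V ibase) (L 0 (C 1)))"

text \<open>The offset \<open>n * d\<close> and the starts of the rows are accumulated by addition,
  since the machine cannot multiply integers.\<close>

definition p_init :: com where
  "p_init = (iN ::= Add (L 0 (C 1)) (L 0 (C 1));; iM1 ::= Add (V iN) (C 1);; iG2 ::= Add (V iM1) (V iM1);;
     ibk ::= C 0;; Fr ikk (V iN) (IA iROW (V ikk) (V ibk);; ibk ::= Add (V ibk) (V iG2));;
     iind ::= C 0;; Fr irow (V 0) (iind ::= Add (V iind) (L 0 (C 1)));;
     iM ::= C 0;; ibase ::= C 0;; Fr irow (V 0) p_row)"

lemma wI_sign [simp]: "wI (p_sign r j p q) = {p, q}" "wR (p_sign r j p q) = {r}" by (auto simp: p_sign_def)
lemma wI_edge [simp]: "wI (p_edge u v x y) = {iEU, iEV, iM}" "wR (p_edge u v x y) = {rEA, rEB}" by (auto simp: p_edge_def)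
lemma wI_scan [simp]: "wI p_scan = {ihit, ij1, ij2}" "wR p_scan = {}" by (auto simp: p_scan_def p_hit_def)
lemma wI_rowedges [simp]: "wI p_rowedges = {16, 17, 18, 19, iEU, iEV, iM}" "wR p_rowedges = {rca, rcb, rEA, rEB}"
  by (auto simp: p_rowedges_def)
lemma wI_row [simp]: "wI p_row = {16, 17, 18, 19, iEU, iEV, iM, ihit, ij1, ij2, icol, ibase}" "wR p_row = {rca, rcb, rEA, rEB}"
  by (auto simp: p_row_def)

lemma scan_sem:
  assumes d: "IM t 0 1 = d" and b: "IM t ibase 0 = b" and h: "IM t ihit 0 = 0" and r: "r = sem (Fr icol (L 0 (C 1)) p_scan) t"
  defines "nz k \<equiv> {j. j < k \<and> RM t 0 (b + j) \<noteq> 0}"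
  shows "CK r \<le> CK t + 1 + 7 * d" and "IM r ihit 0 = 0 \<Longrightarrow> nz d = {}"
    and "IM r ihit 0 \<noteq> 0 \<Longrightarrow> IM r ij1 0 \<in> nz d \<and> IM r ij2 0 \<in> nz d \<and> (\<forall>j\<in>nz d. IM r ij1 0 \<le> j \<and> j \<le> IM r ij2 0)"
proof -
  define Q where "Q i u \<longleftrightarrow> CK u \<le> CK t + 1 + 7 * i \<and> (IM u ihit 0 = 0 \<longrightarrow> nz i = {}) \<and>
    (IM u ihit 0 \<noteq> 0 \<longrightarrow> IM u ij1 0 \<in> nz i \<and> IM u ij2 0 \<in> nz i \<and> (\<forall>j\<in>nz i. IM u ij1 0 \<le> j \<and> j \<le> IM u ij2 0))" for i and u :: st
  have "Q d r"
    unfolding r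
  proof (rule Fr_rule[where Q = Q])
    show "Q 0 (tick t)" by (simp add: Q_def nz_def h)
  next
    fix i u assume f: "frame (insert icol (wI p_scan)) (wR p_scan) t u" and q: "Q i u"
    let ?u = "seti (tick u) icol 0 i"
    have v: "IM u ibase 0 = b" "RM u 0 = RM t 0" using frameI[OF f] frameR[OF f] b by auto
    have hit: "Q (Suc i) (sem p_hit w)" if w: "CK w \<le> CK u + 3" "IM w = IM ?u" "RM w = RM u" and nz0: "RM t 0 (b + i) \<noteq> 0" for w
    proof -
      have nzs: "nz (Suc i) = insert i (nz i)" using nz0 by (auto simp: nz_def less_Suc_eq)
      have lt: "\<And>j. j \<in> nz i \<Longrightarrow> j \<le> i" by (auto simp: nz_def)
      show ?thesis using q w lt unfolding Q_def nzs p_hit_def by auto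
    qed
    have skip: "Q (Suc i) w" if w: "CK w \<le> CK u + 3" "IM w = IM ?u" "RM w = RM u" and nz0: "RM t 0 (b + i) = 0" for w
    proof -
      have nzs: "nz (Suc i) = nz i" using nz0 by (auto simp: nz_def less_Suc_eq)
      show ?thesis using q w unfolding Q_def nzs by auto
    qed
    show "Q (Suc i) (sem p_scan ?u)"
      unfolding p_scan_def using hit skip v by auto
  qed (use d in simp)
  thus "CK r \<le> CK t + 1 + 7 * d" "IM r ihit 0 = 0 \<Longrightarrow> nz d = {}"
    "IM r ihit 0 \<noteq> 0 \<Longrightarrow> IM r ij1 0 \<in> nz d \<and> IM r ij2 0 \<in> nz d \<and> (\<forall>j\<in>nz d. IM r ij1 0 \<le> j \<and> j \<le> IM r ij2 0)"
    unfolding Q_def by blast+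
qed

text \<open>The node whose doubled value, multiplied by \<open>\<bar>a\<bar>\<close>, is
  \<open>a * x j\<close>.\<close>

definition lit :: "nat \<Rightarrow> nat \<Rightarrow> real \<Rightarrow> nat" where "lit d j a = (if 0 < a then j else j + d)"

definition redges :: "nat \<Rightarrow> nat \<Rightarrow> nat \<Rightarrow> real \<Rightarrow> real \<Rightarrow> real \<Rightarrow> edge set" where
  "redges d i j a b c = {(lit d i a, lit d j (- b), \<bar>b\<bar> / \<bar>a\<bar>, c / \<bar>a\<bar>), (lit d j b, lit d i (- a), \<bar>a\<bar> / \<bar>b\<bar>, c / \<bar>b\<bar>)}"

lemma edge_sem:
  assumes "{u, v} \<inter> {iEU, iEV, iM} = {}" "{x, y} \<inter> {rEA, rEB} = {}"
  shows "edges (sem (p_edge u v x y) s) = insert (IM s u 0, IM s v 0, RM s x 0 / RM s y 0, RM s 0 (IM s iind 0 + IM s irow 0) / RM s y 0) (edges s)"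
    and "IM (sem (p_edge u v x y) s) iM 0 = Suc (IM s iM 0)" "CK (sem (p_edge u v x y) s) = CK s + 5"
proof -
  have em: "edges t = (\<lambda>e. (IM t iEU e, IM t iEV e, RM t rEA e, RM t rEB e)) ` {..<IM t iM 0}" for t by (simp add: edges_def)
  show "edges (sem (p_edge u v x y) s) = insert (IM s u 0, IM s v 0, RM s x 0 / RM s y 0, RM s 0 (IM s iind 0 + IM s irow 0) / RM s y 0) (edges s)"
    unfolding em p_edge_def using assms by (auto simp: lessThan_Suc intro!: image_cong)
  show "IM (sem (p_edge u v x y) s) iM 0 = Suc (IM s iM 0)" "CK (sem (p_edge u v x y) s) = CK s + 5"
    using assms by (auto simp: p_edge_def)
qed

lemma sign_sem:
  assumes "r \<noteq> 0" "p \<noteq> q" "{j, 0} \<inter> {p, q} = {}" "IM s 0 1 = d" "RM s r 0 \<noteq> 0"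
  shows "IM (sem (p_sign r j p q) s) p 0 = lit d (IM s j 0) (RM s r 0)" "IM (sem (p_sign r j p q) s) q 0 = lit d (IM s j 0) (- RM s r 0)"
    "RM (sem (p_sign r j p q) s) r 0 = \<bar>RM s r 0\<bar>" "CK (sem (p_sign r j p q) s) \<le> CK s + 4"
  using assms by (auto simp: p_sign_def lit_def)

lemma rowedges_sem:
  assumes s: "IM s 0 1 = d" "IM s ij1 0 = i" "IM s ij2 0 = j" "IM s ibase 0 + i = p" "IM s ibase 0 + j = q"
    and nz: "RM s 0 p \<noteq> 0" "RM s 0 q \<noteq> 0" and r: "r = sem p_rowedges s"
  defines "h \<equiv> if i = j then 2 else 1"
  shows "edges r = redges d i j (RM s 0 p / h) (RM s 0 q / h) (RM s 0 (IM s iind 0 + IM s irow 0)) \<union> edges s"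
    and "IM r iM 0 = IM s iM 0 + 2" "CK r \<le> CK s + 24"
proof -
  define s1 where "s1 = sem (rca ::=r RL 0 (Add (V ibase) (V ij1));; rcb ::=r RL 0 (Add (V ibase) (V ij2));;
     (IF IEq (V ij1) (V ij2) THEN (rca ::=r RDv (RV rca) (OfI (C 2));; rcb ::=r RDv (RV rcb) (OfI (C 2))) ELSE Skip)) s"
  have s1: "IM s1 = IM s" "RM s1 rca 0 = RM s 0 p / h" "RM s1 rcb 0 = RM s 0 q / h" "RM s1 0 = RM s 0" "CK s1 \<le> CK s + 5"
     "RM s1 rEA = RM s rEA" "RM s1 rEB = RM s rEB"
    unfolding s1_def h_def using s by auto
  have h0: "h \<noteq> 0" by (simp add: h_def)
  define s2 where "s2 = sem (p_sign rca ij1 16 17) s1"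
  define s3 where "s3 = sem (p_sign rcb ij2 18 19) s2"
  define s4 where "s4 = sem (p_edge 16 19 rcb rca) s3"
  have r4: "r = sem (p_edge 18 17 rca rcb) s4" by (simp add: r p_rowedges_def s1_def s2_def s3_def s4_def)
  have s2: "IM s2 16 0 = lit d i (RM s 0 p / h)" "IM s2 17 0 = lit d i (- (RM s 0 p / h))" "RM s2 rca 0 = \<bar>RM s 0 p / h\<bar>" "CK s2 \<le> CK s1 + 4"
    unfolding s2_def using sign_sem[of rca 16 17 ij1 s1 d] s s1 nz h0 by auto
  have k2: "IM s2 n = IM s n" if "n \<notin> {16, 17}" for n using that by (simp add: s2_def sem_frameI s1)
  have k2R: "RM s2 n = RM s1 n" if "n \<noteq> rca" for n using that by (simp add: s2_def sem_frameR)
  have s3: "IM s3 18 0 = lit d j (RM s 0 q / h)" "IM s3 19 0 = lit d j (- (RM s 0 q / h))" "RM s3 rcb 0 = \<bar>RM s 0 q / h\<bar>" "CK s3 \<le> CK s2 + 4"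
    unfolding s3_def using sign_sem[of rcb 18 19 ij2 s2 d] s s1 nz h0 by (auto simp: k2 k2R)
  have k3: "IM s3 n = IM s2 n" if "n \<notin> {18, 19}" for n using that by (simp add: s3_def sem_frameI)
  have k3R: "RM s3 n = RM s2 n" if "n \<noteq> rcb" for n using that by (simp add: s3_def sem_frameR)
  have k4: "IM s4 n = IM s3 n" if "n \<notin> {iEU, iEV, iM}" for n using that by (simp add: s4_def sem_frameI)
  have k4R: "RM s4 n = RM s3 n" if "n \<notin> {rEA, rEB}" for n using that by (simp add: s4_def sem_frameR)
  have e3: "edges s3 = edges s" by (rule edges_frame) (simp_all add: k3 k2 k3R k2R s1)
  note E = edge_sem[of 16 19 rcb rca s3, folded s4_def] edge_sem[of 18 17 rca rcb s4, folded r4]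
  show "edges r = redges d i j (RM s 0 p / h) (RM s 0 q / h) (RM s 0 (IM s iind 0 + IM s irow 0)) \<union> edges s"
    using E(1,4) by (simp add: k4 k4R k3 k3R k2 k2R s1 s2 s3 e3 redges_def insert_commute)
  show "IM r iM 0 = IM s iM 0 + 2" "CK r \<le> CK s + 24"
    using E(2,3,5,6) s1 s2 s3 by (simp_all add: k3 k2)
qed

definition dbl :: "nat \<Rightarrow> (nat \<Rightarrow> real) \<Rightarrow> nat \<Rightarrow> real" where "dbl d x v = (if v < d then x v else - x (v - d))"
definition halve :: "nat \<Rightarrow> (nat \<Rightarrow> real) \<Rightarrow> nat \<Rightarrow> real" where "halve d X j = (X j - X (j + d)) / 2"

text \<open>Only the antisymmetric part of a solution matters, since the two edges of a row are each other's mirror image.\<close>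
lemma redges_ssol:
  assumes "i < d" "j < d" "a \<noteq> 0" "b \<noteq> 0"
  shows "a * x i + b * x j < c \<Longrightarrow> ssol (redges d i j a b c) (dbl d x)"
    and "ssol (redges d i j a b c) X \<Longrightarrow> a * halve d X i + b * halve d X j < c"
proof -
  have m: "\<bar>a\<bar> * X (lit d i a) < \<bar>b\<bar> * X (lit d j (- b)) + c \<and> \<bar>b\<bar> * X (lit d j b) < \<bar>a\<bar> * X (lit d i (- a)) + c
     \<longleftrightarrow> ssol (redges d i j a b c) X" for X
  proof -
    have "(p < q / r * t + c / r) = (r * p < q * t + c)" if "0 < r" for p q r t :: real
    proof -
      have "q / r * t + c / r = (q * t + c) / r" by (simp add: add_divide_distrib)
      thus ?thesis using that by (simp add: less_divide_eq mult.commute)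
    qed
    thus ?thesis using assms(3,4) by (simp add: redges_def ssol_def)
  qed
  show "ssol (redges d i j a b c) (dbl d x)" if "a * x i + b * x j < c"
    unfolding m[symmetric] using that assms by (auto simp: lit_def dbl_def abs_if)
  show "a * halve d X i + b * halve d X j < c" if "ssol (redges d i j a b c) X"
    using that unfolding m[symmetric] using assms by (auto simp: lit_def halve_def abs_if field_simps split: if_splits)
qed

lemma redges_wf: "i < d \<Longrightarrow> j < d \<Longrightarrow> a \<noteq> 0 \<Longrightarrow> b \<noteq> 0 \<Longrightarrow> (u, v, e, f) \<in> redges d i j a b c \<Longrightarrow> u < d + d \<and> v < d + d \<and> 0 < e"
  by (auto simp: redges_def lit_def)

text \<open>The way back is restricted to nonzero rows, as a zero row has no edges that could
  enforce it.\<close>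

definition rowenc :: "nat \<Rightarrow> (nat \<Rightarrow> nat \<Rightarrow> real) \<Rightarrow> (nat \<Rightarrow> real) \<Rightarrow> nat \<Rightarrow> edge set \<Rightarrow> bool" where
  "rowenc d A b i E \<longleftrightarrow> (\<forall>(u, v, a, c)\<in>E. u < d + d \<and> v < d + d \<and> 0 < a) \<and>
     (\<forall>x. row_val d A x i < b i \<longrightarrow> ssol E (dbl d x)) \<and>
     ((\<exists>j<d. A i j \<noteq> 0) \<longrightarrow> (\<forall>X. ssol E X \<longrightarrow> row_val d A (halve d X) i < b i))"

lemma row_sem:
  assumes t: "IM t 0 1 = d" "IM t ibase 0 = i * d" "IM t iind 0 = n * d" "IM t irow 0 = i"
    and raw: "\<And>j. j < d \<Longrightarrow> RM t 0 (i * d + j) = A i j" "RM t 0 (n * d + i) = b i"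
    and c2: "card {j. j < d \<and> A i j \<noteq> 0} \<le> 2" and r: "r = sem p_row t"
  shows "CK r \<le> CK t + 7 * d + 28 \<and> IM r ibase 0 = i * d + d \<and> IM r iM 0 \<le> IM t iM 0 + 2 \<and>
    (\<exists>E. edges r = edges t \<union> E \<and> rowenc d A b i E)"
proof -
  define s1 where "s1 = sem (Fr icol (L 0 (C 1)) p_scan) (sem (ihit ::= C 0) t)"
  define s2 where "s2 = sem (IF ILe (C 1) (V ihit) THEN p_rowedges ELSE Skip) s1"
  have r2: "r = sem (ibase ::= Add (V ibase) (L 0 (C 1))) s2" by (simp add: r p_row_def s1_def s2_def)
  have k1: "IM s1 n = IM t n" if "n \<notin> {icol, ihit, ij1, ij2}" for n using that by (simp add: s1_def sem_frameI)
  have k1R: "RM s1 = RM t" by (rule ext) (simp add: s1_def sem_frameR)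
  have e1: "edges s1 = edges t" by (rule edges_frame) (simp_all add: k1 k1R)
  have k2: "IM s2 n = IM s1 n" if "n \<notin> {16, 17, 18, 19, iEU, iEV, iM}" for n using that by (auto simp: s2_def sem_frameI)
  have er: "edges r = edges s2" by (rule edges_frame) (simp_all add: r2)
  have rb: "IM r ibase 0 = i * d + d" "CK r = CK s2 + 1" "IM r iM = IM s2 iM" using t by (simp_all add: r2 k2 k1)
  define nz where "nz = {j. j < d \<and> A i j \<noteq> 0}"
  have nz': "nz = {j. j < d \<and> RM (sem (ihit ::= C 0) t) 0 (i * d + j) \<noteq> 0}" using raw by (auto simp: nz_def)
  note sc = scan_sem[of "sem (ihit ::= C 0) t" d "i * d" s1, folded nz']
  have c1: "CK s1 \<le> CK t + 2 + 7 * d" using sc(1) t by (simp add: s1_def)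
  show ?thesis
  proof (cases "IM s1 ihit 0 = 0")
    case True
    have "nz = {}" using sc(2) True t by (simp add: s1_def)
    hence z: "\<And>j. j < d \<Longrightarrow> A i j = 0" by (auto simp: nz_def)
    have s2: "s2 = tick s1" using True by (simp add: s2_def)
    have "edges s2 = edges t" using e1 by (simp add: s2 edges_def)
    moreover have "rowenc d A b i {}" using z by (auto simp: rowenc_def ssol_def)
    ultimately show ?thesis using rb c1 k1[of iM] er by (auto simp: s2)
  next
    case False
    define p where "p = IM s1 ij1 0"
    define q where "q = IM s1 ij2 0"
    have pq: "p \<in> nz" "q \<in> nz" "\<And>j. j \<in> nz \<Longrightarrow> p \<le> j \<and> j \<le> q"
      using sc(3) False t unfolding p_def q_def by (auto simp: s1_def)
    hence lt: "p < d" "q < d" and n0: "A i p \<noteq> 0" "A i q \<noteq> 0" by (auto simp: nz_def)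
    have fin: "finite nz" by (simp add: nz_def)
    \<comment> \<open>A further nonzero column would lie strictly between the first and the last one
      and make three.\<close>
    have nzpq: "nz = {p, q}"
    proof (rule ccontr)
      assume "nz \<noteq> {p, q}"
      then obtain j where j: "j \<in> nz" "j \<noteq> p" "j \<noteq> q" using pq(1,2) by blast
      hence "p < j" "j < q" using pq(3)[OF j(1)] by auto
      hence "card {p, j, q} = 3" by simp
      moreover have "card {p, j, q} \<le> card nz" using j pq fin by (intro card_mono) auto
      ultimately show False using c2 by (simp add: nz_def)
    qed
    define h where "h = (if p = q then 2 else 1 :: real)"
    have s2: "s2 = sem p_rowedges (tick s1)" using False by (simp add: s2_def)
    have "edges (tick s1) = edges t" using e1 by (simp add: edges_def)
    moreover have pre: "IM (tick s1) 0 1 = d" "IM (tick s1) ij1 0 = p" "IM (tick s1) ij2 0 = q" "IM (tick s1) ibase 0 + p = i * d + p"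
      "IM (tick s1) ibase 0 + q = i * d + q" "RM (tick s1) 0 (i * d + p) \<noteq> 0" "RM (tick s1) 0 (i * d + q) \<noteq> 0"
      using t raw n0 lt by (simp_all add: k1 k1R p_def q_def)
    note re = rowedges_sem[OF pre s2, folded h_def]
    define E where "E = redges d p q (A i p / h) (A i q / h) (b i)"
    have "edges s2 = edges t \<union> E"
      using re(1) calculation lt raw t by (auto simp: k1 k1R E_def)
    moreover have "rowenc d A b i E"
    proof -
      have h: "h \<noteq> 0" by (simp add: h_def)
      have rv: "row_val d A x i = A i p / h * x p + A i q / h * x q" for x
      proof -
        have "row_val d A x i = (\<Sum>j\<in>nz. A i j * x j)" unfolding row_val_def
          by (rule sum.mono_neutral_right) (auto simp: nz_def)
        thus ?thesis unfolding nzpq by (auto simp: h_def)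
      qed
      have ne: "A i p / h \<noteq> 0" "A i q / h \<noteq> 0" using n0 h by simp_all
      show ?thesis unfolding rowenc_def rv E_def
        using redges_ssol[OF lt ne] redges_wf[OF lt ne] by blast
    qed
    ultimately show ?thesis using re(2,3) rb c1 k1[of iM] er by auto
  qed
qed

lemma EUV_edges: "EUV s N \<longleftrightarrow> (\<forall>(u, v, a, b)\<in>edges s. u < N \<and> v < N \<and> 0 < a)"
  by (auto simp: EUV_def edges_def)

lemma init_sem:
  assumes nd: "IM s 0 0 = n" "IM s 0 1 = d"
    and raw: "\<And>i j. i < n \<Longrightarrow> j < d \<Longrightarrow> RM s 0 (i * d + j) = A i j" "\<And>i. i < n \<Longrightarrow> RM s 0 (n * d + i) = b i"
    and A: "LI2 n d A" and r: "r = sem p_init s"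
  shows "stinv (d + d) (edges r) (2 * n) 0 r \<and> CK r \<le> CK s + 10 + 6 * d + 2 * n + n * (7 * d + 29) \<and> IM r iind 0 = n * d \<and>
    (\<forall>x. interior_point n d A b x \<longrightarrow> ssol (edges r) (dbl d x)) \<and>
    (\<forall>X. ssol (edges r) X \<longrightarrow> (\<forall>i<n. (\<exists>j<d. A i j \<noteq> 0) \<longrightarrow> row_val d A (halve d X) i < b i))"
proof -
  define N where "N = d + d"
  define s1 where "s1 = sem (iN ::= Add (L 0 (C 1)) (L 0 (C 1));; iM1 ::= Add (V iN) (C 1);; iG2 ::= Add (V iM1) (V iM1);; ibk ::= C 0) s"
  define s2 where "s2 = sem (Fr ikk (V iN) (IA iROW (V ikk) (V ibk);; ibk ::= Add (V ibk) (V iG2))) s1"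
  define s3 where "s3 = sem (Fr irow (V 0) (iind ::= Add (V iind) (L 0 (C 1)))) (sem (iind ::= C 0) s2)"
  define s4 where "s4 = sem (iM ::= C 0;; ibase ::= C 0) s3"
  have r4: "r = sem (Fr irow (V 0) p_row) s4" by (simp add: r p_init_def s1_def s2_def s3_def s4_def)
  have s1: "CK s1 = CK s + 4" "IM s1 iN 0 = N" "IM s1 iM1 0 = Suc N" "IM s1 iG2 0 = 2 * Suc N" "IM s1 ibk 0 = 0" "IM s1 0 = IM s 0" "RM s1 = RM s"
    using nd by (simp_all add: s1_def N_def)
  define Q2 where "Q2 i t \<longleftrightarrow> CK t = CK s1 + 1 + 3 * i \<and> IM t ibk 0 = i * (2 * Suc N) \<and> (\<forall>k<i. IM t iROW k = k * (2 * Suc N))" for i and t :: st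
  have q2: "Q2 N s2"
    unfolding s2_def
  proof (rule Fr_rule[where Q = Q2])
    fix i t assume f: "frame (insert ikk (wI (IA iROW (V ikk) (V ibk);; ibk ::= Add (V ibk) (V iG2)))) (wR (IA iROW (V ikk) (V ibk);; ibk ::= Add (V ibk) (V iG2))) s1 t"
      and q: "Q2 i t"
    have "IM t iG2 0 = 2 * Suc N" using frameI[OF f, of iG2] s1 by simp
    thus "Q2 (Suc i) (sem (IA iROW (V ikk) (V ibk);; ibk ::= Add (V ibk) (V iG2)) (seti (tick t) ikk 0 i))"
      using q by (auto simp: Q2_def less_Suc_eq)
  qed (use s1 in \<open>simp_all add: Q2_def\<close>)
  have k2: "IM s2 m = IM s1 m" if "m \<notin> {ikk, iROW, ibk}" for m using that by (simp add: s2_def sem_frameI)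
  have k2R: "RM s2 = RM s" by (rule ext) (simp add: s2_def sem_frameR s1)
  have q3: "CK s3 = CK s2 + 2 + 2 * n \<and> IM s3 iind 0 = n * d"
    unfolding s3_def
  proof (rule Fr_rule[where Q = "\<lambda>i t. CK t = CK s2 + 2 + 2 * i \<and> IM t iind 0 = i * d"])
    fix i t assume f: "frame (insert irow (wI (iind ::= Add (V iind) (L 0 (C 1))))) (wR (iind ::= Add (V iind) (L 0 (C 1)))) (sem (iind ::= C 0) s2) t"
      and q: "CK t = CK s2 + 2 + 2 * i \<and> IM t iind 0 = i * d"
    have "IM t 0 1 = d" using frameI[OF f, of 0] s1 nd by (simp add: k2)
    thus "CK (sem (iind ::= Add (V iind) (L 0 (C 1))) (seti (tick t) irow 0 i)) = CK s2 + 2 + 2 * Suc i \<and>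
        IM (sem (iind ::= Add (V iind) (L 0 (C 1))) (seti (tick t) irow 0 i)) iind 0 = Suc i * d" using q by simp
  qed (use s1 nd in \<open>simp_all add: k2\<close>)
  have k3: "IM s3 m = IM s2 m" if "m \<notin> {irow, iind}" for m using that by (simp add: s3_def sem_frameI)
  have k3R: "RM s3 = RM s" by (rule ext) (simp add: s3_def sem_frameR k2R)
  have s4: "CK s4 = CK s + 9 + 3 * N + 2 * n" "IM s4 iM 0 = 0" "IM s4 ibase 0 = 0" "IM s4 0 = IM s 0" "RM s4 = RM s" "IM s4 iind 0 = n * d"
    "IM s4 iN 0 = N" "IM s4 iM1 0 = Suc N" "IM s4 iG2 0 = 2 * Suc N" "\<And>k. k < N \<Longrightarrow> IM s4 iROW k = k * (2 * Suc N)"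
    using q2 q3 s1 by (simp_all add: s4_def k3 k3R k2 Q2_def)
  define Q where "Q i t \<longleftrightarrow> CK t \<le> CK s4 + 1 + i * (7 * d + 29) \<and> IM t ibase 0 = i * d \<and> IM t iM 0 \<le> 2 * i \<and> EUV t N \<and>
     (\<forall>x. (\<forall>k<i. row_val d A x k < b k) \<longrightarrow> ssol (edges t) (dbl d x)) \<and>
     (\<forall>X. ssol (edges t) X \<longrightarrow> (\<forall>k<i. (\<exists>j<d. A k j \<noteq> 0) \<longrightarrow> row_val d A (halve d X) k < b k))" for i and t :: st
  have "Q n r"
    unfolding r4
  proof (rule Fr_rule[where Q = Q])
    show "Q 0 (tick s4)" using s4 by (auto simp: Q_def EUV_def ssol_def edges_def)
  next
    fix i t assume i: "i < ie (V 0) s4" and f: "frame (insert irow (wI p_row)) (wR p_row) s4 t" and q: "Q i t"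
    have iN: "i < n" using i s4 nd by simp
    let ?t = "seti (tick t) irow 0 i"
    have et: "edges ?t = edges t" by (rule edges_frame) simp_all
    have pre: "IM ?t 0 1 = d" "IM ?t ibase 0 = i * d" "IM ?t iind 0 = n * d" "IM ?t irow 0 = i"
      using frameI[OF f, of 0] frameI[OF f, of iind] s4 nd q by (simp_all add: Q_def)
    have rt: "RM ?t 0 = RM s 0" using frameR[OF f, of 0] s4 by simp
    have c2: "card {j. j < d \<and> A i j \<noteq> 0} \<le> 2" using A iN by (auto simp: LI2_def)
    have "CK (sem p_row ?t) \<le> CK ?t + 7 * d + 28 \<and> IM (sem p_row ?t) ibase 0 = i * d + d \<and> IM (sem p_row ?t) iM 0 \<le> IM ?t iM 0 + 2 \<and>
      (\<exists>E. edges (sem p_row ?t) = edges ?t \<union> E \<and> rowenc d A b i E)"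
      by (rule row_sem[where A = A and b = b, OF pre _ _ c2 refl]) (simp_all only: rt raw[OF iN])
    then obtain E where E: "edges (sem p_row ?t) = edges t \<union> E" "rowenc d A b i E"
      and c': "CK (sem p_row ?t) \<le> CK ?t + 7 * d + 28" "IM (sem p_row ?t) ibase 0 = i * d + d" "IM (sem p_row ?t) iM 0 \<le> IM ?t iM 0 + 2"
      unfolding et by blast
    have c: "CK (sem p_row ?t) \<le> CK t + 7 * d + 29" "IM (sem p_row ?t) ibase 0 = i * d + d" "IM (sem p_row ?t) iM 0 \<le> IM t iM 0 + 2"
    proof -
      have "CK ?t = CK t + 1" "IM ?t iM 0 = IM t iM 0" by simp_all
      thus "CK (sem p_row ?t) \<le> CK t + 7 * d + 29" "IM (sem p_row ?t) ibase 0 = i * d + d" "IM (sem p_row ?t) iM 0 \<le> IM t iM 0 + 2"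
        using c' by linarith+
    qed
    note e = E(2)[unfolded rowenc_def, folded N_def]
    have R: "\<forall>(u, v, a, c)\<in>E. u < N \<and> v < N \<and> 0 < a" "\<And>x. row_val d A x i < b i \<Longrightarrow> ssol E (dbl d x)"
      "\<And>X. (\<exists>j<d. A i j \<noteq> 0) \<Longrightarrow> ssol E X \<Longrightarrow> row_val d A (halve d X) i < b i"
      by (fact e[THEN conjunct1], fact e[THEN conjunct2, THEN conjunct1, rule_format], fact e[THEN conjunct2, THEN conjunct2, rule_format])
    have un: "ssol (edges t \<union> E) X \<longleftrightarrow> ssol (edges t) X \<and> ssol E X" for X by (auto simp: ssol_def)
    have q': "CK t \<le> CK s4 + 1 + i * (7 * d + 29)" "IM t iM 0 \<le> 2 * i" "EUV t N"
      "\<And>x. (\<forall>k<i. row_val d A x k < b k) \<Longrightarrow> ssol (edges t) (dbl d x)"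
      "\<And>X k. ssol (edges t) X \<Longrightarrow> k < i \<Longrightarrow> \<exists>j<d. A k j \<noteq> 0 \<Longrightarrow> row_val d A (halve d X) k < b k"
      using q unfolding Q_def by simp_all
    show "Q (Suc i) (sem p_row ?t)"
      unfolding Q_def
    proof (intro conjI allI impI)
      show "CK (sem p_row ?t) \<le> CK s4 + 1 + Suc i * (7 * d + 29)" using c(1) q'(1) by simp
      show "IM (sem p_row ?t) ibase 0 = Suc i * d" using c(2) by simp
      show "IM (sem p_row ?t) iM 0 \<le> 2 * Suc i" using c(3) q'(2) by simp
      show "EUV (sem p_row ?t) N" using q'(3) R(1) unfolding EUV_edges E(1) ball_Un by (rule conjI)
      show "ssol (edges (sem p_row ?t)) (dbl d x)" if "\<forall>k<Suc i. row_val d A x k < b k" for x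
        unfolding E(1) un using that by (intro conjI q'(4) R(2)) simp_all
      show "row_val d A (halve d X) k < b k" if "ssol (edges (sem p_row ?t)) X" "k < Suc i" "\<exists>j<d. A k j \<noteq> 0" for X k
        using that(1)[unfolded E(1) un] that(2,3) q'(5)[of X k] R(3)[of X] by (cases "k = i") simp_all
    qed
  qed (use s4 nd in simp)
  moreover have "IM r m = IM s4 m" if "m \<notin> insert irow (wI p_row)" for m using that by (simp add: r4 sem_frameI)
  ultimately show ?thesis using s4 unfolding stinv_def by (auto simp: Q_def N_def interior_point_def)
qed

section \<open>The final check and the whole program\<close>

definition p_dot :: com where
  "p_dot = (racc ::=r RAd (RV racc) (RMl (RL 0 (Add (V ibase) (V icol))) (RL rXO (V icol))))"

definition p_check :: com where
  "p_check = (racc ::=r OfI (C 0);; Fr icol (L 0 (C 1)) p_dot;;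
     (IF BLt (RV racc) (RL 0 (Add (V iind) (V irow))) THEN Skip ELSE ihit ::= C 0);; ibase ::= Add (V ibase) (L 0 (C 1)))"

text \<open>Input and output share array 0. So the candidate waits in \<open>rXO\<close> while it is
  checked against the matrix and is copied over it afterwards; likewise the flag overwrites
  \<open>n\<close> only after the check has used it.\<close>

definition p_final :: com where
  "p_final = (Fr icol (L 0 (C 1)) (RA rXO (V icol) (RDv (RSb (RL rX (V icol)) (RL rX (Add (V icol) (L 0 (C 1))))) (OfI (C 2))));;
     ihit ::= C 1;; ibase ::= C 0;; Fr irow (V 0) p_check;;
     Fr icol (L 0 (C 1)) (RA 0 (V icol) (RL rXO (V icol)));; IA 0 (C 0) (V ihit))"

definition p_main :: com where
  "p_main = (p_init;; Fr iLL (V iN) p_stage;; p_back;; p_final)"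

lemma wI_check [simp]: "wI p_check = {icol, ihit, ibase}" "wR p_check = {racc}" by (auto simp: p_check_def p_dot_def)

lemma check_sem:
  assumes t: "IM t 0 1 = d" "IM t ibase 0 = i * d" "IM t iind 0 = m" "IM t irow 0 = i"
    and raw: "\<And>j. j < d \<Longrightarrow> RM t 0 (i * d + j) = A i j" "RM t 0 (m + i) = b i"
    and y: "\<And>j. j < d \<Longrightarrow> RM t rXO j = y j" and r: "r = sem p_check t"
  shows "CK r \<le> CK t + 5 + 2 * d \<and> IM r ibase 0 = Suc i * d \<and> IM r ihit 0 = (if row_val d A y i < b i then IM t ihit 0 else 0)"
proof -
  define s1 where "s1 = sem (Fr icol (L 0 (C 1)) p_dot) (sem (racc ::=r OfI (C 0)) t)"
  have "CK s1 = CK t + 2 + 2 * d \<and> RM s1 racc 0 = row_val d A y i"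
    unfolding s1_def
  proof (rule Fr_rule[where Q = "\<lambda>k u. CK u = CK t + 2 + 2 * k \<and> RM u racc 0 = (\<Sum>j<k. A i j * y j)"])
    fix k u assume k: "k < ie (L 0 (C 1)) (sem (racc ::=r OfI (C 0)) t)"
      and f: "frame (insert icol (wI p_dot)) (wR p_dot) (sem (racc ::=r OfI (C 0)) t) u"
      and q: "CK u = CK t + 2 + 2 * k \<and> RM u racc 0 = (\<Sum>j<k. A i j * y j)"
    have kd: "k < d" using k t by simp
    have "IM u ibase 0 = i * d" "RM u 0 = RM t 0" "RM u rXO = RM t rXO"
      using frameI[OF f, of ibase] frameR[OF f, of 0] frameR[OF f, of rXO] t by (simp_all add: p_dot_def)
    thus "CK (sem p_dot (seti (tick u) icol 0 k)) = CK t + 2 + 2 * Suc k \<and>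
        RM (sem p_dot (seti (tick u) icol 0 k)) racc 0 = (\<Sum>j<Suc k. A i j * y j)"
      using q raw(1)[OF kd] y[OF kd] by (simp add: p_dot_def)
  qed (use t in \<open>simp_all add: row_val_def\<close>)
  moreover have "IM s1 n = IM t n" if "n \<noteq> icol" for n using that by (simp add: s1_def sem_frameI p_dot_def)
  moreover have "RM s1 n = RM t n" if "n \<noteq> racc" for n using that by (simp add: s1_def sem_frameR p_dot_def)
  moreover have "r = sem (ibase ::= Add (V ibase) (L 0 (C 1))) (sem (IF BLt (RV racc) (RL 0 (Add (V iind) (V irow))) THEN Skip ELSE ihit ::= C 0) s1)"
    by (simp add: r p_check_def s1_def)
  ultimately show ?thesis using t raw(2) by simp
qed

lemma final_sem:
  assumes nd: "IM s 0 0 = n" "IM s 0 1 = d" "IM s iind 0 = n * d"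
    and raw: "\<And>i j. i < n \<Longrightarrow> j < d \<Longrightarrow> RM s 0 (i * d + j) = A i j" "\<And>i. i < n \<Longrightarrow> RM s 0 (n * d + i) = b i"
    and r: "r = sem p_final s"
  shows "CK r \<le> CK s + 6 + 4 * d + n * (2 * d + 6) \<and> (\<forall>j<d. RM r 0 j = halve d (RM s rX) j) \<and>
    IM r 0 0 = (if interior_point n d A b (halve d (RM s rX)) then 1 else 0)"
proof -
  let ?y = "halve d (RM s rX)"
  let ?c1 = "RA rXO (V icol) (RDv (RSb (RL rX (V icol)) (RL rX (Add (V icol) (L 0 (C 1))))) (OfI (C 2)))"
  let ?c3 = "RA 0 (V icol) (RL rXO (V icol))"
  define s1 where "s1 = sem (Fr icol (L 0 (C 1)) ?c1) s"
  define s2 where "s2 = sem (ihit ::= C 1;; ibase ::= C 0) s1"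
  define s3 where "s3 = sem (Fr irow (V 0) p_check) s2"
  define s4 where "s4 = sem (Fr icol (L 0 (C 1)) ?c3) s3"
  have r4: "r = sem (IA 0 (C 0) (V ihit)) s4" by (simp add: r p_final_def s1_def s2_def s3_def s4_def)
  have q1: "CK s1 = CK s + 1 + 2 * d \<and> (\<forall>j<d. RM s1 rXO j = ?y j)"
    unfolding s1_def
  proof (rule Fr_rule[where Q = "\<lambda>k u. CK u = CK s + 1 + 2 * k \<and> (\<forall>j<k. RM u rXO j = ?y j)"])
    fix k u assume f: "frame (insert icol (wI ?c1)) (wR ?c1) s u" and q: "CK u = CK s + 1 + 2 * k \<and> (\<forall>j<k. RM u rXO j = ?y j)"
    have "IM u 0 1 = d" "RM u rX = RM s rX" using frameI[OF f, of 0] frameR[OF f, of rX] nd by simp_all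
    thus "CK (sem ?c1 (seti (tick u) icol 0 k)) = CK s + 1 + 2 * Suc k \<and> (\<forall>j<Suc k. RM (sem ?c1 (seti (tick u) icol 0 k)) rXO j = ?y j)"
      using q by (auto simp: less_Suc_eq halve_def)
  qed (use nd in simp_all)
  have k1: "IM s1 m = IM s m" if "m \<noteq> icol" for m using that by (simp add: s1_def sem_frameI)
  have k1R: "RM s1 m = RM s m" if "m \<noteq> rXO" for m using that by (simp add: s1_def sem_frameR)
  have s2: "CK s2 = CK s1 + 2" "IM s2 ihit 0 = 1" "IM s2 ibase 0 = 0" "IM s2 0 = IM s 0" "IM s2 iind 0 = n * d" "RM s2 = RM s1"
    using nd by (simp_all add: s2_def k1)
  define Q where "Q i t \<longleftrightarrow> CK t \<le> CK s2 + 1 + i * (2 * d + 6) \<and> IM t ibase 0 = i * d \<and>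
    IM t ihit 0 = (if \<forall>k<i. row_val d A ?y k < b k then 1 else 0)" for i and t :: st
  have q3: "Q n s3"
    unfolding s3_def
  proof (rule Fr_rule[where Q = Q])
    fix i t assume i: "i < ie (V 0) s2" and f: "frame (insert irow (wI p_check)) (wR p_check) s2 t" and q: "Q i t"
    have iN: "i < n" using i s2 nd by simp
    let ?t = "seti (tick t) irow 0 i"
    have pre: "IM ?t 0 1 = d" "IM ?t ibase 0 = i * d" "IM ?t iind 0 = n * d" "IM ?t irow 0 = i"
      using frameI[OF f, of 0] frameI[OF f, of iind] s2 nd q by (simp_all add: Q_def)
    have rt: "RM ?t 0 = RM s 0" "RM ?t rXO = RM s1 rXO" using frameR[OF f, of 0] frameR[OF f, of rXO] s2 k1R by simp_all
    have "CK (sem p_check ?t) \<le> CK ?t + 5 + 2 * d \<and> IM (sem p_check ?t) ibase 0 = Suc i * d \<and>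
      IM (sem p_check ?t) ihit 0 = (if row_val d A ?y i < b i then IM ?t ihit 0 else 0)"
      by (rule check_sem[where A = A and b = b, OF pre _ _ _ refl]) (use q1 in \<open>simp_all only: rt raw[OF iN]\<close>)
    moreover have "IM ?t ihit 0 = IM t ihit 0" "CK ?t = CK t + 1" by simp_all
    ultimately show "Q (Suc i) (sem p_check ?t)" using q unfolding Q_def less_Suc_eq by auto
  qed (use s2 nd in \<open>simp_all add: Q_def\<close>)
  have k3: "IM s3 0 = IM s 0" "RM s3 rXO = RM s1 rXO" using s2 by (simp_all add: s3_def sem_frameI sem_frameR)
  have q4: "CK s4 = CK s3 + 1 + 2 * d \<and> (\<forall>j<d. RM s4 0 j = ?y j)"
    unfolding s4_def
  proof (rule Fr_rule[where Q = "\<lambda>k u. CK u = CK s3 + 1 + 2 * k \<and> (\<forall>j<k. RM u 0 j = ?y j)"])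
    fix k u assume k: "k < ie (L 0 (C 1)) s3" and f: "frame (insert icol (wI ?c3)) (wR ?c3) s3 u" and q: "CK u = CK s3 + 1 + 2 * k \<and> (\<forall>j<k. RM u 0 j = ?y j)"
    have "RM u rXO k = ?y k" using frameR[OF f, of rXO] q1 k k3 nd by simp
    thus "CK (sem ?c3 (seti (tick u) icol 0 k)) = CK s3 + 1 + 2 * Suc k \<and> (\<forall>j<Suc k. RM (sem ?c3 (seti (tick u) icol 0 k)) 0 j = ?y j)"
      using q by (auto simp: less_Suc_eq)
  qed (use nd k3 in simp_all)
  have k4: "IM s4 ihit = IM s3 ihit" by (simp add: s4_def sem_frameI)
  have "IM r 0 0 = IM s3 ihit 0" "RM r 0 = RM s4 0" "CK r = CK s4 + 1" by (simp_all add: r4 k4)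
  thus ?thesis using q1 q3 q4 s2 unfolding Q_def interior_point_def by auto
qed

lemma stinv_frame:
  assumes "\<And>m. m \<noteq> iLL \<Longrightarrow> IM t m = IM s m" "RM t = RM s" "stinv N E0 m0 l s"
  shows "stinv N E0 m0 l t"
proof -
  have 1: "edges t = edges s" by (rule edges_frame) (simp_all add: assms)
  have 2: "EUV t N = EUV s N" by (simp add: EUV_def assms)
  have 3: "rowok (Suc N) t k = rowok (Suc N) s k" "Hrow (Suc N) t k = Hrow (Suc N) s k" "compE (Suc N) t k = compE (Suc N) s k" for k
    by (rule row_frame_local; simp add: assms)+
  show ?thesis using assms(3) unfolding stinv_def 1 2 3 by (simp add: assms)
qed

definition mcost :: "nat \<Rightarrow> nat \<Rightarrow> nat \<Rightarrow> nat" where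
  "mcost n d T = (let N = d + d; m = 2 * n + 2 * N in
     20 + 10 * d + 2 * n + n * (9 * d + 35) + N * (12 + 18 * Suc N + stcost N m (m + 2 * N * Suc N) T))"

text \<open>The flag repeats the verdict of the check, so it is 1 only for a genuine interior point.
  Conversely an interior point makes the encoding feasible, and then the candidate passes.\<close>

lemma main_sem:
  assumes nd: "IM s 0 0 = n" "IM s 0 1 = d" "CK s = 0"
    and raw: "\<And>i j. i < n \<Longrightarrow> j < d \<Longrightarrow> RM s 0 (i * d + j) = A i j" "\<And>i. i < n \<Longrightarrow> RM s 0 (n * d + i) = b i"
    and A: "LI2 n d A" and T: "2 * n + 2 * (d + d) + 2 * (d + d) * Suc (d + d) \<le> 2 ^ T" and r: "r = sem p_main s"
  shows "CK r \<le> mcost n d T" and "IM r 0 0 = (if full_dimensional n d A b then 1 else 0)"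
    and "full_dimensional n d A b \<Longrightarrow> interior_point n d A b (RM r 0)"
proof -
  define N where "N = d + d"
  define c where "c = stcost N (2 * n + 2 * N) (2 * n + 2 * N + 2 * N * Suc N) T"
  define s1 where "s1 = sem p_init s"
  define s2 where "s2 = sem (Fr iLL (V iN) p_stage) s1"
  define s3 where "s3 = sem p_back s2"
  have r3: "r = sem p_final s3" by (simp add: r p_main_def s1_def s2_def s3_def)
  define E where "E = edges s1"
  have I: "stinv N E (2 * n) 0 s1" "CK s1 \<le> 10 + 6 * d + 2 * n + n * (7 * d + 29)" "IM s1 iind 0 = n * d"
    "\<And>x. interior_point n d A b x \<Longrightarrow> ssol E (dbl d x)"
    "\<And>X i. ssol E X \<Longrightarrow> i < n \<Longrightarrow> \<exists>j<d. A i j \<noteq> 0 \<Longrightarrow> row_val d A (halve d X) i < b i"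
    using init_sem[OF nd(1,2) raw A s1_def] nd(3) unfolding N_def E_def by simp_all
  have "stinv N E (2 * n) N s2 \<and> CK s2 \<le> CK s1 + 1 + N * (1 + c)"
    unfolding s2_def
  proof (rule Fr_rule[where Q = "\<lambda>l t. stinv N E (2 * n) l t \<and> CK t \<le> CK s1 + 1 + l * (1 + c)"])
    show "stinv N E (2 * n) 0 (tick s1) \<and> CK (tick s1) \<le> CK s1 + 1 + 0 * (1 + c)" using stinv_frame[OF _ _ I(1), of "tick s1"] by simp
    fix l t assume "l < ie (V iN) s1" and q: "stinv N E (2 * n) l t \<and> CK t \<le> CK s1 + 1 + l * (1 + c)"
    hence l: "l < N" using I(1) by (simp add: stinv_def)
    let ?t = "seti (tick t) iLL 0 l"
    have "stinv N E (2 * n) l ?t" by (rule stinv_frame[of ?t t]) (use q in simp_all)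
    moreover have "IM ?t iLL 0 = l" "CK ?t = CK t + 1" by simp_all
    ultimately show "stinv N E (2 * n) (Suc l) (sem p_stage ?t) \<and> CK (sem p_stage ?t) \<le> CK s1 + 1 + Suc l * (1 + c)"
      using stage_sem[of N E "2 * n" l ?t T, OF _ _ l _ refl] T q unfolding N_def c_def by auto
  next
    show "stinv N E (2 * n) N t \<and> CK t \<le> CK s1 + 1 + N * (1 + c)" if "stinv N E (2 * n) (ie (V iN) s1) t \<and> CK t \<le> CK s1 + 1 + ie (V iN) s1 * (1 + c)" for t
      using that I(1) by (simp add: stinv_def)
  qed
  hence S: "stinv N E (2 * n) N s2" "CK s2 \<le> CK s1 + 1 + N * (1 + c)" by blast+
  note B = back_sem[OF S(1) s3_def]
  have k3: "IM s3 0 = IM s 0" "RM s3 0 = RM s 0" "IM s3 iind = IM s1 iind"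
    by (simp_all add: s3_def s2_def s1_def sem_frameI sem_frameR p_stage_def p_init_def)
  let ?y = "halve d (RM s3 rX)"
  have F: "CK r \<le> CK s3 + 6 + 4 * d + n * (2 * d + 6)" "\<And>j. j < d \<Longrightarrow> RM r 0 j = ?y j"
    "IM r 0 0 = (if interior_point n d A b ?y then 1 else 0)"
    using final_sem[of s3 n d A b r] nd I(3) raw r3 unfolding k3 by simp_all
  have ip: "interior_point n d A b ?y" if "full_dimensional n d A b"
    unfolding interior_point_def
  proof (intro allI impI)
    from that obtain x where x: "interior_point n d A b x" by (auto simp: full_dimensional_def)
    have "ssol E (RM s3 rX)" using B(2) I(4)[OF x] by blast
    fix i assume i: "i < n"
    show "row_val d A ?y i < b i"
    proof (cases "\<exists>j<d. A i j \<noteq> 0")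
      case True thus ?thesis using I(5) \<open>ssol E (RM s3 rX)\<close> i by blast
    next
      \<comment> \<open>A zero row has the same value 0 at every point, so the candidate satisfies
        it because \<open>x\<close> does.\<close>
      case False
      hence "row_val d A z i = 0" for z by (simp add: row_val_def)
      thus ?thesis using x i unfolding interior_point_def by metis
    qed
  qed
  show "IM r 0 0 = (if full_dimensional n d A b then 1 else 0)"
    using F(3) ip by (auto simp: full_dimensional_def)
  have "row_val d A (RM r 0) i = row_val d A ?y i" for i using F(2) by (simp add: row_val_def)
  thus "full_dimensional n d A b \<Longrightarrow> interior_point n d A b (RM r 0)" using ip by (simp add: interior_point_def)
  have "CK r \<le> 20 + 10 * d + 2 * n + n * (9 * d + 35) + N * (12 + 18 * Suc N + c)"
    using F(1) B(1) S(2) I(2) by (simp add: algebra_simps)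
  thus "CK r \<le> mcost n d T" by (simp add: mcost_def Let_def N_def c_def)
qed

section \<open>Running time\<close>

text \<open>The leading term is O(d) eliminations with O(T) tests of cost O(d n), hence the unit
  \<open>X = d * n * T\<close> for one elimination. In each round the work on one line per group
  again has a factor \<open>T\<close>; \<open>T \<le> 5 * n\<close> absorbs it into the cost of a
  test.\<close>

lemma mcost_le:
  assumes d: "1 \<le> d" "d < n" and T: "1 \<le> T" "T \<le> 5 * n"
  shows "mcost n d T \<le> 100000 * (d\<^sup>2 * n * T)"
proof -
  define p where "p = d * n"
  define X where "X = p * T"
  define S where "S = Suc (d + d)"
  define m where "m = 2 * n + 4 * d"
  define Y where "Y = 2 * (d + d) * S"
  define K where "K = m + Y"
  define Z where "Z = 2 * S * (40 * T + 120) + 2 * (2 * S) + 50 + 50 * S * (d + d + m + 1)"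
  have S: "S \<le> 3 * d" and m: "m \<le> 6 * n" using d by (auto simp: S_def m_def)
  have p: "1 \<le> p" "n \<le> p" "d \<le> p" "d * d \<le> p" using d by (auto simp: p_def)
  have X: "p \<le> X" using T by (simp add: X_def)
  have "Y \<le> 2 * (d + d) * (3 * d)" unfolding Y_def using S by (intro mult_le_mono) auto
  also have "\<dots> = 12 * (d * d)" by simp
  finally have K: "K \<le> 22 * p" using p unfolding K_def m_def by linarith
  have U: "40 * T + 120 \<le> 160 * T" "160 * T \<le> 800 * n" using T by auto
  have "2 * S * (40 * T + 120) \<le> 2 * (3 * d) * (800 * n)" using S U by (intro mult_le_mono) auto
  moreover have "50 * S * (d + d + m + 1) \<le> 50 * (3 * d) * (9 * n)" using S m d by (intro mult_le_mono) auto
  ultimately have "2 * S * (40 * T + 120) \<le> 4800 * p" "50 * S * (d + d + m + 1) \<le> 1350 * p" by (simp_all add: p_def)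
  moreover have "a + 2 * (2 * S) + 50 + b \<le> 6212 * p" if "a \<le> 4800 * p" "b \<le> 1350 * p" for a b using that S p by simp
  ultimately have "Z \<le> 6212 * p" unfolding Z_def by blast
  hence "(3 * T + 2) * Z \<le> (5 * T) * (6212 * p)" using T by (intro mult_le_mono) auto
  also have "\<dots> = 31060 * X" by (simp add: X_def)
  finally have 1: "(3 * T + 2) * Z \<le> 31060 * X" .
  have "4 * K * (40 * T + 120) \<le> 4 * (22 * p) * (160 * T)" using K U by (intro mult_le_mono) auto
  also have "\<dots> = 14080 * X" by (simp add: X_def)
  finally have 2: "4 * K * (40 * T + 120) \<le> 14080 * X" .
  have "(d + d) * (3 + 35 * S) \<le> (2 * d) * (108 * d)" using S d by (intro mult_le_mono) auto
  also have "\<dots> = 216 * (d * d)" by simp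
  finally have 3: "(d + d) * (3 + 35 * S) \<le> 216 * p" using p(4) by linarith
  have "stcost (d + d) m K T = 100 + 14 * m + (d + d) * (3 + 35 * S) + 12 * S + (3 * T + 2) * Z + 4 * K * (40 * T + 120)"
    by (simp add: stcost_def S_def Z_def)
  hence st: "stcost (d + d) m K T \<le> 46000 * X" using 1 2 3 S m p X by linarith
  have "12 + 18 * S + stcost (d + d) m K T \<le> 46066 * X" using st S p X by linarith
  hence "(d + d) * (12 + 18 * S + stcost (d + d) m K T) \<le> (2 * d) * (46066 * X)" by (intro mult_le_mono) auto
  also have "\<dots> = 92132 * (d * X)" by simp
  finally have 4: "(d + d) * (12 + 18 * S + stcost (d + d) m K T) \<le> 92132 * (d * X)" .
  have "n * (9 * d + 35) = 9 * p + 35 * n" by (simp add: p_def algebra_simps)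
  moreover have "X \<le> d * X" using d by simp
  moreover have "mcost n d T = 20 + 10 * d + 2 * n + n * (9 * d + 35) + (d + d) * (12 + 18 * S + stcost (d + d) m K T)"
    by (simp add: mcost_def Let_def S_def m_def K_def Y_def)
  ultimately have "mcost n d T \<le> 100000 * (d * X)" using 4 p X by linarith
  thus ?thesis by (simp add: X_def p_def power2_eq_square ac_simps)
qed

lemma wfc_main: "wfc p_main"
  by (simp add: Let_def p_add_def p_addcomp_def p_addline_def p_back_def p_backstep_def p_bline_def p_build_def p_check_def p_compact_def p_compose_def p_copyrow_def p_decide_def p_dot_def p_edge_def p_final_def p_hit_def p_init_def p_lower_def p_main_def p_median_def p_pair_def p_pairing_def p_pick_def p_pop_def p_prune_def p_relax_def p_resolve_def p_resolve_upper_def p_round_def p_row_def p_rowedges_def p_rowentry_def p_scan_def p_search_def p_sift_def p_siftstep_def p_sign_def p_stage_def p_store_def p_storelow_def p_storerow_def p_storeup_def p_test_def p_trace_def p_trstep_def p_upper_def )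

theorem theorem1:
  shows "\<exists>(P :: instr list) (C :: real).
     \<forall>n d (A :: nat \<Rightarrow> nat \<Rightarrow> real) (b :: nat \<Rightarrow> real).
       1 \<le> d \<and> d < n \<and> LI2 n d A \<longrightarrow>
       (\<exists>t. real t \<le> C * real d ^ 2 * real n * ln (real n) \<and>
            halted P (run P t (init_conf n d A b)) \<and>
            (let c = run P t (init_conf n d A b) in
               (out_flag c = 1 \<longleftrightarrow> full_dimensional n d A b) \<and>
               (out_flag c = 0 \<longleftrightarrow> \<not> full_dimensional n d A b) \<and>
               (full_dimensional n d A b \<longrightarrow> interior_point n d A b (out_point c))))"
proof -
  obtain P W where PW: "\<And>n d A b. \<exists>t. t \<le> W * CK (sem p_main (init_st n d A b)) \<and> halted P (run P t (init_conf n d A b)) \<and>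
     out_flag (run P t (init_conf n d A b)) = int (IM (sem p_main (init_st n d A b)) 0 0) \<and>
     out_point (run P t (init_conf n d A b)) = RM (sem p_main (init_st n d A b)) 0"
    using compile_correct[OF wfc_main] by blast
  \<comment> \<open>Machine steps per tick, the constant of \<open>mcost_le\<close>, the factor
    between \<open>T\<close> and the binary logarithm, and the change of its base.\<close>
  define C where "C = real W * 100000 * 9 / ln 2"
  show ?thesis
  proof (rule exI[of _ P], rule exI[of _ C], intro allI impI)
    fix n d A b assume H: "1 \<le> d \<and> d < n \<and> LI2 n d A"
    let ?s = "init_st n d A b"
    have n2: "2 \<le> n" using H by simp
    obtain l where l: "2 ^ l < n" "n \<le> 2 ^ (l + 1)" using ex_power_ivl2[of 2 n] n2 by auto
    \<comment> \<open>The pool holds at most \<open>18 * n * n\<close> lines, with 18 at most 32 and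
      \<open>n * n\<close> at most \<open>2 ^ (2 * l + 2)\<close>; the exponents 5 and
      \<open>2 * l + 2\<close> add up to this value.\<close>
    define T where "T = 2 * l + 7"
    have "l < 2 ^ l" by simp
    hence T: "1 \<le> T" "T \<le> 5 * n" using l unfolding T_def by linarith+
    have "d * d \<le> n * n" "d \<le> n * n" "n \<le> n * n" using H by (auto intro: mult_le_mono order_trans[of d n])
    moreover have "2 * n + 2 * (d + d) + 2 * (d + d) * Suc (d + d) = 2 * n + 8 * d + 8 * (d * d)" by (simp add: algebra_simps)
    ultimately have "2 * n + 2 * (d + d) + 2 * (d + d) * Suc (d + d) \<le> 18 * (n * n)" using \<open>n \<le> n * n\<close> by linarith
    also have "\<dots> \<le> 32 * (2 ^ (l + 1) * 2 ^ (l + 1))" using l(2) by (intro mult_le_mono) simp_all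
    also have "\<dots> = 2 ^ (5 + ((l + 1) + (l + 1)))" unfolding power_add by simp
    also have "5 + ((l + 1) + (l + 1)) = T" by (simp add: T_def)
    finally have T2: "2 * n + 2 * (d + d) + 2 * (d + d) * Suc (d + d) \<le> 2 ^ T" .
    have raw: "RM ?s 0 (i * d + j) = A i j" if "i < n" "j < d" for i j
    proof -
      have "i * d + j < Suc i * d" using that by simp
      also have "\<dots> \<le> n * d" using that by (intro mult_le_mono) auto
      finally show ?thesis using that by (simp add: init_st_def)
    qed
    have raw2: "RM ?s 0 (n * d + i) = b i" if "i < n" for i using that by (simp add: init_st_def)
    note M = main_sem[of ?s n d A b T, OF _ _ _ raw raw2 _ T2 refl]
    have M': "CK (sem p_main ?s) \<le> mcost n d T" "IM (sem p_main ?s) 0 0 = (if full_dimensional n d A b then 1 else 0)"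
      "full_dimensional n d A b \<Longrightarrow> interior_point n d A b (RM (sem p_main ?s) 0)"
      using M H by (simp_all add: init_st_def)
    obtain t where t: "t \<le> W * CK (sem p_main ?s)" "halted P (run P t (init_conf n d A b))"
      "out_flag (run P t (init_conf n d A b)) = int (IM (sem p_main ?s) 0 0)" "out_point (run P t (init_conf n d A b)) = RM (sem p_main ?s) 0"
      using PW by blast
    have "t \<le> W * (100000 * (d\<^sup>2 * n * T))"
    proof -
      have "CK (sem p_main ?s) \<le> 100000 * (d\<^sup>2 * n * T)" by (rule order_trans[OF M'(1) mcost_le[OF _ _ T]]) (use H in simp_all)
      thus ?thesis by (rule order_trans[OF t(1) mult_le_mono2])
    qed
    hence "real t \<le> real (W * (100000 * (d\<^sup>2 * n * T)))" unfolding of_nat_le_iff .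
    also have "\<dots> = real W * (100000 * ((real d)\<^sup>2 * real n * real T))" by simp
    also have "\<dots> \<le> real W * (100000 * ((real d)\<^sup>2 * real n * (9 * (ln (real n) / ln 2))))"
    proof -
      \<comment> \<open>From \<open>1 \<le> log 2 n\<close> the additive 7 costs at most seven
        further logarithms, so nine suffice in total.\<close>
      have "real l \<le> log 2 (real n)" by (rule le_log_of_power) (use l in \<open>simp_all add: less_imp_le flip: of_nat_power\<close>)
      moreover have "1 \<le> log 2 (real n)" using n2 by simp
      ultimately have "real T \<le> 9 * log 2 (real n)" unfolding T_def by simp
      hence "real T \<le> 9 * (ln (real n) / ln 2)" unfolding log_def .
      thus ?thesis by (intro mult_left_mono) auto
    qed
    also have "\<dots> = C * real d ^ 2 * real n * ln (real n)" by (simp add: C_def)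
    finally show "\<exists>t. real t \<le> C * real d ^ 2 * real n * ln (real n) \<and>
            halted P (run P t (init_conf n d A b)) \<and>
            (let c = run P t (init_conf n d A b) in
               (out_flag c = 1 \<longleftrightarrow> full_dimensional n d A b) \<and>
               (out_flag c = 0 \<longleftrightarrow> \<not> full_dimensional n d A b) \<and>
               (full_dimensional n d A b \<longrightarrow> interior_point n d A b (out_point c)))"
      using t M' by (intro exI[of _ t]) (simp add: Let_def)
  qed
qed

end
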